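(* Let $\Omega\subset\mathbb{R}^N$ ($N\ge3$) be a bounded domain, let $f:\mathbb{R}\to\mathbb{R}$ be an odd $\mathcal{C}^1$ function with $f\ge0$ on $[0,\infty)$, and set $F(t)=\int_0^tf(s)\,ds$. Let $1<p_1\le p_2\le\dots\le p_N$ be such that $\sum_{i=1}^N\frac1{p_i}>1$ and $p_N<p^*$, where $p^*=\frac{N}{\left(\sum_{i=1}^N\frac1{p_i}\right)-1}$. Assume: (1) $\lim_{t\to0^+}\frac{f(t)}{t^{p_1-1}}=0$. (2) $\lim_{t\to\infty}\frac{F(t)}{t^{p_N}}=\infty$. (3) $\lim_{t\to\infty}\frac{f(t)}{t^{\alpha-1}}=0$ for some $\alpha\in(p_N,p^* )$. (4) $t\mapsto\frac{f(t)}{t^{p_N-1}}$ is increasing on $(0,\infty)$. Then the problem $$-\sum_{i=1}^N\partial_i\left(|\partial_iu|^{p_i-2}\partial_iu\right)=f(u),\quad u\in\mathcal{D}_0^{1,\overrightarrow{p}}(\Omega),$$ has a nontrivial and non-negative ground state.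
   Context: $\overrightarrow{p}=(p_1,\dots,p_N)$ and $\mathcal{D}_0^{1,\overrightarrow{p}}(\Omega)$ is the completion of $\mathcal{C}_0^\infty(\Omega)$ with respect to the norm $\|u\|=\sum_{i=1}^N\|\partial_iu\|_{p_i}$, where $\|\cdot\|_r$ is the norm of $L^r(\Omega)$. Solutions are weak solutions, i.e. critical points of $\Phi(u)=\sum_{i=1}^N\frac1{p_i}\int_\Omega|\partial_iu|^{p_i}-\int_\Omega F(u)$ on $\mathcal{D}_0^{1,\overrightarrow{p}}(\Omega)$. A nontrivial ground state is a $u_0\ne0$ with $\Phi'(u_0)=0$ and $\Phi(u_0)=\min\{\Phi(u):\ u\ne0,\ \Phi'(u)=0\}$. "Increasing" is meant strictly. *)

theory Defs
  imports "HOL-Analysis.Analysis"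
begin

subsection \<open>Test functions and weak partial derivatives\<close>

definition partial_deriv :: "'n::finite \<Rightarrow> (real^'n \<Rightarrow> real) \<Rightarrow> real^'n \<Rightarrow> real" where
  "partial_deriv i f = (\<lambda>x. frechet_derivative f (at x) (axis i 1))"

fun iterated_partial_deriv :: "'n::finite list \<Rightarrow> (real^'n \<Rightarrow> real) \<Rightarrow> real^'n \<Rightarrow> real" where
  "iterated_partial_deriv [] f = f"
| "iterated_partial_deriv (i # is) f = partial_deriv i (iterated_partial_deriv is f)"

definition smooth :: "(real^'n::finite \<Rightarrow> real) \<Rightarrow> bool" where
  "smooth f \<longleftrightarrow> (\<forall>is. iterated_partial_deriv is f differentiable_on UNIV)"

text \<open>Elements of \<open>C_0^\<infinity>(\<Omega>)\<close> are represented by their extension by zero to the whole space.\<close>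

definition test_functions :: "(real^'n::finite) set \<Rightarrow> (real^'n \<Rightarrow> real) set" where
  "test_functions \<Omega> =
     {\<phi>. smooth \<phi> \<and> compact (closure {x. \<phi> x \<noteq> 0}) \<and> closure {x. \<phi> x \<noteq> 0} \<subseteq> \<Omega>}"

definition locally_integrable :: "(real^'n::finite) set \<Rightarrow> (real^'n \<Rightarrow> real) \<Rightarrow> bool" where
  "locally_integrable \<Omega> u \<longleftrightarrow> (\<forall>K. compact K \<and> K \<subseteq> \<Omega> \<longrightarrow> integrable (lebesgue_on K) u)"

definition is_weak_partial_deriv ::
  "(real^'n::finite) set \<Rightarrow> 'n \<Rightarrow> (real^'n \<Rightarrow> real) \<Rightarrow> (real^'n \<Rightarrow> real) \<Rightarrow> bool" where
  "is_weak_partial_deriv \<Omega> i u g \<longleftrightarrow>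
     locally_integrable \<Omega> u \<and> locally_integrable \<Omega> g \<and>
     (\<forall>\<phi>\<in>test_functions \<Omega>.
        (LINT x|lebesgue_on \<Omega>. u x * partial_deriv i \<phi> x) = - (LINT x|lebesgue_on \<Omega>. g x * \<phi> x))"

text \<open>Weak derivatives are unique up to null sets, so the choice below does not affect any
  integral over \<open>\<Omega>\<close>. Every element of the space \<open>anisotropic_space\<close> below has
  weak derivatives; for test functions they agree almost everywhere with the classical ones.\<close>

definition weak_partial_deriv ::
  "(real^'n::finite) set \<Rightarrow> 'n \<Rightarrow> (real^'n \<Rightarrow> real) \<Rightarrow> real^'n \<Rightarrow> real" where
  "weak_partial_deriv \<Omega> i u = (SOME g. is_weak_partial_deriv \<Omega> i u g)"

subsection \<open>The anisotropic space\<close>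

definition Lp_norm :: "(real^'n::finite) set \<Rightarrow> real \<Rightarrow> (real^'n \<Rightarrow> real) \<Rightarrow> real" where
  "Lp_norm \<Omega> r g = (LINT x|lebesgue_on \<Omega>. \<bar>g x\<bar> powr r) powr (1 / r)"

definition anisotropic_norm ::
  "(real^'n::finite) set \<Rightarrow> ('n \<Rightarrow> real) \<Rightarrow> (real^'n \<Rightarrow> real) \<Rightarrow> real" where
  "anisotropic_norm \<Omega> p u = (\<Sum>i\<in>UNIV. Lp_norm \<Omega> (p i) (weak_partial_deriv \<Omega> i u))"

text \<open>The completion of the test functions with respect to \<open>anisotropic_norm\<close>, realised as a
  space of functions for bounded \<open>\<Omega>\<close>: by the Poincare inequality the norm dominates the
  \<open>L^1\<close> norm, so that a Cauchy sequence of test functions has an \<open>L^1\<close> limit, and, weak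
  derivatives being stable under \<open>L^1\<close> limits, this limit determines the class of the Cauchy
  sequence. Functions that agree almost everywhere on \<open>\<Omega>\<close> represent the same element.\<close>

definition anisotropic_space ::
  "(real^'n::finite) set \<Rightarrow> ('n \<Rightarrow> real) \<Rightarrow> (real^'n \<Rightarrow> real) set" where
  "anisotropic_space \<Omega> p =
     {u. integrable (lebesgue_on \<Omega>) u \<and>
         (\<exists>\<phi> :: nat \<Rightarrow> real^'n \<Rightarrow> real.
            (\<forall>n. \<phi> n \<in> test_functions \<Omega>) \<and>
            (\<forall>e>0. \<exists>M. \<forall>m\<ge>M. \<forall>n\<ge>M. anisotropic_norm \<Omega> p (\<lambda>x. \<phi> m x - \<phi> n x) < e) \<and>
            (\<lambda>n. LINT x|lebesgue_on \<Omega>. \<bar>\<phi> n x - u x\<bar>) \<longlonglongrightarrow> 0)}"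

subsection \<open>Critical points and ground states\<close>

text \<open>Frechet derivative at \<open>u\<close> of a functional \<open>J\<close> on a function space \<open>V\<close> with norm \<open>nrm\<close>,
  as a bounded linear form on \<open>V\<close>. The library notion needs a normed space given by a type,
  whereas here the space depends on \<open>\<Omega>\<close> and \<open>p\<close>.\<close>

definition has_frechet_derivative_in ::
  "('a \<Rightarrow> real) set \<Rightarrow> (('a \<Rightarrow> real) \<Rightarrow> real) \<Rightarrow>
   (('a \<Rightarrow> real) \<Rightarrow> real) \<Rightarrow> ('a \<Rightarrow> real) \<Rightarrow> (('a \<Rightarrow> real) \<Rightarrow> real) \<Rightarrow> bool" where
  "has_frechet_derivative_in V nrm J u L \<longleftrightarrow>
     (\<forall>v\<in>V. \<forall>w\<in>V. L (\<lambda>x. v x + w x) = L v + L w) \<and>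
     (\<forall>c. \<forall>v\<in>V. L (\<lambda>x. c * v x) = c * L v) \<and>
     (\<exists>C. \<forall>v\<in>V. \<bar>L v\<bar> \<le> C * nrm v) \<and>
     (\<forall>e>0. \<exists>d>0. \<forall>v\<in>V. nrm v < d \<longrightarrow> \<bar>J (\<lambda>x. u x + v x) - J u - L v\<bar> \<le> e * nrm v)"

definition critical_point ::
  "('a \<Rightarrow> real) set \<Rightarrow> (('a \<Rightarrow> real) \<Rightarrow> real) \<Rightarrow> (('a \<Rightarrow> real) \<Rightarrow> real) \<Rightarrow> ('a \<Rightarrow> real) \<Rightarrow> bool" where
  "critical_point V nrm J u \<longleftrightarrow> u \<in> V \<and> has_frechet_derivative_in V nrm J u (\<lambda>_. 0)"

definition primitive :: "(real \<Rightarrow> real) \<Rightarrow> real \<Rightarrow> real" where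
  "primitive f t = (LBINT s=0..t. f s)"

definition energy ::
  "(real^'n::finite) set \<Rightarrow> ('n \<Rightarrow> real) \<Rightarrow> (real \<Rightarrow> real) \<Rightarrow> (real^'n \<Rightarrow> real) \<Rightarrow> real" where
  "energy \<Omega> p f u =
     (\<Sum>i\<in>UNIV. 1 / p i * (LINT x|lebesgue_on \<Omega>. \<bar>weak_partial_deriv \<Omega> i u x\<bar> powr p i))
     - (LINT x|lebesgue_on \<Omega>. primitive f (u x))"

text \<open>Weak solutions of \<open>- (\<Sum>i. \<partial>\<^sub>i (\<bar>\<partial>\<^sub>i u\<bar>^(p i - 2) * \<partial>\<^sub>i u)) = f u\<close>.\<close>

definition weak_solution ::
  "(real^'n::finite) set \<Rightarrow> ('n \<Rightarrow> real) \<Rightarrow> (real \<Rightarrow> real) \<Rightarrow> (real^'n \<Rightarrow> real) \<Rightarrow> bool" where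
  "weak_solution \<Omega> p f u \<longleftrightarrow>
     critical_point (anisotropic_space \<Omega> p) (anisotropic_norm \<Omega> p) (energy \<Omega> p f) u"

definition nontrivial_on :: "(real^'n::finite) set \<Rightarrow> (real^'n \<Rightarrow> real) \<Rightarrow> bool" where
  "nontrivial_on \<Omega> u \<longleftrightarrow> \<not> (AE x in lebesgue_on \<Omega>. u x = 0)"

definition nontrivial_ground_state ::
  "(real^'n::finite) set \<Rightarrow> ('n \<Rightarrow> real) \<Rightarrow> (real \<Rightarrow> real) \<Rightarrow> (real^'n \<Rightarrow> real) \<Rightarrow> bool" where
  "nontrivial_ground_state \<Omega> p f u \<longleftrightarrow>
     weak_solution \<Omega> p f u \<and> nontrivial_on \<Omega> u \<and>
     (\<forall>v. weak_solution \<Omega> p f v \<and> nontrivial_on \<Omega> v \<longrightarrow> energy \<Omega> p f u \<le> energy \<Omega> p f v)"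

subsection \<open>Exponents\<close>

text \<open>The coordinate indices are linearly ordered, so that for monotone \<open>p\<close> the following are
  the first and the last exponent \<open>p\<^sub>1\<close> and \<open>p\<^sub>N\<close>.\<close>

definition first_exponent :: "('n::{finite,linorder} \<Rightarrow> real) \<Rightarrow> real" where
  "first_exponent p = p (Min UNIV)"

definition last_exponent :: "('n::{finite,linorder} \<Rightarrow> real) \<Rightarrow> real" where
  "last_exponent p = p (Max UNIV)"

definition critical_exponent :: "('n::finite \<Rightarrow> real) \<Rightarrow> real" where
  "critical_exponent p = real CARD('n) / ((\<Sum>i\<in>UNIV. 1 / p i) - 1)"

end

theory Submission
  imports Defs "HOL-Complex_Analysis.Great_Picard"
begin

text \<open>
  Why the theorem holds. Write the energy as \<open>\<Phi> = G - P\<close> with \<open>G u =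
  (\<Sum>i. 1 / p i * \<integral> \<bar>\<partial>\<^sub>i u\<bar>^(p i))\<close> and \<open>P u =
  \<integral> F(u)\<close>, and let \<open>p1\<close>, \<open>pN\<close> be the first and the last
  exponent. For nonzero \<open>w\<close> the fiber \<open>\<tau> \<mapsto> \<Phi>(\<tau>^(1/pN)
  w)\<close> is strictly concave on \<open>[0, \<infinity>)\<close>: the summands of
  \<open>G\<close> become multiples of \<open>\<tau>^(p i / pN)\<close>, with exponents at most 1,
  and the derivative of \<open>\<tau> \<mapsto> F(\<tau>^(1/pN) y)\<close> is a positive multiple
  of \<open>f(s) / s^(pN - 1)\<close> at \<open>s = \<tau>^(1/pN) \<bar>y\<bar>\<close>, hence
  strictly increasing. The fiber vanishes at 0, is positive somewhere because of the behaviour of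
  \<open>f\<close> at 0, and is eventually nonpositive because \<open>F\<close> outgrows the power
  \<open>pN\<close>; so it attains a maximum. Call \<open>nehari\<close> the set of all nonzero
  \<open>u\<close> whose fiber is maximal at \<open>\<tau> = 1\<close>. A concave fiber that is
  stationary at 1 is maximal there, so \<open>nehari\<close> contains all nontrivial critical
  points, and a minimizer of \<open>\<Phi>\<close> over \<open>nehari\<close> is a ground state as
  soon as it is critical (\<open>critical_in_nehari\<close>,
  \<open>nehari_minimizer_critical\<close>).

  A minimizer exists (\<open>nehari_minimizer_exists\<close>): normalize a minimizing sequence to
  norm 1, and let \<open>w\<close> be the \<open>L\<^sup>1\<close> limit of a subsequence \<open>v
  n\<close>. By maximality of the fibers, \<open>\<Phi>(t v n)\<close> is asymptotically at most
  the infimum \<open>c\<close>, for every \<open>t \<ge> 0\<close>. The potential \<open>P\<close>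
  passes to the limit by the bound in \<open>L\<^sup>q\<close> for some \<open>q >
  \<alpha>\<close>, and \<open>G\<close> is lower semicontinuous, so \<open>\<Phi>(t w) \<le>
  c\<close> for all \<open>t \<ge> 0\<close>. Here \<open>w\<close> is nonzero, as otherwise
  \<open>G(t v n)\<close> would be asymptotically bounded by \<open>c\<close> for every
  \<open>t\<close>, although it grows with \<open>t\<close> uniformly in \<open>n\<close>.
  Replacing \<open>w\<close> by \<open>\<bar>w\<bar>\<close> does not increase
  \<open>\<Phi>\<close>, and the maximum of the fiber of \<open>\<bar>w\<bar>\<close> is the
  minimizer.

  In general \<open>\<Phi>\<close> is differentiable only once, and \<open>nehari\<close> need not
  be a manifold; so it is shown directly that a minimizer \<open>u\<close> is critical
  (\<open>nehari_minimizer_differential_zero\<close>). If the differential at \<open>u\<close>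
  were negative in a direction \<open>v\<close>, then for small \<open>s\<close> the fiber of
  \<open>u + s v\<close> would be larger at 1 than at \<open>1 - \<delta>\<close> and \<open>1 +
  \<delta>\<close>, so by concavity it would be maximal at some \<open>t\<close> between them. But
  near \<open>t = 1\<close> the functional is strictly differentiable along the ray of
  \<open>u\<close>, so that \<open>\<Phi>(t (u + s v)) < \<Phi>(t u) \<le> \<Phi>(u)\<close>,
  contradicting minimality.

  The locale \<open>anisotropic_functional\<close> lists what this argument asks of the space; the
  locale \<open>anisotropic_domain\<close> supplies it. The embedding into
  \<open>L\<^sup>q\<close> below the critical exponent (\<open>tests_embedding\<close>) comes from
  a recursion for the measures of the level sets \<open>{\<bar>\<phi>\<bar> > 2^k}\<close>,
  obtained by comparing \<open>\<phi>\<close> with its translates over a box whose side lengths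
  are adapted to the exponents. Compactness in \<open>L\<^sup>1\<close>
  (\<open>tests_L1_compact\<close>) comes from averaging over small cubes. Lower semicontinuity of
  \<open>G\<close> (\<open>relaxation_tests\<close>) comes from uniform convexity, which turns
  test functions that almost minimize \<open>G\<close> near \<open>w\<close> into a Cauchy
  sequence. Weak derivatives are identified with the limits of classical ones through their
  uniqueness (\<open>weak_partial_deriv_unique\<close>).
\<close>

section \<open>Convexity and remainder estimates for powers\<close>

lemma mean_value_real:
  fixes h h' :: "real \<Rightarrow> real"
  assumes "a < b" and "continuous_on {a..b} h"
    and "\<And>t. a < t \<Longrightarrow> t < b \<Longrightarrow> (h has_real_derivative h' t) (at t)"
  obtains \<xi> where "a < \<xi>" "\<xi> < b" "h b - h a = h' \<xi> * (b - a)"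
  using mvt[of a b h "\<lambda>x. (*) (h' x)"] assms unfolding has_field_derivative_def by metis

text \<open>By the mean value theorem the two slopes of the chords from the intermediate point to
  \<open>x\<close> and to \<open>y\<close> are values of \<open>h'\<close>, in increasing order.
  Continuity suffices at the end points, which matters for fibers starting at 0.\<close>

lemma strict_convexity_from_derivative:
  fixes h h' :: "real \<Rightarrow> real"
  assumes "x < y" and cont: "continuous_on {x..y} h"
    and deriv: "\<And>t. x < t \<Longrightarrow> t < y \<Longrightarrow> (h has_real_derivative h' t) (at t)"
    and mono: "\<And>t t'. x < t \<Longrightarrow> t < t' \<Longrightarrow> t' < y \<Longrightarrow> h' t < h' t'"
    and s: "0 < s" "s < 1"
  shows "h ((1 - s) * x + s * y) < (1 - s) * h x + s * h y"
proof -
  define m where "m = (1 - s) * x + s * y"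
  have mx: "m - x = s * (y - x)" and ym: "y - m = (1 - s) * (y - x)"
    by (simp_all add: m_def algebra_simps)
  have xm: "x < m" "m < y" using mx ym s assms(1) by (smt (verit) mult_pos_pos)+
  obtain \<xi> where \<xi>: "x < \<xi>" "\<xi> < m" "h m - h x = h' \<xi> * (m - x)"
    by (rule mean_value_real[of x m h h']) (use xm deriv in \<open>auto intro: continuous_on_subset[OF cont]\<close>)
  obtain \<eta> where \<eta>: "m < \<eta>" "\<eta> < y" "h y - h m = h' \<eta> * (y - m)"
    by (rule mean_value_real[of m y h h']) (use xm deriv in \<open>auto intro: continuous_on_subset[OF cont]\<close>)
  have "h' \<xi> < h' \<eta>" using mono \<xi> \<eta> by auto
  moreover have "0 < s * (1 - s) * (y - x)" using s assms(1) by simp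
  ultimately have "h' \<xi> * (s * (1 - s) * (y - x)) < h' \<eta> * (s * (1 - s) * (y - x))"
    by (rule mult_strict_right_mono)
  moreover have "(1 - s) * (h m - h x) = h' \<xi> * (s * (1 - s) * (y - x))"
    unfolding \<xi>(3) mx by simp
  moreover have "s * (h y - h m) = h' \<eta> * (s * (1 - s) * (y - x))"
    unfolding \<eta>(3) ym by simp
  ultimately have "(1 - s) * (h m - h x) < s * (h y - h m)" by (simp only:)
  thus ?thesis unfolding m_def[symmetric] by (simp add: algebra_simps)
qed

lemma powr_strict_convex:
  fixes p :: real
  assumes "1 < p" "0 \<le> x" "x < y" "0 < s" "s < 1"
  shows "((1 - s) * x + s * y) powr p < (1 - s) * x powr p + s * y powr p"
proof (rule strict_convexity_from_derivative[where h' = "\<lambda>t. p * t powr (p - 1)"])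
  show "continuous_on {x..y} (\<lambda>t. t powr p)"
    using assms by (intro continuous_on_powr' continuous_intros) auto
next
  fix t assume "x < t" "t < y"
  thus "((\<lambda>t. t powr p) has_real_derivative p * t powr (p - 1)) (at t)"
    using assms by (auto intro!: derivative_eq_intros simp: powr_diff)
qed (use assms in \<open>auto intro!: powr_less_mono2\<close>)

lemma powr_concave:
  fixes r :: real
  assumes "0 < r" "r \<le> 1" "0 \<le> x" "0 \<le> y" "0 < s" "s < 1"
  shows "(1 - s) * x powr r + s * y powr r \<le> ((1 - s) * x + s * y) powr r"
proof -
  have *: "(1 - s) * x powr r + s * y powr r \<le> ((1 - s) * x + s * y) powr r"
    if "r < 1" "0 \<le> x" "x < y" "0 < s" "s < 1" for x y s :: real
  proof -
    have "- (((1 - s) * x + s * y) powr r) < (1 - s) * (- (x powr r)) + s * (- (y powr r))"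
    proof (rule strict_convexity_from_derivative[where h' = "\<lambda>t. - (r * t powr (r - 1))"])
      show "continuous_on {x..y} (\<lambda>t. - (t powr r))"
        using assms that by (intro continuous_on_minus continuous_on_powr' continuous_intros) auto
    next
      fix t assume "x < t" "t < y"
      thus "((\<lambda>t. - (t powr r)) has_real_derivative - (r * t powr (r - 1))) (at t)"
        using assms that by (auto intro!: derivative_eq_intros simp: powr_diff)
    next
      fix t t' assume "x < t" "t < t'" "t' < y"
      hence "t' powr (r - 1) < t powr (r - 1)"
        using that by (intro powr_less_mono2_neg) auto
      thus "- (r * t powr (r - 1)) < - (r * t' powr (r - 1))" using assms by simp
    qed (use that in auto)
    thus ?thesis by simp
  qed
  consider "r = 1" | "r < 1" "x < y" | "r < 1" "x = y" | "r < 1" "y < x" using assms by linarith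
  thus ?thesis
  proof cases
    case 1 thus ?thesis using assms by (simp add: add_nonneg_nonneg)
  next
    case 2 thus ?thesis using * assms by auto
  next
    case 3 thus ?thesis by (simp add: algebra_simps)
  next
    case 4 thus ?thesis using *[of y x "1 - s"] assms by (simp add: add.commute)
  qed
qed

lemma powr_add_le:
  fixes p :: real
  assumes "0 \<le> p" "0 \<le> a" "0 \<le> b"
  shows "(a + b) powr p \<le> 2 powr p * (a powr p + b powr p)"
proof -
  have "(a + b) powr p \<le> (2 * max a b) powr p" using assms by (intro powr_mono2) auto
  also have "\<dots> = 2 powr p * max a b powr p" using assms by (simp add: powr_mult)
  also have "\<dots> \<le> 2 powr p * (a powr p + b powr p)"
    by (intro mult_left_mono) (auto simp: max_def)
  finally show ?thesis .
qed

lemma powr_abs_add_le: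
  fixes p a b :: real
  assumes "0 \<le> p"
  shows "\<bar>a + b\<bar> powr p \<le> 2 powr p * (\<bar>a\<bar> powr p + \<bar>b\<bar> powr p)"
    and "\<bar>a - b\<bar> powr p \<le> 2 powr p * (\<bar>a\<bar> powr p + \<bar>b\<bar> powr p)"
proof -
  have "\<bar>a + b\<bar> powr p \<le> (\<bar>a\<bar> + \<bar>b\<bar>) powr p" "\<bar>a - b\<bar> powr p \<le> (\<bar>a\<bar> + \<bar>b\<bar>) powr p"
    using assms by (auto intro!: powr_mono2)
  thus "\<bar>a + b\<bar> powr p \<le> 2 powr p * (\<bar>a\<bar> powr p + \<bar>b\<bar> powr p)"
    "\<bar>a - b\<bar> powr p \<le> 2 powr p * (\<bar>a\<bar> powr p + \<bar>b\<bar> powr p)"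
    using powr_add_le[OF assms, of "\<bar>a\<bar>" "\<bar>b\<bar>"] by auto
qed

text \<open>A crude form of Young's inequality without conjugate exponents: replace both factors
  by the larger of the two numbers.\<close>

lemma powr_times_le_sum:
  fixes p x y :: real
  assumes "1 \<le> p" "0 \<le> x" "0 \<le> y"
  shows "y powr (p - 1) * x \<le> y powr p + x powr p"
proof -
  have "y powr (p - 1) * x \<le> max x y powr (p - 1) * max x y"
    using assms by (intro mult_mono powr_mono2) auto
  also have "\<dots> = max x y powr p"
    using assms by (cases "max x y = 0") (auto simp: powr_mult_base' max_def powr_diff)
  also have "\<dots> \<le> y powr p + x powr p" by (auto simp: max_def)
  finally show ?thesis .
qed

lemma powr_abs_midpoint_less:
  fixes p a b :: real
  assumes "1 < p" "a \<noteq> b"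
  shows "\<bar>(a + b) / 2\<bar> powr p < (\<bar>a\<bar> powr p + \<bar>b\<bar> powr p) / 2"
proof -
  have *: "((x + y) / 2) powr p < (x powr p + y powr p) / 2" if "0 \<le> x" "x < y" for x y :: real
  proof -
    have e: "(1 - 1/2) * x + 1/2 * y = (x + y) / 2" by (simp add: field_simps)
    have "((1 - 1/2) * x + 1/2 * y) powr p < (1 - 1/2) * x powr p + 1/2 * y powr p"
      by (rule powr_strict_convex) (use that assms in auto)
    thus ?thesis unfolding e by (simp add: field_simps)
  qed
  have le: "\<bar>(a + b) / 2\<bar> powr p \<le> ((\<bar>a\<bar> + \<bar>b\<bar>) / 2) powr p"
    using assms by (intro powr_mono2) auto
  consider "\<bar>a\<bar> < \<bar>b\<bar>" | "\<bar>b\<bar> < \<bar>a\<bar>" | "a = - b" using assms by linarith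
  thus ?thesis
  proof cases
    case 1 thus ?thesis using *[of "\<bar>a\<bar>" "\<bar>b\<bar>"] le by auto
  next
    case 2 thus ?thesis using *[of "\<bar>b\<bar>" "\<bar>a\<bar>"] le by (auto simp: add.commute)
  next
    case 3 thus ?thesis using assms by auto
  qed
qed

lemma powr_abs_midpoint_le:
  fixes p a b :: real
  assumes "1 < p"
  shows "\<bar>(a + b) / 2\<bar> powr p \<le> (\<bar>a\<bar> powr p + \<bar>b\<bar> powr p) / 2"
  using powr_abs_midpoint_less[OF assms, of a b] by (cases "a = b") auto

lemma continuous_on_abs_powr:
  fixes g :: "'a::topological_space \<Rightarrow> real"
  assumes "0 < p" "continuous_on A g"
  shows "continuous_on A (\<lambda>x. \<bar>g x\<bar> powr p)"
  using assms by (intro continuous_on_powr' continuous_intros) auto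

text \<open>A quantitative form of the uniform convexity of \<open>L\<^sup>p\<close>, at the level
  of integrands. The Clarkson inequalities would distinguish exponents below and above 2;
  compactness treats all \<open>p > 1\<close> alike. Both sides are homogeneous, so only
  \<open>\<bar>a\<bar>^p + \<bar>b\<bar>^p = 1\<close> matters. There the pairs with
  \<open>\<bar>a - b\<bar>^p \<ge> \<epsilon>\<close> form a compact set avoiding the diagonal, on
  which the convexity defect has a positive minimum.\<close>

lemma powr_uniformly_convex:
  fixes p \<epsilon> :: real
  assumes p: "1 < p" and \<epsilon>: "0 < \<epsilon>"
  obtains C where "0 \<le> C"
    "\<And>a b. \<bar>a - b\<bar> powr p \<le> \<epsilon> * (\<bar>a\<bar> powr p + \<bar>b\<bar> powr p)
        + C * ((\<bar>a\<bar> powr p + \<bar>b\<bar> powr p) / 2 - \<bar>(a + b) / 2\<bar> powr p)"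
proof -
  define N where "N = (\<lambda>z::real\<times>real. \<bar>fst z\<bar> powr p + \<bar>snd z\<bar> powr p)"
  define d where "d = (\<lambda>z::real\<times>real. \<bar>fst z - snd z\<bar> powr p)"
  define D where "D = (\<lambda>z::real\<times>real. N z / 2 - \<bar>(fst z + snd z) / 2\<bar> powr p)"
  define S where "S = {z. N z = 1 \<and> \<epsilon> \<le> d z}"
  have cN: "continuous_on UNIV N" and cd: "continuous_on UNIV d" and cD: "continuous_on UNIV D"
    unfolding N_def d_def D_def using p
    by (intro continuous_intros continuous_on_abs_powr; simp)+
  have D0: "0 \<le> D z" for z
    unfolding D_def N_def using powr_abs_midpoint_le[OF p] by auto
  have hom: "N (r *\<^sub>R z) = r powr p * N z" "d (r *\<^sub>R z) = r powr p * d z"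
    "D (r *\<^sub>R z) = r powr p * D z" if "0 < r" for r z
  proof -
    have e: "\<bar>r * a\<bar> powr p = r powr p * \<bar>a\<bar> powr p" for a
      using that by (simp add: abs_mult powr_mult)
    show "N (r *\<^sub>R z) = r powr p * N z" by (simp add: N_def e algebra_simps)
    have "\<bar>fst (r *\<^sub>R z) - snd (r *\<^sub>R z)\<bar> = \<bar>r * (fst z - snd z)\<bar>" by (simp add: algebra_simps)
    thus "d (r *\<^sub>R z) = r powr p * d z" by (simp only: d_def e)
    have "\<bar>(fst (r *\<^sub>R z) + snd (r *\<^sub>R z)) / 2\<bar> = \<bar>r * ((fst z + snd z) / 2)\<bar>" by (simp add: algebra_simps)
    thus "D (r *\<^sub>R z) = r powr p * D z"
      unfolding D_def by (simp only: e) (simp add: N_def e algebra_simps)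
  qed
  have dN: "d z \<le> 2 powr p * N z" for z
    unfolding d_def N_def using powr_abs_add_le(2)[of p] p by auto
  have "compact S"
  proof (rule compact_eq_bounded_closed[THEN iffD2], intro conjI)
    have "S \<subseteq> {-1..1} \<times> {-1..1}"
    proof
      fix z assume "z \<in> S"
      hence 1: "\<bar>fst z\<bar> powr p + \<bar>snd z\<bar> powr p = 1" by (simp add: S_def N_def)
      have "\<bar>fst z\<bar> powr p \<le> 1" "\<bar>snd z\<bar> powr p \<le> 1"
        using 1 powr_ge_zero[of "\<bar>snd z\<bar>" p] powr_ge_zero[of "\<bar>fst z\<bar>" p] by linarith+
      moreover have "y \<le> 1" if "0 \<le> y" "y powr p \<le> 1" for y :: real
      proof (rule ccontr)
        assume "\<not> y \<le> 1"
        hence "1 powr p < y powr p" using p by (intro powr_less_mono2) auto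
        thus False using that by simp
      qed
      ultimately have "\<bar>fst z\<bar> \<le> 1" "\<bar>snd z\<bar> \<le> 1" by auto
      thus "z \<in> {-1..1} \<times> {-1..1}" by (cases z) auto
    qed
    thus "bounded S" by (rule bounded_subset[rotated]) (intro bounded_Times; simp)
    show "closed S" unfolding S_def
      by (intro closed_Collect_conj closed_Collect_eq closed_Collect_le cN cd continuous_intros)
  qed
  have "\<exists>\<delta>>0. \<forall>z\<in>S. \<delta> \<le> D z"
  proof (cases "S = {}")
    case True thus ?thesis by (intro exI[of _ 1]) auto
  next
    case False
    obtain z0 where z0: "z0 \<in> S" "\<And>z. z \<in> S \<Longrightarrow> D z0 \<le> D z"
      using continuous_attains_inf[OF \<open>compact S\<close> False] cD continuous_on_subset by (metis top_greatest)
    have "fst z0 \<noteq> snd z0" using z0 \<epsilon> by (auto simp: S_def d_def)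
    hence "0 < D z0" unfolding D_def N_def using powr_abs_midpoint_less[OF p] by auto
    thus ?thesis using z0 by blast
  qed
  then obtain \<delta> where \<delta>: "0 < \<delta>" "\<And>z. z \<in> S \<Longrightarrow> \<delta> \<le> D z" by blast
  define C where "C = 2 powr p / \<delta>"
  have C0: "0 \<le> C" using \<delta> by (simp add: C_def)
  have main: "d z \<le> \<epsilon> * N z + C * D z" for z
  proof (cases "N z = 0")
    case True
    thus ?thesis using dN[of z] mult_nonneg_nonneg[OF C0 D0[of z]] by simp
  next
    case False
    hence Np: "0 < N z" unfolding N_def by (simp add: add_nonneg_nonneg order_less_le)
    define r where "r = N z powr (1 / p)"
    have r: "0 < r" "r powr p = N z" using Np p by (auto simp: r_def powr_powr)
    define w where "w = (1 / r) *\<^sub>R z"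
    have zw: "z = r *\<^sub>R w" using r by (simp add: w_def)
    have Nw: "N w = 1" using hom(1)[OF r(1), of w] r Np zw by auto
    have "d w \<le> \<epsilon> * N w + C * D w"
    proof (cases "w \<in> S")
      case True
      have "d w \<le> 2 powr p" using dN[of w] Nw by simp
      also have "2 powr p = C * \<delta>" using \<delta> by (simp add: C_def)
      also have "\<dots> \<le> C * D w" using \<delta>(2)[OF True] C0 by (rule mult_left_mono)
      finally show ?thesis using Nw \<epsilon> by simp
    next
      case False
      thus ?thesis using Nw mult_nonneg_nonneg[OF C0 D0[of w]] by (simp add: S_def)
    qed
    hence "r powr p * d w \<le> r powr p * (\<epsilon> * N w + C * D w)" by (intro mult_left_mono) auto
    thus ?thesis using hom[OF r(1), of w] zw by (simp add: algebra_simps)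
  qed
  show ?thesis
  proof (rule that[OF C0])
    fix a b :: real
    show "\<bar>a - b\<bar> powr p \<le> \<epsilon> * (\<bar>a\<bar> powr p + \<bar>b\<bar> powr p)
        + C * ((\<bar>a\<bar> powr p + \<bar>b\<bar> powr p) / 2 - \<bar>(a + b) / 2\<bar> powr p)"
      using main[of "(a, b)"] by (simp add: d_def D_def N_def)
  qed
qed

text \<open>The integrand version of strict differentiability along a ray: the base point of the
  increment is \<open>t * a\<close>, whereas the linear term uses the slope at \<open>a\<close>
  itself. If \<open>b\<close> is small compared with \<open>\<kappa> + \<bar>a\<bar>\<close>, the
  mean value theorem leads to a point close to \<open>a\<close>, where \<open>f\<close> oscillates
  little by \<open>osc\<close>; otherwise \<open>a\<close> is controlled by \<open>b\<close>, and
  growth alone gives the power of \<open>b\<close>. The value \<open>\<kappa> = 0\<close> serves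
  homogeneous powers, and \<open>\<kappa> = 1\<close> nonlinearities whose behaviour at 0 is not
  that of a power.\<close>

lemma remainder_estimate:
  fixes f F :: "real \<Rightarrow> real" and \<kappa> A q \<epsilon> :: real
  assumes q: "1 < q" and \<kappa>: "0 \<le> \<kappa>" and A: "0 \<le> A"
    and deriv: "\<And>x. (F has_real_derivative f x) (at x)"
    and growth: "\<And>x. \<bar>f x\<bar> \<le> A * (\<kappa> + \<bar>x\<bar>) powr (q - 1)"
    and osc: "\<And>\<epsilon>. 0 < \<epsilon> \<Longrightarrow> \<exists>\<delta>>0. \<forall>a x. \<bar>x - a\<bar> \<le> \<delta> * (\<kappa> + \<bar>a\<bar>) \<longrightarrow>
                \<bar>f x - f a\<bar> \<le> \<epsilon> * (\<kappa> + \<bar>a\<bar>) powr (q - 1)"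
    and \<epsilon>: "0 < \<epsilon>"
  obtains C d where "0 \<le> C" "0 < d"
    "\<And>t a b. \<bar>t - 1\<bar> < d \<Longrightarrow> \<bar>F (t * a + b) - F (t * a) - f a * b\<bar>
        \<le> \<epsilon> * ((\<kappa> + \<bar>a\<bar>) powr (q - 1) * \<bar>b\<bar>) + C * \<bar>b\<bar> powr q"
proof -
  obtain \<delta>0 where \<delta>0: "0 < \<delta>0" "\<And>a x. \<bar>x - a\<bar> \<le> \<delta>0 * (\<kappa> + \<bar>a\<bar>) \<Longrightarrow>
                \<bar>f x - f a\<bar> \<le> \<epsilon> * (\<kappa> + \<bar>a\<bar>) powr (q - 1)"
    using osc[OF \<epsilon>] by blast
  define \<delta> where "\<delta> = min \<delta>0 1"
  have \<delta>: "0 < \<delta>" "\<delta> \<le> 1" "\<And>a x. \<bar>x - a\<bar> \<le> \<delta> * (\<kappa> + \<bar>a\<bar>) \<Longrightarrow>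
                \<bar>f x - f a\<bar> \<le> \<epsilon> * (\<kappa> + \<bar>a\<bar>) powr (q - 1)"
  proof -
    show "0 < \<delta>" "\<delta> \<le> 1" using \<delta>0 by (auto simp: \<delta>_def)
    fix a x assume a: "\<bar>x - a\<bar> \<le> \<delta> * (\<kappa> + \<bar>a\<bar>)"
    have "\<delta> * (\<kappa> + \<bar>a\<bar>) \<le> \<delta>0 * (\<kappa> + \<bar>a\<bar>)" using \<kappa> by (intro mult_right_mono) (auto simp: \<delta>_def)
    thus "\<bar>f x - f a\<bar> \<le> \<epsilon> * (\<kappa> + \<bar>a\<bar>) powr (q - 1)" using a \<delta>0(2)[of x a] by linarith
  qed
  define B where "B = 4 / \<delta> + 1"
  define C where "C = 2 * A * B powr (q - 1)"
  have B: "1 \<le> B" using \<delta> by (simp add: B_def)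
  have C0: "0 \<le> C" using A by (simp add: C_def)
  have main: "\<bar>F (t * a + b) - F (t * a) - f a * b\<bar>
        \<le> \<epsilon> * ((\<kappa> + \<bar>a\<bar>) powr (q - 1) * \<bar>b\<bar>) + C * \<bar>b\<bar> powr q" if t: "\<bar>t - 1\<bar> < \<delta> / 2" for t a b
  proof (cases "b = 0")
    case True thus ?thesis by simp
  next
    case b: False
    obtain \<xi> where \<xi>: "\<bar>\<xi> - t * a\<bar> \<le> \<bar>b\<bar>" "F (t * a + b) - F (t * a) = f \<xi> * b"
    proof -
      have c: "continuous_on S F" for S
        by (intro continuous_at_imp_continuous_on ballI DERIV_isCont[OF deriv])
      consider "b > 0" | "b < 0" using b by linarith
      thus ?thesis
      proof cases
        case 1
        obtain \<xi> where "t * a < \<xi>" "\<xi> < t * a + b" "F (t * a + b) - F (t * a) = f \<xi> * (t * a + b - t * a)"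
          by (rule mean_value_real[of "t * a" "t * a + b" F f]) (use 1 c deriv in auto)
        thus ?thesis by (intro that[of \<xi>]) (use 1 in auto)
      next
        case 2
        obtain \<xi> where "t * a + b < \<xi>" "\<xi> < t * a" "F (t * a) - F (t * a + b) = f \<xi> * (t * a - (t * a + b))"
          by (rule mean_value_real[of "t * a + b" "t * a" F f]) (use 2 c deriv in auto)
        thus ?thesis by (intro that[of \<xi>]) (use 2 in \<open>auto simp: algebra_simps\<close>)
      qed
    qed
    have e: "\<bar>F (t * a + b) - F (t * a) - f a * b\<bar> = \<bar>f \<xi> - f a\<bar> * \<bar>b\<bar>"
      unfolding \<xi>(2) by (simp add: abs_mult[symmetric] algebra_simps)
    have ta: "\<bar>t * a - a\<bar> \<le> \<delta> / 2 * \<bar>a\<bar>"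
    proof -
      have "\<bar>t * a - a\<bar> = \<bar>t - 1\<bar> * \<bar>a\<bar>" by (simp add: abs_mult[symmetric] algebra_simps)
      also have "\<dots> \<le> \<delta> / 2 * \<bar>a\<bar>" using t by (intro mult_right_mono) auto
      finally show ?thesis .
    qed
    have pos: "0 \<le> \<epsilon> * ((\<kappa> + \<bar>a\<bar>) powr (q - 1) * \<bar>b\<bar>)" "0 \<le> C * \<bar>b\<bar> powr q"
      using \<epsilon> C0 by auto
    show ?thesis
    proof (cases "\<bar>b\<bar> \<le> \<delta> / 2 * (\<kappa> + \<bar>a\<bar>)")
      case True
      have "\<bar>\<xi> - a\<bar> \<le> \<delta> / 2 * \<bar>a\<bar> + \<delta> / 2 * (\<kappa> + \<bar>a\<bar>)" using \<xi>(1) ta True by linarith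
      also have "\<dots> \<le> \<delta> * (\<kappa> + \<bar>a\<bar>)" using mult_nonneg_nonneg[of \<delta> \<kappa>] \<kappa> \<delta> by (simp add: field_simps)
      finally have "\<bar>f \<xi> - f a\<bar> \<le> \<epsilon> * (\<kappa> + \<bar>a\<bar>) powr (q - 1)" by (rule \<delta>(3))
      hence "\<bar>f \<xi> - f a\<bar> * \<bar>b\<bar> \<le> \<epsilon> * (\<kappa> + \<bar>a\<bar>) powr (q - 1) * \<bar>b\<bar>" by (intro mult_right_mono) auto
      thus ?thesis using e pos by (simp add: algebra_simps)
    next
      case False
      hence ka: "\<kappa> + \<bar>a\<bar> \<le> 2 / \<delta> * \<bar>b\<bar>" using \<delta> by (simp add: field_simps)
      have "\<delta> / 2 * \<bar>a\<bar> \<le> 1 * \<bar>a\<bar>" using \<delta> by (intro mult_right_mono) auto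
      hence "\<bar>\<xi>\<bar> \<le> 2 * \<bar>a\<bar> + \<bar>b\<bar>" using \<xi>(1) ta by linarith
      hence "\<kappa> + \<bar>\<xi>\<bar> \<le> 2 * (2 / \<delta> * \<bar>b\<bar>) + \<bar>b\<bar>" using ka \<kappa> by linarith
      hence k1: "\<kappa> + \<bar>\<xi>\<bar> \<le> B * \<bar>b\<bar>" by (simp add: B_def algebra_simps)
      have "2 / \<delta> \<le> B" using \<delta> by (simp add: B_def field_simps)
      hence "2 / \<delta> * \<bar>b\<bar> \<le> B * \<bar>b\<bar>" by (rule mult_right_mono) auto
      hence k2: "\<kappa> + \<bar>a\<bar> \<le> B * \<bar>b\<bar>" using ka by linarith
      have g: "\<bar>f x\<bar> \<le> A * (B powr (q - 1) * \<bar>b\<bar> powr (q - 1))" if "\<kappa> + \<bar>x\<bar> \<le> B * \<bar>b\<bar>" for x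
      proof -
        have "(\<kappa> + \<bar>x\<bar>) powr (q - 1) \<le> (B * \<bar>b\<bar>) powr (q - 1)"
          using that \<kappa> q by (intro powr_mono2) auto
        hence "A * (\<kappa> + \<bar>x\<bar>) powr (q - 1) \<le> A * (B powr (q - 1) * \<bar>b\<bar> powr (q - 1))"
          using A B by (intro mult_left_mono) (auto simp: powr_mult)
        thus ?thesis using growth[of x] by linarith
      qed
      have "\<bar>f \<xi> - f a\<bar> \<le> C * \<bar>b\<bar> powr (q - 1)"
        using g[OF k1] g[OF k2] by (simp add: C_def)
      hence "\<bar>f \<xi> - f a\<bar> * \<bar>b\<bar> \<le> C * \<bar>b\<bar> powr (q - 1) * \<bar>b\<bar>" by (intro mult_right_mono) auto
      also have "\<dots> = C * \<bar>b\<bar> powr q" using b by (simp add: powr_diff)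
      finally show ?thesis using e pos by linarith
    qed
  qed
  show ?thesis by (rule that[OF C0 _ main, of "\<delta> / 2"]) (use \<delta> in auto)
qed

lemma abs_powr_has_derivative:
  fixes p x :: real
  assumes p: "1 < p"
  shows "((\<lambda>x. \<bar>x\<bar> powr p / p) has_real_derivative sgn x * \<bar>x\<bar> powr (p - 1)) (at x)"
proof -
  consider "x > 0" | "x < 0" | "x = 0" by linarith
  thus ?thesis
  proof cases
    case 1
    have "((\<lambda>x. x powr p / p) has_real_derivative x powr (p - 1)) (at x)"
      using 1 p by (auto intro!: derivative_eq_intros simp: powr_diff)
    moreover have "\<forall>\<^sub>F y in nhds x. \<bar>y\<bar> powr p / p = y powr p / p"
      by (rule eventually_mono[OF eventually_nhds_in_open[of "{0<..}" x]]) (use 1 in auto)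
    ultimately show ?thesis using 1 by (subst DERIV_cong_ev[OF refl _ refl]) auto
  next
    case 2
    have "((\<lambda>x. (- x) powr p / p) has_real_derivative - ((- x) powr (p - 1))) (at x)"
      using 2 p by (auto intro!: derivative_eq_intros simp: powr_diff)
    moreover have "\<forall>\<^sub>F y in nhds x. \<bar>y\<bar> powr p / p = (- y) powr p / p"
      by (rule eventually_mono[OF eventually_nhds_in_open[of "{..<0}" x]]) (use 2 in auto)
    ultimately show ?thesis using 2 by (subst DERIV_cong_ev[OF refl _ refl]) auto
  next
    case 3
    have c: "((\<lambda>h::real. \<bar>h\<bar> powr (p - 1) / p) \<longlongrightarrow> 0) (at 0)"
    proof -
      have "isCont (\<lambda>h::real. \<bar>h\<bar> powr (p - 1) / p) 0"
        using continuous_on_abs_powr[of "p - 1" UNIV "\<lambda>h. h"] p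
        by (intro continuous_intros) (auto simp: continuous_on_eq_continuous_at)
      thus ?thesis by (simp add: isCont_def)
    qed
    have "((\<lambda>h. (\<bar>h\<bar> powr p / p) / h) \<longlongrightarrow> 0) (at (0::real))"
    proof (rule tendsto_rabs_zero_cancel, rule tendsto_cong[THEN iffD1, OF _ c])
      have "\<bar>h\<bar> powr (p - 1) / p = \<bar>(\<bar>h\<bar> powr p / p) / h\<bar>" if "h \<noteq> 0" for h :: real
        using that p by (simp add: powr_diff abs_mult)
      thus "\<forall>\<^sub>F h in at 0. \<bar>h\<bar> powr (p - 1) / p = \<bar>(\<bar>h\<bar> powr p / p) / h\<bar>"
        by (auto simp: eventually_at_filter)
    qed
    thus ?thesis using 3 by (simp add: has_field_derivative_iff)
  qed
qed

text \<open>The oscillation hypothesis of the general estimate reduces by multiplicativity of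
  \<open>sgn x * \<bar>x\<bar> powr (p - 1)\<close> to continuity at 1.\<close>

lemma power_remainder_estimate:
  fixes p \<epsilon> :: real
  assumes p: "1 < p" and \<epsilon>: "0 < \<epsilon>"
  obtains C d where "0 \<le> C" "0 < d"
    "\<And>t a b. \<bar>t - 1\<bar> < d \<Longrightarrow>
       \<bar>\<bar>t * a + b\<bar> powr p / p - \<bar>t * a\<bar> powr p / p - sgn a * \<bar>a\<bar> powr (p - 1) * b\<bar>
        \<le> \<epsilon> * (\<bar>a\<bar> powr (p - 1) * \<bar>b\<bar>) + C * \<bar>b\<bar> powr p"
proof -
  define s where "s = (\<lambda>x::real. sgn x * \<bar>x\<bar> powr (p - 1))"
  have s_mult: "s (a * y) = s a * s y" for a y
    by (simp add: s_def sgn_mult abs_mult powr_mult)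
  have s_abs: "\<bar>s a\<bar> = \<bar>a\<bar> powr (p - 1)" for a by (simp add: s_def abs_mult sgn_if)
  have osc: "\<exists>\<delta>>0. \<forall>a x. \<bar>x - a\<bar> \<le> \<delta> * (0 + \<bar>a\<bar>) \<longrightarrow> \<bar>s x - s a\<bar> \<le> e * (0 + \<bar>a\<bar>) powr (p - 1)"
    if e: "0 < e" for e
  proof -
    have "isCont (\<lambda>x::real. x powr (p - 1)) 1" by (intro continuous_intros) auto
    then obtain \<delta> where \<delta>: "0 < \<delta>" "\<And>y. \<bar>y - 1\<bar> < \<delta> \<Longrightarrow> \<bar>y powr (p - 1) - 1\<bar> < e"
      using e unfolding continuous_at_eps_delta dist_real_def by auto
    define \<delta>' where "\<delta>' = min \<delta> 1 / 2"
    have \<delta>': "0 < \<delta>'" "\<delta>' < \<delta>" "\<delta>' < 1" using \<delta>(1) by (auto simp: \<delta>'_def)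
    have "\<bar>s x - s a\<bar> \<le> e * (0 + \<bar>a\<bar>) powr (p - 1)" if x: "\<bar>x - a\<bar> \<le> \<delta>' * (0 + \<bar>a\<bar>)" for a x
    proof (cases "a = 0")
      case True thus ?thesis using x by simp
    next
      case False
      define y where "y = x / a"
      have xy: "x = a * y" using False by (simp add: y_def)
      have "\<bar>x - a\<bar> = \<bar>a\<bar> * \<bar>y - 1\<bar>" unfolding xy by (simp add: abs_mult[symmetric] algebra_simps)
      hence y: "\<bar>y - 1\<bar> \<le> \<delta>'" using x False by simp
      hence y0: "0 < y" "\<bar>y - 1\<bar> < \<delta>" using \<delta>' by auto
      have sy: "\<bar>s y - 1\<bar> \<le> e" using \<delta>(2)[OF y0(2)] y0(1) by (simp add: s_def)
      have "\<bar>s x - s a\<bar> = \<bar>s a\<bar> * \<bar>s y - 1\<bar>"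
        unfolding xy s_mult by (simp add: abs_mult[symmetric] algebra_simps)
      also have "\<dots> \<le> \<bar>s a\<bar> * e" using sy by (intro mult_left_mono) auto
      finally show ?thesis by (simp add: s_abs mult.commute)
    qed
    thus ?thesis using \<delta>' by blast
  qed
  obtain C d where "0 \<le> C" "0 < d"
    "\<And>t a b. \<bar>t - 1\<bar> < d \<Longrightarrow> \<bar>\<bar>t * a + b\<bar> powr p / p - \<bar>t * a\<bar> powr p / p - s a * b\<bar>
        \<le> \<epsilon> * ((0 + \<bar>a\<bar>) powr (p - 1) * \<bar>b\<bar>) + C * \<bar>b\<bar> powr p"
    by (rule remainder_estimate[where F = "\<lambda>x. \<bar>x\<bar> powr p / p" and f = s and \<kappa> = 0 and A = 1 and q = p, OF p _ _ _ _ osc \<epsilon>])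
      (auto simp: s_abs, simp add: s_def abs_powr_has_derivative[OF p])
  thus ?thesis using that by (auto simp: s_def)
qed

section \<open>Odd superlinear nonlinearities\<close>

text \<open>The one-dimensional hypotheses on \<open>f\<close>. The primitive is represented by
  its derivative and its value at 0, so that estimates for \<open>F\<close> follow from the mean
  value theorem.\<close>

locale superlinear_nonlinearity =
  fixes f F :: "real \<Rightarrow> real" and p1 pN \<alpha> :: real
  assumes p1: "1 < p1" and p1_le: "p1 \<le> pN" and pN_less: "pN < \<alpha>"
    and cont: "continuous_on UNIV f" and odd: "\<And>t. f (- t) = - f t"
    and nonneg: "\<And>t. 0 \<le> t \<Longrightarrow> 0 \<le> f t"
    and deriv: "\<And>t. (F has_real_derivative f t) (at t)" and F_zero: "F 0 = 0"
    and at_zero: "((\<lambda>t. f t / t powr (p1 - 1)) \<longlongrightarrow> 0) (at_right 0)"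
    and superlinear: "filterlim (\<lambda>t. F t / t powr pN) at_top at_top"
    and subcritical: "((\<lambda>t. f t / t powr (\<alpha> - 1)) \<longlongrightarrow> 0) at_top"
    and increasing: "strict_mono_on {0<..} (\<lambda>t. f t / t powr (pN - 1))"
begin

lemma F_even: "F (- t) = F t"
proof -
  have "((\<lambda>t. F (- t) - F t) has_real_derivative 0) (at t)" for t
    by (rule derivative_eq_intros refl DERIV_chain2[OF deriv] deriv)+ (simp add: odd)
  hence "F (- t) - F t = F (- 0) - F 0" by (intro DERIV_isconst_all[of "\<lambda>t. F (- t) - F t"]) auto
  thus ?thesis by simp
qed

lemma F_abs: "F \<bar>t\<bar> = F t" using F_even by (cases "0 \<le> t") auto

lemma F_cont: "continuous_on S F"
  by (intro continuous_at_imp_continuous_on ballI DERIV_isCont[OF deriv])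

lemma F_le_if_f_le:
  assumes "0 \<le> x" "\<And>\<xi>. 0 < \<xi> \<Longrightarrow> \<xi> < x \<Longrightarrow> f \<xi> \<le> B"
  shows "F x \<le> B * x"
proof (cases "x = 0")
  case False
  obtain \<xi> where "0 < \<xi>" "\<xi> < x" "F x - F 0 = f \<xi> * (x - 0)"
    by (rule mean_value_real[of 0 x F f]) (use False assms deriv F_cont in auto)
  thus ?thesis using assms F_zero by (auto intro!: mult_right_mono)
qed (simp add: F_zero)

lemma F_nonneg: "0 \<le> F t"
proof -
  have "0 \<le> F x" if x0: "0 < x" for x
  proof -
    obtain \<xi> where "0 < \<xi>" "\<xi> < x" "F x - F 0 = f \<xi> * (x - 0)"
      by (rule mean_value_real[of 0 x F f]) (use x0 deriv F_cont in auto)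
    thus ?thesis using nonneg[of \<xi>] F_zero x0 by simp
  qed
  thus ?thesis using F_abs[of t] F_zero by (metis abs_ge_zero order_le_less)
qed

lemma f_abs: "\<bar>f t\<bar> = f \<bar>t\<bar>"
  using odd[of t] nonneg[of t] nonneg[of "- t"] by (cases "0 \<le> t") auto

text \<open>Beyond some threshold the subcritical growth gives the factor
  \<open>\<epsilon>\<close>; below it \<open>f\<close> is bounded by compactness.\<close>

lemma f_growth_eps:
  assumes "0 < \<epsilon>"
  obtains C where "0 \<le> C" "\<And>x. \<bar>f x\<bar> \<le> \<epsilon> * \<bar>x\<bar> powr (\<alpha> - 1) + C"
proof -
  have "\<forall>\<^sub>F t in at_top. \<bar>f t / t powr (\<alpha> - 1)\<bar> < \<epsilon>"
    using tendstoD[OF subcritical assms] by (simp add: dist_real_def)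
  then obtain T where T: "\<And>t. t \<ge> T \<Longrightarrow> \<bar>f t / t powr (\<alpha> - 1)\<bar> < \<epsilon>"
    by (auto simp: eventually_at_top_linorder)
  define T' where "T' = max T 1"
  have "bounded (f ` {0..T'})"
    by (intro compact_imp_bounded compact_continuous_image continuous_on_subset[OF cont]) auto
  then obtain C where "\<forall>y\<in>f ` {0..T'}. norm y \<le> C" unfolding bounded_iff by blast
  hence C: "\<bar>f x\<bar> \<le> C" if "x \<in> {0..T'}" for x using that by auto
  have C0: "0 \<le> C" using order_trans[OF abs_ge_zero C[of 0]] by (simp add: T'_def)
  have "f x \<le> \<epsilon> * x powr (\<alpha> - 1) + C" if "0 \<le> x" for x
  proof (cases "x \<le> T'")
    case True
    thus ?thesis using C[of x] that assms by (simp add: add_increasing)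
  next
    case False
    hence "\<bar>f x / x powr (\<alpha> - 1)\<bar> < \<epsilon>" "0 < x" using T[of x] by (auto simp: T'_def)
    hence "f x < \<epsilon> * x powr (\<alpha> - 1)" by (auto simp: abs_less_iff field_simps)
    thus ?thesis using C0 by simp
  qed
  thus ?thesis using f_abs by (intro that[OF C0]) auto
qed

lemma f_growth:
  obtains A where "0 \<le> A" "\<And>x. \<bar>f x\<bar> \<le> A * (1 + \<bar>x\<bar>) powr (\<alpha> - 1)"
proof -
  obtain C where C: "0 \<le> C" "\<And>x. \<bar>f x\<bar> \<le> 1 * \<bar>x\<bar> powr (\<alpha> - 1) + C"
    by (rule f_growth_eps[of 1]) auto
  have "\<bar>f x\<bar> \<le> (1 + C) * (1 + \<bar>x\<bar>) powr (\<alpha> - 1)" for x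
  proof -
    have a: "0 \<le> \<alpha> - 1" using p1 p1_le pN_less by simp
    have "\<bar>x\<bar> powr (\<alpha> - 1) \<le> (1 + \<bar>x\<bar>) powr (\<alpha> - 1)" using a by (intro powr_mono2) auto
    moreover have "C * 1 \<le> C * (1 + \<bar>x\<bar>) powr (\<alpha> - 1)"
      using a C by (intro mult_left_mono ge_one_powr_ge_zero) auto
    ultimately show ?thesis using C(2)[of x] by (simp add: algebra_simps)
  qed
  thus ?thesis using C by (intro that[of "1 + C"]) auto
qed

text \<open>For large \<open>\<bar>a\<bar>\<close> both values are small compared with the
  right-hand side, by the arbitrarily small factor in \<open>f_growth_eps\<close>; for bounded
  \<open>a\<close> this is uniform continuity on a compact interval.\<close>

lemma f_oscillation:
  assumes \<epsilon>: "0 < \<epsilon>"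
  shows "\<exists>\<delta>>0. \<forall>a x. \<bar>x - a\<bar> \<le> \<delta> * (1 + \<bar>a\<bar>) \<longrightarrow> \<bar>f x - f a\<bar> \<le> \<epsilon> * (1 + \<bar>a\<bar>) powr (\<alpha> - 1)"
proof -
  have \<alpha>: "0 < \<alpha> - 1" using p1 p1_le pN_less by simp
  define \<epsilon>' where "\<epsilon>' = \<epsilon> / (4 * 2 powr (\<alpha> - 1))"
  have e': "0 < \<epsilon>'" using \<epsilon> by (simp add: \<epsilon>'_def)
  obtain C where C: "0 \<le> C" "\<And>x. \<bar>f x\<bar> \<le> \<epsilon>' * \<bar>x\<bar> powr (\<alpha> - 1) + C"
    by (rule f_growth_eps[OF e']) blast
  define R where "R = (4 * C / \<epsilon>) powr (1 / (\<alpha> - 1))"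
  have R0: "0 \<le> R" by (simp add: R_def)
  have R: "C \<le> \<epsilon> / 4 * (1 + \<bar>a\<bar>) powr (\<alpha> - 1)" if "R \<le> \<bar>a\<bar>" for a
  proof -
    have "4 * C / \<epsilon> = R powr (\<alpha> - 1)" using \<alpha> C \<epsilon> by (cases "C = 0") (auto simp: R_def powr_powr)
    also have "\<dots> \<le> (1 + \<bar>a\<bar>) powr (\<alpha> - 1)" using that R0 \<alpha> by (intro powr_mono2) auto
    finally show ?thesis using \<epsilon> by (simp add: field_simps)
  qed
  define K where "K = {- (3 * R + 2)..3 * R + 2}"
  have "uniformly_continuous_on K f"
    by (intro compact_uniformly_continuous continuous_on_subset[OF cont]) (auto simp: K_def)
  then obtain \<eta> where \<eta>: "0 < \<eta>" "\<And>x a. x \<in> K \<Longrightarrow> a \<in> K \<Longrightarrow> \<bar>x - a\<bar> < \<eta> \<Longrightarrow> \<bar>f x - f a\<bar> < \<epsilon>"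
    unfolding uniformly_continuous_on_def dist_real_def using \<epsilon> by metis
  define \<delta> where "\<delta> = min 1 (\<eta> / (2 * (1 + R)))"
  have \<delta>: "0 < \<delta>" "\<delta> \<le> 1" "\<delta> * (1 + R) < \<eta>"
  proof -
    show "0 < \<delta>" "\<delta> \<le> 1" using \<eta> R0 by (auto simp: \<delta>_def)
    have "\<delta> * (1 + R) \<le> \<eta> / (2 * (1 + R)) * (1 + R)" using R0 by (intro mult_right_mono) (auto simp: \<delta>_def)
    also have "\<dots> = \<eta> / 2" using R0 by (auto simp: divide_simps)
    finally show "\<delta> * (1 + R) < \<eta>" using \<eta> by simp
  qed
  have "\<bar>f x - f a\<bar> \<le> \<epsilon> * (1 + \<bar>a\<bar>) powr (\<alpha> - 1)" if x: "\<bar>x - a\<bar> \<le> \<delta> * (1 + \<bar>a\<bar>)" for a x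
  proof (cases "R \<le> \<bar>a\<bar>")
    case True
    define Y where "Y = (1 + \<bar>a\<bar>) powr (\<alpha> - 1)"
    have "\<delta> * (1 + \<bar>a\<bar>) \<le> 1 * (1 + \<bar>a\<bar>)" using \<delta> by (intro mult_right_mono) auto
    hence "\<bar>x - a\<bar> \<le> 1 + \<bar>a\<bar>" using x by simp
    hence "\<bar>x\<bar> \<le> 2 * (1 + \<bar>a\<bar>)" using abs_triangle_ineq2[of x a] abs_ge_zero[of a] by (simp add: algebra_simps del: abs_ge_zero)
    hence "\<bar>x\<bar> powr (\<alpha> - 1) \<le> (2 * (1 + \<bar>a\<bar>)) powr (\<alpha> - 1)" using \<alpha> by (intro powr_mono2) auto
    also have "\<dots> = 2 powr (\<alpha> - 1) * Y" unfolding Y_def by (rule powr_mult)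
    finally have "\<epsilon>' * \<bar>x\<bar> powr (\<alpha> - 1) \<le> \<epsilon>' * (2 powr (\<alpha> - 1) * Y)" using e' by (intro mult_left_mono) auto
    also have "\<dots> = \<epsilon> / 4 * Y" by (simp add: \<epsilon>'_def)
    finally have 1: "\<bar>f x\<bar> \<le> \<epsilon> / 4 * Y + C" using C(2)[of x] by linarith
    have "\<bar>a\<bar> powr (\<alpha> - 1) \<le> Y" using \<alpha> by (auto simp: Y_def intro!: powr_mono2)
    moreover have "\<epsilon>' \<le> \<epsilon> / 4"
    proof -
      have "1 \<le> 2 powr (\<alpha> - 1)" using \<alpha> by (intro ge_one_powr_ge_zero) auto
      thus ?thesis using \<epsilon> by (simp add: \<epsilon>'_def field_simps)
    qed
    ultimately have "\<epsilon>' * \<bar>a\<bar> powr (\<alpha> - 1) \<le> \<epsilon> / 4 * Y" using e' by (intro mult_mono) auto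
    hence 2: "\<bar>f a\<bar> \<le> \<epsilon> / 4 * Y + C" using C(2)[of a] by linarith
    have "C \<le> \<epsilon> / 4 * Y" using R[OF True] by (simp add: Y_def)
    hence "\<bar>f x - f a\<bar> \<le> \<epsilon> * Y" using 1 2 by linarith
    thus ?thesis by (simp add: Y_def)
  next
    case False
    have "\<delta> * (1 + \<bar>a\<bar>) \<le> \<delta> * (1 + R)" using False \<delta> by (intro mult_left_mono) auto
    hence xa: "\<bar>x - a\<bar> < \<eta>" using x \<delta> by linarith
    have "\<delta> * (1 + \<bar>a\<bar>) \<le> 1 * (1 + \<bar>a\<bar>)" using \<delta> by (intro mult_right_mono) auto
    hence "x \<in> K" "a \<in> K" using x False R0 unfolding K_def by auto
    hence "\<bar>f x - f a\<bar> \<le> \<epsilon> * 1" using \<eta>(2)[OF _ _ xa] by simp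
    also have "\<dots> \<le> \<epsilon> * (1 + \<bar>a\<bar>) powr (\<alpha> - 1)"
      using \<epsilon> \<alpha> by (intro mult_left_mono ge_one_powr_ge_zero) auto
    finally show ?thesis .
  qed
  thus ?thesis using \<delta> by blast
qed

lemma F_remainder_estimate:
  assumes "0 < \<epsilon>"
  obtains C d where "0 \<le> C" "0 < d"
    "\<And>t a b. \<bar>t - 1\<bar> < d \<Longrightarrow> \<bar>F (t * a + b) - F (t * a) - f a * b\<bar>
        \<le> \<epsilon> * ((1 + \<bar>a\<bar>) powr (\<alpha> - 1) * \<bar>b\<bar>) + C * \<bar>b\<bar> powr \<alpha>"
proof -
  obtain A where A: "0 \<le> A" "\<And>x. \<bar>f x\<bar> \<le> A * (1 + \<bar>x\<bar>) powr (\<alpha> - 1)" by (rule f_growth) blast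
  have "1 < \<alpha>" using p1 p1_le pN_less by simp
  thus ?thesis
    by (rule remainder_estimate[OF _ _ A(1) deriv A(2) f_oscillation assms, where thesis = thesis]) (use that in auto)
qed

lemma F_growth:
  obtains A where "0 \<le> A" "\<And>x. F x \<le> A * (1 + \<bar>x\<bar> powr \<alpha>)"
proof -
  have \<alpha>: "0 < \<alpha> - 1" using p1 p1_le pN_less by simp
  obtain A where A: "0 \<le> A" "\<And>x. \<bar>f x\<bar> \<le> A * (1 + \<bar>x\<bar>) powr (\<alpha> - 1)" by (rule f_growth) blast
  have "F x \<le> A * 2 powr \<alpha> * (1 + \<bar>x\<bar> powr \<alpha>)" if "0 \<le> x" for x
  proof -
    have "F x \<le> (A * (1 + x) powr (\<alpha> - 1)) * x"
    proof (rule F_le_if_f_le[OF that])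
      fix \<xi> assume x: "0 < \<xi>" "\<xi> < x"
      have "A * (1 + \<xi>) powr (\<alpha> - 1) \<le> A * (1 + x) powr (\<alpha> - 1)"
        using x A \<alpha> by (intro mult_left_mono powr_mono2) auto
      thus "f \<xi> \<le> A * (1 + x) powr (\<alpha> - 1)" using A(2)[of \<xi>] x by simp
    qed
    also have "\<dots> \<le> (A * (1 + x) powr (\<alpha> - 1)) * (1 + x)" using that A by (intro mult_left_mono) auto
    also have "\<dots> = A * (1 + x) powr \<alpha>" using that by (simp add: powr_diff)
    also have "\<dots> \<le> A * (2 powr \<alpha> * (1 powr \<alpha> + x powr \<alpha>))"
      using A \<alpha> that by (intro mult_left_mono powr_add_le) auto
    finally show ?thesis using that by (simp add: algebra_simps)
  qed
  from this[of "\<bar>x\<bar>" for x] show ?thesis using A F_abs by (intro that[of "A * 2 powr \<alpha>"]) auto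
qed

lemma F_small:
  assumes "0 < \<epsilon>"
  obtains C where "0 \<le> C" "\<And>x. F x \<le> \<epsilon> * \<bar>x\<bar> powr p1 + C * \<bar>x\<bar> powr \<alpha>"
proof -
  have \<alpha>: "0 < \<alpha>" using p1 p1_le pN_less by simp
  obtain A where A: "0 \<le> A" "\<And>x. F x \<le> A * (1 + \<bar>x\<bar> powr \<alpha>)" by (rule F_growth) blast
  have "\<forall>\<^sub>F t in at_right 0. \<bar>f t / t powr (p1 - 1)\<bar> < \<epsilon>"
    using tendstoD[OF at_zero assms] by (simp add: dist_real_def)
  then obtain \<eta> where \<eta>: "0 < \<eta>" "\<And>t. 0 < t \<Longrightarrow> t < \<eta> \<Longrightarrow> \<bar>f t / t powr (p1 - 1)\<bar> < \<epsilon>"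
    by (auto simp: eventually_at_right_field)
  define C where "C = A * (1 / \<eta> powr \<alpha> + 1)"
  have C0: "0 \<le> C" using A by (simp add: C_def)
  have "F x \<le> \<epsilon> * x powr p1 + C * x powr \<alpha>" if x: "0 \<le> x" for x
  proof (cases "x < \<eta>")
    case True
    have "F x \<le> (\<epsilon> * x powr (p1 - 1)) * x"
    proof (rule F_le_if_f_le[OF x])
      fix \<xi> assume y: "0 < \<xi>" "\<xi> < x"
      have "f \<xi> \<le> \<epsilon> * \<xi> powr (p1 - 1)" using \<eta>(2)[of \<xi>] y True by (auto simp: abs_less_iff field_simps)
      also have "\<dots> \<le> \<epsilon> * x powr (p1 - 1)" using y p1 assms by (intro mult_left_mono powr_mono2) auto
      finally show "f \<xi> \<le> \<epsilon> * x powr (p1 - 1)" .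
    qed
    also have "\<dots> = \<epsilon> * x powr p1" using x by (cases "x = 0") (auto simp: powr_diff)
    finally show ?thesis using C0 by (simp add: add_increasing2)
  next
    case False
    have "\<eta> powr \<alpha> \<le> x powr \<alpha>" using False \<eta> \<alpha> by (intro powr_mono2) auto
    hence "1 \<le> x powr \<alpha> / \<eta> powr \<alpha>" using \<eta> by (simp add: field_simps)
    hence "A * (1 + x powr \<alpha>) \<le> A * (x powr \<alpha> / \<eta> powr \<alpha> + x powr \<alpha>)" using A by (intro mult_left_mono) auto
    also have "\<dots> = C * x powr \<alpha>" by (simp add: C_def algebra_simps)
    finally have "F x \<le> C * x powr \<alpha>" using A(2)[of x] x by simp
    thus ?thesis using assms by (simp add: add_increasing)
  qed
  from this[of "\<bar>x\<bar>" for x] show ?thesis using C0 F_abs by (intro that[of C]) auto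
qed

lemma F_large:
  assumes "0 < B"
  obtains C where "\<And>x. B * \<bar>x\<bar> powr pN - C \<le> F x"
proof -
  have pN: "0 < pN" using p1 p1_le by simp
  obtain T where T: "\<And>t. t \<ge> T \<Longrightarrow> B \<le> F t / t powr pN"
    using superlinear by (auto simp: filterlim_at_top eventually_at_top_linorder)
  define T' where "T' = max T 1"
  have "B * x powr pN - B * T' powr pN \<le> F x" if x: "0 \<le> x" for x
  proof (cases "T' \<le> x")
    case True
    hence "B \<le> F x / x powr pN" "0 < x" by (auto simp: T'_def intro: T)
    hence "B * x powr pN \<le> F x" by (simp add: field_simps)
    moreover have "0 \<le> B * T' powr pN" using assms by simp
    ultimately show ?thesis by linarith
  next
    case False
    hence "B * x powr pN \<le> B * T' powr pN" using x assms pN by (intro mult_left_mono powr_mono2) auto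
    thus ?thesis using F_nonneg[of x] by linarith
  qed
  from this[of "\<bar>x\<bar>" for x] show ?thesis using F_abs by (intro that[of "B * T' powr pN"]) auto
qed

text \<open>The substitution \<open>\<tau> = t^pN\<close> makes the derivative in
  \<open>\<tau>\<close> a multiple of \<open>f(s) / s^(pN - 1)\<close>, so that monotonicity of
  this quotient is precisely strict convexity in \<open>\<tau>\<close>.\<close>

lemma F_strictly_convex:
  assumes y: "y \<noteq> 0" and \<tau>: "0 \<le> \<tau>1" "\<tau>1 < \<tau>2" and s: "0 < s" "s < 1"
  shows "F (((1 - s) * \<tau>1 + s * \<tau>2) powr (1 / pN) * y)
      < (1 - s) * F (\<tau>1 powr (1 / pN) * y) + s * F (\<tau>2 powr (1 / pN) * y)"
proof -
  have pN: "1 < pN" using p1 p1_le by simp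
  define z where "z = \<bar>y\<bar>"
  have z: "0 < z" using y by (simp add: z_def)
  have e: "F (c * y) = F (c * z)" if "0 \<le> c" for c
    using F_abs[of "c * y"] that by (simp add: abs_mult z_def)
  have "F (((1 - s) * \<tau>1 + s * \<tau>2) powr (1 / pN) * z)
      < (1 - s) * F (\<tau>1 powr (1 / pN) * z) + s * F (\<tau>2 powr (1 / pN) * z)"
  proof (rule strict_convexity_from_derivative[where
        h' = "\<lambda>\<tau>. z powr pN / pN * (f (\<tau> powr (1 / pN) * z) / (\<tau> powr (1 / pN) * z) powr (pN - 1))"])
    show "continuous_on {\<tau>1..\<tau>2} (\<lambda>\<tau>. F (\<tau> powr (1 / pN) * z))"
      using pN \<tau> by (intro continuous_on_compose2[OF F_cont[of UNIV]] continuous_on_mult continuous_on_powr' continuous_intros) auto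
  next
    fix t assume "\<tau>1 < t" "t < \<tau>2"
    hence t: "0 < t" using \<tau> by simp
    have "((\<lambda>\<tau>. F (\<tau> powr (1 / pN) * z)) has_real_derivative
        f (t powr (1 / pN) * z) * (1 / pN * t powr (1 / pN - 1) * z)) (at t)"
      using t by (intro DERIV_chain2[OF deriv]) (auto intro!: derivative_eq_intros simp: powr_diff)
    moreover have "f (t powr (1 / pN) * z) * (1 / pN * t powr (1 / pN - 1) * z) =
       z powr pN / pN * (f (t powr (1 / pN) * z) / (t powr (1 / pN) * z) powr (pN - 1))"
    proof -
      have "(t powr (1 / pN)) powr (pN - 1) = t powr (1 - 1 / pN)"
      proof -
        have "1 / pN * (pN - 1) = 1 - 1 / pN" using pN by (simp add: field_simps)
        thus ?thesis by (simp only: powr_powr)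
      qed
      moreover have "t powr (1 / pN - 1) * t powr (1 - 1 / pN) = 1" using t by (simp add: powr_add[symmetric])
      ultimately have "t powr (1 / pN - 1) = 1 / (t powr (1 / pN)) powr (pN - 1)" using t by (simp add: field_simps)
      thus ?thesis using z pN by (simp add: powr_mult powr_diff)
    qed
    ultimately show "((\<lambda>\<tau>. F (\<tau> powr (1 / pN) * z)) has_real_derivative
       z powr pN / pN * (f (t powr (1 / pN) * z) / (t powr (1 / pN) * z) powr (pN - 1))) (at t)" by simp
  next
    fix t t' assume t: "\<tau>1 < t" "t < t'" "t' < \<tau>2"
    hence "t powr (1 / pN) * z < t' powr (1 / pN) * z"
      using z \<tau> pN by (intro mult_strict_right_mono powr_less_mono2) auto
    hence "f (t powr (1 / pN) * z) / (t powr (1 / pN) * z) powr (pN - 1)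
        < f (t' powr (1 / pN) * z) / (t' powr (1 / pN) * z) powr (pN - 1)"
      using t z \<tau> by (intro strict_mono_onD[OF increasing]) auto
    thus "z powr pN / pN * (f (t powr (1 / pN) * z) / (t powr (1 / pN) * z) powr (pN - 1))
        < z powr pN / pN * (f (t' powr (1 / pN) * z) / (t' powr (1 / pN) * z) powr (pN - 1))"
      using z pN by (intro mult_strict_left_mono) auto
  qed (use \<tau> s in auto)
  thus ?thesis by (simp add: e)
qed

end

section \<open>Convergence of integrals of powers\<close>

lemma integrable_powr_diff:
  fixes g h :: "'a \<Rightarrow> real"
  assumes "0 \<le> p" and [measurable]: "g \<in> borel_measurable M" "h \<in> borel_measurable M"
    and "integrable M (\<lambda>x. \<bar>g x\<bar> powr p)" "integrable M (\<lambda>x. \<bar>h x\<bar> powr p)"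
  shows "integrable M (\<lambda>x. \<bar>g x - h x\<bar> powr p)" "integrable M (\<lambda>x. \<bar>g x + h x\<bar> powr p)"
proof -
  have i: "integrable M (\<lambda>x. 2 powr p * (\<bar>g x\<bar> powr p + \<bar>h x\<bar> powr p))" using assms by auto
  show "integrable M (\<lambda>x. \<bar>g x - h x\<bar> powr p)"
    by (rule Bochner_Integration.integrable_bound[OF i]) (use powr_abs_add_le(2)[OF assms(1)] in auto)
  show "integrable M (\<lambda>x. \<bar>g x + h x\<bar> powr p)"
    by (rule Bochner_Integration.integrable_bound[OF i]) (use powr_abs_add_le(1)[OF assms(1)] in auto)
qed

lemma integral_powr_add_le:
  fixes g h :: "'a \<Rightarrow> real"
  assumes "0 \<le> p" and [measurable]: "g \<in> borel_measurable M" "h \<in> borel_measurable M"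
    and i: "integrable M (\<lambda>x. \<bar>g x\<bar> powr p)" "integrable M (\<lambda>x. \<bar>h x\<bar> powr p)"
  shows "(LINT x|M. \<bar>g x - h x\<bar> powr p) \<le> 2 powr p * ((LINT x|M. \<bar>g x\<bar> powr p) + (LINT x|M. \<bar>h x\<bar> powr p))"
    and "(LINT x|M. \<bar>g x + h x\<bar> powr p) \<le> 2 powr p * ((LINT x|M. \<bar>g x\<bar> powr p) + (LINT x|M. \<bar>h x\<bar> powr p))"
proof -
  have e: "2 powr p * ((LINT x|M. \<bar>g x\<bar> powr p) + (LINT x|M. \<bar>h x\<bar> powr p))
     = (LINT x|M. 2 powr p * (\<bar>g x\<bar> powr p + \<bar>h x\<bar> powr p))" using i by simp
  show "(LINT x|M. \<bar>g x - h x\<bar> powr p) \<le> 2 powr p * ((LINT x|M. \<bar>g x\<bar> powr p) + (LINT x|M. \<bar>h x\<bar> powr p))"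
    unfolding e by (intro integral_mono integrable_powr_diff assms powr_abs_add_le integrable_mult_right Bochner_Integration.integrable_add)
  show "(LINT x|M. \<bar>g x + h x\<bar> powr p) \<le> 2 powr p * ((LINT x|M. \<bar>g x\<bar> powr p) + (LINT x|M. \<bar>h x\<bar> powr p))"
    unfolding e by (intro integral_mono integrable_powr_diff assms powr_abs_add_le integrable_mult_right Bochner_Integration.integrable_add)
qed

lemma AE_zero_if_powr_integral_zero:
  fixes g :: "'a \<Rightarrow> real"
  assumes "integrable M (\<lambda>x. \<bar>g x\<bar> powr p)" "(LINT x|M. \<bar>g x\<bar> powr p) = 0"
  shows "AE x in M. g x = 0"
proof -
  have "AE x in M. \<bar>g x\<bar> powr p = 0"
    using integral_nonneg_eq_0_iff_AE[OF assms(1)] assms(2) by auto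
  thus ?thesis by eventually_elim auto
qed

text \<open>The increments of the sequence, weighted by \<open>2^k\<close>, have summable
  integrals. At almost every point they therefore tend to 0, which bounds the increments by a
  geometric sequence. This works for every \<open>p > 0\<close>, without a triangle inequality for
  the \<open>p\<close>-norm.\<close>

lemma AE_convergent_if_fast_Cauchy:
  fixes u :: "nat \<Rightarrow> 'a \<Rightarrow> real"
  assumes p: "0 < p" and meas[measurable]: "\<And>n. u n \<in> borel_measurable M"
    and fast: "\<And>k. (\<integral>\<^sup>+x. ennreal (\<bar>u (Suc k) x - u k x\<bar> powr p) \<partial>M) \<le> ennreal ((1/4) ^ k)"
  shows "AE x in M. convergent (\<lambda>n. u n x)"
proof -
  define T where "T = (\<lambda>k x. ennreal (2 ^ k * \<bar>u (Suc k) x - u k x\<bar> powr p))"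
  have [measurable]: "T k \<in> borel_measurable M" for k unfolding T_def by measurable
  have "(\<integral>\<^sup>+x. (\<Sum>k. T k x) \<partial>M) = (\<Sum>k. \<integral>\<^sup>+x. T k x \<partial>M)" by (rule nn_integral_suminf) measurable
  also have "\<dots> \<le> (\<Sum>k. ennreal ((1/2) ^ k))"
  proof (intro suminf_le)
    fix k
    have "(\<integral>\<^sup>+x. T k x \<partial>M) = ennreal (2 ^ k) * (\<integral>\<^sup>+x. ennreal (\<bar>u (Suc k) x - u k x\<bar> powr p) \<partial>M)"
      unfolding T_def by (subst nn_integral_cmult[symmetric]) (auto simp: ennreal_mult)
    also have "\<dots> \<le> ennreal (2 ^ k) * ennreal ((1/4) ^ k)" by (intro mult_left_mono fast) auto
    also have "\<dots> = ennreal ((1/2) ^ k)" by (simp add: ennreal_mult[symmetric] power_mult_distrib[symmetric])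
    finally show "(\<integral>\<^sup>+x. T k x \<partial>M) \<le> ennreal ((1/2) ^ k)" .
  qed auto
  also have "\<dots> = ennreal (\<Sum>k. (1/2) ^ k)" by (intro suminf_ennreal2 summable_geometric) auto
  also have "\<dots> < \<infinity>" by simp
  finally have "AE x in M. (\<Sum>k. T k x) \<noteq> \<infinity>" by (intro nn_integral_PInf_AE) auto
  thus ?thesis
  proof eventually_elim
    case (elim x)
    define t where "t = (\<lambda>k. 2 ^ k * \<bar>u (Suc k) x - u k x\<bar> powr p)"
    have "summable t"
      using elim unfolding T_def t_def by (intro summable_suminf_not_top) auto
    hence "t \<longlonglongrightarrow> 0" by (rule summable_LIMSEQ_zero)
    hence "\<forall>\<^sub>F k in sequentially. t k < 1" by (rule order_tendstoD) simp
    hence ev: "\<forall>\<^sub>F k in sequentially. \<bar>u (Suc k) x - u k x\<bar> \<le> ((1/2) powr (1/p)) ^ k"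
    proof eventually_elim
      case (elim k)
      hence "\<bar>u (Suc k) x - u k x\<bar> powr p \<le> (1/2) ^ k" by (simp add: t_def field_simps)
      hence "(\<bar>u (Suc k) x - u k x\<bar> powr p) powr (1/p) \<le> ((1/2) ^ k) powr (1/p)"
        using p by (intro powr_mono2) auto
      moreover have "((1/2::real) ^ k) powr (1/p) = ((1/2) powr (1/p)) ^ k"
        by (simp add: powr_realpow[symmetric] powr_powr mult.commute)
      ultimately show ?case using p by (simp add: powr_powr)
    qed
    have "(1/2::real) powr (1/p) < 1 powr (1/p)" using p by (intro powr_less_mono2) auto
    hence "summable (\<lambda>k. ((1/2::real) powr (1/p)) ^ k)" by (intro summable_geometric) auto
    hence "summable (\<lambda>k. u (Suc k) x - u k x)"
      by (rule summable_comparison_test_ev[rotated]) (use ev in auto)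
    hence "convergent (\<lambda>n. \<Sum>k<n. u (Suc k) x - u k x)" by (simp add: summable_iff_convergent)
    hence "convergent (\<lambda>n. u n x - u 0 x)" by (simp only: sum_lessThan_telescope[of "\<lambda>k. u k x"])
    hence "convergent (\<lambda>n. (u n x - u 0 x) + u 0 x)" by (intro convergent_add convergent_const)
    thus ?case by simp
  qed
qed

text \<open>Completeness of \<open>L\<^sup>p\<close>, phrased with the integrals of powers instead
  of norms: a fast subsequence converges almost everywhere, and Fatou's lemma carries the Cauchy
  bound over to the limit.\<close>

lemma powr_complete:
  fixes u :: "nat \<Rightarrow> 'a \<Rightarrow> real"
  assumes p: "0 < p" and meas[measurable]: "\<And>n. u n \<in> borel_measurable M"
    and int: "\<And>n. integrable M (\<lambda>x. \<bar>u n x\<bar> powr p)"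
    and Cauchy: "\<And>e. 0 < e \<Longrightarrow> \<exists>N. \<forall>m\<ge>N. \<forall>n\<ge>N. (LINT x|M. \<bar>u m x - u n x\<bar> powr p) < e"
  obtains g where "g \<in> borel_measurable M" "integrable M (\<lambda>x. \<bar>g x\<bar> powr p)"
    "(\<lambda>n. LINT x|M. \<bar>u n x - g x\<bar> powr p) \<longlonglongrightarrow> 0"
proof -
  have intd: "integrable M (\<lambda>x. \<bar>u m x - u n x\<bar> powr p)" for m n
    using p by (intro integrable_powr_diff int meas) auto
  have nn: "(\<integral>\<^sup>+x. ennreal (\<bar>u m x - u n x\<bar> powr p) \<partial>M) = ennreal (LINT x|M. \<bar>u m x - u n x\<bar> powr p)" for m n
    using intd by (intro nn_integral_eq_integral) auto
  obtain N where N: "\<And>k m n. N k \<le> m \<Longrightarrow> N k \<le> n \<Longrightarrow> (LINT x|M. \<bar>u m x - u n x\<bar> powr p) < (1/4) ^ k"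
    using Cauchy[of "(1/4)^k" for k] by (metis zero_less_power zero_less_divide_1_iff zero_less_numeral)
  define r where "r = (\<lambda>k. (\<Sum>j\<le>k. N j) + k)"
  have r: "strict_mono r" by (auto simp: strict_mono_Suc_iff r_def)
  have Nr: "N k \<le> r j" if "k \<le> j" for k j
  proof -
    have "N k \<le> (\<Sum>i\<le>j. N i)" using that by (intro member_le_sum) auto
    thus ?thesis by (simp add: r_def)
  qed
  have conv: "AE x in M. convergent (\<lambda>n. u (r n) x)"
  proof (rule AE_convergent_if_fast_Cauchy[OF p])
    fix k show "(\<integral>\<^sup>+x. ennreal (\<bar>u (r (Suc k)) x - u (r k) x\<bar> powr p) \<partial>M) \<le> ennreal ((1/4) ^ k)"
      unfolding nn using N[OF Nr[of k "Suc k"] Nr[of k k]] by (intro ennreal_leI) auto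
  qed auto
  define g where "g = (\<lambda>x. lim (\<lambda>n. u (r n) x))"
  have [measurable]: "g \<in> borel_measurable M" unfolding g_def by measurable
  have g: "AE x in M. (\<lambda>n. u (r n) x) \<longlonglongrightarrow> g x"
    using conv by eventually_elim (auto simp: g_def convergent_LIMSEQ_iff)
  have fatou: "(\<integral>\<^sup>+x. ennreal (\<bar>u m x - g x\<bar> powr p) \<partial>M) \<le> ennreal e"
    if e: "0 < e" and NN: "\<And>m n. NN \<le> m \<Longrightarrow> NN \<le> n \<Longrightarrow> (LINT x|M. \<bar>u m x - u n x\<bar> powr p) < e" and m: "NN \<le> m" for e NN m
  proof -
    have "(\<integral>\<^sup>+x. ennreal (\<bar>u m x - g x\<bar> powr p) \<partial>M)
        = (\<integral>\<^sup>+x. liminf (\<lambda>n. ennreal (\<bar>u m x - u (r n) x\<bar> powr p)) \<partial>M)"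
    proof (rule nn_integral_cong_AE, use g in eventually_elim)
      case (elim x)
      have "(\<lambda>n. ennreal (\<bar>u m x - u (r n) x\<bar> powr p)) \<longlonglongrightarrow> ennreal (\<bar>u m x - g x\<bar> powr p)"
        using p by (intro tendsto_ennrealI tendsto_powr' tendsto_intros elim) auto
      thus ?case by (rule lim_imp_Liminf[symmetric, OF sequentially_bot])
    qed
    also have "\<dots> \<le> liminf (\<lambda>n. \<integral>\<^sup>+x. ennreal (\<bar>u m x - u (r n) x\<bar> powr p) \<partial>M)"
      by (rule nn_integral_liminf) measurable
    also have "\<dots> \<le> ennreal e"
    proof -
      have "\<forall>\<^sub>F n in sequentially. (\<integral>\<^sup>+x. ennreal (\<bar>u m x - u (r n) x\<bar> powr p) \<partial>M) \<le> ennreal e"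
        unfolding nn
      proof (rule eventually_sequentiallyI[of NN])
        fix n assume "NN \<le> n"
        hence "NN \<le> r n" using seq_suble[OF r, of n] by simp
        thus "ennreal (LINT x|M. \<bar>u m x - u (r n) x\<bar> powr p) \<le> ennreal e"
          using NN[OF m] by (intro ennreal_leI) (auto intro: less_imp_le)
      qed
      thus ?thesis by (intro Liminf_le) auto
    qed
    finally show ?thesis .
  qed
  have intg: "integrable M (\<lambda>x. \<bar>u m x - g x\<bar> powr p)" and le: "(LINT x|M. \<bar>u m x - g x\<bar> powr p) \<le> e"
    if "0 < e" and "\<And>m n. NN \<le> m \<Longrightarrow> NN \<le> n \<Longrightarrow> (LINT x|M. \<bar>u m x - u n x\<bar> powr p) < e" and "NN \<le> m" for e NN m
  proof -
    note f = fatou[OF that]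
    show i: "integrable M (\<lambda>x. \<bar>u m x - g x\<bar> powr p)"
      using f by (intro integrableI_bounded) (auto intro: le_less_trans)
    show "(LINT x|M. \<bar>u m x - g x\<bar> powr p) \<le> e"
      using f that(1) unfolding nn_integral_eq_integral[OF i, simplified] by (simp add: ennreal_le_iff)
  qed
  obtain N1 where N1: "\<And>m n. N1 \<le> m \<Longrightarrow> N1 \<le> n \<Longrightarrow> (LINT x|M. \<bar>u m x - u n x\<bar> powr p) < 1"
    using Cauchy[of 1] by auto
  have "integrable M (\<lambda>x. \<bar>u N1 x - (u N1 x - g x)\<bar> powr p)"
    by (rule integrable_powr_diff(1)) (use p int in \<open>auto intro: intg[OF _ N1]\<close>)
  hence ig: "integrable M (\<lambda>x. \<bar>g x\<bar> powr p)" by simp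
  have lim: "(\<lambda>n. LINT x|M. \<bar>u n x - g x\<bar> powr p) \<longlonglongrightarrow> 0"
  proof (rule LIMSEQ_I)
    fix e :: real assume e: "0 < e"
    obtain NN where NN: "\<And>m n. NN \<le> m \<Longrightarrow> NN \<le> n \<Longrightarrow> (LINT x|M. \<bar>u m x - u n x\<bar> powr p) < e / 2"
      using Cauchy[of "e/2"] e by auto
    have "norm ((LINT x|M. \<bar>u n x - g x\<bar> powr p) - 0) < e" if "NN \<le> n" for n
      using le[OF _ NN that] e by (simp add: integral_nonneg_AE)
    thus "\<exists>no. \<forall>n\<ge>no. norm ((LINT x|M. \<bar>u n x - g x\<bar> powr p) - 0) < e" by blast
  qed
  show ?thesis by (rule that[of g]) (use ig lim in auto)
qed

text \<open>If \<open>a\<close> is relatively close to \<open>b\<close>, continuity of the power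
  at 1 applies; otherwise both numbers are controlled by \<open>\<bar>a - b\<bar>\<close>.\<close>

lemma powr_abs_diff_eps:
  fixes p \<epsilon> :: real
  assumes p: "0 < p" and \<epsilon>: "0 < \<epsilon>"
  obtains C where "0 \<le> C"
    "\<And>a b. \<bar>\<bar>a\<bar> powr p - \<bar>b\<bar> powr p\<bar> \<le> \<epsilon> * \<bar>b\<bar> powr p + C * \<bar>a - b\<bar> powr p"
proof -
  have "isCont (\<lambda>x::real. x powr p) 1" by (intro continuous_intros) auto
  then obtain \<delta> where \<delta>: "0 < \<delta>" "\<And>y. \<bar>y - 1\<bar> < \<delta> \<Longrightarrow> \<bar>y powr p - 1\<bar> < \<epsilon>"
    using \<epsilon> unfolding continuous_at_eps_delta dist_real_def by auto
  define C where "C = 1 + (1 + 1 / \<delta>) powr p + (1 / \<delta>) powr p"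
  have C0: "0 \<le> C" by (simp add: C_def)
  have "\<bar>\<bar>a\<bar> powr p - \<bar>b\<bar> powr p\<bar> \<le> \<epsilon> * \<bar>b\<bar> powr p + C * \<bar>a - b\<bar> powr p" for a b
  proof (cases "\<bar>a - b\<bar> < \<delta> * \<bar>b\<bar>")
    case True
    hence b: "0 < \<bar>b\<bar>" by (cases "b = 0") auto
    define y where "y = \<bar>a\<bar> / \<bar>b\<bar>"
    have a: "\<bar>a\<bar> = y * \<bar>b\<bar>" "0 \<le> y" using b by (auto simp: y_def)
    have "\<bar>y - 1\<bar> * \<bar>b\<bar> = \<bar>(y - 1) * \<bar>b\<bar>\<bar>" by (simp add: abs_mult)
    also have "\<dots> = \<bar>\<bar>a\<bar> - \<bar>b\<bar>\<bar>" unfolding a(1) by (simp add: algebra_simps)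
    also have "\<dots> < \<delta> * \<bar>b\<bar>" using True by linarith
    finally have "\<bar>y - 1\<bar> < \<delta>" using b by simp
    hence "\<bar>y powr p - 1\<bar> < \<epsilon>" by (rule \<delta>)
    hence "\<bar>y powr p - 1\<bar> * \<bar>b\<bar> powr p \<le> \<epsilon> * \<bar>b\<bar> powr p" by (intro mult_right_mono) auto
    moreover have "\<bar>y powr p - 1\<bar> * \<bar>b\<bar> powr p = \<bar>(y powr p - 1) * \<bar>b\<bar> powr p\<bar>" by (simp add: abs_mult)
    moreover have "(y powr p - 1) * \<bar>b\<bar> powr p = \<bar>a\<bar> powr p - \<bar>b\<bar> powr p"
      unfolding a(1) by (simp add: powr_mult algebra_simps)
    moreover have "0 \<le> C * \<bar>a - b\<bar> powr p" using C0 by simp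
    ultimately show ?thesis by simp
  next
    case False
    hence b: "\<bar>b\<bar> \<le> (1 / \<delta>) * \<bar>a - b\<bar>" using \<delta>(1) by (simp add: field_simps)
    hence a: "\<bar>a\<bar> \<le> (1 + 1 / \<delta>) * \<bar>a - b\<bar>" by (simp add: algebra_simps)
    have "\<bar>a\<bar> powr p \<le> ((1 + 1 / \<delta>) * \<bar>a - b\<bar>) powr p" "\<bar>b\<bar> powr p \<le> ((1 / \<delta>) * \<bar>a - b\<bar>) powr p"
      using a b p by (auto intro!: powr_mono2)
    hence "\<bar>a\<bar> powr p \<le> (1 + 1 / \<delta>) powr p * \<bar>a - b\<bar> powr p" "\<bar>b\<bar> powr p \<le> (1 / \<delta>) powr p * \<bar>a - b\<bar> powr p"
      unfolding powr_mult by auto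
    moreover have "0 \<le> \<bar>a\<bar> powr p" "0 \<le> \<bar>b\<bar> powr p" "0 \<le> \<bar>a - b\<bar> powr p" by auto
    ultimately have "\<bar>\<bar>a\<bar> powr p - \<bar>b\<bar> powr p\<bar> \<le> (1 + 1 / \<delta>) powr p * \<bar>a - b\<bar> powr p + (1 / \<delta>) powr p * \<bar>a - b\<bar> powr p + \<bar>a - b\<bar> powr p"
      by linarith
    also have "\<dots> = C * \<bar>a - b\<bar> powr p" by (simp add: C_def algebra_simps)
    finally show ?thesis using \<epsilon> by (simp add: add_increasing)
  qed
  thus ?thesis using C0 that by blast
qed

lemma powr_integral_continuous:
  fixes u :: "nat \<Rightarrow> 'a \<Rightarrow> real"
  assumes p: "0 < p" and [measurable]: "\<And>n. u n \<in> borel_measurable M" "g \<in> borel_measurable M"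
    and iu: "\<And>n. integrable M (\<lambda>x. \<bar>u n x\<bar> powr p)" and ig: "integrable M (\<lambda>x. \<bar>g x\<bar> powr p)"
    and lim: "(\<lambda>n. LINT x|M. \<bar>u n x - g x\<bar> powr p) \<longlonglongrightarrow> 0"
  shows "(\<lambda>n. LINT x|M. \<bar>u n x\<bar> powr p) \<longlonglongrightarrow> (LINT x|M. \<bar>g x\<bar> powr p)"
proof (rule LIMSEQ_I)
  fix e :: real assume e: "0 < e"
  define A where "A = (LINT x|M. \<bar>g x\<bar> powr p)"
  have A: "0 \<le> A" by (simp add: A_def)
  obtain C where C: "0 \<le> C"
    "\<And>a b. \<bar>\<bar>a\<bar> powr p - \<bar>b\<bar> powr p\<bar> \<le> e / (2 * (A + 1)) * \<bar>b\<bar> powr p + C * \<bar>a - b\<bar> powr p"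
    by (rule powr_abs_diff_eps[OF p, of "e / (2 * (A + 1))"]) (use e A in auto)
  have bound: "\<bar>(LINT x|M. \<bar>u n x\<bar> powr p) - A\<bar> \<le> e / (2 * (A + 1)) * A + C * (LINT x|M. \<bar>u n x - g x\<bar> powr p)" for n
  proof -
    have id: "integrable M (\<lambda>x. \<bar>u n x - g x\<bar> powr p)" using p by (intro integrable_powr_diff iu ig) auto
    have "\<bar>(LINT x|M. \<bar>u n x\<bar> powr p) - A\<bar> = \<bar>LINT x|M. \<bar>u n x\<bar> powr p - \<bar>g x\<bar> powr p\<bar>"
      using iu ig by (simp add: A_def)
    also have "\<dots> \<le> (LINT x|M. \<bar>\<bar>u n x\<bar> powr p - \<bar>g x\<bar> powr p\<bar>)" by (rule integral_abs_bound)
    also have "\<dots> \<le> (LINT x|M. e / (2 * (A + 1)) * \<bar>g x\<bar> powr p + C * \<bar>u n x - g x\<bar> powr p)"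
      by (intro integral_mono C(2)) (use iu ig id in auto)
    also have "\<dots> = e / (2 * (A + 1)) * A + C * (LINT x|M. \<bar>u n x - g x\<bar> powr p)"
      using ig id by (simp add: A_def)
    finally show ?thesis .
  qed
  have "(\<lambda>n. C * (LINT x|M. \<bar>u n x - g x\<bar> powr p)) \<longlonglongrightarrow> 0"
    using tendsto_mult_right_zero[OF lim, of C] by simp
  hence "\<forall>\<^sub>F n in sequentially. C * (LINT x|M. \<bar>u n x - g x\<bar> powr p) < e / 2"
    by (rule order_tendstoD) (use e in simp)
  then obtain N where N: "\<And>n. N \<le> n \<Longrightarrow> C * (LINT x|M. \<bar>u n x - g x\<bar> powr p) < e / 2"
    by (auto simp: eventually_sequentially)
  have "e / (2 * (A + 1)) * A \<le> e / 2" using e A by (simp add: field_simps)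
  hence "norm ((LINT x|M. \<bar>u n x\<bar> powr p) - A) < e" if "N \<le> n" for n
    using bound[of n] N[OF that] unfolding real_norm_def by linarith
  thus "\<exists>no. \<forall>n\<ge>no. norm ((LINT x|M. \<bar>u n x\<bar> powr p) - (LINT x|M. \<bar>g x\<bar> powr p)) < e"
    unfolding A_def by blast
qed

lemma L1_AE_convergent_subsequence:
  fixes u :: "nat \<Rightarrow> 'a \<Rightarrow> real"
  assumes "\<And>n. integrable M (u n)" "integrable M g" "(\<lambda>n. LINT x|M. \<bar>u n x - g x\<bar>) \<longlonglongrightarrow> 0"
  obtains r where "strict_mono r" "AE x in M. (\<lambda>n. u (r n) x) \<longlonglongrightarrow> g x"
proof -
  have "\<exists>r. strict_mono r \<and> (AE x in M. (\<lambda>n. u (r n) x - g x) \<longlonglongrightarrow> 0)"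
    using tendsto_L1_AE_subseq[of M "\<lambda>n x. u n x - g x"] assms by auto
  then obtain r where r: "strict_mono r" "AE x in M. (\<lambda>n. u (r n) x - g x) \<longlonglongrightarrow> 0" by blast
  from r(2) have "AE x in M. (\<lambda>n. u (r n) x) \<longlonglongrightarrow> g x"
    by eventually_elim (simp add: LIM_zero_iff)
  thus ?thesis using that r by blast
qed

text \<open>Fatou's lemma along an almost everywhere convergent subsequence.\<close>

lemma integral_powr_le_if_L1_limit:
  fixes u :: "nat \<Rightarrow> 'a \<Rightarrow> real"
  assumes q: "0 < q" and "\<And>n. integrable M (u n)" "integrable M g"
    and lim: "(\<lambda>n. LINT x|M. \<bar>u n x - g x\<bar>) \<longlonglongrightarrow> 0"
    and int: "\<And>n. integrable M (\<lambda>x. \<bar>u n x\<bar> powr q)"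
    and le: "\<And>n. (LINT x|M. \<bar>u n x\<bar> powr q) \<le> K"
  shows "integrable M (\<lambda>x. \<bar>g x\<bar> powr q)" "(LINT x|M. \<bar>g x\<bar> powr q) \<le> K"
proof -
  have [measurable]: "u n \<in> borel_measurable M" "g \<in> borel_measurable M" for n
    using assms by auto
  obtain r where r: "strict_mono r" "AE x in M. (\<lambda>n. u (r n) x) \<longlonglongrightarrow> g x"
    by (rule L1_AE_convergent_subsequence[of M u g]) (use assms in auto)
  have K0: "0 \<le> K" using le[of 0] by (rule order_trans[rotated]) simp
  have "(\<integral>\<^sup>+x. ennreal (\<bar>g x\<bar> powr q) \<partial>M) = (\<integral>\<^sup>+x. liminf (\<lambda>n. ennreal (\<bar>u (r n) x\<bar> powr q)) \<partial>M)"
  proof (rule nn_integral_cong_AE, use r(2) in eventually_elim)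
    case (elim x)
    have "(\<lambda>n. ennreal (\<bar>u (r n) x\<bar> powr q)) \<longlonglongrightarrow> ennreal (\<bar>g x\<bar> powr q)"
      using q by (intro tendsto_ennrealI tendsto_powr' tendsto_intros elim) auto
    thus ?case by (rule lim_imp_Liminf[symmetric, OF sequentially_bot])
  qed
  also have "\<dots> \<le> liminf (\<lambda>n. \<integral>\<^sup>+x. ennreal (\<bar>u (r n) x\<bar> powr q) \<partial>M)"
    by (rule nn_integral_liminf) measurable
  also have "\<dots> \<le> ennreal K"
  proof -
    have "(\<integral>\<^sup>+x. ennreal (\<bar>u (r n) x\<bar> powr q) \<partial>M) \<le> ennreal K" for n
      using le[of "r n"] int by (subst nn_integral_eq_integral) (auto intro: ennreal_leI)
    thus ?thesis by (intro Liminf_le) auto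
  qed
  finally have f: "(\<integral>\<^sup>+x. ennreal (\<bar>g x\<bar> powr q) \<partial>M) \<le> ennreal K" .
  show i: "integrable M (\<lambda>x. \<bar>g x\<bar> powr q)"
    using f by (intro integrableI_bounded) (auto intro: le_less_trans)
  show "(LINT x|M. \<bar>g x\<bar> powr q) \<le> K"
    using f K0 unfolding nn_integral_eq_integral[OF i, simplified] by (simp add: ennreal_le_iff)
qed

section \<open>Integral functionals of superposition type\<close>

text \<open>Integrated form of the pointwise remainder. It is required only for increments
  \<open>h\<close> whose \<open>q\<close>-th modular is at most \<open>K * \<tau> powr q\<close>,
  because on an anisotropic space the smallness of an element is expressed by a different power
  for each derivative; \<open>\<tau>\<close> is the common scale. The mixed term is split by
  Young's inequality at scale \<open>\<tau>\<close>, and the pure power of \<open>h\<close> is of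
  higher order since \<open>q > 1\<close>.\<close>

lemma superposition_strictly_differentiable:
  fixes \<Phi> \<phi> :: "real \<Rightarrow> real" and g :: "'a \<Rightarrow> real" and \<kappa> q A B K \<epsilon> :: real
  assumes q: "1 < q" and \<kappa>: "0 \<le> \<kappa>" and K: "0 \<le> K" and \<epsilon>: "0 < \<epsilon>"
    and rem: "\<And>\<epsilon>. 0 < \<epsilon> \<Longrightarrow> \<exists>C d. 0 \<le> C \<and> 0 < d \<and> (\<forall>t a b. \<bar>t - 1\<bar> < d \<longrightarrow>
        \<bar>\<Phi> (t * a + b) - \<Phi> (t * a) - \<phi> a * b\<bar> \<le> \<epsilon> * ((\<kappa> + \<bar>a\<bar>) powr (q - 1) * \<bar>b\<bar>) + C * \<bar>b\<bar> powr q)"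
    and [measurable]: "\<Phi> \<in> borel_measurable borel" "\<phi> \<in> borel_measurable borel" "g \<in> borel_measurable M"
    and \<phi>_growth: "\<And>x. \<bar>\<phi> x\<bar> \<le> A * (\<kappa> + \<bar>x\<bar>) powr (q - 1)" and A: "0 \<le> A"
    and \<Phi>_growth: "\<And>x. \<bar>\<Phi> x\<bar> \<le> B * (\<kappa> + \<bar>x\<bar>) powr q" and B: "0 \<le> B"
    and ig: "integrable M (\<lambda>x. (\<kappa> + \<bar>g x\<bar>) powr q)"
  shows "\<exists>d>0. \<forall>t \<tau> h. \<bar>t - 1\<bar> < d \<longrightarrow> 0 < \<tau> \<longrightarrow> \<tau> < d \<longrightarrow> h \<in> borel_measurable M \<longrightarrow>
      integrable M (\<lambda>x. \<bar>h x\<bar> powr q) \<longrightarrow> (LINT x|M. \<bar>h x\<bar> powr q) \<le> K * \<tau> powr q \<longrightarrow>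
      \<bar>(LINT x|M. \<Phi> (t * g x + h x)) - (LINT x|M. \<Phi> (t * g x)) - (LINT x|M. \<phi> (g x) * h x)\<bar> \<le> \<epsilon> * \<tau>"
proof -
  define Y where "Y = (LINT x|M. (\<kappa> + \<bar>g x\<bar>) powr q)"
  have Y: "0 \<le> Y" unfolding Y_def by simp
  define \<epsilon>' where "\<epsilon>' = \<epsilon> / (2 * (Y + K + 1))"
  have e': "0 < \<epsilon>'" using \<epsilon> Y K by (simp add: \<epsilon>'_def)
  obtain C d where C: "0 \<le> C" and d: "0 < d" and R: "\<And>t a b. \<bar>t - 1\<bar> < d \<Longrightarrow>
        \<bar>\<Phi> (t * a + b) - \<Phi> (t * a) - \<phi> a * b\<bar> \<le> \<epsilon>' * ((\<kappa> + \<bar>a\<bar>) powr (q - 1) * \<bar>b\<bar>) + C * \<bar>b\<bar> powr q"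
    using rem[OF e'] by blast
  define d' where "d' = min d ((\<epsilon> / (2 * (C * K + 1))) powr (1 / (q - 1)))"
  have CK: "0 \<le> C * K" using C K by simp
  have d': "0 < d'" "d' \<le> d" using d \<epsilon> CK by (auto simp: d'_def)
  have d'2: "C * K * \<tau> powr q \<le> \<epsilon> / 2 * \<tau>" if "0 < \<tau>" "\<tau> < d'" for \<tau>
  proof -
    have "\<tau> powr (q - 1) \<le> ((\<epsilon> / (2 * (C * K + 1))) powr (1 / (q - 1))) powr (q - 1)"
      using that q by (intro powr_mono2) (auto simp: d'_def)
    also have "\<dots> = \<epsilon> / (2 * (C * K + 1))" using q \<epsilon> CK by (simp add: powr_powr)
    finally have "C * K * \<tau> powr (q - 1) \<le> C * K * (\<epsilon> / (2 * (C * K + 1)))" using CK by (rule mult_left_mono)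
    also have "\<dots> \<le> \<epsilon> / 2"
    proof -
      have "C * K * \<epsilon> \<le> (C * K + 1) * \<epsilon>" using \<epsilon> by (intro mult_right_mono) auto
      thus ?thesis using CK by (simp add: field_simps)
    qed
    finally have "C * K * \<tau> powr (q - 1) * \<tau> \<le> \<epsilon> / 2 * \<tau>" using that by (intro mult_right_mono) auto
    thus ?thesis using that by (simp add: powr_diff)
  qed
  have main: "\<bar>(LINT x|M. \<Phi> (t * g x + h x)) - (LINT x|M. \<Phi> (t * g x)) - (LINT x|M. \<phi> (g x) * h x)\<bar> \<le> \<epsilon> * \<tau>"
    if t: "\<bar>t - 1\<bar> < d'" and \<tau>: "0 < \<tau>" "\<tau> < d'" and hm[measurable]: "h \<in> borel_measurable M"
      and ih: "integrable M (\<lambda>x. \<bar>h x\<bar> powr q)" and hK: "(LINT x|M. \<bar>h x\<bar> powr q) \<le> K * \<tau> powr q" for t \<tau> h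
  proof -
    have iP: "integrable M (\<lambda>x. \<Phi> (t * g x + k x))"
      if [measurable]: "k \<in> borel_measurable M" and ik: "integrable M (\<lambda>x. \<bar>k x\<bar> powr q)" for k
    proof (rule Bochner_Integration.integrable_bound)
      show "integrable M (\<lambda>x. B * (2 powr q * ((1 + \<bar>t\<bar>) powr q * (\<kappa> + \<bar>g x\<bar>) powr q + \<bar>k x\<bar> powr q)))"
        using ig ik by auto
      have "norm (\<Phi> (t * g x + k x)) \<le> norm (B * (2 powr q * ((1 + \<bar>t\<bar>) powr q * (\<kappa> + \<bar>g x\<bar>) powr q + \<bar>k x\<bar> powr q)))" for x
      proof -
        have "\<kappa> + \<bar>t * g x + k x\<bar> \<le> (1 + \<bar>t\<bar>) * (\<kappa> + \<bar>g x\<bar>) + \<bar>k x\<bar>"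
        proof -
          have "\<bar>t * g x + k x\<bar> \<le> \<bar>t\<bar> * \<bar>g x\<bar> + \<bar>k x\<bar>" by (simp add: abs_mult[symmetric])
          moreover have "0 \<le> \<bar>t\<bar> * \<kappa>" using \<kappa> by simp
          moreover have "(1 + \<bar>t\<bar>) * (\<kappa> + \<bar>g x\<bar>) = \<kappa> + \<bar>g x\<bar> + \<bar>t\<bar> * \<kappa> + \<bar>t\<bar> * \<bar>g x\<bar>"
            by (simp add: algebra_simps)
          ultimately show ?thesis using abs_ge_zero[of "g x"] by linarith
        qed
        hence "(\<kappa> + \<bar>t * g x + k x\<bar>) powr q \<le> ((1 + \<bar>t\<bar>) * (\<kappa> + \<bar>g x\<bar>) + \<bar>k x\<bar>) powr q"
          using \<kappa> q by (intro powr_mono2) auto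
        also have "\<dots> \<le> 2 powr q * (((1 + \<bar>t\<bar>) * (\<kappa> + \<bar>g x\<bar>)) powr q + \<bar>k x\<bar> powr q)"
          using \<kappa> q by (intro powr_add_le) auto
        also have "((1 + \<bar>t\<bar>) * (\<kappa> + \<bar>g x\<bar>)) powr q = (1 + \<bar>t\<bar>) powr q * (\<kappa> + \<bar>g x\<bar>) powr q" by (rule powr_mult)
        finally have "B * (\<kappa> + \<bar>t * g x + k x\<bar>) powr q \<le> B * (2 powr q * ((1 + \<bar>t\<bar>) powr q * (\<kappa> + \<bar>g x\<bar>) powr q + \<bar>k x\<bar> powr q))"
          using B by (rule mult_left_mono)
        thus ?thesis using \<Phi>_growth[of "t * g x + k x"] by simp
      qed
      thus "AE x in M. norm (\<Phi> (t * g x + k x)) \<le> norm (B * (2 powr q * ((1 + \<bar>t\<bar>) powr q * (\<kappa> + \<bar>g x\<bar>) powr q + \<bar>k x\<bar> powr q)))"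
        by simp
    qed measurable
    have i1: "integrable M (\<lambda>x. \<Phi> (t * g x + h x))" using iP[OF hm ih] .
    have i2: "integrable M (\<lambda>x. \<Phi> (t * g x))" using iP[of "\<lambda>_. 0"] by simp
    have young: "(\<kappa> + \<bar>g x\<bar>) powr (q - 1) * \<bar>h x\<bar> \<le> \<tau> * ((\<kappa> + \<bar>g x\<bar>) powr q + \<bar>h x\<bar> powr q / \<tau> powr q)" for x
    proof -
      have "(\<kappa> + \<bar>g x\<bar>) powr (q - 1) * (\<bar>h x\<bar> / \<tau>) \<le> (\<kappa> + \<bar>g x\<bar>) powr q + (\<bar>h x\<bar> / \<tau>) powr q"
        using q \<kappa> \<tau> by (intro powr_times_le_sum) auto
      also have "(\<bar>h x\<bar> / \<tau>) powr q = \<bar>h x\<bar> powr q / \<tau> powr q" using \<tau> by (simp add: powr_divide)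
      finally have "\<tau> * ((\<kappa> + \<bar>g x\<bar>) powr (q - 1) * (\<bar>h x\<bar> / \<tau>)) \<le> \<tau> * ((\<kappa> + \<bar>g x\<bar>) powr q + \<bar>h x\<bar> powr q / \<tau> powr q)"
        using \<tau> by (intro mult_left_mono) auto
      thus ?thesis using \<tau> by simp
    qed
    have i3: "integrable M (\<lambda>x. \<phi> (g x) * h x)"
    proof (rule Bochner_Integration.integrable_bound)
      show "integrable M (\<lambda>x. A * (\<tau> * ((\<kappa> + \<bar>g x\<bar>) powr q + \<bar>h x\<bar> powr q / \<tau> powr q)))"
        using ig ih by auto
      have "norm (\<phi> (g x) * h x) \<le> norm (A * (\<tau> * ((\<kappa> + \<bar>g x\<bar>) powr q + \<bar>h x\<bar> powr q / \<tau> powr q)))" for x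
      proof -
        have "\<bar>\<phi> (g x)\<bar> * \<bar>h x\<bar> \<le> A * (\<kappa> + \<bar>g x\<bar>) powr (q - 1) * \<bar>h x\<bar>" by (intro mult_right_mono \<phi>_growth) auto
        also have "\<dots> = A * ((\<kappa> + \<bar>g x\<bar>) powr (q - 1) * \<bar>h x\<bar>)" by simp
        also have "\<dots> \<le> A * (\<tau> * ((\<kappa> + \<bar>g x\<bar>) powr q + \<bar>h x\<bar> powr q / \<tau> powr q))"
          using A by (intro mult_left_mono young) auto
        finally show ?thesis using A \<tau> by (simp add: abs_mult)
      qed
      thus "AE x in M. norm (\<phi> (g x) * h x) \<le> norm (A * (\<tau> * ((\<kappa> + \<bar>g x\<bar>) powr q + \<bar>h x\<bar> powr q / \<tau> powr q)))"
        by simp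
    qed measurable
    have "\<bar>(LINT x|M. \<Phi> (t * g x + h x)) - (LINT x|M. \<Phi> (t * g x)) - (LINT x|M. \<phi> (g x) * h x)\<bar>
       = \<bar>LINT x|M. \<Phi> (t * g x + h x) - \<Phi> (t * g x) - \<phi> (g x) * h x\<bar>"
      using i1 i2 i3 by simp
    also have "\<dots> \<le> (LINT x|M. \<bar>\<Phi> (t * g x + h x) - \<Phi> (t * g x) - \<phi> (g x) * h x\<bar>)"
      by (rule integral_abs_bound)
    also have "\<dots> \<le> (LINT x|M. \<epsilon>' * (\<tau> * ((\<kappa> + \<bar>g x\<bar>) powr q + \<bar>h x\<bar> powr q / \<tau> powr q)) + C * \<bar>h x\<bar> powr q)"
    proof (rule integral_mono)
      show "integrable M (\<lambda>x. \<bar>\<Phi> (t * g x + h x) - \<Phi> (t * g x) - \<phi> (g x) * h x\<bar>)" using i1 i2 i3 by auto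
      show "integrable M (\<lambda>x. \<epsilon>' * (\<tau> * ((\<kappa> + \<bar>g x\<bar>) powr q + \<bar>h x\<bar> powr q / \<tau> powr q)) + C * \<bar>h x\<bar> powr q)"
        using ig ih by auto
      fix x
      have "\<epsilon>' * ((\<kappa> + \<bar>g x\<bar>) powr (q - 1) * \<bar>h x\<bar>) \<le> \<epsilon>' * (\<tau> * ((\<kappa> + \<bar>g x\<bar>) powr q + \<bar>h x\<bar> powr q / \<tau> powr q))"
        using e' by (intro mult_left_mono young) auto
      thus "\<bar>\<Phi> (t * g x + h x) - \<Phi> (t * g x) - \<phi> (g x) * h x\<bar>
         \<le> \<epsilon>' * (\<tau> * ((\<kappa> + \<bar>g x\<bar>) powr q + \<bar>h x\<bar> powr q / \<tau> powr q)) + C * \<bar>h x\<bar> powr q"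
        using R[of t "g x" "h x"] t d'(2) by linarith
    qed
    also have "\<dots> = \<epsilon>' * (\<tau> * (Y + (LINT x|M. \<bar>h x\<bar> powr q) / \<tau> powr q)) + C * (LINT x|M. \<bar>h x\<bar> powr q)"
      using ig ih by (simp add: Y_def)
    also have "\<dots> \<le> \<epsilon>' * (\<tau> * (Y + K)) + C * (K * \<tau> powr q)"
      using hK e' \<tau> C by (intro add_mono mult_left_mono) (auto simp: field_simps)
    also have "\<epsilon>' * (\<tau> * (Y + K)) \<le> \<epsilon>' * (\<tau> * (Y + K + 1))" using e' \<tau> by (intro mult_left_mono) auto
    also have "\<epsilon>' * (\<tau> * (Y + K + 1)) = \<epsilon> / 2 * \<tau>" 
    proof -
      have "Y + K + 1 \<noteq> 0" using Y K by simp
      thus ?thesis by (simp add: \<epsilon>'_def divide_simps)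
    qed
    finally show ?thesis using d'2[OF \<tau>] by (simp add: algebra_simps)
  qed
  show ?thesis using main d'(1) by blast
qed

text \<open>Bounds in \<open>L\<^sup>q\<close> with \<open>q > \<alpha>\<close> make the
  integrands uniformly integrable. Concretely, cutting the functions off at height
  \<open>R\<close> changes all integrals by at most a multiple of \<open>R powr (\<alpha> -
  q)\<close>, and for the bounded truncations dominated convergence applies.\<close>

lemma (in finite_measure) superposition_integral_continuous:
  fixes F :: "real \<Rightarrow> real" and u :: "nat \<Rightarrow> 'a \<Rightarrow> real"
  assumes \<alpha>: "0 < \<alpha>" "\<alpha> < q" and Fc: "continuous_on UNIV F" and A: "0 \<le> A"
    and F: "\<And>x. \<bar>F x\<bar> \<le> A * (1 + \<bar>x\<bar> powr \<alpha>)"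
    and [measurable]: "\<And>n. u n \<in> borel_measurable M" "w \<in> borel_measurable M"
    and conv: "AE x in M. (\<lambda>n. u n x) \<longlonglongrightarrow> w x"
    and iu: "\<And>n. integrable M (\<lambda>x. \<bar>u n x\<bar> powr q)" "\<And>n. (LINT x|M. \<bar>u n x\<bar> powr q) \<le> K"
    and iw: "integrable M (\<lambda>x. \<bar>w x\<bar> powr q)" "(LINT x|M. \<bar>w x\<bar> powr q) \<le> K"
  shows "(\<lambda>n. LINT x|M. F (u n x)) \<longlonglongrightarrow> (LINT x|M. F (w x))"
proof -
  have [measurable]: "F \<in> borel_measurable borel" using Fc by (rule borel_measurable_continuous_onI)
  have K: "0 \<le> K" using iw(2) by (rule order_trans[rotated]) simp
  \<comment> \<open>truncation at height \<open>R\<close>\<close>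
  define cl where "cl = (\<lambda>R x::real. max (- R) (min R x))"
  have Fcl: "continuous_on UNIV (\<lambda>x. F (cl R x))" for R
    unfolding cl_def by (intro continuous_on_compose2[OF Fc] continuous_intros) auto
  hence [measurable]: "(\<lambda>x. F (cl R x)) \<in> borel_measurable borel" for R
    by (rule borel_measurable_continuous_onI)
  have bd: "\<bar>F (cl R x)\<bar> \<le> A * (1 + R powr \<alpha>)" if "1 \<le> R" for R x
  proof -
    have "\<bar>cl R x\<bar> \<le> R" using that by (auto simp: cl_def)
    hence "\<bar>cl R x\<bar> powr \<alpha> \<le> R powr \<alpha>" using \<alpha> by (intro powr_mono2) auto
    hence "A * (1 + \<bar>cl R x\<bar> powr \<alpha>) \<le> A * (1 + R powr \<alpha>)" using A by (intro mult_left_mono) auto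
    thus ?thesis using F[of "cl R x"] by linarith
  qed
  have diff: "\<bar>F x - F (cl R x)\<bar> \<le> 4 * A * R powr (\<alpha> - q) * \<bar>x\<bar> powr q" if R: "1 \<le> R" for R x
  proof (cases "\<bar>x\<bar> \<le> R")
    case True
    hence "cl R x = x" by (auto simp: cl_def)
    thus ?thesis using A by simp
  next
    case False
    have "R powr \<alpha> \<le> \<bar>x\<bar> powr \<alpha>" "1 \<le> \<bar>x\<bar> powr \<alpha>"
      using False R \<alpha> by (auto intro!: powr_mono2 ge_one_powr_ge_zero)
    hence "A * (1 + \<bar>x\<bar> powr \<alpha>) \<le> A * (2 * \<bar>x\<bar> powr \<alpha>)" "A * (1 + R powr \<alpha>) \<le> A * (2 * \<bar>x\<bar> powr \<alpha>)"
      using A by (auto intro!: mult_left_mono)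
    hence 1: "\<bar>F x - F (cl R x)\<bar> \<le> 4 * A * \<bar>x\<bar> powr \<alpha>" using F[of x] bd[OF R, of x] by linarith
    have "\<bar>x\<bar> powr \<alpha> = \<bar>x\<bar> powr (\<alpha> - q) * \<bar>x\<bar> powr q" using False R by (simp add: powr_add[symmetric])
    also have "\<dots> \<le> R powr (\<alpha> - q) * \<bar>x\<bar> powr q"
      using False R \<alpha> by (intro mult_right_mono powr_mono2') auto
    finally have "4 * A * \<bar>x\<bar> powr \<alpha> \<le> 4 * A * (R powr (\<alpha> - q) * \<bar>x\<bar> powr q)" using A by (intro mult_left_mono) auto
    thus ?thesis using 1 by simp
  qed
  have icl: "integrable M (\<lambda>x. F (cl R (v x)))" if "1 \<le> R" and [measurable]: "v \<in> borel_measurable M" for R v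
    by (rule integrable_const_bound[where B = "A * (1 + R powr \<alpha>)"]) (use bd[OF that(1)] in auto)
  have iF: "integrable M (\<lambda>x. F (v x))"
    if [measurable]: "v \<in> borel_measurable M" and i: "integrable M (\<lambda>x. \<bar>v x\<bar> powr q)" for v
  proof -
    have "integrable M (\<lambda>x. F (v x) - F (cl 1 (v x)))"
      by (rule Bochner_Integration.integrable_bound[OF integrable_mult_right[OF i, of "4 * A"]])
        (use diff[of 1] A in \<open>auto simp: abs_mult\<close>)
    from Bochner_Integration.integrable_add[OF this icl[of 1 v]] show ?thesis by simp
  qed
  have dI: "\<bar>(LINT x|M. F (v x)) - (LINT x|M. F (cl R (v x)))\<bar> \<le> 4 * A * K * R powr (\<alpha> - q)"
    if R: "1 \<le> R" and vm[measurable]: "v \<in> borel_measurable M" and i: "integrable M (\<lambda>x. \<bar>v x\<bar> powr q)" "(LINT x|M. \<bar>v x\<bar> powr q) \<le> K" for v R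
  proof -
    have "\<bar>(LINT x|M. F (v x)) - (LINT x|M. F (cl R (v x)))\<bar> = \<bar>LINT x|M. F (v x) - F (cl R (v x))\<bar>"
      using iF[OF vm i(1)] icl[OF R vm] by simp
    also have "\<dots> \<le> (LINT x|M. \<bar>F (v x) - F (cl R (v x))\<bar>)" by (rule integral_abs_bound)
    also have "\<dots> \<le> (LINT x|M. 4 * A * R powr (\<alpha> - q) * \<bar>v x\<bar> powr q)"
      by (intro integral_mono diff R) (use iF[OF vm i(1)] icl[OF R vm] i(1) in auto)
    also have "\<dots> = 4 * A * R powr (\<alpha> - q) * (LINT x|M. \<bar>v x\<bar> powr q)" by simp
    also have "\<dots> \<le> 4 * A * R powr (\<alpha> - q) * K" using A i(2) by (intro mult_left_mono) auto
    finally show ?thesis by (simp add: mult_ac)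
  qed
  show ?thesis
  proof (rule LIMSEQ_I)
    fix e :: real assume e: "0 < e"
    have "((\<lambda>R. 4 * A * K * R powr (\<alpha> - q)) \<longlongrightarrow> 4 * A * K * 0) at_top"
      using \<alpha> by (intro tendsto_mult tendsto_const tendsto_neg_powr filterlim_ident) auto
    hence "\<forall>\<^sub>F R in at_top. 4 * A * K * R powr (\<alpha> - q) < e / 3"
      by (rule order_tendstoD) (use e in auto)
    then obtain R0 where R0: "\<And>R. R0 \<le> R \<Longrightarrow> 4 * A * K * R powr (\<alpha> - q) < e / 3"
      by (auto simp: eventually_at_top_linorder)
    define R where "R = max 1 R0"
    have R: "1 \<le> R" "4 * A * K * R powr (\<alpha> - q) < e / 3" using R0[of R] by (auto simp: R_def)
    have "(\<lambda>n. LINT x|M. F (cl R (u n x))) \<longlonglongrightarrow> (LINT x|M. F (cl R (w x)))"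
    proof (rule integral_dominated_convergence[where w = "\<lambda>_. A * (1 + R powr \<alpha>)"])
      show "AE x in M. (\<lambda>n. F (cl R (u n x))) \<longlonglongrightarrow> F (cl R (w x))"
        using conv
      proof eventually_elim
        case (elim x)
        have "isCont (\<lambda>x. F (cl R x)) (w x)" using Fcl[of R] by (simp add: continuous_on_eq_continuous_at)
        from isCont_tendsto_compose[OF this elim] show ?case .
      qed
    qed (use bd[OF R(1)] in auto)
    then obtain N where N: "\<And>n. N \<le> n \<Longrightarrow> \<bar>(LINT x|M. F (cl R (u n x))) - (LINT x|M. F (cl R (w x)))\<bar> < e / 3"
      using LIMSEQ_D[of _ _ "e / 3"] e by (metis real_norm_def zero_less_divide_iff zero_less_numeral)
    have "norm ((LINT x|M. F (u n x)) - (LINT x|M. F (w x))) < e" if "N \<le> n" for n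
    proof -
      have "\<bar>(LINT x|M. F (u n x)) - (LINT x|M. F (cl R (u n x)))\<bar> < e / 3"
        using dI[OF R(1) _ iu(1)[of n] iu(2)[of n]] R(2) by auto
      moreover have "\<bar>(LINT x|M. F (w x)) - (LINT x|M. F (cl R (w x)))\<bar> < e / 3"
        using dI[OF R(1) _ iw] R(2) by auto
      ultimately show ?thesis using N[OF that] unfolding real_norm_def by linarith
    qed
    thus "\<exists>no. \<forall>n\<ge>no. norm ((LINT x|M. F (u n x)) - (LINT x|M. F (w x))) < e" by blast
  qed
qed

section \<open>Ground states of functionals with strictly concave fibers\<close>

text \<open>What the variational argument needs from a function space \<open>V\<close> with
  derivatives \<open>D i\<close>: the linear structure up to null sets, a subcritical embedding,
  compactness and lower semicontinuity with respect to \<open>L\<^sup>1\<close> convergence,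
  compatibility with absolute values, and a Poincare inequality in the direction \<open>i1\<close>
  that carries the smallest exponent. Relaxation is membership of a limit and lower semicontinuity
  of the Dirichlet energy in one statement; it also implies that \<open>V\<close> and the energy
  do not distinguish functions that agree almost everywhere.\<close>

locale anisotropic_functional = finite_measure M + superlinear_nonlinearity f F p1 pN \<alpha>
  for M :: "'a measure" and f F :: "real \<Rightarrow> real" and p1 pN \<alpha> :: real +
  fixes V :: "('a \<Rightarrow> real) set" and D :: "'n::finite \<Rightarrow> ('a \<Rightarrow> real) \<Rightarrow> 'a \<Rightarrow> real"
    and p :: "'n \<Rightarrow> real" and i1 :: 'n and q :: real
  assumes p_ge: "\<And>i. p1 \<le> p i" and p_le: "\<And>i. p i \<le> pN" and p_i1: "p i1 = p1" and q: "\<alpha> < q"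
    and V_int: "\<And>u. u \<in> V \<Longrightarrow> integrable M u"
    and D_meas: "\<And>u i. u \<in> V \<Longrightarrow> D i u \<in> borel_measurable M"
    and D_int: "\<And>u i. u \<in> V \<Longrightarrow> integrable M (\<lambda>x. \<bar>D i u x\<bar> powr p i)"
    and V_lin: "\<And>a b u v. u \<in> V \<Longrightarrow> v \<in> V \<Longrightarrow> (\<lambda>x. a * u x + b * v x) \<in> V"
    and D_lin: "\<And>a b u v i. u \<in> V \<Longrightarrow> v \<in> V \<Longrightarrow>
           AE x in M. D i (\<lambda>x. a * u x + b * v x) x = a * D i u x + b * D i v x"
    and embedding: "\<exists>K. \<forall>u\<in>V. (\<forall>i. (LINT x|M. \<bar>D i u x\<bar> powr p i) \<le> 1) \<longrightarrow>
           integrable M (\<lambda>x. \<bar>u x\<bar> powr q) \<and> (LINT x|M. \<bar>u x\<bar> powr q) \<le> K"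
    and compactness: "\<And>(u :: nat \<Rightarrow> 'a \<Rightarrow> real) B. (\<And>n. u n \<in> V) \<Longrightarrow> (\<And>n i. (LINT x|M. \<bar>D i (u n) x\<bar> powr p i) \<le> B) \<Longrightarrow>
           \<exists>(r :: nat \<Rightarrow> nat) w. strict_mono r \<and> integrable M w \<and> (\<lambda>n. LINT x|M. \<bar>u (r n) x - w x\<bar>) \<longlonglongrightarrow> (0::real)"
    and relaxation: "\<And>w B. integrable M w \<Longrightarrow>
           (\<And>e. 0 < e \<Longrightarrow> \<exists>v\<in>V. (LINT x|M. \<bar>v x - w x\<bar>) \<le> e \<and>
               (\<Sum>i\<in>UNIV. 1 / p i * (LINT x|M. \<bar>D i v x\<bar> powr p i)) \<le> B) \<Longrightarrow>
           w \<in> V \<and> (\<Sum>i\<in>UNIV. 1 / p i * (LINT x|M. \<bar>D i w x\<bar> powr p i)) \<le> B"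
    and absolute_value: "\<And>u. u \<in> V \<Longrightarrow> (\<lambda>x. \<bar>u x\<bar>) \<in> V \<and>
           (\<Sum>i\<in>UNIV. 1 / p i * (LINT x|M. \<bar>D i (\<lambda>x. \<bar>u x\<bar>) x\<bar> powr p i))
             \<le> (\<Sum>i\<in>UNIV. 1 / p i * (LINT x|M. \<bar>D i u x\<bar> powr p i))"
    and poincare: "\<And>u. u \<in> V \<Longrightarrow> (LINT x|M. \<bar>D i1 u x\<bar> powr p i1) = 0 \<Longrightarrow> AE x in M. u x = 0"
    and nonzero: "\<exists>u\<in>V. \<not> (AE x in M. u x = 0)"
begin

definition modular :: "'n \<Rightarrow> ('a \<Rightarrow> real) \<Rightarrow> real" where
  "modular i u = (LINT x|M. \<bar>D i u x\<bar> powr p i)"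

definition dirichlet :: "('a \<Rightarrow> real) \<Rightarrow> real" where
  "dirichlet u = (\<Sum>i\<in>UNIV. 1 / p i * (LINT x|M. \<bar>D i u x\<bar> powr p i))"

definition potential :: "('a \<Rightarrow> real) \<Rightarrow> real" where
  "potential u = (LINT x|M. F (u x))"

definition functional :: "('a \<Rightarrow> real) \<Rightarrow> real" where
  "functional u = (\<Sum>i\<in>UNIV. 1 / p i * (LINT x|M. \<bar>D i u x\<bar> powr p i)) - (LINT x|M. F (u x))"

definition nrm :: "('a \<Rightarrow> real) \<Rightarrow> real" where
  "nrm u = (\<Sum>i\<in>UNIV. (LINT x|M. \<bar>D i u x\<bar> powr p i) powr (1 / p i))"

definition differential :: "('a \<Rightarrow> real) \<Rightarrow> ('a \<Rightarrow> real) \<Rightarrow> real" where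
  "differential u v = (\<Sum>i\<in>UNIV. LINT x|M. sgn (D i u x) * \<bar>D i u x\<bar> powr (p i - 1) * D i v x)
     - (LINT x|M. f (u x) * v x)"

definition trivial :: "('a \<Rightarrow> real) \<Rightarrow> bool" where
  "trivial u \<longleftrightarrow> (AE x in M. u x = 0)"

lemma functional_eq: "functional u = dirichlet u - potential u"
  by (simp add: functional_def dirichlet_def potential_def)

lemma dirichlet_eq: "dirichlet u = (\<Sum>i\<in>UNIV. 1 / p i * modular i u)"
  by (simp add: dirichlet_def modular_def)

lemma p_gt: "1 < p i" using p1 p_ge[of i] by linarith

lemma pN: "1 < pN" and \<alpha>: "1 < \<alpha>" "p1 < \<alpha>" "pN < \<alpha>" and q': "1 < q"
  using p1 p1_le pN_less q by auto

lemma V_meas: "u \<in> V \<Longrightarrow> u \<in> borel_measurable M"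
  using V_int by auto

lemma V_scale: "u \<in> V \<Longrightarrow> (\<lambda>x. c * u x) \<in> V"
  using V_lin[of u u c 0] by simp

lemma D_scale: "u \<in> V \<Longrightarrow> AE x in M. D i (\<lambda>x. c * u x) x = c * D i u x"
  using D_lin[of u u i c 0] by simp

lemma modular_nonneg: "0 \<le> modular i u" by (simp add: modular_def)

lemma modular_scale:
  assumes "u \<in> V" shows "modular i (\<lambda>x. c * u x) = \<bar>c\<bar> powr p i * modular i u"
proof -
  have "modular i (\<lambda>x. c * u x) = (LINT x|M. \<bar>c\<bar> powr p i * \<bar>D i u x\<bar> powr p i)"
    unfolding modular_def
  proof (rule integral_cong_AE)
    show "AE x in M. \<bar>D i (\<lambda>x. c * u x) x\<bar> powr p i = \<bar>c\<bar> powr p i * \<bar>D i u x\<bar> powr p i"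
      using D_scale[OF assms, of i c] by eventually_elim (simp add: abs_mult powr_mult)
  qed (use D_meas[OF assms] D_meas[OF V_scale[OF assms]] in measurable)
  thus ?thesis by (simp add: modular_def)
qed

lemma nrm_nonneg: "0 \<le> nrm u" by (auto simp: nrm_def intro: sum_nonneg)

lemma nrm_scale: assumes "u \<in> V" shows "nrm (\<lambda>x. c * u x) = \<bar>c\<bar> * nrm u"
proof -
  have "modular i (\<lambda>x. c * u x) powr (1 / p i) = \<bar>c\<bar> * modular i u powr (1 / p i)" for i
    unfolding modular_scale[OF assms] powr_mult using p_gt[of i] by (simp add: powr_powr)
  thus ?thesis by (simp add: nrm_def modular_def[symmetric] sum_distrib_left)
qed

lemma modular_le_nrm: "modular i u \<le> nrm u powr p i"
proof -
  have "modular i u powr (1 / p i) \<le> nrm u"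
    unfolding nrm_def modular_def[symmetric] by (rule member_le_sum) auto
  hence "(modular i u powr (1 / p i)) powr p i \<le> nrm u powr p i"
    using p_gt[of i] by (intro powr_mono2) auto
  thus ?thesis using p_gt[of i] modular_nonneg[of i u] by (simp add: powr_powr)
qed

lemma modular_le_powr:
  assumes "nrm u \<le> \<tau>" shows "modular i u \<le> \<tau> powr p i"
proof -
  have "nrm u powr p i \<le> \<tau> powr p i" using assms nrm_nonneg p_gt[of i] by (intro powr_mono2) auto
  thus ?thesis using modular_le_nrm[of i u] by linarith
qed

text \<open>The embedding assumed on the unit ball of the modulars is rescaled to radius
  \<open>\<tau>\<close>. The bound \<open>modular i v \<le> \<tau> powr p i\<close> for all
  \<open>i\<close> is what replaces \<open>norm v \<le> \<tau>\<close>: it is implied by the norm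
  bound and behaves well under scaling.\<close>

lemma embedding_scaled:
  assumes r: "1 \<le> r" "r \<le> q"
  obtains K where "0 \<le> K" "\<And>v \<tau>. v \<in> V \<Longrightarrow> 0 < \<tau> \<Longrightarrow> (\<And>i. modular i v \<le> \<tau> powr p i) \<Longrightarrow>
      integrable M (\<lambda>x. \<bar>v x\<bar> powr r) \<and> (LINT x|M. \<bar>v x\<bar> powr r) \<le> K * \<tau> powr r"
proof -
  obtain K where K: "\<And>u. u \<in> V \<Longrightarrow> (\<And>i. modular i u \<le> 1) \<Longrightarrow>
      integrable M (\<lambda>x. \<bar>u x\<bar> powr q) \<and> (LINT x|M. \<bar>u x\<bar> powr q) \<le> K"
    using embedding unfolding modular_def by blast
  define K' where "K' = measure M (space M) + \<bar>K\<bar>"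
  have "integrable M (\<lambda>x. \<bar>v x\<bar> powr r) \<and> (LINT x|M. \<bar>v x\<bar> powr r) \<le> K' * \<tau> powr r"
    if v: "v \<in> V" and \<tau>: "0 < \<tau>" and m: "\<And>i. modular i v \<le> \<tau> powr p i" for v \<tau>
  proof -
    define w where "w = (\<lambda>x. (1 / \<tau>) * v x)"
    have w: "w \<in> V" unfolding w_def by (rule V_scale[OF v])
    note [measurable] = V_meas[OF w]
    have "modular i w \<le> 1" for i
      unfolding w_def modular_scale[OF v] using m[of i] \<tau> by (simp add: powr_divide field_simps)
    hence iq: "integrable M (\<lambda>x. \<bar>w x\<bar> powr q)" "(LINT x|M. \<bar>w x\<bar> powr q) \<le> K" using K[OF w] by auto
    have le: "\<bar>w x\<bar> powr r \<le> 1 + \<bar>w x\<bar> powr q" for x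
    proof (cases "\<bar>w x\<bar> \<le> 1")
      case True
      thus ?thesis using powr_mono2[of r "\<bar>w x\<bar>" 1] r by (simp add: add_increasing2)
    next
      case False
      hence "\<bar>w x\<bar> powr r \<le> \<bar>w x\<bar> powr q" using r by (intro powr_mono) auto
      thus ?thesis by simp
    qed
    have i1: "integrable M (\<lambda>x. 1 + \<bar>w x\<bar> powr q)" using iq by auto
    have ir: "integrable M (\<lambda>x. \<bar>w x\<bar> powr r)"
      by (rule Bochner_Integration.integrable_bound[OF i1]) (use le in auto)
    have "(LINT x|M. \<bar>w x\<bar> powr r) \<le> (LINT x|M. 1 + \<bar>w x\<bar> powr q)" by (intro integral_mono ir i1 le)
    also have "\<dots> \<le> K'" using iq by (simp add: K'_def)
    finally have wr: "(LINT x|M. \<bar>w x\<bar> powr r) \<le> K'" .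
    have e: "\<bar>v x\<bar> powr r = \<tau> powr r * \<bar>w x\<bar> powr r" for x
      using \<tau> by (simp add: w_def abs_mult powr_mult powr_divide)
    show ?thesis unfolding e using ir wr \<tau> by (auto simp: mult.commute intro!: mult_left_mono)
  qed
  thus ?thesis by (intro that[of K']) (auto simp: K'_def)
qed

lemma V_integrable_powr:
  assumes "u \<in> V" "1 \<le> r" "r \<le> q"
  shows "integrable M (\<lambda>x. \<bar>u x\<bar> powr r)"
proof -
  obtain K where "\<And>v \<tau>. v \<in> V \<Longrightarrow> 0 < \<tau> \<Longrightarrow> (\<And>i. modular i v \<le> \<tau> powr p i) \<Longrightarrow>
      integrable M (\<lambda>x. \<bar>v x\<bar> powr r) \<and> (LINT x|M. \<bar>v x\<bar> powr r) \<le> K * \<tau> powr r"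
    by (rule embedding_scaled[OF assms(2,3)]) blast
  from this[of u "nrm u + 1"] show ?thesis using assms modular_le_powr nrm_nonneg[of u] by auto
qed

lemma F_measurable [measurable]: "F \<in> borel_measurable borel"
  using F_cont by (intro borel_measurable_continuous_onI)

lemma f_measurable [measurable]: "f \<in> borel_measurable borel"
  using cont by (intro borel_measurable_continuous_onI)

lemma F_integrable:
  assumes "u \<in> V" shows "integrable M (\<lambda>x. F (u x))"
proof -
  note [measurable] = V_meas[OF assms]
  obtain A where A: "0 \<le> A" "\<And>x. F x \<le> A * (1 + \<bar>x\<bar> powr \<alpha>)" by (rule F_growth) blast
  have "integrable M (\<lambda>x. A * (1 + \<bar>u x\<bar> powr \<alpha>))"
    using V_integrable_powr[OF assms, of \<alpha>] \<alpha> q by auto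
  thus ?thesis
    by (rule Bochner_Integration.integrable_bound) (use A F_nonneg in auto)
qed

lemma potential_strictly_differentiable:
  assumes u: "u \<in> V" and \<epsilon>: "0 < \<epsilon>"
  shows "\<exists>d>0. \<forall>t \<tau> v. \<bar>t - 1\<bar> < d \<longrightarrow> 0 < \<tau> \<longrightarrow> \<tau> < d \<longrightarrow> v \<in> V \<longrightarrow> (\<forall>i. modular i v \<le> \<tau> powr p i) \<longrightarrow>
    \<bar>(LINT x|M. F (t * u x + v x)) - (LINT x|M. F (t * u x)) - (LINT x|M. f (u x) * v x)\<bar> \<le> \<epsilon> * \<tau>"
proof -
  note [measurable] = V_meas[OF u]
  obtain K where K: "0 \<le> K" "\<And>v \<tau>. v \<in> V \<Longrightarrow> 0 < \<tau> \<Longrightarrow> (\<And>i. modular i v \<le> \<tau> powr p i) \<Longrightarrow>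
      integrable M (\<lambda>x. \<bar>v x\<bar> powr \<alpha>) \<and> (LINT x|M. \<bar>v x\<bar> powr \<alpha>) \<le> K * \<tau> powr \<alpha>"
    by (rule embedding_scaled[of \<alpha>]) (use \<alpha> q in auto)
  obtain A where A: "0 \<le> A" "\<And>x. \<bar>f x\<bar> \<le> A * (1 + \<bar>x\<bar>) powr (\<alpha> - 1)" by (rule f_growth) blast
  obtain B where B: "0 \<le> B" "\<And>x. F x \<le> B * (1 + \<bar>x\<bar> powr \<alpha>)" by (rule F_growth) blast
  have FB: "\<bar>F x\<bar> \<le> (2 * B) * (1 + \<bar>x\<bar>) powr \<alpha>" for x
  proof -
    have "1 \<le> (1 + \<bar>x\<bar>) powr \<alpha>" using \<alpha> by (intro ge_one_powr_ge_zero) auto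
    moreover have "\<bar>x\<bar> powr \<alpha> \<le> (1 + \<bar>x\<bar>) powr \<alpha>" using \<alpha> by (intro powr_mono2) auto
    ultimately have "B * (1 + \<bar>x\<bar> powr \<alpha>) \<le> B * (2 * (1 + \<bar>x\<bar>) powr \<alpha>)" using B by (intro mult_left_mono) auto
    thus ?thesis using B(2)[of x] F_nonneg[of x] by simp
  qed
  have iu: "integrable M (\<lambda>x. (1 + \<bar>u x\<bar>) powr \<alpha>)"
  proof (rule Bochner_Integration.integrable_bound)
    show "integrable M (\<lambda>x. 2 powr \<alpha> * (1 powr \<alpha> + \<bar>u x\<bar> powr \<alpha>))"
      using V_integrable_powr[OF u, of \<alpha>] \<alpha> q by auto
    show "AE x in M. norm ((1 + \<bar>u x\<bar>) powr \<alpha>) \<le> norm (2 powr \<alpha> * (1 powr \<alpha> + \<bar>u x\<bar> powr \<alpha>))"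
      using powr_add_le[of \<alpha> 1] \<alpha> by auto
  qed measurable
  obtain d where d: "0 < d" "\<And>t \<tau> h. \<bar>t - 1\<bar> < d \<Longrightarrow> 0 < \<tau> \<Longrightarrow> \<tau> < d \<Longrightarrow> h \<in> borel_measurable M \<Longrightarrow>
      integrable M (\<lambda>x. \<bar>h x\<bar> powr \<alpha>) \<Longrightarrow> (LINT x|M. \<bar>h x\<bar> powr \<alpha>) \<le> K * \<tau> powr \<alpha> \<Longrightarrow>
      \<bar>(LINT x|M. F (t * u x + h x)) - (LINT x|M. F (t * u x)) - (LINT x|M. f (u x) * h x)\<bar> \<le> \<epsilon> * \<tau>"
  proof -
    have "\<exists>d>0. \<forall>t \<tau> h. \<bar>t - 1\<bar> < d \<longrightarrow> 0 < \<tau> \<longrightarrow> \<tau> < d \<longrightarrow> h \<in> borel_measurable M \<longrightarrow>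
      integrable M (\<lambda>x. \<bar>h x\<bar> powr \<alpha>) \<longrightarrow> (LINT x|M. \<bar>h x\<bar> powr \<alpha>) \<le> K * \<tau> powr \<alpha> \<longrightarrow>
      \<bar>(LINT x|M. F (t * u x + h x)) - (LINT x|M. F (t * u x)) - (LINT x|M. f (u x) * h x)\<bar> \<le> \<epsilon> * \<tau>"
    proof (rule superposition_strictly_differentiable[OF _ _ K(1) \<epsilon> _ _ _ _ A(2) A(1) FB _ iu])
      fix e :: real assume e: "0 < e"
      show "\<exists>C d. 0 \<le> C \<and> 0 < d \<and> (\<forall>t a b. \<bar>t - 1\<bar> < d \<longrightarrow>
        \<bar>F (t * a + b) - F (t * a) - f a * b\<bar> \<le> e * ((1 + \<bar>a\<bar>) powr (\<alpha> - 1) * \<bar>b\<bar>) + C * \<bar>b\<bar> powr \<alpha>)"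
        by (rule F_remainder_estimate[OF e]) blast
    qed (use \<alpha> B in auto)
    thus ?thesis using that by blast
  qed
  have "\<bar>(LINT x|M. F (t * u x + v x)) - (LINT x|M. F (t * u x)) - (LINT x|M. f (u x) * v x)\<bar> \<le> \<epsilon> * \<tau>"
    if "\<bar>t - 1\<bar> < d" "0 < \<tau>" "\<tau> < d" "v \<in> V" "\<forall>i. modular i v \<le> \<tau> powr p i" for t \<tau> v
    using d(2)[OF that(1-3) V_meas[OF that(4)]] K(2)[OF that(4,2)] that(5) by auto
  thus ?thesis using d(1) by blast
qed

lemma modular_strictly_differentiable:
  assumes u: "u \<in> V" and \<epsilon>: "0 < \<epsilon>"
  shows "\<exists>d>0. \<forall>t \<tau> v. \<bar>t - 1\<bar> < d \<longrightarrow> 0 < \<tau> \<longrightarrow> \<tau> < d \<longrightarrow> v \<in> V \<longrightarrow> (\<forall>i. modular i v \<le> \<tau> powr p i) \<longrightarrow>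
    \<bar>1 / p i * modular i (\<lambda>x. t * u x + v x) - 1 / p i * modular i (\<lambda>x. t * u x)
      - (LINT x|M. sgn (D i u x) * \<bar>D i u x\<bar> powr (p i - 1) * D i v x)\<bar> \<le> \<epsilon> * \<tau>"
proof -
  note [measurable] = D_meas[OF u]
  have p: "1 < p i" by (rule p_gt)
  have "\<exists>d>0. \<forall>t \<tau> h. \<bar>t - 1\<bar> < d \<longrightarrow> 0 < \<tau> \<longrightarrow> \<tau> < d \<longrightarrow> h \<in> borel_measurable M \<longrightarrow>
      integrable M (\<lambda>x. \<bar>h x\<bar> powr p i) \<longrightarrow> (LINT x|M. \<bar>h x\<bar> powr p i) \<le> 1 * \<tau> powr p i \<longrightarrow>
      \<bar>(LINT x|M. (\<lambda>y. \<bar>y\<bar> powr p i / p i) (t * D i u x + h x)) - (LINT x|M. (\<lambda>y. \<bar>y\<bar> powr p i / p i) (t * D i u x))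
       - (LINT x|M. (\<lambda>y. sgn y * \<bar>y\<bar> powr (p i - 1)) (D i u x) * h x)\<bar> \<le> \<epsilon> * \<tau>"
  proof (rule superposition_strictly_differentiable[where \<kappa> = 0 and A = 1 and B = "1 / p i"])
    fix e :: real assume e: "0 < e"
    show "\<exists>C d. 0 \<le> C \<and> 0 < d \<and> (\<forall>t a b. \<bar>t - 1\<bar> < d \<longrightarrow>
        \<bar>\<bar>t * a + b\<bar> powr p i / p i - \<bar>t * a\<bar> powr p i / p i - sgn a * \<bar>a\<bar> powr (p i - 1) * b\<bar>
          \<le> e * ((0 + \<bar>a\<bar>) powr (p i - 1) * \<bar>b\<bar>) + C * \<bar>b\<bar> powr p i)"
      by (rule power_remainder_estimate[OF p e]) (simp only: add_0, blast)
  qed (use p \<epsilon> D_int[OF u] in \<open>auto simp: abs_mult sgn_if\<close>)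
  then obtain d where d: "0 < d" "\<And>t \<tau> h. \<bar>t - 1\<bar> < d \<Longrightarrow> 0 < \<tau> \<Longrightarrow> \<tau> < d \<Longrightarrow> h \<in> borel_measurable M \<Longrightarrow>
      integrable M (\<lambda>x. \<bar>h x\<bar> powr p i) \<Longrightarrow> (LINT x|M. \<bar>h x\<bar> powr p i) \<le> \<tau> powr p i \<Longrightarrow>
      \<bar>(LINT x|M. \<bar>t * D i u x + h x\<bar> powr p i / p i) - (LINT x|M. \<bar>t * D i u x\<bar> powr p i / p i)
       - (LINT x|M. sgn (D i u x) * \<bar>D i u x\<bar> powr (p i - 1) * h x)\<bar> \<le> \<epsilon> * \<tau>"
    by auto
  have "\<bar>1 / p i * modular i (\<lambda>x. t * u x + v x) - 1 / p i * modular i (\<lambda>x. t * u x)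
      - (LINT x|M. sgn (D i u x) * \<bar>D i u x\<bar> powr (p i - 1) * D i v x)\<bar> \<le> \<epsilon> * \<tau>"
    if t: "\<bar>t - 1\<bar> < d" "0 < \<tau>" "\<tau> < d" and v: "v \<in> V" and m: "\<forall>i. modular i v \<le> \<tau> powr p i" for t \<tau> v
  proof -
    note [measurable] = D_meas[OF v] D_meas[OF V_lin[OF u v]] D_meas[OF V_scale[OF u]]
    have l: "AE x in M. D i (\<lambda>x. t * u x + v x) x = t * D i u x + D i v x"
      using D_lin[OF u v, of i t 1] by simp
    have [measurable]: "D i (\<lambda>x. t * u x + v x) \<in> borel_measurable M"
      using D_meas[OF V_lin[OF u v, of t 1]] by simp
    have "1 / p i * modular i (\<lambda>x. t * u x + v x) = (LINT x|M. \<bar>D i (\<lambda>x. t * u x + v x) x\<bar> powr p i / p i)"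
      by (simp add: modular_def)
    also have "\<dots> = (LINT x|M. \<bar>t * D i u x + D i v x\<bar> powr p i / p i)"
    proof (rule integral_cong_AE)
      show "AE x in M. \<bar>D i (\<lambda>x. t * u x + v x) x\<bar> powr p i / p i = \<bar>t * D i u x + D i v x\<bar> powr p i / p i"
        using l by eventually_elim simp
    qed measurable
    finally have 1: "1 / p i * modular i (\<lambda>x. t * u x + v x) = (LINT x|M. \<bar>t * D i u x + D i v x\<bar> powr p i / p i)" .
    have "1 / p i * modular i (\<lambda>x. t * u x) = (LINT x|M. \<bar>D i (\<lambda>x. t * u x) x\<bar> powr p i / p i)"
      by (simp add: modular_def)
    also have "\<dots> = (LINT x|M. \<bar>t * D i u x\<bar> powr p i / p i)"
    proof (rule integral_cong_AE)
      show "AE x in M. \<bar>D i (\<lambda>x. t * u x) x\<bar> powr p i / p i = \<bar>t * D i u x\<bar> powr p i / p i"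
        using D_scale[OF u, of i t] by eventually_elim simp
    qed measurable
    finally have 2: "1 / p i * modular i (\<lambda>x. t * u x) = (LINT x|M. \<bar>t * D i u x\<bar> powr p i / p i)" .
    show ?thesis unfolding 1 2
      by (rule d(2)[OF t]) (use D_int[OF v] m in \<open>auto simp: modular_def\<close>)
  qed
  thus ?thesis using d(1) by blast
qed

text \<open>The error is uniform for all base points \<open>t * u\<close> with \<open>t\<close>
  close to 1, with the differential taken at \<open>u\<close>; differentiability at
  \<open>u\<close> is the case \<open>t = 1\<close>.\<close>

lemma functional_strictly_differentiable:
  assumes u: "u \<in> V" and \<epsilon>: "0 < \<epsilon>"
  obtains d where "0 < d" "\<And>t \<tau> v. \<bar>t - 1\<bar> < d \<Longrightarrow> 0 < \<tau> \<Longrightarrow> \<tau> < d \<Longrightarrow> v \<in> V \<Longrightarrow> (\<And>i. modular i v \<le> \<tau> powr p i) \<Longrightarrow>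
    \<bar>functional (\<lambda>x. t * u x + v x) - functional (\<lambda>x. t * u x) - differential u v\<bar> \<le> \<epsilon> * \<tau>"
proof -
  define N where "N = real CARD('n) + 1"
  define e where "e = \<epsilon> / N"
  have N: "0 < N" by (simp add: N_def)
  have e: "0 < e" using \<epsilon> N by (simp add: e_def)
  define P where "P = (\<lambda>t v. (LINT x|M. F (t * u x + v x)) - (LINT x|M. F (t * u x)) - (LINT x|M. f (u x) * v x))"
  define R where "R = (\<lambda>i t v. 1 / p i * modular i (\<lambda>x. t * u x + v x) - 1 / p i * modular i (\<lambda>x. t * u x)
      - (LINT x|M. sgn (D i u x) * \<bar>D i u x\<bar> powr (p i - 1) * D i v x))"
  define adm where "adm = (\<lambda>d t \<tau> v. \<bar>t - 1\<bar> < d \<and> 0 < \<tau> \<and> \<tau> < d \<and> v \<in> V \<and> (\<forall>i. modular i v \<le> \<tau> powr p i))"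
  have "\<exists>d>0. \<forall>t \<tau> v. adm d t \<tau> v \<longrightarrow> \<bar>P t v\<bar> \<le> e * \<tau>"
    using potential_strictly_differentiable[OF u e] unfolding adm_def P_def by (simp only: imp_conjL)
  then obtain d0 where d0: "0 < d0" "\<And>t \<tau> v. adm d0 t \<tau> v \<Longrightarrow> \<bar>P t v\<bar> \<le> e * \<tau>" by blast
  have "\<exists>d>0. \<forall>t \<tau> v. adm d t \<tau> v \<longrightarrow> \<bar>R i t v\<bar> \<le> e * \<tau>" for i
    using modular_strictly_differentiable[OF u e, of i] unfolding adm_def R_def by (simp only: imp_conjL)
  then obtain d1 where d1: "\<And>i. 0 < d1 i" "\<And>i t \<tau> v. adm (d1 i) t \<tau> v \<Longrightarrow> \<bar>R i t v\<bar> \<le> e * \<tau>"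
    by metis
  define d where "d = Min (insert d0 (range d1))"
  have d: "0 < d" "d \<le> d0" "\<And>i. d \<le> d1 i"
    using d0 d1(1) unfolding d_def by (auto intro!: Min_le simp del: Min_insert)
  show ?thesis
  proof (rule that[OF d(1)])
    fix t \<tau> v assume t: "\<bar>t - 1\<bar> < d" "0 < \<tau>" "\<tau> < d" and v: "v \<in> V" and m: "\<And>i. modular i v \<le> \<tau> powr p i"
    have P: "\<bar>P t v\<bar> \<le> e * \<tau>" using t v m d by (intro d0(2)) (auto simp: adm_def)
    have R: "\<bar>R i t v\<bar> \<le> e * \<tau>" for i using t v m d(3)[of i] by (intro d1(2)) (auto simp: adm_def)
    have "functional (\<lambda>x. t * u x + v x) - functional (\<lambda>x. t * u x) - differential u v = (\<Sum>i\<in>UNIV. R i t v) - P t v"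
      by (simp add: functional_def differential_def R_def P_def modular_def sum_subtractf)
    also have "\<bar>\<dots>\<bar> \<le> \<bar>\<Sum>i\<in>UNIV. R i t v\<bar> + \<bar>P t v\<bar>" by simp
    also have "\<bar>\<Sum>i\<in>UNIV. R i t v\<bar> \<le> (\<Sum>i\<in>UNIV. \<bar>R i t v\<bar>)" by (rule sum_abs)
    also have "(\<Sum>i\<in>UNIV. \<bar>R i t v\<bar>) \<le> (\<Sum>i\<in>(UNIV::'n set). e * \<tau>)" by (intro sum_mono R)
    also have "\<dots> = real CARD('n) * (e * \<tau>)" by simp
    also have "real CARD('n) * (e * \<tau>) + \<bar>P t v\<bar> \<le> N * (e * \<tau>)" using P by (simp add: N_def algebra_simps)
    also have "N * (e * \<tau>) = \<epsilon> * \<tau>" using N by (simp add: e_def)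
    finally show "\<bar>functional (\<lambda>x. t * u x + v x) - functional (\<lambda>x. t * u x) - differential u v\<bar> \<le> \<epsilon> * \<tau>" by simp
  qed
qed

lemma differential_scale:
  assumes u: "u \<in> V" and v: "v \<in> V"
  shows "differential u (\<lambda>x. c * v x) = c * differential u v"
proof -
  note [measurable] = D_meas[OF u] D_meas[OF v] D_meas[OF V_scale[OF v]]
  have "(LINT x|M. sgn (D i u x) * \<bar>D i u x\<bar> powr (p i - 1) * D i (\<lambda>x. c * v x) x)
     = (LINT x|M. c * (sgn (D i u x) * \<bar>D i u x\<bar> powr (p i - 1) * D i v x))" for i
    by (rule integral_cong_AE) (use D_scale[OF v, of i c] in \<open>auto elim!: eventually_mono\<close>)
  moreover have "(LINT x|M. f (u x) * (c * v x)) = (LINT x|M. c * (f (u x) * v x))" by (simp add: mult_ac)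
  ultimately show ?thesis by (simp add: differential_def sum_distrib_left right_diff_distrib)
qed

lemma functional_line_continuous:
  assumes u: "u \<in> V" and v: "v \<in> V"
  shows "((\<lambda>s. functional (\<lambda>x. u x + s * v x)) \<longlongrightarrow> functional u) (at 0)"
proof -
  define T where "T = nrm v + 1"
  have T: "0 < T" using nrm_nonneg[of v] by (simp add: T_def)
  obtain d where d: "0 < d" "\<And>t \<tau> w. \<bar>t - 1\<bar> < d \<Longrightarrow> 0 < \<tau> \<Longrightarrow> \<tau> < d \<Longrightarrow> w \<in> V \<Longrightarrow> (\<And>i. modular i w \<le> \<tau> powr p i) \<Longrightarrow>
    \<bar>functional (\<lambda>x. t * u x + w x) - functional (\<lambda>x. t * u x) - differential u w\<bar> \<le> 1 * \<tau>"
    by (rule functional_strictly_differentiable[OF u, of 1]) auto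
  have le: "\<bar>functional (\<lambda>x. u x + s * v x) - functional u\<bar> \<le> \<bar>s\<bar> * (T + \<bar>differential u v\<bar>)"
    if s: "s \<noteq> 0" "\<bar>s\<bar> < d / T" for s
  proof -
    have "modular i (\<lambda>x. s * v x) \<le> (\<bar>s\<bar> * T) powr p i" for i
      by (rule modular_le_powr) (simp add: nrm_scale[OF v] T_def mult_left_mono)
    moreover have "\<bar>s\<bar> * T < d" "0 < \<bar>s\<bar> * T" using s T by (auto simp: field_simps)
    ultimately have "\<bar>functional (\<lambda>x. 1 * u x + s * v x) - functional (\<lambda>x. 1 * u x) - differential u (\<lambda>x. s * v x)\<bar> \<le> 1 * (\<bar>s\<bar> * T)"
      using d(1) V_scale[OF v] by (intro d(2)) auto
    moreover have "\<bar>s * differential u v\<bar> = \<bar>s\<bar> * \<bar>differential u v\<bar>" by (rule abs_mult)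
    ultimately show ?thesis by (simp add: differential_scale[OF u v] algebra_simps)
  qed
  have "((\<lambda>s. \<bar>s\<bar> * (T + \<bar>differential u v\<bar>)) \<longlongrightarrow> \<bar>0\<bar> * (T + \<bar>differential u v\<bar>)) (at 0)"
    by (intro tendsto_intros)
  hence 0: "((\<lambda>s. \<bar>s\<bar> * (T + \<bar>differential u v\<bar>)) \<longlongrightarrow> 0) (at 0)" by simp
  have "\<forall>\<^sub>F s in at 0. norm (functional (\<lambda>x. u x + s * v x) - functional u) \<le> \<bar>s\<bar> * (T + \<bar>differential u v\<bar>)"
    unfolding eventually_at using T d(1) le by (intro exI[of _ "d / T"]) (auto simp: dist_real_def)
  from Lim_null_comparison[OF this 0] show ?thesis by (simp add: LIM_zero_iff)
qed

text \<open>The Dirichlet part is concave since all exponents \<open>p i / pN\<close> are at most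
  1. Strictness comes from the potential, on the set where \<open>w\<close> does not vanish.\<close>

lemma functional_fiber_strictly_concave:
  assumes w: "w \<in> V" "\<not> trivial w" and \<tau>: "0 \<le> \<tau>1" "\<tau>1 < \<tau>2" and s: "0 < s" "s < 1"
  shows "(1 - s) * functional (\<lambda>x. \<tau>1 powr (1 / pN) * w x) + s * functional (\<lambda>x. \<tau>2 powr (1 / pN) * w x)
     < functional (\<lambda>x. ((1 - s) * \<tau>1 + s * \<tau>2) powr (1 / pN) * w x)"
proof -
  define m where "m = (1 - s) * \<tau>1 + s * \<tau>2"
  have m: "0 \<le> m" using \<tau> s by (simp add: m_def)
  have mod: "modular i (\<lambda>x. \<tau> powr (1 / pN) * w x) = \<tau> powr (p i / pN) * modular i w" if "0 \<le> \<tau>" for \<tau> i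
    unfolding modular_scale[OF w(1)] using that by (simp add: powr_powr)
  have "(1 - s) * dirichlet (\<lambda>x. \<tau>1 powr (1 / pN) * w x) + s * dirichlet (\<lambda>x. \<tau>2 powr (1 / pN) * w x)
     = (\<Sum>i\<in>UNIV. 1 / p i * (((1 - s) * \<tau>1 powr (p i / pN) + s * \<tau>2 powr (p i / pN)) * modular i w))"
    using \<tau> by (simp add: dirichlet_eq mod)
      (simp add: sum_distrib_left sum.distrib[symmetric] algebra_simps add_divide_distrib diff_divide_distrib)
  also have "\<dots> \<le> (\<Sum>i\<in>UNIV. 1 / p i * (m powr (p i / pN) * modular i w))"
  proof (intro sum_mono mult_left_mono mult_right_mono)
    fix i show "(1 - s) * \<tau>1 powr (p i / pN) + s * \<tau>2 powr (p i / pN) \<le> m powr (p i / pN)"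
      unfolding m_def using p_gt[of i] p_le[of i] pN \<tau> s by (intro powr_concave) auto
  qed (use p_gt modular_nonneg in \<open>auto intro: less_imp_le order_trans[OF zero_le_one]\<close>)
  also have "\<dots> = dirichlet (\<lambda>x. m powr (1 / pN) * w x)" using m by (simp add: dirichlet_eq mod)
  finally have G: "(1 - s) * dirichlet (\<lambda>x. \<tau>1 powr (1 / pN) * w x) + s * dirichlet (\<lambda>x. \<tau>2 powr (1 / pN) * w x)
     \<le> dirichlet (\<lambda>x. m powr (1 / pN) * w x)" .
  define d where "d = (\<lambda>x. (1 - s) * F (\<tau>1 powr (1 / pN) * w x) + s * F (\<tau>2 powr (1 / pN) * w x) - F (m powr (1 / pN) * w x))"
  have iF: "integrable M (\<lambda>x. F (c * w x))" for c using F_integrable[OF V_scale[OF w(1)]] .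
  have id: "integrable M d" unfolding d_def using iF by auto
  have dpos: "0 < d x" if "w x \<noteq> 0" for x
    unfolding d_def m_def using F_strictly_convex[OF that \<tau> s] by simp
  have dnn: "0 \<le> d x" for x using dpos[of x] by (cases "w x = 0") (auto simp: d_def F_zero)
  have "integral\<^sup>L M d \<noteq> 0"
  proof
    assume "integral\<^sup>L M d = 0"
    hence "AE x in M. d x = 0" using integral_nonneg_eq_0_iff_AE[OF id] dnn by auto
    hence "AE x in M. w x = 0" by eventually_elim (use dpos in force)
    thus False using w(2) by (simp add: trivial_def)
  qed
  moreover have "0 \<le> integral\<^sup>L M d" using dnn by simp
  ultimately have "0 < integral\<^sup>L M d" by simp
  also have "integral\<^sup>L M d = (1 - s) * potential (\<lambda>x. \<tau>1 powr (1 / pN) * w x) + s * potential (\<lambda>x. \<tau>2 powr (1 / pN) * w x)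
     - potential (\<lambda>x. m powr (1 / pN) * w x)"
    unfolding d_def potential_def using iF by simp
  finally show ?thesis using G unfolding functional_eq m_def[symmetric] by (simp add: algebra_simps)
qed

lemma modular_le_dirichlet: "1 / p i * modular i u \<le> dirichlet u"
proof -
  have "0 \<le> 1 / p i * modular i u" for i
    using p_gt[of i] modular_nonneg[of i u] by (intro mult_nonneg_nonneg) auto
  thus ?thesis unfolding dirichlet_eq
    by (intro member_le_sum[where f = "\<lambda>i. 1 / p i * modular i u"]) auto
qed

lemma modular_i1_nonzero:
  assumes w: "w \<in> V" "\<not> trivial w" shows "modular i1 w \<noteq> 0"
proof
  assume "modular i1 w = 0"
  hence "AE x in M. w x = 0" unfolding modular_def by (rule poincare[OF w(1)])
  thus False using w(2) by (simp add: trivial_def)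
qed

lemma powr_root_inverse: "0 \<le> t \<Longrightarrow> (t powr pN) powr (1 / pN) = t"
  using pN by (simp add: powr_powr)

lemma functional_fiber_quasiconcave:
  assumes w: "w \<in> V" "\<not> trivial w" and t: "0 \<le> t1" "t1 < t2" "t2 < t3"
  shows "min (functional (\<lambda>x. t1 * w x)) (functional (\<lambda>x. t3 * w x)) < functional (\<lambda>x. t2 * w x)"
proof -
  define s where "s = (t2 powr pN - t1 powr pN) / (t3 powr pN - t1 powr pN)"
  have 1: "t1 powr pN < t2 powr pN" "t2 powr pN < t3 powr pN" using t pN by (auto intro!: powr_less_mono2)
  have s: "0 < s" "s < 1" using 1 by (auto simp: s_def)
  have "t2 powr pN = t1 powr pN + s * (t3 powr pN - t1 powr pN)" using 1 by (simp add: s_def)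
  hence m: "(1 - s) * (t1 powr pN) + s * (t3 powr pN) = t2 powr pN" by (simp add: algebra_simps)
  have "(1 - s) * functional (\<lambda>x. t1 * w x) + s * functional (\<lambda>x. t3 * w x) < functional (\<lambda>x. t2 * w x)"
    using functional_fiber_strictly_concave[OF w _ _ s, of "t1 powr pN" "t3 powr pN"] 1 t
    unfolding m by (simp add: powr_root_inverse)
  moreover have "min a b \<le> (1 - s) * a + s * b" for a b
  proof -
    have "(1 - s) * min a b + s * min a b \<le> (1 - s) * a + s * b" using s by (intro add_mono mult_left_mono) auto
    thus ?thesis by (simp add: algebra_simps)
  qed
  ultimately show ?thesis by (meson le_less_trans)
qed

lemma functional_zero: "u \<in> V \<Longrightarrow> functional (\<lambda>x. 0 * u x) = 0"
  using modular_scale[of u _ 0] by (simp add: functional_eq dirichlet_eq potential_def F_zero)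

text \<open>The value on a null function is found by relaxation, with the zero function as
  approximation, because \<open>D\<close> is not assumed to respect equality almost everywhere.\<close>

lemma functional_trivial:
  assumes u: "u \<in> V" "trivial u" shows "functional u = 0"
proof -
  have z: "dirichlet (\<lambda>x. 0 * u x) = 0" using modular_scale[of u _ 0] u by (simp add: dirichlet_eq)
  have "u \<in> V \<and> dirichlet u \<le> 0" unfolding dirichlet_def
  proof (rule relaxation[OF V_int[OF u(1)]])
    fix e :: real assume e: "0 < e"
    have "(LINT x|M. \<bar>0 * u x - u x\<bar>) = (LINT x|M. 0)"
      using u V_meas[OF u(1)] by (intro integral_cong_AE) (auto simp: trivial_def)
    thus "\<exists>v\<in>V. (LINT x|M. \<bar>v x - u x\<bar>) \<le> e \<and> (\<Sum>i\<in>UNIV. 1 / p i * (LINT x|M. \<bar>D i v x\<bar> powr p i)) \<le> 0"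
      using e z V_scale[OF u(1), of 0] unfolding dirichlet_def by (intro bexI[of _ "\<lambda>x. 0 * u x"]) auto
  qed
  moreover have "0 \<le> dirichlet u" unfolding dirichlet_eq
    using p_gt modular_nonneg by (intro sum_nonneg mult_nonneg_nonneg) (auto intro: less_imp_le order_trans[OF zero_le_one])
  moreover have "potential u = (LINT x|M. 0)" unfolding potential_def
    using u V_meas[OF u(1)] by (intro integral_cong_AE) (auto simp: trivial_def F_zero elim!: eventually_mono)
  ultimately show ?thesis by (simp add: functional_eq)
qed

lemma trivial_scale: "t \<noteq> 0 \<Longrightarrow> trivial (\<lambda>x. t * u x) \<longleftrightarrow> trivial u"
  by (simp add: trivial_def)

lemma functional_fiber_continuous:
  assumes w: "w \<in> V" shows "continuous_on A (\<lambda>t. functional (\<lambda>x. t * w x))"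
proof (rule continuous_at_imp_continuous_on, rule ballI)
  fix t0 :: real
  have "((\<lambda>s. functional (\<lambda>x. t0 * w x + s * w x)) \<longlongrightarrow> functional (\<lambda>x. t0 * w x)) (at 0)"
    by (rule functional_line_continuous[OF V_scale[OF w] w])
  hence "((\<lambda>s. functional (\<lambda>x. (t0 + s) * w x)) \<longlongrightarrow> functional (\<lambda>x. t0 * w x)) (at 0)"
    by (simp add: distrib_right)
  thus "isCont (\<lambda>t. functional (\<lambda>x. t * w x)) t0" by (simp add: isCont_def LIM_offset_zero_iff)
qed

text \<open>For \<open>t \<ge> 1\<close> the Dirichlet part grows at most like \<open>t powr
  pN\<close>, and the potential dominates any multiple of this power.\<close>

lemma functional_fiber_eventually_nonpos:
  assumes w: "w \<in> V" "\<not> trivial w"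
  obtains T where "0 < T" "\<And>t. T \<le> t \<Longrightarrow> functional (\<lambda>x. t * w x) \<le> 0"
proof -
  define I where "I = (LINT x|M. \<bar>w x\<bar> powr pN)"
  have iw: "integrable M (\<lambda>x. \<bar>w x\<bar> powr pN)" using V_integrable_powr[OF w(1), of pN] pN \<alpha> q by auto
  have "I \<noteq> 0"
  proof
    assume "I = 0"
    hence "AE x in M. w x = 0" unfolding I_def by (rule AE_zero_if_powr_integral_zero[OF iw])
    thus False using w(2) by (simp add: trivial_def)
  qed
  moreover have "0 \<le> I" by (simp add: I_def)
  ultimately have I: "0 < I" by simp
  have d0: "0 \<le> dirichlet w" unfolding dirichlet_eq
    using p_gt modular_nonneg by (intro sum_nonneg mult_nonneg_nonneg) (auto intro: less_imp_le order_trans[OF zero_le_one])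
  \<comment> \<open>The factor for which the potential eventually exceeds \<open>t powr pN *
    dirichlet w\<close> by the full power \<open>t powr pN\<close>, which absorbs the additive
    constant \<open>C * m\<close>.\<close>
  define B where "B = (dirichlet w + 1) / I"
  have B: "0 < B" using d0 I by (simp add: B_def)
  obtain C where C: "\<And>x. B * \<bar>x\<bar> powr pN - C \<le> F x" by (rule F_large[OF B]) blast
  define m where "m = measure M (space M)"
  have "functional (\<lambda>x. t * w x) \<le> 0" if t: "max 1 (C * m) \<le> t" for t
  proof -
    have t1: "1 \<le> t" "C * m \<le> t" using t by auto
    have "dirichlet (\<lambda>x. t * w x) \<le> (\<Sum>i\<in>UNIV. 1 / p i * (t powr pN * modular i w))"
      unfolding dirichlet_eq modular_scale[OF w(1)]
    proof (intro sum_mono mult_left_mono mult_right_mono)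
      fix i show "\<bar>t\<bar> powr p i \<le> t powr pN" using t1 p_le[of i] by (simp add: powr_mono)
    qed (use p_gt modular_nonneg in \<open>auto intro: less_imp_le order_trans[OF zero_le_one]\<close>)
    also have "\<dots> = t powr pN * dirichlet w" by (simp add: dirichlet_eq sum_distrib_left mult_ac)
    finally have 1: "dirichlet (\<lambda>x. t * w x) \<le> t powr pN * dirichlet w" .
    have "(LINT x|M. B * t powr pN * \<bar>w x\<bar> powr pN - C) \<le> potential (\<lambda>x. t * w x)"
      unfolding potential_def
    proof (rule integral_mono)
      fix x show "B * t powr pN * \<bar>w x\<bar> powr pN - C \<le> F (t * w x)"
        using C[of "t * w x"] t1 by (simp add: abs_mult powr_mult mult_ac)
    qed (use iw F_integrable[OF V_scale[OF w(1)]] in auto)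
    also have "(LINT x|M. B * t powr pN * \<bar>w x\<bar> powr pN - C) = B * t powr pN * I - C * m"
      using iw by (simp add: I_def m_def)
    also have "B * t powr pN * I = t powr pN * (dirichlet w + 1)" using I by (simp add: B_def)
    finally have 2: "t powr pN * (dirichlet w + 1) - C * m \<le> potential (\<lambda>x. t * w x)" .
    have "t powr 1 \<le> t powr pN" using t1 pN by (intro powr_mono) auto
    hence "C * m \<le> t powr pN" using t1 by simp
    thus ?thesis using 1 2 by (simp add: functional_eq algebra_simps)
  qed
  thus ?thesis by (intro that[of "max 1 (C * m)"]) auto
qed

text \<open>For small \<open>t\<close> the derivative in the direction \<open>i1\<close>
  contributes the lowest power \<open>t powr p1\<close>, with a positive coefficient by the
  Poincare inequality; the potential is smaller by the behaviour of \<open>f\<close> at 0.\<close>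

lemma functional_fiber_positive:
  assumes w: "w \<in> V" "\<not> trivial w"
  obtains t where "0 < t" "0 < functional (\<lambda>x. t * w x)"
proof -
  define \<rho> where "\<rho> = modular i1 w / p1"
  have "modular i1 w \<noteq> 0" by (rule modular_i1_nonzero[OF w])
  hence \<rho>: "0 < \<rho>" using modular_nonneg[of i1 w] p1 by (simp add: \<rho>_def)
  define I1 where "I1 = (LINT x|M. \<bar>w x\<bar> powr p1)"
  define I2 where "I2 = (LINT x|M. \<bar>w x\<bar> powr \<alpha>)"
  have I: "0 \<le> I1" "0 \<le> I2" by (auto simp: I1_def I2_def)
  have i: "integrable M (\<lambda>x. \<bar>w x\<bar> powr p1)" "integrable M (\<lambda>x. \<bar>w x\<bar> powr \<alpha>)"
    using V_integrable_powr[OF w(1)] p1 \<alpha> q by auto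
  define \<epsilon> where "\<epsilon> = \<rho> / (2 * (I1 + 1))"
  have e: "0 < \<epsilon>" "\<epsilon> * I1 \<le> \<rho> / 2" using \<rho> I by (auto simp: \<epsilon>_def field_simps)
  obtain C where C: "0 \<le> C" "\<And>x. F x \<le> \<epsilon> * \<bar>x\<bar> powr p1 + C * \<bar>x\<bar> powr \<alpha>" by (rule F_small[OF e(1)]) blast
  define t where "t = (\<rho> / (4 * (C * I2 + 1))) powr (1 / (\<alpha> - p1))"
  have CI: "0 \<le> C * I2" using C I by simp
  have t: "0 < t" using \<rho> CI by (simp add: t_def)
  have "t powr (\<alpha> - p1) = \<rho> / (4 * (C * I2 + 1))" using \<alpha> \<rho> CI by (simp add: t_def powr_powr)
  hence "C * I2 * t powr (\<alpha> - p1) = C * I2 * \<rho> / (4 * (C * I2 + 1))" by simp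
  also have "\<dots> \<le> \<rho> / 4"
  proof -
    have "C * I2 * \<rho> \<le> (C * I2 + 1) * \<rho>" using \<rho> by (intro mult_right_mono) auto
    thus ?thesis using CI by (simp add: field_simps)
  qed
  finally have small: "C * I2 * t powr (\<alpha> - p1) < \<rho> / 2" using \<rho> by simp
  have ta: "t powr \<alpha> = t powr p1 * t powr (\<alpha> - p1)" by (simp add: powr_add[symmetric])
  have "1 / p i1 * modular i1 (\<lambda>x. t * w x) \<le> dirichlet (\<lambda>x. t * w x)"
    by (rule modular_le_dirichlet)
  hence 1: "t powr p1 * \<rho> \<le> dirichlet (\<lambda>x. t * w x)"
    unfolding modular_scale[OF w(1)] using t by (simp add: \<rho>_def p_i1)
  have "potential (\<lambda>x. t * w x) \<le> (LINT x|M. \<epsilon> * t powr p1 * \<bar>w x\<bar> powr p1 + C * t powr \<alpha> * \<bar>w x\<bar> powr \<alpha>)"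
    unfolding potential_def
  proof (rule integral_mono)
    fix x show "F (t * w x) \<le> \<epsilon> * t powr p1 * \<bar>w x\<bar> powr p1 + C * t powr \<alpha> * \<bar>w x\<bar> powr \<alpha>"
      using C(2)[of "t * w x"] t by (simp add: abs_mult powr_mult mult_ac)
  qed (use i F_integrable[OF V_scale[OF w(1)]] in auto)
  also have "\<dots> = \<epsilon> * t powr p1 * I1 + C * t powr \<alpha> * I2" using i by (simp add: I1_def I2_def)
  also have "\<dots> = t powr p1 * (\<epsilon> * I1 + C * I2 * t powr (\<alpha> - p1))" by (simp add: ta algebra_simps)
  also have "\<dots> < t powr p1 * \<rho>" using t small e by (intro mult_strict_left_mono) auto
  finally show ?thesis using 1 t by (intro that[of t]) (auto simp: functional_eq)
qed

text \<open>The Nehari set, described by maximality along the ray instead of the equation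
  \<open>\<Phi>'(u) u = 0\<close>. By concavity of the fibers both descriptions agree, and
  maximality is the property that is used.\<close>

definition nehari :: "('a \<Rightarrow> real) set" where
  "nehari = {u \<in> V. \<not> trivial u \<and> (\<forall>s\<ge>0. functional (\<lambda>x. s * u x) \<le> functional u)}"

lemma fiber_max_exists:
  assumes w: "w \<in> V" "\<not> trivial w"
  obtains t where "0 < t" "(\<lambda>x. t * w x) \<in> nehari"
    "\<And>s. 0 \<le> s \<Longrightarrow> functional (\<lambda>x. s * w x) \<le> functional (\<lambda>x. t * w x)"
proof -
  define h where "h = (\<lambda>t. functional (\<lambda>x. t * w x))"
  obtain T where T: "0 < T" "\<And>t. T \<le> t \<Longrightarrow> h t \<le> 0"
    unfolding h_def by (rule functional_fiber_eventually_nonpos[OF w]) blast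
  obtain t0 where t0: "0 < t0" "0 < h t0" unfolding h_def by (rule functional_fiber_positive[OF w]) blast
  obtain t where t: "t \<in> {0..T}" "\<And>s. s \<in> {0..T} \<Longrightarrow> h s \<le> h t"
    using continuous_attains_sup[of "{0..T}" h] T functional_fiber_continuous[OF w(1)] unfolding h_def by force
  have "t0 \<in> {0..T}" using T(2)[of t0] t0 by force
  hence ht: "0 < h t" using t(2)[of t0] t0 by simp
  have "h 0 = 0" unfolding h_def by (rule functional_zero[OF w(1)])
  hence tp: "0 < t" using t(1) ht by (cases "t = 0") auto
  have max: "h s \<le> h t" if "0 \<le> s" for s
    using that t(2)[of s] T(2)[of s] ht by (cases "s \<le> T") auto
  have "(\<lambda>x. t * w x) \<in> nehari"
  proof -
    have "functional (\<lambda>x. s * (t * w x)) \<le> functional (\<lambda>x. t * w x)" if "0 \<le> s" for s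
      using max[of "s * t"] that tp by (simp add: h_def mult.assoc)
    thus ?thesis using V_scale[OF w(1)] trivial_scale[of t w] w(2) tp by (simp add: nehari_def)
  qed
  thus ?thesis using that tp max by (simp add: h_def)
qed

lemma nehari_nonneg: "u \<in> nehari \<Longrightarrow> 0 \<le> functional u"
  using functional_zero[of u] by (force simp: nehari_def)

text \<open>For bounded sequences the \<open>L\<^sup>q\<close> bound with \<open>q >
  \<alpha>\<close> upgrades almost everywhere convergence to convergence of the potential.\<close>

lemma potential_continuous_AE:
  assumes u: "\<And>n. u n \<in> V" "\<And>n i. modular i (u n) \<le> 1" and w: "w \<in> V"
    and conv: "AE x in M. (\<lambda>n. u n x) \<longlonglongrightarrow> w x"
  shows "(\<lambda>n. potential (\<lambda>x. t * u n x)) \<longlonglongrightarrow> potential (\<lambda>x. t * w x)"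
proof -
  obtain K where K: "0 \<le> K" "\<And>v \<tau>. v \<in> V \<Longrightarrow> 0 < \<tau> \<Longrightarrow> (\<And>i. modular i v \<le> \<tau> powr p i) \<Longrightarrow>
      integrable M (\<lambda>x. \<bar>v x\<bar> powr q) \<and> (LINT x|M. \<bar>v x\<bar> powr q) \<le> K * \<tau> powr q"
    by (rule embedding_scaled[of q]) (use q' in auto)
  have iu: "integrable M (\<lambda>x. \<bar>u n x\<bar> powr q)" "(LINT x|M. \<bar>u n x\<bar> powr q) \<le> K" for n
    using K(2)[OF u(1), of 1 n] u(2) by auto
  have iw: "integrable M (\<lambda>x. \<bar>w x\<bar> powr q)" using V_integrable_powr[OF w, of q] q' by auto
  define K' where "K' = \<bar>t\<bar> powr q * max K (LINT x|M. \<bar>w x\<bar> powr q)"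
  obtain A where A: "0 \<le> A" "\<And>x. F x \<le> A * (1 + \<bar>x\<bar> powr \<alpha>)" by (rule F_growth) blast
  show ?thesis unfolding potential_def
  proof (rule superposition_integral_continuous[OF _ q F_cont A(1), where K = K'])
    show "AE x in M. (\<lambda>n. t * u n x) \<longlonglongrightarrow> t * w x"
      using conv by eventually_elim (intro tendsto_intros)
    have sc: "\<bar>t * a\<bar> powr q = \<bar>t\<bar> powr q * \<bar>a\<bar> powr q" for a by (simp add: abs_mult powr_mult)
    show "integrable M (\<lambda>x. \<bar>t * u n x\<bar> powr q)" "integrable M (\<lambda>x. \<bar>t * w x\<bar> powr q)" for n
      unfolding sc using iu iw by auto
    show "(LINT x|M. \<bar>t * u n x\<bar> powr q) \<le> K'" "(LINT x|M. \<bar>t * w x\<bar> powr q) \<le> K'" for n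
      unfolding sc K'_def using iu(2)[of n] by (auto intro!: mult_left_mono)
  qed (use \<alpha> A F_nonneg V_meas[OF V_scale[OF u(1)]] V_meas[OF V_scale[OF w]] in auto)
qed

text \<open>Minimizing sequences are normalized first, since boundedness of a minimizing sequence
  is not known in advance; normalization loses nothing because every point of the fiber of
  \<open>a n\<close> has an energy of at most \<open>functional (a n)\<close>.\<close>

lemma nehari_minimizer_exists:
  obtains u where "u \<in> nehari" "\<And>v. v \<in> nehari \<Longrightarrow> functional u \<le> functional v" "\<And>x. 0 \<le> u x"
proof -
  define c where "c = Inf (functional ` nehari)"
  have ne: "nehari \<noteq> {}"
  proof -
    obtain w where "w \<in> V" "\<not> trivial w" using nonzero by (auto simp: trivial_def)
    then obtain t where "(\<lambda>x. t * w x) \<in> nehari" by (rule fiber_max_exists)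
    thus ?thesis by auto
  qed
  have bb: "bdd_below (functional ` nehari)" using nehari_nonneg by (intro bdd_belowI[of _ 0]) auto
  have c_le: "c \<le> functional v" if "v \<in> nehari" for v unfolding c_def using that bb by (intro cInf_lower) auto
  have ex: "\<exists>v. v \<in> nehari \<and> functional v < c + e" if "0 < e" for e
    using cInf_lessD[of "functional ` nehari" "c + e"] ne that unfolding c_def by auto
  have "\<forall>n. \<exists>v. v \<in> nehari \<and> functional v < c + 1 / real (Suc n)" by (intro allI ex) simp
  then obtain a where a: "\<And>n. a n \<in> nehari" "\<And>n. functional (a n) < c + 1 / real (Suc n)" by metis
  have aV: "a n \<in> V" and ant: "\<not> trivial (a n)" for n using a(1)[of n] by (auto simp: nehari_def)
  have nrm_pos: "0 < nrm (a n)" for n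
  proof -
    have "modular i1 (a n) \<noteq> 0" by (rule modular_i1_nonzero[OF aV ant])
    moreover have "modular i1 (a n) = 0" if "nrm (a n) = 0"
      using modular_le_nrm[of i1 "a n"] modular_nonneg[of i1 "a n"] that by simp
    ultimately show ?thesis using nrm_nonneg[of "a n"] by force
  qed
  define v where "v = (\<lambda>n x. (1 / nrm (a n)) * a n x)"
  have vV: "v n \<in> V" for n unfolding v_def by (rule V_scale[OF aV])
  have vn: "nrm (v n) = 1" for n
    unfolding v_def nrm_scale[OF aV] using nrm_pos[of n] by simp
  have vm: "modular i (v n) \<le> 1" for i n using modular_le_nrm[of i "v n"] by (simp add: vn)
  have vE: "functional (\<lambda>x. t * v n x) \<le> functional (a n)" if "0 \<le> t" for t n
  proof -
    have "0 \<le> t / nrm (a n)" using that nrm_pos[of n] by simp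
    hence "functional (\<lambda>x. (t / nrm (a n)) * a n x) \<le> functional (a n)"
      using a(1)[of n] unfolding nehari_def by blast
    thus ?thesis by (simp add: v_def)
  qed
  obtain r0 :: "nat \<Rightarrow> nat" and w where r0: "strict_mono r0" "integrable M w" "(\<lambda>n. LINT x|M. \<bar>v (r0 n) x - w x\<bar>) \<longlonglongrightarrow> 0"
    using compactness[of v 1] vV vm unfolding modular_def by blast
  obtain r1 :: "nat \<Rightarrow> nat" where r1: "strict_mono r1" "AE x in M. (\<lambda>n. v (r0 (r1 n)) x) \<longlonglongrightarrow> w x"
    by (rule L1_AE_convergent_subsequence[of M "\<lambda>n. v (r0 n)" w]) (use r0 V_int[OF vV] in auto)
  define r where "r = r0 \<circ> r1"
  have r: "strict_mono r" unfolding r_def by (rule strict_mono_o[OF r0(1) r1(1)])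
  have L1: "(\<lambda>n. LINT x|M. \<bar>v (r n) x - w x\<bar>) \<longlonglongrightarrow> 0"
    using LIMSEQ_subseq_LIMSEQ[OF r0(3) r1(1)] by (simp add: r_def o_def)
  have ae: "AE x in M. (\<lambda>n. v (r n) x) \<longlonglongrightarrow> w x" using r1(2) by (simp add: r_def)
  have alim: "(\<lambda>n. functional (a (r n))) \<longlonglongrightarrow> c"
  proof (rule tendsto_sandwich[of "\<lambda>_. c" _ _ "\<lambda>n. c + 1 / real (Suc (r n))"])
    show "(\<lambda>n. c + 1 / real (Suc (r n))) \<longlonglongrightarrow> c"
      using tendsto_add[OF tendsto_const[of c] LIMSEQ_subseq_LIMSEQ[OF LIMSEQ_Suc[OF lim_inverse_n'] r]]
      by (simp add: o_def)
  qed (use c_le[OF a(1)] less_imp_le[OF a(2)] in auto)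
  \<comment> \<open>Lower semicontinuity along the sequence \<open>t * v (r n)\<close>, in the
    form in which relaxation provides it.\<close>
  have relax: "(\<lambda>x. t * w x) \<in> V \<and> dirichlet (\<lambda>x. t * w x) \<le> B"
    if B: "\<forall>\<^sub>F n in sequentially. dirichlet (\<lambda>x. t * v (r n) x) \<le> B" for t B
    unfolding dirichlet_def
  proof (rule relaxation)
    show "integrable M (\<lambda>x. t * w x)" using r0(2) by simp
    fix e :: real assume e: "0 < e"
    have "(\<lambda>n. \<bar>t\<bar> * (LINT x|M. \<bar>v (r n) x - w x\<bar>)) \<longlonglongrightarrow> \<bar>t\<bar> * 0" by (intro tendsto_intros L1)
    hence "\<forall>\<^sub>F n in sequentially. \<bar>t\<bar> * (LINT x|M. \<bar>v (r n) x - w x\<bar>) < e" by (rule order_tendstoD) (use e in simp)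
    with B have "\<forall>\<^sub>F n in sequentially. dirichlet (\<lambda>x. t * v (r n) x) \<le> B \<and> \<bar>t\<bar> * (LINT x|M. \<bar>v (r n) x - w x\<bar>) < e"
      by eventually_elim simp
    then obtain n where n: "dirichlet (\<lambda>x. t * v (r n) x) \<le> B" "\<bar>t\<bar> * (LINT x|M. \<bar>v (r n) x - w x\<bar>) < e"
      by (auto simp: eventually_sequentially)
    have "(LINT x|M. \<bar>t * v (r n) x - t * w x\<bar>) = (LINT x|M. \<bar>t\<bar> * \<bar>v (r n) x - w x\<bar>)"
      by (intro Bochner_Integration.integral_cong refl) (simp add: abs_mult[symmetric] algebra_simps)
    hence "(LINT x|M. \<bar>t * v (r n) x - t * w x\<bar>) \<le> e" using n(2) by simp
    thus "\<exists>v\<in>V. (LINT x|M. \<bar>v x - t * w x\<bar>) \<le> e \<and> (\<Sum>i\<in>UNIV. 1 / p i * (LINT x|M. \<bar>D i v x\<bar> powr p i)) \<le> B"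
      using n(1) unfolding dirichlet_def by (intro bexI[OF _ V_scale[OF vV[of "r n"], of t]] conjI)
  qed
  have wV: "w \<in> V"
  proof -
    have "dirichlet (v n) \<le> (\<Sum>i\<in>UNIV. 1 / p i * 1)" for n
      unfolding dirichlet_eq using p_gt vm by (intro sum_mono mult_left_mono) (auto intro: less_imp_le order_trans[OF zero_le_one])
    hence "\<forall>\<^sub>F n in sequentially. dirichlet (\<lambda>x. 1 * v (r n) x) \<le> (\<Sum>i\<in>UNIV. 1 / p i * 1)" by simp
    from relax[OF this] show ?thesis by simp
  qed
  have pot: "(\<lambda>n. potential (\<lambda>x. t * v (r n) x)) \<longlonglongrightarrow> potential (\<lambda>x. t * w x)" for t
    by (rule potential_continuous_AE[OF vV vm wV ae])
  have bound: "\<forall>\<^sub>F n in sequentially. dirichlet (\<lambda>x. t * v (r n) x) \<le> c + potential (\<lambda>x. t * w x) + e"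
    if t: "0 \<le> t" and e: "0 < e" for t e
  proof -
    have "\<forall>\<^sub>F n in sequentially. functional (a (r n)) < c + e / 2"
      by (rule order_tendstoD(2)[OF alim]) (use e in simp)
    moreover have "\<forall>\<^sub>F n in sequentially. potential (\<lambda>x. t * v (r n) x) < potential (\<lambda>x. t * w x) + e / 2"
      by (rule order_tendstoD(2)[OF pot]) (use e in simp)
    ultimately show ?thesis
    proof eventually_elim
      case (elim n)
      thus ?case using vE[OF t, of "r n"] by (simp add: functional_eq)
    qed
  qed
  have wle: "functional (\<lambda>x. t * w x) \<le> c" if t: "0 \<le> t" for t
  proof (rule field_le_epsilon)
    fix e :: real assume "0 < e"
    from relax[OF bound[OF t this]] show "functional (\<lambda>x. t * w x) \<le> c + e" by (simp add: functional_eq)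
  qed
  \<comment> \<open>If \<open>w\<close> vanished, so would the limits of the potentials, and
    \<open>bound\<close> would bound the Dirichlet energies of \<open>t * v (r n)\<close> by
    \<open>c + 1\<close> for every \<open>t\<close>. But the norm of \<open>v n\<close> is 1, so
    one of the \<open>N\<close> derivatives has norm at least \<open>1 / N\<close>, and for
    \<open>t \<ge> N\<close> the energy grows at least linearly in \<open>t\<close>.\<close>
  have wnt: "\<not> trivial w"
  proof
    assume triv: "trivial w"
    define N where "N = real CARD('n)"
    have N: "1 \<le> N" unfolding N_def by (simp add: Suc_leI)
    have p0: "potential (\<lambda>x. t * w x) = 0" for t
    proof -
      have "potential (\<lambda>x. t * w x) = (LINT x|M. 0)" unfolding potential_def
        using triv V_meas[OF wV] by (intro integral_cong_AE) (auto simp: trivial_def F_zero elim!: eventually_mono)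
      thus ?thesis by simp
    qed
    have low: "(t / N) / pN \<le> dirichlet (\<lambda>x. t * v n x)" if t: "N \<le> t" for t n
    proof -
      have "\<exists>i. 1 / N \<le> modular i (v n) powr (1 / p i)"
      proof (rule ccontr)
        assume "\<nexists>i. 1 / N \<le> modular i (v n) powr (1 / p i)"
        hence "nrm (v n) < (\<Sum>i\<in>(UNIV::'n set). 1 / N)"
          unfolding nrm_def modular_def[symmetric] by (intro sum_strict_mono) (auto simp: not_le)
        thus False by (simp add: vn N_def)
      qed
      then obtain i where i: "1 / N \<le> modular i (v n) powr (1 / p i)" by blast
      have "(1 / N) powr p i \<le> (modular i (v n) powr (1 / p i)) powr p i"
        using i N p_gt[of i] by (intro powr_mono2) auto
      hence m: "(1 / N) powr p i \<le> modular i (v n)" using p_gt[of i] modular_nonneg[of i "v n"] by (simp add: powr_powr)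
      have "(t / N) powr 1 \<le> (t / N) powr p i" using t N p_gt[of i] by (intro powr_mono) auto
      also have "(t / N) powr p i = t powr p i * (1 / N) powr p i" using t N by (simp add: powr_divide)
      also have "\<dots> \<le> t powr p i * modular i (v n)" using m by (intro mult_left_mono) auto
      finally have "t / N \<le> modular i (\<lambda>x. t * v n x)"
        unfolding modular_scale[OF vV] using t N by simp
      hence "(t / N) / pN \<le> modular i (\<lambda>x. t * v n x) / p i"
        using p_le[of i] p_gt[of i] t N modular_nonneg by (intro frac_le) auto
      also have "\<dots> \<le> dirichlet (\<lambda>x. t * v n x)"
        using modular_le_dirichlet[of i] by simp
      finally show ?thesis .
    qed
    have up: "(t / N) / pN \<le> c + 1" if t: "N \<le> t" for t
    proof -
      have "\<forall>\<^sub>F n in sequentially. dirichlet (\<lambda>x. t * v (r n) x) \<le> c + 1"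
        using bound[of t 1] t N by (simp add: p0)
      then obtain n where "dirichlet (\<lambda>x. t * v (r n) x) \<le> c + 1" by (auto simp: eventually_sequentially)
      thus ?thesis using low[OF t, of "r n"] by linarith
    qed
    have "1 * 1 \<le> pN * (\<bar>c\<bar> + 2)" using pN by (intro mult_mono) auto
    hence "N * 1 \<le> N * (pN * (\<bar>c\<bar> + 2))" using N by (intro mult_left_mono) auto
    \<comment> \<open>The value of \<open>t\<close> is chosen such that the left-hand side equals
      \<open>\<bar>c\<bar> + 2\<close>.\<close>
    hence "(N * (pN * (\<bar>c\<bar> + 2)) / N) / pN \<le> c + 1" by (intro up) simp
    moreover have "(N * (pN * (\<bar>c\<bar> + 2)) / N) / pN = \<bar>c\<bar> + 2" using N pN by simp
    ultimately show False by linarith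
  qed
  define z where "z = (\<lambda>x. \<bar>w x\<bar>)"
  have zV: "z \<in> V" using absolute_value[OF wV] by (simp add: z_def)
  have znt: "\<not> trivial z" using wnt by (simp add: trivial_def z_def)
  have zle: "functional (\<lambda>x. t * z x) \<le> c" if t: "0 \<le> t" for t
  proof -
    have e: "(\<lambda>x. t * z x) = (\<lambda>x. \<bar>t * w x\<bar>)" using t by (simp add: z_def abs_mult)
    have "dirichlet (\<lambda>x. t * z x) \<le> dirichlet (\<lambda>x. t * w x)"
      unfolding e dirichlet_def using absolute_value[OF V_scale[OF wV], of t] by simp
    moreover have "potential (\<lambda>x. t * z x) = potential (\<lambda>x. t * w x)"
      unfolding e potential_def by (simp add: F_abs)
    ultimately show ?thesis using wle[OF t] by (simp add: functional_eq)
  qed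
  obtain t where t: "0 < t" "(\<lambda>x. t * z x) \<in> nehari" by (rule fiber_max_exists[OF zV znt]) blast
  show ?thesis
  proof (rule that[OF t(2)])
    show "functional (\<lambda>x. t * z x) \<le> functional v" if "v \<in> nehari" for v
      using zle[of t] t c_le[OF that] by simp
  qed (use t in \<open>auto simp: z_def\<close>)
qed

text \<open>The argument by contradiction moves from \<open>u\<close> in a direction
  \<open>v\<close> of descent and then returns to the Nehari set along the fiber of \<open>u + s *
  v\<close>. The return point \<open>t\<close> is not known to depend continuously on
  \<open>s\<close>, but comparing three points of the fiber confines it to a neighbourhood of 1,
  and this is all that strict differentiability requires.\<close>

lemma nehari_minimizer_differential_zero:
  assumes u: "u \<in> nehari" and min: "\<And>v. v \<in> nehari \<Longrightarrow> functional u \<le> functional v" and v: "v \<in> V"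
  shows "differential u v = 0"
proof -
  have uV: "u \<in> V" and unt: "\<not> trivial u" and umax: "\<And>s. 0 \<le> s \<Longrightarrow> functional (\<lambda>x. s * u x) \<le> functional u"
    using u by (auto simp: nehari_def)
  define c where "c = functional u"
  have "\<not> differential u v < 0" if v: "v \<in> V" for v
  proof
    assume neg: "differential u v < 0"
    define \<eta> where "\<eta> = - differential u v"
    have \<eta>: "0 < \<eta>" using neg by (simp add: \<eta>_def)
    define T where "T = nrm v + 1"
    have T: "0 < T" using nrm_nonneg[of v] by (simp add: T_def)
    obtain d where d: "0 < d" "\<And>t \<tau> w. \<bar>t - 1\<bar> < d \<Longrightarrow> 0 < \<tau> \<Longrightarrow> \<tau> < d \<Longrightarrow> w \<in> V \<Longrightarrow> (\<And>i. modular i w \<le> \<tau> powr p i) \<Longrightarrow>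
      \<bar>functional (\<lambda>x. t * u x + w x) - functional (\<lambda>x. t * u x) - differential u w\<bar> \<le> \<eta> / (4 * T) * \<tau>"
      by (rule functional_strictly_differentiable[OF uV, of "\<eta> / (4 * T)"]) (use \<eta> T in auto)
    \<comment> \<open>Descent at all base points \<open>t * u\<close> near \<open>u\<close>: the
      differential contributes \<open>- \<eta> * (t * s)\<close>, and the error is a quarter of
      that.\<close>
    have drop: "functional (\<lambda>x. t * (u x + s * v x)) < c"
      if t: "\<bar>t - 1\<bar> < d" "0 < t" and s: "0 < s" "t * s * T < d" for t s
    proof -
      have m: "modular i (\<lambda>x. (t * s) * v x) \<le> (t * s * T) powr p i" for i
        using t s by (intro modular_le_powr) (simp add: nrm_scale[OF v] T_def mult_left_mono)
      have "\<bar>functional (\<lambda>x. t * u x + (t * s) * v x) - functional (\<lambda>x. t * u x) - differential u (\<lambda>x. (t * s) * v x)\<bar>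
          \<le> \<eta> / (4 * T) * (t * s * T)"
        using t s T by (intro d(2) m V_scale[OF v]) auto
      also have "\<dots> = \<eta> * (t * s) / 4" using T by simp
      finally have "functional (\<lambda>x. t * u x + (t * s) * v x) \<le> functional (\<lambda>x. t * u x) - \<eta> * (t * s) + \<eta> * (t * s) / 4"
        unfolding differential_scale[OF uV v] by (simp add: \<eta>_def mult.commute)
      moreover have "0 < \<eta> * (t * s)" using \<eta> t s by simp
      ultimately have "functional (\<lambda>x. t * u x + (t * s) * v x) < functional (\<lambda>x. t * u x)" by linarith
      thus ?thesis using umax[of t] t by (simp add: c_def algebra_simps)
    qed
    define \<delta> where "\<delta> = min d 1 / 2"
    have \<delta>: "0 < \<delta>" "\<delta> < d" "\<delta> < 1" using d(1) by (auto simp: \<delta>_def)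
    \<comment> \<open>Strict concavity makes the maximum of the fiber of \<open>u\<close> unique:
      between two maximizers the value would be larger.\<close>
    have lt: "functional (\<lambda>x. t * u x) < c" if t: "0 \<le> t" "t \<noteq> 1" for t
    proof (rule ccontr)
      assume "\<not> functional (\<lambda>x. t * u x) < c"
      hence e: "functional (\<lambda>x. t * u x) = c" using umax[OF t(1)] by (simp add: c_def)
      have "c < functional (\<lambda>x. ((t + 1) / 2) * u x)"
      proof (cases "t < 1")
        case True
        thus ?thesis using functional_fiber_quasiconcave[OF uV unt t(1), of "(t + 1) / 2" 1] e
          by (simp add: c_def)
      next
        case False
        thus ?thesis using functional_fiber_quasiconcave[OF uV unt, of 1 "(t + 1) / 2" t] e t
          by (simp add: c_def)
      qed
      thus False using umax[of "(t + 1) / 2"] t by (simp add: c_def)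
    qed
    \<comment> \<open>a level separating the values at \<open>1 - \<delta>\<close> and \<open>1 +
      \<delta>\<close> from the value at 1\<close>
    define m where "m = (max (functional (\<lambda>x. (1 - \<delta>) * u x)) (functional (\<lambda>x. (1 + \<delta>) * u x)) + c) / 2"
    have m: "functional (\<lambda>x. (1 - \<delta>) * u x) < m" "functional (\<lambda>x. (1 + \<delta>) * u x) < m" "m < c"
      using lt[of "1 - \<delta>"] lt[of "1 + \<delta>"] \<delta> by (auto simp: m_def)
    have tend: "((\<lambda>s. functional (\<lambda>x. t * (u x + s * v x))) \<longlongrightarrow> functional (\<lambda>x. t * u x)) (at_right 0)" for t
    proof -
      have "((\<lambda>s. functional (\<lambda>x. t * u x + s * (t * v x))) \<longlongrightarrow> functional (\<lambda>x. t * u x)) (at 0)"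
        by (rule functional_line_continuous[OF V_scale[OF uV] V_scale[OF v]])
      hence "((\<lambda>s. functional (\<lambda>x. t * (u x + s * v x))) \<longlongrightarrow> functional (\<lambda>x. t * u x)) (at 0)"
        by (simp add: algebra_simps)
      thus ?thesis by (rule filterlim_mono[OF _ order_refl at_le]) simp
    qed
    \<comment> \<open>By continuity in \<open>s\<close> the three values of the fiber of \<open>u
      + s * v\<close> stay on their sides of \<open>m\<close>.\<close>
    have "\<forall>\<^sub>F s in at_right 0. functional (\<lambda>x. (1 - \<delta>) * (u x + s * v x)) < m"
      by (rule order_tendstoD(2)[OF tend m(1)])
    moreover have "\<forall>\<^sub>F s in at_right 0. functional (\<lambda>x. (1 + \<delta>) * (u x + s * v x)) < m"
      by (rule order_tendstoD(2)[OF tend m(2)])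
    moreover have "\<forall>\<^sub>F s in at_right 0. m < functional (\<lambda>x. 1 * (u x + s * v x))"
      by (rule order_tendstoD(1)[OF tend]) (use m(3) in \<open>simp add: c_def\<close>)
    moreover have "\<forall>\<^sub>F s in at_right 0. s < d / (2 * T)"
      by (rule order_tendstoD(2)[OF tendsto_ident_at]) (use d(1) T in auto)
    moreover have "\<forall>\<^sub>F s::real in at_right 0. 0 < s" by (rule eventually_at_right_less)
    ultimately have "\<forall>\<^sub>F s in at_right 0. functional (\<lambda>x. (1 - \<delta>) * (u x + s * v x)) < m \<and>
       functional (\<lambda>x. (1 + \<delta>) * (u x + s * v x)) < m \<and> m < functional (\<lambda>x. 1 * (u x + s * v x)) \<and> s < d / (2 * T) \<and> 0 < s"
      by eventually_elim simp
    then obtain s where s: "functional (\<lambda>x. (1 - \<delta>) * (u x + s * v x)) < m"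
       "functional (\<lambda>x. (1 + \<delta>) * (u x + s * v x)) < m" "m < functional (\<lambda>x. 1 * (u x + s * v x))" "s < d / (2 * T)" "0 < s"
      using eventually_happens'[of "at_right (0::real)"] by auto
    define w where "w = (\<lambda>x. u x + s * v x)"
    have wV: "w \<in> V" unfolding w_def using V_lin[OF uV v, of 1 s] by simp
    have wnt: "\<not> trivial w"
    proof
      assume tr: "trivial w"
      hence "trivial (\<lambda>x. k * w x)" for k by (auto simp: trivial_def)
      hence z: "functional (\<lambda>x. k * w x) = 0" for k by (intro functional_trivial V_scale[OF wV])
      show False using s(1,3) z[of 1] z[of "1 - \<delta>"] unfolding w_def by linarith
    qed
    obtain t where t: "0 < t" "(\<lambda>x. t * w x) \<in> nehari" "\<And>s. 0 \<le> s \<Longrightarrow> functional (\<lambda>x. s * w x) \<le> functional (\<lambda>x. t * w x)"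
      by (rule fiber_max_exists[OF wV wnt]) blast
    have t1: "m < functional (\<lambda>x. t * w x)" using t(3)[of 1] s(3) by (simp add: w_def)
    have "1 - \<delta> < t"
    proof (rule ccontr)
      assume "\<not> 1 - \<delta> < t"
      hence "t = 1 - \<delta> \<or> t < 1 - \<delta>" by auto
      thus False
      proof
        assume "t = 1 - \<delta>" thus False using t1 s(1) by (simp add: w_def)
      next
        assume "t < 1 - \<delta>"
        from functional_fiber_quasiconcave[OF wV wnt _ this, of 1] show False
          using t(1) \<delta> t1 s(1,3) by (simp add: w_def min_def split: if_splits)
      qed
    qed
    moreover have "t < 1 + \<delta>"
    proof (rule ccontr)
      assume "\<not> t < 1 + \<delta>"
      hence "t = 1 + \<delta> \<or> 1 + \<delta> < t" by auto
      thus False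
      proof
        assume "t = 1 + \<delta>" thus False using t1 s(2) by (simp add: w_def)
      next
        assume "1 + \<delta> < t"
        from functional_fiber_quasiconcave[OF wV wnt _ _ this, of 1] show False
          using t(1) \<delta> t1 s(2,3) by (simp add: w_def min_def split: if_splits)
      qed
    qed
    ultimately have td: "\<bar>t - 1\<bar> < d" "t < 2" using \<delta> by auto
    have "t * (s * T) \<le> 2 * (s * T)" using td s T by (intro mult_right_mono) auto
    also have "2 * (s * T) < d" using s(4) T by (simp add: field_simps)
    finally have "functional (\<lambda>x. t * w x) < c"
      unfolding w_def using td t(1) s(5) by (intro drop) (auto simp: mult.assoc)
    thus False using min[OF t(2)] by (simp add: c_def)
  qed
  from this[OF v] this[OF V_scale[OF v, of "-1"]] differential_scale[OF uV v, of "-1"] show ?thesis by simp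
qed

text \<open>The estimate for the remainder is available at scales \<open>\<tau> > 0\<close>
  exceeding the norm of the increment; it follows at the norm itself by letting
  \<open>\<tau>\<close> decrease, which includes increments of norm 0.\<close>

lemma nehari_minimizer_critical:
  assumes u: "u \<in> nehari" and min: "\<And>v. v \<in> nehari \<Longrightarrow> functional u \<le> functional v"
  shows "critical_point V nrm functional u"
proof -
  have uV: "u \<in> V" using u by (simp add: nehari_def)
  have "\<exists>d>0. \<forall>v\<in>V. nrm v < d \<longrightarrow> \<bar>functional (\<lambda>x. u x + v x) - functional u - 0\<bar> \<le> e * nrm v" if e: "0 < e" for e
  proof -
    obtain d where d: "0 < d" "\<And>t \<tau> w. \<bar>t - 1\<bar> < d \<Longrightarrow> 0 < \<tau> \<Longrightarrow> \<tau> < d \<Longrightarrow> w \<in> V \<Longrightarrow> (\<And>i. modular i w \<le> \<tau> powr p i) \<Longrightarrow>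
      \<bar>functional (\<lambda>x. t * u x + w x) - functional (\<lambda>x. t * u x) - differential u w\<bar> \<le> e * \<tau>"
      by (rule functional_strictly_differentiable[OF uV e]) blast
    have "\<bar>functional (\<lambda>x. u x + v x) - functional u - 0\<bar> \<le> e * nrm v" if v: "v \<in> V" "nrm v < d" for v
    proof (rule dense_ge_bounded[of "e * nrm v" "e * d"])
      show "e * nrm v < e * d" using v e by simp
      fix y assume y: "e * nrm v < y" "y < e * d"
      define \<tau> where "\<tau> = y / e"
      have \<tau>: "nrm v < \<tau>" "\<tau> < d" "y = e * \<tau>" using y e by (auto simp: \<tau>_def field_simps)
      have "\<bar>functional (\<lambda>x. 1 * u x + v x) - functional (\<lambda>x. 1 * u x) - differential u v\<bar> \<le> e * \<tau>"
        using d(1) \<tau> nrm_nonneg[of v] v by (intro d(2) modular_le_powr) auto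
      thus "\<bar>functional (\<lambda>x. u x + v x) - functional u - 0\<bar> \<le> y"
        using nehari_minimizer_differential_zero[OF u min v(1)] \<tau> by simp
    qed
    thus ?thesis using d(1) by blast
  qed
  thus ?thesis using uV unfolding critical_point_def has_frechet_derivative_in_def by (auto intro!: exI[of _ 0])
qed

text \<open>In the variable \<open>\<tau>\<close> the fiber is concave and its derivative at 1
  vanishes, so 1 is a maximum. The derivative is used only through difference quotients: the point
  \<open>s0\<close> is compared with points \<open>t\<close> at small distance from 1 on the way
  to it.\<close>

lemma critical_in_nehari:
  assumes crit: "critical_point V nrm functional v" and nt: "\<not> trivial v"
  shows "v \<in> nehari"
proof -
  have vV: "v \<in> V" and D: "\<And>e. 0 < e \<Longrightarrow> \<exists>d>0. \<forall>h\<in>V. nrm h < d \<longrightarrow> \<bar>functional (\<lambda>x. v x + h x) - functional v\<bar> \<le> e * nrm h"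
    using crit unfolding critical_point_def has_frechet_derivative_in_def by auto
  define T where "T = nrm v + 1"
  have T: "0 < T" "nrm v \<le> T" using nrm_nonneg[of v] by (auto simp: T_def)
  have "functional (\<lambda>x. s0 * v x) \<le> functional v" if s0: "0 \<le> s0" for s0
  proof (cases "s0 = 1")
    case False
    define \<tau>0 where "\<tau>0 = s0 powr pN"
    have \<tau>0: "0 \<le> \<tau>0" "s0 = \<tau>0 powr (1 / pN)" using powr_root_inverse[OF s0] by (auto simp: \<tau>0_def)
    have \<tau>1: "\<tau>0 \<noteq> 1" using False \<tau>0 by auto
    define A where "A = \<bar>\<tau>0 - 1\<bar> * T"
    have A: "0 < A" using \<tau>1 T by (simp add: A_def)
    have "functional (\<lambda>x. s0 * v x) - functional v \<le> 0 + e" if e: "0 < e" for e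
    proof -
      obtain d where d: "0 < d" "\<And>h. h \<in> V \<Longrightarrow> nrm h < d \<Longrightarrow> \<bar>functional (\<lambda>x. v x + h x) - functional v\<bar> \<le> e / A * nrm h"
        using D[of "e / A"] e A by auto
      \<comment> \<open>weight of \<open>\<tau>0\<close> in a convex combination with 1, small
        enough for \<open>v\<close> and \<open>t * v\<close> to be within \<open>d\<close> of each
        other\<close>
      define \<theta> where "\<theta> = min (1/2) (d / (2 * A))"
      have \<theta>: "0 < \<theta>" "\<theta> < 1" "\<theta> * A < d"
      proof -
        show "0 < \<theta>" "\<theta> < 1" using d(1) A by (auto simp: \<theta>_def)
        have "\<theta> * A \<le> d / (2 * A) * A" using A by (intro mult_right_mono) (auto simp: \<theta>_def)
        thus "\<theta> * A < d" using A d(1) by simp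
      qed
      define \<tau> where "\<tau> = (1 - \<theta>) * 1 + \<theta> * \<tau>0"
      define t where "t = \<tau> powr (1 / pN)"
      have \<tau>p: "0 < \<tau>" using \<theta> \<tau>0 by (simp add: \<tau>_def add_pos_nonneg)
      have concave: "(1 - \<theta>) * functional v + \<theta> * functional (\<lambda>x. s0 * v x) \<le> functional (\<lambda>x. t * v x)"
      proof (cases "1 < \<tau>0")
        case True
        from functional_fiber_strictly_concave[OF vV nt _ this \<theta>(1,2)] show ?thesis
          unfolding t_def \<tau>_def \<tau>0(2)[symmetric] by simp
      next
        case False
        hence "\<tau>0 < 1" using \<tau>1 by simp
        from functional_fiber_strictly_concave[OF vV nt \<tau>0(1) this, of "1 - \<theta>"] show ?thesis
          using \<theta> unfolding t_def \<tau>_def \<tau>0(2)[symmetric] by (simp add: add.commute)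
      qed
      have t1: "\<bar>t - 1\<bar> \<le> \<bar>\<tau> - 1\<bar>"
      proof (cases "1 \<le> \<tau>")
        case True
        have "\<tau> powr 0 \<le> \<tau> powr (1 / pN)" "\<tau> powr (1 / pN) \<le> \<tau> powr 1"
          using True pN by (intro powr_mono; simp)+
        thus ?thesis using True by (simp add: t_def)
      next
        case False
        have "\<tau> powr 1 \<le> \<tau> powr (1 / pN)" "\<tau> powr (1 / pN) \<le> \<tau> powr 0"
          using False pN \<tau>p by (intro powr_mono'; simp)+
        thus ?thesis using False \<tau>p by (simp add: t_def)
      qed
      have "\<tau> - 1 = \<theta> * (\<tau>0 - 1)" by (simp add: \<tau>_def algebra_simps)
      hence "\<bar>\<tau> - 1\<bar> = \<theta> * \<bar>\<tau>0 - 1\<bar>" using \<theta> by (simp add: abs_mult)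
      hence nh: "nrm (\<lambda>x. (t - 1) * v x) \<le> \<theta> * A"
        unfolding nrm_scale[OF vV] A_def using t1 T \<theta> mult_mono[of "\<bar>t - 1\<bar>" "\<theta> * \<bar>\<tau>0 - 1\<bar>" "nrm v" T] nrm_nonneg[of v] by (simp add: mult.assoc)
      have "\<bar>functional (\<lambda>x. v x + (t - 1) * v x) - functional v\<bar> \<le> e / A * nrm (\<lambda>x. (t - 1) * v x)"
        using nh \<theta> by (intro d(2) V_scale[OF vV]) auto
      also have "\<dots> \<le> e / A * (\<theta> * A)" using nh e A by (intro mult_left_mono) auto
      also have "\<dots> = \<theta> * e" using A by simp
      finally have "functional (\<lambda>x. t * v x) - functional v \<le> \<theta> * e" by (simp add: algebra_simps)
      hence "\<theta> * (functional (\<lambda>x. s0 * v x) - functional v) \<le> \<theta> * e" using concave by (simp add: algebra_simps)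
      thus ?thesis using \<theta> by simp
    qed
    hence "functional (\<lambda>x. s0 * v x) - functional v \<le> 0" by (rule field_le_epsilon)
    thus ?thesis by simp
  qed simp
  thus ?thesis using vV nt by (simp add: nehari_def)
qed

lemma ground_state_exists:
  obtains u where "critical_point V nrm functional u" "\<not> (AE x in M. u x = 0)" "\<And>x. 0 \<le> u x"
    "\<And>v. critical_point V nrm functional v \<Longrightarrow> \<not> (AE x in M. v x = 0) \<Longrightarrow> functional u \<le> functional v"
proof -
  obtain u where u: "u \<in> nehari" "\<And>v. v \<in> nehari \<Longrightarrow> functional u \<le> functional v" "\<And>x. 0 \<le> u x"
    by (rule nehari_minimizer_exists) blast
  show ?thesis
  proof (rule that)
    show "critical_point V nrm functional u" by (rule nehari_minimizer_critical[OF u(1,2)])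
    show "\<not> (AE x in M. u x = 0)" using u(1) by (simp add: nehari_def trivial_def)
    fix v assume v: "critical_point V nrm functional v" "\<not> (AE x in M. v x = 0)"
    show "functional u \<le> functional v"
      by (rule u(2), rule critical_in_nehari[OF v(1)]) (use v(2) in \<open>simp add: trivial_def\<close>)
  qed (rule u(3))
qed

end

section \<open>Smooth functions and bumps on boxes\<close>

lemma partial_derivI:
  assumes "(f has_derivative f') (at x)"
  shows "partial_deriv i f x = f' (axis i 1)"
  using frechet_derivative_at[OF assms] by (simp add: partial_deriv_def)

lemma has_derivative_partial:
  fixes f :: "real^'n::finite \<Rightarrow> real"
  assumes "f differentiable (at x)"
  shows "(f has_derivative frechet_derivative f (at x)) (at x)"
  using assms by (simp add: frechet_derivative_works)

lemma differentiable_on_UNIV_iff: "f differentiable_on UNIV \<longleftrightarrow> (\<forall>x. f differentiable (at x))"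
  by (auto simp: differentiable_on_def)

text \<open>Iterated derivatives never leave such a set, so no formula for higher derivatives is
  needed.\<close>

lemma smooth_if_closed:
  assumes "f \<in> A" and diff: "\<And>g. g \<in> A \<Longrightarrow> g differentiable_on UNIV"
    and closed: "\<And>g i. g \<in> A \<Longrightarrow> partial_deriv i g \<in> A"
  shows "smooth f"
proof -
  have "iterated_partial_deriv is f \<in> A" for "is"
    by (induction "is") (use assms in auto)
  thus ?thesis by (simp add: smooth_def diff)
qed

lemma smooth_differentiable: "smooth f \<Longrightarrow> f differentiable (at x)"
  unfolding smooth_def by (metis differentiable_on_UNIV_iff iterated_partial_deriv.simps(1))

lemma iterated_partial_deriv_snoc:
  "iterated_partial_deriv (is @ [i]) f = iterated_partial_deriv is (partial_deriv i f)"
  by (induction "is") auto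

lemma smooth_partial_deriv: "smooth f \<Longrightarrow> smooth (partial_deriv i f)"
  unfolding smooth_def using iterated_partial_deriv_snoc[of _ i f] by metis

text \<open>Polynomial expressions in the functions of \<open>S\<close>. If the first derivatives
  of the generators are again polynomial in the generators, all such expressions are smooth; this
  covers \<open>sqrt (\<phi>\<^sup>2 + \<epsilon>\<^sup>2)\<close> and \<open>exp (- 1 /
  t)\<close> with their reciprocal factors.\<close>

inductive_set generated_algebra :: "(real^'n::finite \<Rightarrow> real) set \<Rightarrow> (real^'n \<Rightarrow> real) set" for S where
  base: "s \<in> S \<Longrightarrow> s \<in> generated_algebra S"
| const: "(\<lambda>_. c) \<in> generated_algebra S"
| add: "f \<in> generated_algebra S \<Longrightarrow> g \<in> generated_algebra S \<Longrightarrow> (\<lambda>x. f x + g x) \<in> generated_algebra S"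
| mult: "f \<in> generated_algebra S \<Longrightarrow> g \<in> generated_algebra S \<Longrightarrow> (\<lambda>x. f x * g x) \<in> generated_algebra S"

lemma partial_deriv_const: "partial_deriv i (\<lambda>_. c) = (\<lambda>_. 0)"
  by (intro ext partial_derivI[THEN trans]) (rule has_derivative_const, simp)

lemma partial_deriv_add:
  assumes "\<And>x. f differentiable (at x)" "\<And>x. g differentiable (at x)"
  shows "partial_deriv i (\<lambda>x. f x + g x) = (\<lambda>x. partial_deriv i f x + partial_deriv i g x)"
proof
  fix x
  show "partial_deriv i (\<lambda>x. f x + g x) x = partial_deriv i f x + partial_deriv i g x"
    by (rule partial_derivI[THEN trans, OF has_derivative_add[OF has_derivative_partial[OF assms(1)] has_derivative_partial[OF assms(2)]]])
      (simp add: partial_deriv_def)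
qed

lemma partial_deriv_mult:
  assumes "\<And>x. f differentiable (at x)" "\<And>x. g differentiable (at x)"
  shows "partial_deriv i (\<lambda>x. f x * g x) = (\<lambda>x. f x * partial_deriv i g x + partial_deriv i f x * g x)"
proof
  fix x
  show "partial_deriv i (\<lambda>x. f x * g x) x = f x * partial_deriv i g x + partial_deriv i f x * g x"
    by (rule partial_derivI[THEN trans, OF has_derivative_mult[OF has_derivative_partial[OF assms(1)] has_derivative_partial[OF assms(2)]]])
      (simp add: partial_deriv_def)
qed

lemma smooth_generated_algebra:
  assumes S: "\<And>s x. s \<in> S \<Longrightarrow> s differentiable (at x)"
    and closed: "\<And>s i. s \<in> S \<Longrightarrow> partial_deriv i s \<in> generated_algebra S"
    and f: "f \<in> generated_algebra S"
  shows "smooth f"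
proof (rule smooth_if_closed[OF f])
  have diff: "g differentiable (at x)" if "g \<in> generated_algebra S" for g x
    using that by induction (auto intro: S)
  show "g differentiable_on UNIV" if "g \<in> generated_algebra S" for g
    using diff[OF that] by (simp add: differentiable_on_UNIV_iff)
  show "partial_deriv i g \<in> generated_algebra S" if "g \<in> generated_algebra S" for g i
    using that
  proof induction
    case (add f g)
    thus ?case by (subst partial_deriv_add) (auto intro: diff generated_algebra.intros)
  next
    case (mult f g)
    thus ?case by (subst partial_deriv_mult) (auto intro: diff generated_algebra.intros)
  qed (auto simp: partial_deriv_const intro: closed generated_algebra.intros)
qed

lemma smooth_const: "smooth (\<lambda>_. c)"
  by (rule smooth_generated_algebra[of "{}"]) (auto intro: generated_algebra.intros)

lemma
  assumes "smooth f" "smooth g"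
  shows smooth_add: "smooth (\<lambda>x. f x + g x)" and smooth_mult: "smooth (\<lambda>x. f x * g x)"
proof -
  have *: "smooth h" if "h \<in> generated_algebra {f. smooth f}" for h
    by (rule smooth_generated_algebra[OF _ _ that])
      (auto intro: smooth_differentiable smooth_partial_deriv generated_algebra.base)
  have fg: "f \<in> generated_algebra {f. smooth f}" "g \<in> generated_algebra {f. smooth f}"
    using assms by (auto intro: generated_algebra.base)
  show "smooth (\<lambda>x. f x + g x)" by (intro * generated_algebra.add fg)
  show "smooth (\<lambda>x. f x * g x)" by (intro * generated_algebra.mult fg)
qed

lemma smooth_cmult: "smooth f \<Longrightarrow> smooth (\<lambda>x. c * f x)"
  using smooth_mult[OF smooth_const] .

lemma smooth_diff: "smooth f \<Longrightarrow> smooth g \<Longrightarrow> smooth (\<lambda>x. f x - g x)"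
  using smooth_add[of f "\<lambda>x. - 1 * g x"] smooth_cmult[of g "-1"] by simp

lemma smooth_prod:
  assumes "finite I" "\<And>i. i \<in> I \<Longrightarrow> smooth (f i)"
  shows "smooth (\<lambda>x. \<Prod>i\<in>I. f i x)"
  using assms by (induction I rule: finite_induct) (auto intro: smooth_const smooth_mult)

text \<open>The root \<open>r\<close> and its reciprocal \<open>k\<close> generate, together with
  the smooth functions, an algebra closed under differentiation.\<close>

lemma smooth_sqrt_regularization:
  assumes \<phi>: "smooth \<phi>" and \<epsilon>: "0 < \<epsilon>"
  shows "smooth (\<lambda>x. sqrt ((\<phi> x)\<^sup>2 + \<epsilon>\<^sup>2))"
    and "partial_deriv i (\<lambda>x. sqrt ((\<phi> x)\<^sup>2 + \<epsilon>\<^sup>2)) x = \<phi> x / sqrt ((\<phi> x)\<^sup>2 + \<epsilon>\<^sup>2) * partial_deriv i \<phi> x"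
proof -
  define r where "r = (\<lambda>x. sqrt ((\<phi> x)\<^sup>2 + \<epsilon>\<^sup>2))"
  have pos: "0 < (\<phi> x)\<^sup>2 + \<epsilon>\<^sup>2" for x using \<epsilon> by (simp add: add_nonneg_pos)
  have r0: "0 < r x" for x using pos by (simp add: r_def)
  have dr: "(r has_derivative (\<lambda>h. \<phi> x / r x * frechet_derivative \<phi> (at x) h)) (at x)" for x
    unfolding r_def using pos[of x]
    by (auto intro!: derivative_eq_intros has_derivative_partial smooth_differentiable[OF \<phi>] simp: field_simps)
  show pr: "partial_deriv i (\<lambda>x. sqrt ((\<phi> x)\<^sup>2 + \<epsilon>\<^sup>2)) x = \<phi> x / sqrt ((\<phi> x)\<^sup>2 + \<epsilon>\<^sup>2) * partial_deriv i \<phi> x" for i x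
    using partial_derivI[OF dr] by (simp add: r_def partial_deriv_def)
  define k where "k = (\<lambda>x. 1 / r x)"
  have dk: "(k has_derivative (\<lambda>h. - (\<phi> x * (k x * (k x * k x))) * frechet_derivative \<phi> (at x) h)) (at x)" for x
    unfolding k_def using r0[of x]
    by (auto intro!: derivative_eq_intros dr simp: field_simps)
  define S where "S = insert r (insert k {f. smooth f})"
  have kS: "k \<in> generated_algebra S" and sS: "\<And>f. smooth f \<Longrightarrow> f \<in> generated_algebra S"
    by (auto simp: S_def intro: generated_algebra.base)
  show "smooth (\<lambda>x. sqrt ((\<phi> x)\<^sup>2 + \<epsilon>\<^sup>2))" unfolding r_def[symmetric]
  proof (rule smooth_generated_algebra[of S])
    show "s differentiable (at x)" if "s \<in> S" for s x
      using that dr dk by (auto simp: S_def intro: smooth_differentiable differentiableI)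
    show "partial_deriv i s \<in> generated_algebra S" if "s \<in> S" for s i
    proof -
      have 1: "partial_deriv i r = (\<lambda>x. (\<phi> x * k x) * partial_deriv i \<phi> x)"
        using partial_derivI[OF dr] by (intro ext) (simp add: k_def partial_deriv_def)
      have 2: "partial_deriv i k = (\<lambda>x. ((\<lambda>_. -1) x * (\<phi> x * (k x * (k x * k x)))) * partial_deriv i \<phi> x)"
        using partial_derivI[OF dk] by (intro ext) (simp add: partial_deriv_def)
      have "partial_deriv i r \<in> generated_algebra S"
        unfolding 1 by (intro generated_algebra.mult kS sS \<phi> smooth_partial_deriv)
      moreover have "partial_deriv i k \<in> generated_algebra S"
        unfolding 2 by (intro generated_algebra.mult generated_algebra.const kS sS \<phi> smooth_partial_deriv)
      ultimately show ?thesis using that by (auto simp: S_def intro: sS[unfolded S_def] smooth_partial_deriv)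
    qed
  qed (auto simp: S_def intro: generated_algebra.base)
qed

text \<open>The function \<open>exp (- 1 / t)\<close> with a pole factor. The factor makes the
  family closed under differentiation up to linear combinations, as all members vanish to infinite
  order at 0.\<close>

definition flat_exp :: "nat \<Rightarrow> real \<Rightarrow> real" where
  "flat_exp m t = (if 0 < t then exp (- 1 / t) / t ^ m else 0)"

lemma flat_exp_tendsto: "((\<lambda>t. exp (- 1 / t) / t ^ m) \<longlongrightarrow> 0) (at_right (0::real))"
proof -
  have "((\<lambda>x. x ^ m / exp x) \<longlongrightarrow> (0::real)) at_top" by (rule tendsto_power_div_exp_0)
  hence "((\<lambda>t. inverse t ^ m / exp (inverse t)) \<longlongrightarrow> (0::real)) (at_right 0)"
    by (rule filterlim_compose[OF _ filterlim_inverse_at_top_right])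
  thus ?thesis by (simp add: exp_minus field_simps)
qed

lemma flat_exp_has_derivative:
  "(flat_exp m has_real_derivative (flat_exp (m + 2) t - m * flat_exp (m + 1) t)) (at t)"
proof -
  consider "0 < t" | "t < 0" | "t = 0" by linarith
  thus ?thesis
  proof cases
    case 1
    have "((\<lambda>t. exp (- 1 / t) / t ^ m) has_real_derivative (flat_exp (m + 2) t - m * flat_exp (m + 1) t)) (at t)"
      using 1 by (auto intro!: derivative_eq_intros simp: flat_exp_def field_simps power2_eq_square power_Suc[symmetric] simp del: power_Suc)
         (cases m; simp add: field_simps)
    thus ?thesis
      by (rule has_field_derivative_transform_within_open[of _ _ _ "{0<..}"]) (use 1 in \<open>auto simp: flat_exp_def\<close>)
  next
    case 2
    have "((\<lambda>t. 0) has_real_derivative (flat_exp (m + 2) t - m * flat_exp (m + 1) t)) (at t)"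
      using 2 by (simp add: flat_exp_def)
    thus ?thesis
      by (rule has_field_derivative_transform_within_open[of _ _ _ "{..<0}"]) (use 2 in \<open>auto simp: flat_exp_def\<close>)
  next
    case 3
    have "((\<lambda>h. flat_exp m h / h) \<longlongrightarrow> 0) (at_right 0)"
    proof (rule tendsto_cong[THEN iffD1, OF _ flat_exp_tendsto[of "Suc m"]])
      show "\<forall>\<^sub>F h in at_right 0. exp (- 1 / h) / h ^ Suc m = flat_exp m h / h"
        using eventually_at_right_less[of "0::real"] by eventually_elim (simp add: flat_exp_def)
    qed
    moreover have "((\<lambda>h. flat_exp m h / h) \<longlongrightarrow> 0) (at_left 0)"
    proof (rule tendsto_cong[THEN iffD1, OF _ tendsto_const])
      show "\<forall>\<^sub>F h in at_left 0. 0 = flat_exp m h / h"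
        unfolding eventually_at_left_field by (intro exI[of _ "-1"]) (simp add: flat_exp_def)
    qed
    ultimately have "((\<lambda>h. flat_exp m h / h) \<longlongrightarrow> 0) (at 0)" by (simp add: filterlim_split_at)
    thus ?thesis using 3 by (simp add: has_field_derivative_iff flat_exp_def)
  qed
qed

lemma smooth_flat_exp_affine: "smooth (\<lambda>x::real^'n::finite. flat_exp m (c * x $ j + d))"
proof -
  define S where "S = {\<lambda>x::real^'n. flat_exp m (c * x $ j + d) |m. True}"
  have D: "((\<lambda>x::real^'n. flat_exp m (c * x $ j + d)) has_derivative
      (\<lambda>h. (flat_exp (m + 2) (c * x $ j + d) - m * flat_exp (m + 1) (c * x $ j + d)) * (c * h $ j))) (at x)" for m x
  proof -
    have "((\<lambda>x::real^'n. c * x $ j + d) has_derivative (\<lambda>h. c * h $ j)) (at x)"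
      by (auto intro!: derivative_eq_intros bounded_linear.has_derivative[OF bounded_linear_vec_nth] has_derivative_ident)
    from has_derivative_compose[OF this flat_exp_has_derivative[unfolded has_field_derivative_def]]
    show ?thesis by simp
  qed
  show ?thesis
  proof (rule smooth_generated_algebra[of S])
    show "s differentiable (at x)" if "s \<in> S" for s x
      using that D unfolding S_def by (auto intro: differentiableI)
    show "partial_deriv i s \<in> generated_algebra S" if sS: "s \<in> S" for s i
    proof -
      obtain m where s: "s = (\<lambda>x. flat_exp m (c * x $ j + d))" using sS by (auto simp: S_def)
      have B: "(\<lambda>x. flat_exp k (c * x $ j + d)) \<in> generated_algebra S" for k
        by (rule generated_algebra.base) (auto simp: S_def)
      have "partial_deriv i s = (\<lambda>x. (\<lambda>x. flat_exp (m + 2) (c * x $ j + d)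
           + (\<lambda>_. - real m) x * flat_exp (m + 1) (c * x $ j + d)) x * (\<lambda>_. c * axis i 1 $ j) x)"
        unfolding s using partial_derivI[OF D] by (intro ext) simp
      also have "\<dots> \<in> generated_algebra S"
        by (intro generated_algebra.mult generated_algebra.add generated_algebra.const B)
      finally show ?thesis .
    qed
  qed (auto simp: S_def intro: generated_algebra.base)
qed

text \<open>A product of one-dimensional bumps, positive exactly in the open box; with increasing
  \<open>k\<close> it tends to the indicator of the box.\<close>

definition box_bump :: "nat \<Rightarrow> real^'n::finite \<Rightarrow> real^'n \<Rightarrow> real^'n \<Rightarrow> real" where
  "box_bump k a b x = (\<Prod>j\<in>UNIV. flat_exp 0 (real (Suc k) * x $ j + - real (Suc k) * a $ j)
      * flat_exp 0 (- real (Suc k) * x $ j + real (Suc k) * b $ j))"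

lemma box_bump_smooth: "smooth (box_bump k a b)"
  unfolding box_bump_def by (intro smooth_prod smooth_mult smooth_flat_exp_affine) auto

lemma flat_exp_0_bounds: "0 \<le> flat_exp 0 t" "flat_exp 0 t \<le> 1"
  by (auto simp: flat_exp_def)

lemma box_bump_bounds: "0 \<le> box_bump k a b x" "box_bump k a b x \<le> 1"
  unfolding box_bump_def by (auto intro!: prod_nonneg prod_le_1 mult_le_one mult_nonneg_nonneg simp: flat_exp_0_bounds)

lemma box_bump_zero: "x \<notin> box a b \<Longrightarrow> box_bump k a b x = 0"
proof -
  assume "x \<notin> box a b"
  then obtain j where "x $ j \<le> a $ j \<or> b $ j \<le> x $ j" by (auto simp: mem_box_cart not_less)
  hence "real (Suc k) * x $ j + - real (Suc k) * a $ j \<le> 0 \<or> - real (Suc k) * x $ j + real (Suc k) * b $ j \<le> 0"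
    by (auto simp del: of_nat_Suc)
  thus ?thesis unfolding box_bump_def
    by (intro prod_zero bexI[of _ j]) (auto simp: flat_exp_def)
qed

lemma box_bump_pos: "x \<in> box a b \<Longrightarrow> 0 < box_bump k a b x"
proof -
  assume "x \<in> box a b"
  hence "0 < real (Suc k) * (x $ j - a $ j)" "0 < real (Suc k) * (b $ j - x $ j)" for j
    by (auto simp: mem_box_cart)
  thus ?thesis unfolding box_bump_def
    by (intro prod_pos) (auto simp: flat_exp_def algebra_simps)
qed

lemma flat_exp_0_tendsto: "0 < s \<Longrightarrow> (\<lambda>k. flat_exp 0 (real (Suc k) * s)) \<longlonglongrightarrow> 1"
proof -
  assume s: "0 < s"
  have "(\<lambda>k. exp (- ((1 / s) * (1 / real (Suc k))))) \<longlonglongrightarrow> exp (- ((1 / s) * 0))"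
    by (intro tendsto_intros LIMSEQ_Suc[OF lim_inverse_n'])
  moreover have "flat_exp 0 (real (Suc k) * s) = exp (- ((1 / s) * (1 / real (Suc k))))" for k
    using s by (simp add: flat_exp_def mult.commute del: of_nat_Suc)
  ultimately show ?thesis by simp
qed

lemma box_bump_tendsto:
  fixes a b x :: "real^'n::finite"
  shows "(\<lambda>k. box_bump k a b x) \<longlonglongrightarrow> indicator (box a b) x"
proof (cases "x \<in> box a b")
  case True
  have "(\<lambda>k. \<Prod>j\<in>UNIV. flat_exp 0 (real (Suc k) * (x $ j - a $ j)) * flat_exp 0 (real (Suc k) * (b $ j - x $ j)))
     \<longlonglongrightarrow> (\<Prod>j\<in>(UNIV::'n set). 1 * 1)"
    using True by (intro tendsto_prod tendsto_mult flat_exp_0_tendsto) (auto simp: mem_box_cart)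
  thus ?thesis using True by (simp add: box_bump_def algebra_simps)
next
  case False
  thus ?thesis by (simp add: box_bump_zero)
qed

lemma test_functions_iff:
  assumes "bounded \<Omega>"
  shows "\<phi> \<in> test_functions \<Omega> \<longleftrightarrow> smooth \<phi> \<and> closure {x. \<phi> x \<noteq> 0} \<subseteq> \<Omega>"
proof -
  have "compact (closure {x. \<phi> x \<noteq> 0})" if "closure {x. \<phi> x \<noteq> 0} \<subseteq> \<Omega>"
    using bounded_subset[OF assms that] by (simp add: compact_eq_bounded_closed)
  thus ?thesis by (auto simp: test_functions_def)
qed

text \<open>On a bounded set compactness of the support is automatic, so only the inclusion of
  supports has to be checked.\<close>

lemma test_functions_support_subset:
  assumes "bounded \<Omega>" "\<phi> \<in> test_functions \<Omega>" "smooth \<psi>" "\<And>x. \<phi> x = 0 \<Longrightarrow> \<psi> x = 0"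
  shows "\<psi> \<in> test_functions \<Omega>"
proof -
  have "closure {x. \<psi> x \<noteq> 0} \<subseteq> closure {x. \<phi> x \<noteq> 0}" by (intro closure_mono) (use assms(4) in auto)
  thus ?thesis using assms by (auto simp: test_functions_iff)
qed

lemma test_functions_add:
  assumes "bounded \<Omega>" "\<phi> \<in> test_functions \<Omega>" "\<psi> \<in> test_functions \<Omega>"
  shows "(\<lambda>x. a * \<phi> x + b * \<psi> x) \<in> test_functions \<Omega>"
proof -
  have "{x. a * \<phi> x + b * \<psi> x \<noteq> 0} \<subseteq> {x. \<phi> x \<noteq> 0} \<union> {x. \<psi> x \<noteq> 0}" by auto
  hence "closure {x. a * \<phi> x + b * \<psi> x \<noteq> 0} \<subseteq> closure {x. \<phi> x \<noteq> 0} \<union> closure {x. \<psi> x \<noteq> 0}"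
    unfolding closure_Un[symmetric] by (rule closure_mono)
  thus ?thesis using assms by (auto simp: test_functions_iff intro!: smooth_add smooth_cmult)
qed

lemma box_bump_test:
  assumes "bounded \<Omega>" "cbox a b \<subseteq> \<Omega>" shows "box_bump k a b \<in> test_functions \<Omega>"
proof -
  have "{x. box_bump k a b x \<noteq> 0} \<subseteq> cbox a b" using box_bump_zero box_subset_cbox by blast
  hence "closure {x. box_bump k a b x \<noteq> 0} \<subseteq> cbox a b" by (rule closure_minimal[OF _ closed_cbox])
  thus ?thesis using assms by (auto simp: test_functions_iff box_bump_smooth)
qed

section \<open>Integrals of test functions\<close>

lemma lborel_nn_integral_shift:
  fixes f :: "'a::euclidean_space \<Rightarrow> ennreal"
  assumes [measurable]: "f \<in> borel_measurable borel"
  shows "(\<integral>\<^sup>+x. f (x + c) \<partial>lborel) = (\<integral>\<^sup>+x. f x \<partial>lborel)"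
proof -
  have "(\<integral>\<^sup>+x. f x \<partial>lborel) = (\<integral>\<^sup>+x. f x \<partial>distr lborel borel ((+) c))" by (simp add: lborel_distr_plus)
  also have "\<dots> = (\<integral>\<^sup>+x. f (c + x) \<partial>lborel)" by (rule nn_integral_distr) auto
  finally show ?thesis by (simp add: add.commute)
qed

lemma lborel_integral_shift:
  fixes f :: "'a::euclidean_space \<Rightarrow> real"
  assumes [measurable]: "f \<in> borel_measurable borel"
  shows "(LINT x|lborel. f (x + c)) = (LINT x|lborel. f x)"
proof -
  have "(LINT x|lborel. f x) = (LINT x|distr lborel borel ((+) c). f x)" by (simp add: lborel_distr_plus)
  also have "\<dots> = (LINT x|lborel. f (c + x))" by (rule integral_distr) auto
  finally show ?thesis by (simp add: add.commute)
qed

lemma lborel_integrable_shift: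
  fixes f :: "'a::euclidean_space \<Rightarrow> real"
  assumes "integrable lborel f"
  shows "integrable lborel (\<lambda>x. f (x + c))"
proof -
  have [measurable]: "f \<in> borel_measurable borel" using assms by auto
  have "integrable (distr lborel borel ((+) c)) f" using assms by (simp add: lborel_distr_plus)
  hence "integrable lborel (\<lambda>x. f (c + x))" by (subst (asm) integrable_distr_eq) auto
  thus ?thesis by (simp add: add.commute)
qed

lemma lebesgue_on_integral:
  fixes g :: "real^'n::finite \<Rightarrow> real"
  assumes \<Omega>: "\<Omega> \<in> sets lebesgue" and g: "g \<in> borel_measurable borel" and z: "\<And>x. x \<notin> \<Omega> \<Longrightarrow> g x = 0"
  shows "(LINT x|lebesgue_on \<Omega>. g x) = (LINT x|lborel. g x)"
proof -
  have "(LINT x|lebesgue_on \<Omega>. g x) = (LINT x|lebesgue. indicator \<Omega> x *\<^sub>R g x)"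
    using \<Omega> by (intro integral_restrict_space) auto
  also have "\<dots> = (LINT x|lebesgue. g x)"
    by (intro Bochner_Integration.integral_cong refl) (auto simp: indicator_def z)
  also have "\<dots> = (LINT x|lborel. g x)" using g by (intro integral_completion) auto
  finally show ?thesis .
qed

lemma lebesgue_on_measurable:
  "g \<in> borel_measurable borel \<Longrightarrow> g \<in> borel_measurable (lebesgue_on \<Omega>)"
  by (intro measurable_restrict_space1 measurable_completion) simp

lemma lebesgue_on_integrable_subset:
  fixes g :: "real^'n::finite \<Rightarrow> real"
  assumes i: "integrable (lebesgue_on \<Omega>) g" and K: "K \<subseteq> \<Omega>" "K \<in> sets lebesgue" and \<Omega>: "\<Omega> \<in> sets lebesgue"
  shows "integrable (lebesgue_on K) g"
proof -
  have "integrable lebesgue (\<lambda>x. indicator \<Omega> x *\<^sub>R g x)"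
    using integrable_restrict_space[of \<Omega> lebesgue g] i \<Omega> by simp
  hence "integrable lebesgue (\<lambda>x. indicator K x *\<^sub>R (indicator \<Omega> x *\<^sub>R g x))"
    by (rule integrable_mult_indicator[OF K(2)])
  also have "(\<lambda>x. indicator K x *\<^sub>R (indicator \<Omega> x *\<^sub>R g x)) = (\<lambda>x. indicator K x *\<^sub>R g x)"
    using K by (auto simp: indicator_def fun_eq_iff)
  finally show ?thesis using K by (subst integrable_restrict_space) auto
qed

lemma lborel_integrable_imp_lebesgue_on:
  fixes g :: "real^'n::finite \<Rightarrow> real"
  assumes "integrable lborel g" "K \<in> sets lebesgue"
  shows "integrable (lebesgue_on K) g"
proof -
  have "g \<in> borel_measurable lborel" using assms by auto
  hence "integrable lebesgue g" using assms by (simp add: integrable_completion)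
  hence "integrable (lebesgue_on UNIV) g" by (simp add: lebesgue_on_UNIV_eq)
  from lebesgue_on_integrable_subset[OF this _ assms(2)] show ?thesis by simp
qed

lemma smooth_continuous: "smooth f \<Longrightarrow> continuous_on A f"
  by (intro continuous_at_imp_continuous_on ballI differentiable_imp_continuous_within smooth_differentiable)

lemma smooth_measurable: "smooth f \<Longrightarrow> f \<in> borel_measurable borel"
  by (intro borel_measurable_continuous_onI smooth_continuous)

lemma smooth_line_derivative:
  assumes "smooth f"
  shows "((\<lambda>s. f (x + s *\<^sub>R axis i 1)) has_real_derivative partial_deriv i f (x + s *\<^sub>R axis i 1)) (at s)"
proof -
  have "((\<lambda>s. x + s *\<^sub>R axis i 1) has_derivative (\<lambda>h. h *\<^sub>R axis i (1::real))) (at s)"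
    by (auto intro!: derivative_eq_intros)
  from has_derivative_compose[OF this has_derivative_partial[OF smooth_differentiable[OF assms]]]
  have "((\<lambda>s. f (x + s *\<^sub>R axis i 1)) has_derivative
     (\<lambda>h. frechet_derivative f (at (x + s *\<^sub>R axis i 1)) (h *\<^sub>R axis i 1))) (at s)" .
  moreover have "linear (frechet_derivative f (at (x + s *\<^sub>R axis i 1)))"
    by (rule linear_frechet_derivative[OF smooth_differentiable[OF assms]])
  hence "frechet_derivative f (at (x + s *\<^sub>R axis i 1)) (h *\<^sub>R axis i 1) = partial_deriv i f (x + s *\<^sub>R axis i 1) * h" for h
    by (simp add: linear_cmul partial_deriv_def)
  ultimately show ?thesis by (simp add: has_field_derivative_def)
qed

lemma test_smooth: "\<phi> \<in> test_functions \<Omega> \<Longrightarrow> smooth \<phi>"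
  by (simp add: test_functions_def)

lemma zero_off_closure:
  fixes f :: "'a::topological_space \<Rightarrow> real"
  assumes "x \<notin> closure {x. f x \<noteq> 0}" shows "f x = 0"
  using assms subsetD[OF closure_subset[of "{x. f x \<noteq> 0}"], of x] by auto

lemma test_zero: "\<phi> \<in> test_functions \<Omega> \<Longrightarrow> x \<notin> \<Omega> \<Longrightarrow> \<phi> x = 0"
  using zero_off_closure[of x \<phi>] by (auto simp: test_functions_def)

lemma test_partial_deriv:
  assumes "bounded \<Omega>" "\<phi> \<in> test_functions \<Omega>"
  shows "partial_deriv i \<phi> \<in> test_functions \<Omega>"
proof -
  define K where "K = closure {x. \<phi> x \<noteq> 0}"
  have K: "K \<subseteq> \<Omega>" "closed K" using assms by (auto simp: K_def test_functions_def)
  have "partial_deriv i \<phi> x = 0" if x: "x \<notin> K" for x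
  proof -
    have z: "\<phi> y = 0" if "y \<in> - K" for y using zero_off_closure[of _ \<phi>] that unfolding K_def by blast
    have "(\<phi> has_derivative (\<lambda>_. 0)) (at x)"
      by (rule has_derivative_transform_within_open[OF has_derivative_const[of 0] open_Compl[OF K(2)]]) (use x z in auto)
    thus ?thesis using partial_derivI by fastforce
  qed
  hence "{x. partial_deriv i \<phi> x \<noteq> 0} \<subseteq> K" by blast
  hence "closure {x. partial_deriv i \<phi> x \<noteq> 0} \<subseteq> K" using K(2) by (rule closure_minimal)
  thus ?thesis using K assms by (auto simp: test_functions_iff intro: smooth_partial_deriv test_smooth)
qed

lemma test_bounded:
  fixes \<phi> :: "real^'n::finite \<Rightarrow> real"
  assumes "\<phi> \<in> test_functions \<Omega>"
  obtains C where "0 \<le> C" "\<And>x. \<bar>\<phi> x\<bar> \<le> C"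
proof -
  define K where "K = closure {x. \<phi> x \<noteq> 0}"
  have K: "compact K" using assms by (simp add: K_def test_functions_def)
  have "bounded (\<phi> ` K)"
    by (intro compact_imp_bounded compact_continuous_image K smooth_continuous test_smooth[OF assms])
  then obtain B where B: "\<And>y. y \<in> \<phi> ` K \<Longrightarrow> norm y \<le> B" unfolding bounded_iff by blast
  have "\<bar>\<phi> x\<bar> \<le> \<bar>B\<bar>" for x
  proof (cases "x \<in> K")
    case True thus ?thesis using B[of "\<phi> x"] by auto
  next
    case False
    hence "\<phi> x = 0" unfolding K_def by (rule zero_off_closure)
    thus ?thesis by simp
  qed
  thus ?thesis by (intro that[of "\<bar>B\<bar>"]) auto
qed

lemma test_integrable:
  fixes \<phi> :: "real^'n::finite \<Rightarrow> real"
  assumes "\<phi> \<in> test_functions \<Omega>"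
  shows "integrable lborel \<phi>"
proof -
  define K where "K = closure {x. \<phi> x \<noteq> 0}"
  have K: "compact K" using assms by (simp add: K_def test_functions_def)
  have z: "\<phi> x = 0" if "x \<notin> K" for x using zero_off_closure[of _ \<phi>] that unfolding K_def by blast
  have "integrable lborel (\<lambda>x. indicator K x *\<^sub>R \<phi> x)"
    by (rule borel_integrable_compact[OF K smooth_continuous[OF test_smooth[OF assms]]])
  also have "(\<lambda>x. indicator K x *\<^sub>R \<phi> x) = \<phi>" using z by (auto simp: indicator_def fun_eq_iff)
  finally show ?thesis .
qed

lemma test_powr_integrable:
  fixes \<phi> :: "real^'n::finite \<Rightarrow> real"
  assumes t: "\<phi> \<in> test_functions \<Omega>" and p: "0 < p"
  shows "integrable lborel (\<lambda>x. \<bar>\<phi> x\<bar> powr p)"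
proof -
  define K where "K = closure {x. \<phi> x \<noteq> 0}"
  have K: "compact K" using t by (simp add: K_def test_functions_def)
  have z: "\<phi> x = 0" if "x \<notin> K" for x using zero_off_closure[of _ \<phi>] that unfolding K_def by blast
  have "integrable lborel (\<lambda>x. indicator K x *\<^sub>R \<bar>\<phi> x\<bar> powr p)"
    by (rule borel_integrable_compact[OF K continuous_on_abs_powr[OF p smooth_continuous[OF test_smooth[OF t]]]])
  also have "(\<lambda>x. indicator K x *\<^sub>R \<bar>\<phi> x\<bar> powr p) = (\<lambda>x. \<bar>\<phi> x\<bar> powr p)" using z by (auto simp: indicator_def fun_eq_iff)
  finally show ?thesis .
qed

lemma test_mult:
  assumes "bounded \<Omega>" "\<phi> \<in> test_functions \<Omega>" "\<psi> \<in> test_functions \<Omega>"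
  shows "(\<lambda>x. \<phi> x * \<psi> x) \<in> test_functions \<Omega>"
  using assms by (intro test_functions_support_subset[OF assms(1,2)] smooth_mult test_smooth) auto

text \<open>By translation invariance the difference quotients of \<open>w\<close> have integral
  0, and they converge to the derivative dominatedly. In contrast to Fubini's theorem this needs
  no splitting of a coordinate from \<open>real^'n\<close>.\<close>

lemma test_partial_deriv_integral_zero:
  fixes w :: "real^'n::finite \<Rightarrow> real"
  assumes \<Omega>: "bounded \<Omega>" and w: "w \<in> test_functions \<Omega>"
  shows "(LINT x|lborel. partial_deriv i w x) = 0"
proof -
  define e where "e = axis i (1::real)"
  note dw = test_partial_deriv[OF \<Omega> w, of i]
  note [measurable] = smooth_measurable[OF test_smooth[OF w]] smooth_measurable[OF test_smooth[OF dw]]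
  obtain C where C: "0 \<le> C" "\<And>x. \<bar>partial_deriv i w x\<bar> \<le> C" by (rule test_bounded[OF dw]) blast
  obtain R where R: "0 < R" "\<And>x. x \<in> \<Omega> \<Longrightarrow> norm x \<le> R" using \<Omega> by (auto simp: bounded_pos)
  define q where "q = (\<lambda>n x. real (Suc n) * (w (x + (1 / real (Suc n)) *\<^sub>R e) - w x))"
  have "(\<lambda>n. LINT x|lborel. q n x) \<longlonglongrightarrow> (LINT x|lborel. partial_deriv i w x)"
  proof (rule integral_dominated_convergence[where w = "\<lambda>x. C * indicator (cball 0 (R + 1)) x"])
    show "integrable lborel (\<lambda>x::real^'n. C * indicator (cball 0 (R + 1)) x)"
      using emeasure_compact_finite[of "cball (0::real^'n) (R+1)"] by (intro integrable_mult_right integrable_real_indicator) auto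
    show "AE x in lborel. (\<lambda>n. q n x) \<longlonglongrightarrow> partial_deriv i w x"
    proof (rule AE_I2)
      fix x
      have "((\<lambda>h. (w (x + h *\<^sub>R e) - w x) / h) \<longlongrightarrow> partial_deriv i w x) (at 0)"
        using smooth_line_derivative[OF test_smooth[OF w], of x i 0] by (simp add: DERIV_def e_def)
      moreover have "filterlim (\<lambda>n. 1 / real (Suc n)) (at 0) sequentially"
        unfolding filterlim_at using LIMSEQ_Suc[OF lim_inverse_n'] by auto
      ultimately have "(\<lambda>n. (w (x + (1 / real (Suc n)) *\<^sub>R e) - w x) / (1 / real (Suc n))) \<longlonglongrightarrow> partial_deriv i w x"
        by (rule filterlim_compose)
      thus "(\<lambda>n. q n x) \<longlonglongrightarrow> partial_deriv i w x" by (simp add: q_def mult.commute del: of_nat_Suc)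
    qed
    show "AE x in lborel. norm (q n x) \<le> C * indicator (cball 0 (R + 1)) x" for n
    proof (rule AE_I2)
      fix x :: "real^'n"
      define h where "h = 1 / real (Suc n)"
      have h: "0 < h" "h \<le> 1" by (auto simp: h_def)
      have qh: "q n x = (w (x + h *\<^sub>R e) - w x) / h" by (simp add: q_def h_def mult.commute del: of_nat_Suc)
      obtain s where s: "w (x + h *\<^sub>R e) - w (x + 0 *\<^sub>R e) = partial_deriv i w (x + s *\<^sub>R e) * (h - 0)"
        using mean_value_real[of 0 h "\<lambda>s. w (x + s *\<^sub>R e)" "\<lambda>s. partial_deriv i w (x + s *\<^sub>R e)"]
          smooth_line_derivative[OF test_smooth[OF w]] h unfolding e_def
        by (metis DERIV_isCont continuous_at_imp_continuous_on)
      have "\<bar>q n x\<bar> \<le> C" using s h C(2)[of "x + s *\<^sub>R e"] by (simp add: qh)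
      moreover have "q n x = 0" if "x \<notin> cball 0 (R + 1)"
      proof -
        have nx: "R + 1 < norm x" using that by simp
        have "norm x \<le> norm (x + h *\<^sub>R e) + norm (h *\<^sub>R e)" by (metis add_diff_cancel norm_triangle_sub norm_minus_commute norm_triangle_ineq4)
        moreover have "norm (h *\<^sub>R e) \<le> 1" using h by (simp add: e_def)
        ultimately have "R < norm (x + h *\<^sub>R e)" using nx by linarith
        hence "x \<notin> \<Omega>" "x + h *\<^sub>R e \<notin> \<Omega>" using R(2) nx by force+
        thus ?thesis using test_zero[OF w] by (simp add: qh)
      qed
      ultimately show "norm (q n x) \<le> C * indicator (cball 0 (R + 1)) x"
        by (cases "x \<in> cball 0 (R + 1)") auto
    qed
  qed (auto simp: q_def)
  moreover have "(LINT x|lborel. q n x) = 0" for n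
  proof -
    have "(LINT x|lborel. q n x) = real (Suc n) * ((LINT x|lborel. w (x + (1 / real (Suc n)) *\<^sub>R e)) - (LINT x|lborel. w x))"
      unfolding q_def using lborel_integrable_shift[OF test_integrable[OF w]] test_integrable[OF w] by simp
    also have "\<dots> = 0" by (subst lborel_integral_shift) auto
    finally show ?thesis .
  qed
  ultimately show ?thesis using LIMSEQ_unique[OF _ tendsto_const] by force
qed

lemma test_integration_by_parts:
  fixes \<phi> \<psi> :: "real^'n::finite \<Rightarrow> real"
  assumes \<Omega>: "bounded \<Omega>" "\<Omega> \<in> sets lebesgue" and t: "\<phi> \<in> test_functions \<Omega>" "\<psi> \<in> test_functions \<Omega>"
  shows "(LINT x|lebesgue_on \<Omega>. \<phi> x * partial_deriv i \<psi> x) = - (LINT x|lebesgue_on \<Omega>. partial_deriv i \<phi> x * \<psi> x)"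
proof -
  note d = test_partial_deriv[OF \<Omega>(1) t(1), of i] test_partial_deriv[OF \<Omega>(1) t(2), of i]
  note m = test_mult[OF \<Omega>(1) t(1) d(2)] test_mult[OF \<Omega>(1) d(1) t(2)]
  have "(LINT x|lborel. \<phi> x * partial_deriv i \<psi> x) + (LINT x|lborel. partial_deriv i \<phi> x * \<psi> x)
     = (LINT x|lborel. partial_deriv i (\<lambda>x. \<phi> x * \<psi> x) x)"
    using test_integrable[OF m(1)] test_integrable[OF m(2)]
    by (subst partial_deriv_mult) (auto intro: smooth_differentiable test_smooth t)
  also have "\<dots> = 0" by (rule test_partial_deriv_integral_zero[OF \<Omega>(1) test_mult[OF \<Omega>(1) t]])
  finally have "(LINT x|lborel. \<phi> x * partial_deriv i \<psi> x) = - (LINT x|lborel. partial_deriv i \<phi> x * \<psi> x)" by simp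
  moreover have "(LINT x|lebesgue_on \<Omega>. \<phi> x * partial_deriv i \<psi> x) = (LINT x|lborel. \<phi> x * partial_deriv i \<psi> x)"
    by (rule lebesgue_on_integral[OF \<Omega>(2) smooth_measurable[OF test_smooth[OF m(1)]] test_zero[OF m(1)]])
  moreover have "(LINT x|lebesgue_on \<Omega>. partial_deriv i \<phi> x * \<psi> x) = (LINT x|lborel. partial_deriv i \<phi> x * \<psi> x)"
    by (rule lebesgue_on_integral[OF \<Omega>(2) smooth_measurable[OF test_smooth[OF m(2)]] test_zero[OF m(2)]])
  ultimately show ?thesis by simp
qed

section \<open>Uniqueness of weak derivatives\<close>

lemma box_Int_Int_stable: "Int_stable (range (\<lambda>(a, b). box a b :: 'a::euclidean_space set))"
proof (rule Int_stableI)
  fix A B :: "'a set" assume "A \<in> range (\<lambda>(a, b). box a b)" "B \<in> range (\<lambda>(a, b). box a b)"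
  then obtain a b c d where "A = box a b" "B = box c d" by auto
  hence "A \<inter> B = (\<lambda>(a, b). box a b) (\<Sum>i\<in>Basis. max (a \<bullet> i) (c \<bullet> i) *\<^sub>R i, \<Sum>i\<in>Basis. min (b \<bullet> i) (d \<bullet> i) *\<^sub>R i)"
    by (simp add: box_Int_box)
  thus "A \<inter> B \<in> range (\<lambda>(a, b). box a b)" by (rule range_eqI)
qed

text \<open>Boxes form an intersection-stable generator of the Borel sets, so the integral
  vanishes over every Borel set.\<close>

lemma AE_zero_if_box_integrals_zero_borel:
  fixes h :: "'a::euclidean_space \<Rightarrow> real"
  assumes i: "integrable lborel h" and z: "\<And>a b. (LINT x:box a b|lborel. h x) = 0" and tot: "(LINT x|lborel. h x) = 0"
  shows "AE x in lborel. h x = 0"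
proof -
  have si: "set_integrable lborel A h" if "A \<in> sets borel" for A
    unfolding set_integrable_def using that by (intro integrable_mult_indicator i) auto
  have sb: "sets (borel :: 'a measure) = sigma_sets UNIV (range (\<lambda>(a, b). box a b))"
    by (subst borel_eq_box) (simp add: sets_measure_of)
  have subset_Pow_UNIV: "range (\<lambda>(a, b). box a b :: 'a set) \<subseteq> Pow UNIV" by simp
  have "(LINT x:A|lborel. h x) = 0" if "A \<in> sets lborel" for A
  proof -
    have "A \<in> sigma_sets UNIV (range (\<lambda>(a, b). box a b :: 'a set))" using that sb by simp
    with box_Int_Int_stable subset_Pow_UNIV show ?thesis
    proof (induction rule: sigma_sets_induct_disjoint)
      case (basic A)
      thus ?case using z by auto
    next
      case empty
      show ?case by (simp add: set_lebesgue_integral_def)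
    next
      case (compl A)
      have A: "A \<in> sets borel" using compl(1) sb by simp
      have "(LINT x:A \<union> (UNIV - A)|lborel. h x) = (LINT x:A|lborel. h x) + (LINT x:UNIV - A|lborel. h x)"
        using A by (intro set_integral_Un si) auto
      thus ?case using compl(2) tot by (simp add: set_lebesgue_integral_def)
    next
      case (union A)
      have A: "A i \<in> sets borel" for i using union(2) sb by auto
      have "(LINT x:(\<Union>i. A i)|lborel. h x) = (\<Sum>i. (LINT x:(A i)|lborel. h x))"
        by (rule lebesgue_integral_countable_add) (use A union(1) in \<open>auto simp: disjoint_family_on_def intro!: si\<close>)
      thus ?case using union(3) by simp
    qed
  qed
  thus ?thesis using density_unique_real[OF i integrable_zero] by (simp add: set_lebesgue_integral_def)
qed

text \<open>Reduction of Lebesgue measurable functions that are integrable only on one box to the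
  Borel case, by extending with 0 and choosing a Borel representative.\<close>

lemma AE_zero_if_subbox_integrals_zero:
  fixes h :: "real^'n::finite \<Rightarrow> real"
  assumes i: "integrable lebesgue (\<lambda>x. indicator (box a b) x * h x)"
    and z: "\<And>c d. cbox c d \<subseteq> cbox a b \<Longrightarrow> (LINT x|lebesgue. indicator (box c d) x * h x) = 0"
  shows "AE x in lborel. x \<in> box a b \<longrightarrow> h x = 0"
proof -
  define k where "k = (\<lambda>x. indicator (box a b) x * h x)"
  have ik: "integrable lebesgue k" using i by (simp add: k_def)
  obtain k' where k'[measurable]: "k' \<in> borel_measurable lborel" and kk: "AE x in lborel. k x = k' x"
    using completion_ex_borel_measurable_real[of k lborel] ik by auto
  have kkl: "AE x in lebesgue. k x = k' x" using kk by (simp add: AE_completion)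
  have k'l[measurable]: "k' \<in> borel_measurable lebesgue" using k' by (rule measurable_completion)
  have km[measurable]: "k \<in> borel_measurable lebesgue" using ik by auto
  have "integrable lebesgue k'" using integrable_cong_AE[OF km k'l kkl] ik by simp
  hence ik': "integrable lborel k'" using integrable_completion[OF k'] by simp
  have eq: "(LINT x|lborel. indicator A x * k' x) = (LINT x|lebesgue. indicator A x * k x)"
    if [measurable]: "A \<in> sets borel" for A
  proof -
    have [measurable]: "A \<in> sets lebesgue" using that by simp
    have "(LINT x|lborel. indicator A x * k' x) = (LINT x|lebesgue. indicator A x * k' x)"
      by (rule integral_completion[symmetric]) simp
    also have "\<dots> = (LINT x|lebesgue. indicator A x * k x)"
      using kkl by (intro integral_cong_AE) (auto elim!: eventually_mono)
    finally show ?thesis .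
  qed
  have "(LINT x:box c d|lborel. k' x) = 0" for c d
  proof -
    define c' d' where "c' = (\<chi> j. max (c $ j) (a $ j))" and "d' = (\<chi> j. min (d $ j) (b $ j))"
    have bx: "box c d \<inter> box a b = box c' d'" by (auto simp: mem_box_cart c'_def d'_def)
    have cb: "cbox c' d' \<subseteq> cbox a b" by (auto simp: mem_box_cart c'_def d'_def)
    have "(LINT x:box c d|lborel. k' x) = (LINT x|lebesgue. indicator (box c d) x * k x)"
      using eq[of "box c d"] by (simp add: set_lebesgue_integral_def)
    also have "(\<lambda>x. indicator (box c d) x * k x) = (\<lambda>x. indicator (box c' d') x * h x)"
      unfolding k_def bx[symmetric] by (auto simp: indicator_def)
    finally show ?thesis using z[OF cb] by simp
  qed
  moreover have "(LINT x|lborel. k' x) = 0"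
    using eq[of UNIV] z[of a b] by (simp add: k_def)
  ultimately have "AE x in lborel. k' x = 0" by (intro AE_zero_if_box_integrals_zero_borel ik')
  with kk have "AE x in lborel. k x = 0" by eventually_elim simp
  thus ?thesis by eventually_elim (auto simp: k_def)
qed

text \<open>An open set is a countable union of boxes with rational corners, and the boundaries of
  these are negligible.\<close>

lemma AE_on_open_if_AE_on_boxes:
  fixes \<Omega> :: "(real^'n::finite) set"
  assumes \<Omega>: "open \<Omega>" and ae: "\<And>a b. cbox a b \<subseteq> \<Omega> \<Longrightarrow> AE x in lborel. x \<in> box a b \<longrightarrow> P x"
  shows "AE x in lebesgue_on \<Omega>. P x"
proof -
  define a' where "a' = (\<lambda>f::real^'n \<Rightarrow> real \<times> real. \<Sum>i\<in>Basis. fst (f i) *\<^sub>R i)"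
  define b' where "b' = (\<lambda>f::real^'n \<Rightarrow> real \<times> real. \<Sum>i\<in>Basis. snd (f i) *\<^sub>R i)"
  define I where "I = {f\<in>Basis \<rightarrow>\<^sub>E \<rat> \<times> \<rat>. cbox (a' f) (b' f) \<subseteq> \<Omega>}"
  have U: "\<Omega> = (\<Union>f\<in>I. cbox (a' f) (b' f))" unfolding I_def a'_def b'_def by (rule open_UNION_cbox[OF \<Omega>])
  have cI: "countable I" unfolding I_def
    by (rule countable_subset[of _ "Basis \<rightarrow>\<^sub>E \<rat> \<times> \<rat>"]) (auto intro!: countable_PiE countable_SIGMA countable_rat)
  have "AE x in lebesgue. x \<in> cbox a b \<longrightarrow> P x" if ab: "cbox a b \<subseteq> \<Omega>" for a b
  proof -
    have "AE x in lebesgue. x \<in> box a b \<longrightarrow> P x" using ae[OF ab] by (simp add: AE_completion)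
    moreover have "AE x in lebesgue. x \<notin> cbox a b - box a b"
      using negligible_frontier_interval[of a b] by (intro AE_not_in) (simp add: negligible_iff_null_sets)
    ultimately show ?thesis by eventually_elim auto
  qed
  hence "AE x in lebesgue. \<forall>f\<in>I. x \<in> cbox (a' f) (b' f) \<longrightarrow> P x"
    unfolding AE_ball_countable[OF cI] by (auto simp: I_def)
  hence "AE x in lebesgue. x \<in> \<Omega> \<longrightarrow> P x"
    by eventually_elim (use U in blast)
  thus ?thesis using \<Omega> by (subst AE_restrict_space_iff) auto
qed

text \<open>Two weak derivatives have the same integrals against \<open>box_bump k c d\<close>,
  hence in the limit \<open>k \<longlongrightarrow> \<infinity>\<close> over the box itself.\<close>

lemma weak_partial_deriv_unique:
  fixes \<Omega> :: "(real^'n::finite) set"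
  assumes \<Omega>: "open \<Omega>" "bounded \<Omega>"
    and g: "is_weak_partial_deriv \<Omega> i u g" and g': "is_weak_partial_deriv \<Omega> i u g'"
  shows "AE x in lebesgue_on \<Omega>. g x = g' x"
proof (rule AE_on_open_if_AE_on_boxes[OF \<Omega>(1)])
  fix a b :: "real^'n" assume ab: "cbox a b \<subseteq> \<Omega>"
  have ml: "\<Omega> \<in> sets lebesgue" using \<Omega>(1) by auto
  have int: "integrable lebesgue (\<lambda>x. indicator (cbox a b) x * k x)" if "locally_integrable \<Omega> k" for k
  proof -
    have "integrable (lebesgue_on (cbox a b)) k" using that ab by (auto simp: locally_integrable_def)
    thus ?thesis by (subst (asm) integrable_restrict_space) auto
  qed
  have lim: "(\<lambda>k. LINT x|lebesgue_on \<Omega>. h x * box_bump k c d x) \<longlonglongrightarrow> (LINT x|lebesgue. indicator (box c d) x * h x)"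
    if li: "locally_integrable \<Omega> h" and cd: "cbox c d \<subseteq> cbox a b" for h c d
  proof -
    define H where "H = (\<lambda>x. indicator (cbox a b) x * h x)"
    have iH: "integrable lebesgue H" unfolding H_def by (rule int[OF li])
    have [measurable]: "H \<in> borel_measurable lebesgue" using iH by auto
    have bm[measurable]: "box_bump k c d \<in> borel_measurable lebesgue" for k
      by (intro measurable_completion) (simp add: smooth_measurable box_bump_smooth)
    have bx: "box c d \<subseteq> cbox a b" using cd box_subset_cbox by blast
    have [measurable]: "box c d \<in> sets lebesgue" by simp
    have "(\<lambda>k. LINT x|lebesgue. H x * box_bump k c d x) \<longlonglongrightarrow> (LINT x|lebesgue. H x * indicator (box c d) x)"
    proof (rule integral_dominated_convergence[where w = "\<lambda>x. \<bar>H x\<bar>"])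
      show "AE x in lebesgue. (\<lambda>k. H x * box_bump k c d x) \<longlonglongrightarrow> H x * indicator (box c d) x"
        by (intro AE_I2 tendsto_intros box_bump_tendsto)
      show "AE x in lebesgue. norm (H x * box_bump k c d x) \<le> \<bar>H x\<bar>" for k
        using box_bump_bounds[of k c d] by (auto simp: abs_mult mult_left_le)
    qed (use iH in auto)
    moreover have "(LINT x|lebesgue. H x * box_bump k c d x) = (LINT x|lebesgue_on \<Omega>. h x * box_bump k c d x)" for k
    proof -
      have "(LINT x|lebesgue_on \<Omega>. h x * box_bump k c d x) = (LINT x|lebesgue. indicator \<Omega> x *\<^sub>R (h x * box_bump k c d x))"
        using ml by (intro integral_restrict_space) auto
      also have "(\<lambda>x. indicator \<Omega> x *\<^sub>R (h x * box_bump k c d x)) = (\<lambda>x. H x * box_bump k c d x)"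
      proof
        fix x show "indicator \<Omega> x *\<^sub>R (h x * box_bump k c d x) = H x * box_bump k c d x"
          using box_bump_zero[of x c d k] ab bx by (cases "x \<in> box c d") (auto simp: H_def indicator_def)
      qed
      finally show ?thesis by simp
    qed
    moreover have "(\<lambda>x. H x * indicator (box c d) x) = (\<lambda>x. indicator (box c d) x * h x)"
      using bx by (auto simp: H_def indicator_def fun_eq_iff)
    ultimately show ?thesis by simp
  qed
  have lg: "locally_integrable \<Omega> g" "locally_integrable \<Omega> g'" using g g' by (auto simp: is_weak_partial_deriv_def)
  have ibx: "integrable lebesgue (\<lambda>x. indicator (box c d) x * k x)" if "locally_integrable \<Omega> k" "cbox c d \<subseteq> cbox a b" for k c d
  proof -
    have "integrable lebesgue (\<lambda>x. indicator (box c d) x *\<^sub>R (indicator (cbox a b) x * k x))"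
      by (intro integrable_mult_indicator int that) auto
    also have "(\<lambda>x. indicator (box c d) x *\<^sub>R (indicator (cbox a b) x * k x)) = (\<lambda>x. indicator (box c d) x * k x)"
      using that(2) box_subset_cbox[of c d] by (auto simp: indicator_def fun_eq_iff)
    finally show ?thesis .
  qed
  have "AE x in lborel. x \<in> box a b \<longrightarrow> g x - g' x = 0"
  proof (rule AE_zero_if_subbox_integrals_zero)
    show "integrable lebesgue (\<lambda>x. indicator (box a b) x * (g x - g' x))"
      using ibx[OF lg(1), of a b] ibx[OF lg(2), of a b] by (simp add: right_diff_distrib)
    fix c d :: "real^'n" assume cd: "cbox c d \<subseteq> cbox a b"
    have t: "box_bump k c d \<in> test_functions \<Omega>" for k using cd ab by (intro box_bump_test \<Omega>) auto
    have W: "(LINT x|lebesgue_on \<Omega>. u x * partial_deriv i (box_bump k c d) x) = - (LINT x|lebesgue_on \<Omega>. G x * box_bump k c d x)"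
      if "is_weak_partial_deriv \<Omega> i u G" for k G
    proof -
      have "\<forall>\<phi>\<in>test_functions \<Omega>. (LINT x|lebesgue_on \<Omega>. u x * partial_deriv i \<phi> x) = - (LINT x|lebesgue_on \<Omega>. G x * \<phi> x)"
        using that unfolding is_weak_partial_deriv_def by (elim conjE)
      from bspec[OF this t[of k]] show ?thesis .
    qed
    have "(LINT x|lebesgue_on \<Omega>. g x * box_bump k c d x) = (LINT x|lebesgue_on \<Omega>. g' x * box_bump k c d x)" for k
      using W[OF g, of k] W[OF g', of k] by simp
    hence "(LINT x|lebesgue. indicator (box c d) x * g x) = (LINT x|lebesgue. indicator (box c d) x * g' x)"
      using LIMSEQ_unique lim[OF lg(1) cd] lim[OF lg(2) cd] by simp
    thus "(LINT x|lebesgue. indicator (box c d) x * (g x - g' x)) = 0"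
      using ibx[OF lg(1) cd] ibx[OF lg(2) cd] by (simp add: right_diff_distrib)
  qed
  thus "AE x in lborel. x \<in> box a b \<longrightarrow> g x = g' x" by eventually_elim simp
qed

lemma weak_partial_deriv_AE_eq:
  fixes \<Omega> :: "(real^'n::finite) set"
  assumes "open \<Omega>" "bounded \<Omega>" "is_weak_partial_deriv \<Omega> i u g"
  shows "AE x in lebesgue_on \<Omega>. weak_partial_deriv \<Omega> i u x = g x"
proof (rule weak_partial_deriv_unique[OF assms(1,2) _ assms(3)])
  show "is_weak_partial_deriv \<Omega> i u (weak_partial_deriv \<Omega> i u)"
    unfolding weak_partial_deriv_def by (rule someI[of "is_weak_partial_deriv \<Omega> i u" g, OF assms(3)])
qed

section \<open>The anisotropic space as a closure of the test functions\<close>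

lemma (in finite_measure) integrable_if_powr_integrable:
  fixes u :: "'a \<Rightarrow> real"
  assumes p: "1 \<le> p" and m[measurable]: "u \<in> borel_measurable M" and i: "integrable M (\<lambda>x. \<bar>u x\<bar> powr p)"
  shows "integrable M u"
proof (rule Bochner_Integration.integrable_bound)
  show "integrable M (\<lambda>x. 1 + \<bar>u x\<bar> powr p)" using i by auto
  have "\<bar>u x\<bar> \<le> 1 + \<bar>u x\<bar> powr p" for x
  proof (cases "\<bar>u x\<bar> \<le> 1")
    case False
    hence "\<bar>u x\<bar> powr 1 \<le> \<bar>u x\<bar> powr p" using p by (intro powr_mono) auto
    thus ?thesis by simp
  qed (simp add: add_increasing2)
  thus "AE x in M. norm (u x) \<le> norm (1 + \<bar>u x\<bar> powr p)" by simp
qed (rule m)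

text \<open>Split at height \<open>e\<close>: below it the integrand contributes at most
  \<open>e\<close> times the total measure, above it the power dominates.\<close>

lemma (in finite_measure) L1_tendsto_zero_if_powr:
  fixes u :: "nat \<Rightarrow> 'a \<Rightarrow> real"
  assumes p: "1 \<le> p" and m[measurable]: "\<And>n. u n \<in> borel_measurable M"
    and i: "\<And>n. integrable M (\<lambda>x. \<bar>u n x\<bar> powr p)" and lim: "(\<lambda>n. LINT x|M. \<bar>u n x\<bar> powr p) \<longlonglongrightarrow> 0"
  shows "(\<lambda>n. LINT x|M. \<bar>u n x\<bar>) \<longlonglongrightarrow> 0"
proof (rule LIMSEQ_I)
  fix r :: real assume r: "0 < r"
  define m where "m = measure M (space M)"
  define e where "e = r / (2 * (m + 1))"
  have m0: "0 \<le> m" by (simp add: m_def)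
  have e: "0 < e" "e * m < r / 2" using r m0 by (auto simp: e_def field_simps)
  have iu: "integrable M (u n)" for n by (rule integrable_if_powr_integrable[OF p m i])
  have le: "(LINT x|M. \<bar>u n x\<bar>) \<le> e * m + e powr (1 - p) * (LINT x|M. \<bar>u n x\<bar> powr p)" for n
  proof -
    have pt: "\<bar>y\<bar> \<le> e + e powr (1 - p) * \<bar>y\<bar> powr p" for y :: real
    proof (cases "\<bar>y\<bar> \<le> e")
      case True thus ?thesis by (simp add: add_increasing2)
    next
      case False
      have "\<bar>y\<bar> = \<bar>y\<bar> powr (1 - p) * \<bar>y\<bar> powr p" using False e by (simp add: powr_add[symmetric])
      also have "\<dots> \<le> e powr (1 - p) * \<bar>y\<bar> powr p"
        using False e p by (intro mult_right_mono powr_mono2') auto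
      finally show ?thesis using e by simp
    qed
    have "(LINT x|M. \<bar>u n x\<bar>) \<le> (LINT x|M. e + e powr (1 - p) * \<bar>u n x\<bar> powr p)"
      by (intro integral_mono pt) (use iu i in auto)
    also have "\<dots> = e * m + e powr (1 - p) * (LINT x|M. \<bar>u n x\<bar> powr p)" using i by (simp add: m_def)
    finally show ?thesis .
  qed
  have "(\<lambda>n. e powr (1 - p) * (LINT x|M. \<bar>u n x\<bar> powr p)) \<longlonglongrightarrow> 0"
    using tendsto_mult_right_zero[OF lim] by simp
  hence "\<forall>\<^sub>F n in sequentially. e powr (1 - p) * (LINT x|M. \<bar>u n x\<bar> powr p) < r / 2"
    by (rule order_tendstoD) (use r in simp)
  then obtain N where N: "\<And>n. N \<le> n \<Longrightarrow> e powr (1 - p) * (LINT x|M. \<bar>u n x\<bar> powr p) < r / 2"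
    by (auto simp: eventually_sequentially)
  have "norm ((LINT x|M. \<bar>u n x\<bar>) - 0) < r" if "N \<le> n" for n
    using le[of n] N[OF that] e(2) by simp
  thus "\<exists>no. \<forall>n\<ge>no. norm ((LINT x|M. \<bar>u n x\<bar>) - 0) < r" by blast
qed

locale anisotropic_domain =
  fixes \<Omega> :: "(real^'n::finite) set" and p :: "'n \<Rightarrow> real"
  assumes open_domain: "open \<Omega>" and bounded_domain: "bounded \<Omega>" and p_gt_one: "\<And>i. 1 < p i"
begin

abbreviation M :: "(real^'n) measure" where "M \<equiv> lebesgue_on \<Omega>"

abbreviation tests :: "(real^'n \<Rightarrow> real) set" where "tests \<equiv> test_functions \<Omega>"

lemma domain_measurable: "\<Omega> \<in> sets lebesgue" using open_domain by auto

lemma domain_lmeasurable: "\<Omega> \<in> lmeasurable"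
  using bounded_domain domain_measurable by (rule bounded_set_imp_lmeasurable)

lemma finite_measure_domain: "finite_measure M"
  by (rule finite_measure_lebesgue_on[OF domain_lmeasurable])

sublocale finite_measure M by (rule finite_measure_domain)

lemma p_pos: "0 < p i" "0 \<le> p i" "1 \<le> p i" using p_gt_one[of i] by auto

lemma tests_measurable: "\<phi> \<in> tests \<Longrightarrow> \<phi> \<in> borel_measurable M"
  by (intro lebesgue_on_measurable smooth_measurable test_smooth)

lemma tests_integrable: "\<phi> \<in> tests \<Longrightarrow> integrable M \<phi>"
  by (intro lborel_integrable_imp_lebesgue_on test_integrable domain_measurable)

lemma tests_powr_integrable: "\<phi> \<in> tests \<Longrightarrow> 0 < r \<Longrightarrow> integrable M (\<lambda>x. \<bar>\<phi> x\<bar> powr r)"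
  by (intro lborel_integrable_imp_lebesgue_on test_powr_integrable domain_measurable)

lemma tests_partial_deriv: "\<phi> \<in> tests \<Longrightarrow> partial_deriv i \<phi> \<in> tests"
  by (rule test_partial_deriv[OF bounded_domain])

lemmas tests_add = test_functions_add[OF bounded_domain]

lemma tests_diff: "\<phi> \<in> tests \<Longrightarrow> \<psi> \<in> tests \<Longrightarrow> (\<lambda>x. \<phi> x - \<psi> x) \<in> tests"
  using tests_add[of \<phi> \<psi> 1 "-1"] by simp

lemma tests_partial_deriv_add:
  assumes "\<phi> \<in> tests" "\<psi> \<in> tests"
  shows "partial_deriv i (\<lambda>x. a * \<phi> x + b * \<psi> x) = (\<lambda>x. a * partial_deriv i \<phi> x + b * partial_deriv i \<psi> x)"
proof -
  have d: "(\<lambda>x. c * \<eta> x) differentiable (at x)" "\<eta> differentiable (at x)" if "\<eta> \<in> tests" for c \<eta> x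
    using that by (auto intro!: smooth_differentiable smooth_cmult test_smooth)
  have s: "partial_deriv i (\<lambda>x. c * \<eta> x) = (\<lambda>x. c * partial_deriv i \<eta> x)" if "\<eta> \<in> tests" for c \<eta>
    using partial_deriv_mult[of "\<lambda>_. c" \<eta> i] d[OF that] by (simp add: partial_deriv_const)
  show ?thesis using d assms by (subst partial_deriv_add) (auto simp: s)
qed

lemma tests_partial_deriv_diff:
  "\<phi> \<in> tests \<Longrightarrow> \<psi> \<in> tests \<Longrightarrow>
     partial_deriv i (\<lambda>x. \<phi> x - \<psi> x) = (\<lambda>x. partial_deriv i \<phi> x - partial_deriv i \<psi> x)"
  using tests_partial_deriv_add[of \<phi> \<psi> i 1 "-1"] by simp

text \<open>Membership of the space with explicit \<open>L\<^sup>p\<close> limits \<open>g\<close>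
  of the derivatives of an approximating sequence of test functions. These limits are the weak
  derivatives, but unlike those they can be computed with.\<close>

definition has_gradient :: "(real^'n \<Rightarrow> real) \<Rightarrow> ('n \<Rightarrow> real^'n \<Rightarrow> real) \<Rightarrow> bool" where
  "has_gradient u g \<longleftrightarrow> integrable M u \<and>
     (\<forall>i. g i \<in> borel_measurable M \<and> integrable M (\<lambda>x. \<bar>g i x\<bar> powr p i)) \<and>
     (\<exists>\<phi>. (\<forall>n. \<phi> n \<in> tests) \<and>
        (\<forall>i. (\<lambda>n. LINT x|M. \<bar>partial_deriv i (\<phi> n) x - g i x\<bar> powr p i) \<longlonglongrightarrow> 0) \<and>
        (\<lambda>n. LINT x|M. \<bar>\<phi> n x - u x\<bar>) \<longlonglongrightarrow> 0)"

lemma has_gradientE: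
  assumes "has_gradient u g"
  obtains \<phi> where "\<And>n. \<phi> n \<in> tests"
    "\<And>i. (\<lambda>n. LINT x|M. \<bar>partial_deriv i (\<phi> n) x - g i x\<bar> powr p i) \<longlonglongrightarrow> 0"
    "(\<lambda>n. LINT x|M. \<bar>\<phi> n x - u x\<bar>) \<longlonglongrightarrow> 0"
  using assms unfolding has_gradient_def by blast

lemma has_gradientD:
  assumes "has_gradient u g"
  shows "integrable M u" "g i \<in> borel_measurable M" "integrable M (\<lambda>x. \<bar>g i x\<bar> powr p i)" "integrable M (g i)"
proof -
  show *: "integrable M u" "g i \<in> borel_measurable M" "integrable M (\<lambda>x. \<bar>g i x\<bar> powr p i)"
    using assms by (auto simp: has_gradient_def)
  show "integrable M (g i)" by (rule integrable_if_powr_integrable[OF p_pos(3) *(2,3)])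
qed

lemma tests_has_gradient:
  assumes "\<phi> \<in> tests" shows "has_gradient \<phi> (\<lambda>i. partial_deriv i \<phi>)"
  unfolding has_gradient_def
proof (intro conjI allI exI[of _ "\<lambda>_. \<phi>"])
  note d = tests_partial_deriv[OF assms]
  show "integrable M \<phi>" by (rule tests_integrable[OF assms])
  show "partial_deriv i \<phi> \<in> borel_measurable M" "integrable M (\<lambda>x. \<bar>partial_deriv i \<phi> x\<bar> powr p i)" for i
    by (rule tests_measurable[OF d], rule tests_powr_integrable[OF d p_pos(1)])
qed (use assms in auto)

lemma integral_bounded_mult_tendsto:
  fixes h :: "nat \<Rightarrow> real^'n \<Rightarrow> real"
  assumes i: "\<And>n. integrable M (h n)" "integrable M k" and lim: "(\<lambda>n. LINT x|M. \<bar>h n x - k x\<bar>) \<longlonglongrightarrow> 0"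
    and \<psi>: "\<psi> \<in> tests"
  shows "(\<lambda>n. LINT x|M. h n x * \<psi> x) \<longlonglongrightarrow> (LINT x|M. k x * \<psi> x)"
proof -
  obtain C where C: "0 \<le> C" "\<And>x. \<bar>\<psi> x\<bar> \<le> C" by (rule test_bounded[OF \<psi>]) blast
  note [measurable] = tests_measurable[OF \<psi>]
  have iprod: "integrable M (\<lambda>x. l x * \<psi> x)" if l: "integrable M l" for l
  proof (rule Bochner_Integration.integrable_bound)
    show "integrable M (\<lambda>x. C * \<bar>l x\<bar>)" using l by auto
    show "AE x in M. norm (l x * \<psi> x) \<le> norm (C * \<bar>l x\<bar>)"
      using C by (auto simp: abs_mult mult.commute[of C] intro!: mult_left_mono)
  qed (use l in measurable)
  have le: "\<bar>(LINT x|M. h n x * \<psi> x) - (LINT x|M. k x * \<psi> x)\<bar> \<le> C * (LINT x|M. \<bar>h n x - k x\<bar>)" for n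
  proof -
    have "\<bar>(LINT x|M. h n x * \<psi> x) - (LINT x|M. k x * \<psi> x)\<bar> = \<bar>LINT x|M. h n x * \<psi> x - k x * \<psi> x\<bar>"
      using iprod[OF i(1)] iprod[OF i(2)] by simp
    also have "\<dots> \<le> (LINT x|M. \<bar>h n x * \<psi> x - k x * \<psi> x\<bar>)" by (rule integral_abs_bound)
    also have "\<dots> \<le> (LINT x|M. C * \<bar>h n x - k x\<bar>)"
    proof (rule integral_mono)
      show "\<bar>h n x * \<psi> x - k x * \<psi> x\<bar> \<le> C * \<bar>h n x - k x\<bar>" for x
        using C(2)[of x] mult_right_mono[of "\<bar>\<psi> x\<bar>" C "\<bar>h n x - k x\<bar>"]
        by (simp add: abs_mult[symmetric] algebra_simps)
    qed (use iprod[OF i(1)] iprod[OF i(2)] i in auto)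
    finally show ?thesis by simp
  qed
  have "(\<lambda>n. (LINT x|M. h n x * \<psi> x) - (LINT x|M. k x * \<psi> x)) \<longlonglongrightarrow> 0"
    by (rule Lim_null_comparison[OF always_eventually tendsto_mult_right_zero[OF lim, of C]]) (simp add: le)
  thus ?thesis by (simp add: LIM_zero_iff)
qed

text \<open>Integration by parts for test functions passes to the limit, as all convergences hold
  in \<open>L\<^sup>1\<close> and are tested against bounded functions.\<close>

lemma has_gradient_weak_partial_deriv:
  assumes u: "has_gradient u g" shows "is_weak_partial_deriv \<Omega> i u (g i)"
proof -
  note D = has_gradientD[OF u]
  obtain \<phi> where \<phi>: "\<And>n. \<phi> n \<in> tests"
    "\<And>i. (\<lambda>n. LINT x|M. \<bar>partial_deriv i (\<phi> n) x - g i x\<bar> powr p i) \<longlonglongrightarrow> 0"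
    "(\<lambda>n. LINT x|M. \<bar>\<phi> n x - u x\<bar>) \<longlonglongrightarrow> 0" by (rule has_gradientE[OF u]) blast
  note d\<phi> = tests_partial_deriv[OF \<phi>(1)]
  have li: "locally_integrable \<Omega> h" if "integrable M h" for h
    unfolding locally_integrable_def
    using that by (auto intro!: lebesgue_on_integrable_subset[OF _ _ _ domain_measurable] dest: compact_imp_closed)
  have L1: "(\<lambda>n. LINT x|M. \<bar>partial_deriv i (\<phi> n) x - g i x\<bar>) \<longlonglongrightarrow> 0"
    using D(2)[of i] tests_measurable[OF d\<phi>]
    by (intro L1_tendsto_zero_if_powr[OF p_pos(3) _ _ \<phi>(2)] borel_measurable_diff integrable_powr_diff p_pos
        tests_powr_integrable[OF d\<phi>] D) auto
  have "(LINT x|M. u x * partial_deriv i \<psi> x) = - (LINT x|M. g i x * \<psi> x)" if \<psi>: "\<psi> \<in> tests" for \<psi>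
  proof (rule LIMSEQ_unique)
    show "(\<lambda>n. LINT x|M. \<phi> n x * partial_deriv i \<psi> x) \<longlonglongrightarrow> (LINT x|M. u x * partial_deriv i \<psi> x)"
      by (rule integral_bounded_mult_tendsto[OF tests_integrable[OF \<phi>(1)] D(1) \<phi>(3) tests_partial_deriv[OF \<psi>]])
    have "(\<lambda>n. - (LINT x|M. partial_deriv i (\<phi> n) x * \<psi> x)) \<longlonglongrightarrow> - (LINT x|M. g i x * \<psi> x)"
      by (intro tendsto_minus integral_bounded_mult_tendsto[OF tests_integrable[OF d\<phi>] D(4) L1 \<psi>])
    thus "(\<lambda>n. LINT x|M. \<phi> n x * partial_deriv i \<psi> x) \<longlonglongrightarrow> - (LINT x|M. g i x * \<psi> x)"
      unfolding test_integration_by_parts[OF bounded_domain domain_measurable \<phi>(1) \<psi>] .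
  qed
  thus ?thesis unfolding is_weak_partial_deriv_def using li[OF D(1)] li[OF D(4)] by blast
qed

lemma weak_partial_deriv_eq_gradient:
  "has_gradient u g \<Longrightarrow> AE x in M. weak_partial_deriv \<Omega> i u x = g i x"
  by (rule weak_partial_deriv_AE_eq[OF open_domain bounded_domain has_gradient_weak_partial_deriv])

text \<open>The chosen representative inherits measurability from \<open>g i\<close>, because the
  Lebesgue measure is complete.\<close>

lemma weak_partial_deriv_measurable:
  assumes u: "has_gradient u g" shows "weak_partial_deriv \<Omega> i u \<in> borel_measurable M"
proof -
  have "(\<lambda>x. indicator \<Omega> x *\<^sub>R g i x) \<in> borel_measurable lebesgue"
    using has_gradientD(2)[OF u, of i] domain_measurable by (subst (asm) borel_measurable_restrict_space_iff) auto
  moreover have "AE x in lebesgue. x \<in> \<Omega> \<longrightarrow> weak_partial_deriv \<Omega> i u x = g i x"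
    using weak_partial_deriv_eq_gradient[OF u, of i] domain_measurable by (subst (asm) AE_restrict_space_iff) auto
  hence "AE x in lebesgue. indicator \<Omega> x *\<^sub>R g i x = indicator \<Omega> x *\<^sub>R weak_partial_deriv \<Omega> i u x"
    by eventually_elim (auto simp: indicator_def)
  ultimately have "(\<lambda>x. indicator \<Omega> x *\<^sub>R weak_partial_deriv \<Omega> i u x) \<in> borel_measurable lebesgue"
    by (rule borel_measurable_AE)
  thus ?thesis using domain_measurable by (subst borel_measurable_restrict_space_iff) auto
qed

definition modular :: "'n \<Rightarrow> (real^'n \<Rightarrow> real) \<Rightarrow> real" where
  "modular i u = (LINT x|M. \<bar>weak_partial_deriv \<Omega> i u x\<bar> powr p i)"

lemma modular_nonneg: "0 \<le> modular i u" by (simp add: modular_def)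

lemma modular_eq:
  assumes u: "has_gradient u g" shows "modular i u = (LINT x|M. \<bar>g i x\<bar> powr p i)"
  unfolding modular_def using weak_partial_deriv_measurable[OF u, of i] has_gradientD(2)[OF u, of i]
  by (intro integral_cong_AE) (use weak_partial_deriv_eq_gradient[OF u, of i] in \<open>auto elim!: eventually_mono\<close>)

lemma anisotropic_norm_eq: "anisotropic_norm \<Omega> p u = (\<Sum>i\<in>UNIV. modular i u powr (1 / p i))"
  by (simp add: anisotropic_norm_def Lp_norm_def modular_def)

lemma modular_diff_tests:
  assumes "\<phi> \<in> tests" "\<psi> \<in> tests"
  shows "modular i (\<lambda>x. \<phi> x - \<psi> x) = (LINT x|M. \<bar>partial_deriv i \<phi> x - partial_deriv i \<psi> x\<bar> powr p i)"
  using modular_eq[OF tests_has_gradient[OF tests_diff[OF assms]]] tests_partial_deriv_diff[OF assms] by simp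

lemma anisotropic_norm_less:
  assumes e: "0 < e" and m: "\<And>i. modular i u < (e / real CARD('n)) powr p i"
  shows "anisotropic_norm \<Omega> p u < e"
proof -
  have "modular i u powr (1 / p i) < e / real CARD('n)" for i
  proof -
    have "modular i u powr (1 / p i) < ((e / real CARD('n)) powr p i) powr (1 / p i)"
      using m[of i] modular_nonneg[of i u] p_pos[of i] by (intro powr_less_mono2) auto
    thus ?thesis using e p_pos[of i] by (simp add: powr_powr)
  qed
  hence "anisotropic_norm \<Omega> p u < (\<Sum>i\<in>(UNIV::'n set). e / real CARD('n))"
    unfolding anisotropic_norm_eq by (intro sum_strict_mono) auto
  thus ?thesis by simp
qed

lemma modular_less:
  assumes "anisotropic_norm \<Omega> p u < e" shows "modular i u < e powr p i"
proof -
  have "modular i u powr (1 / p i) \<le> anisotropic_norm \<Omega> p u"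
    unfolding anisotropic_norm_eq by (rule member_le_sum) auto
  hence "modular i u powr (1 / p i) < e" using assms by simp
  hence "(modular i u powr (1 / p i)) powr p i < e powr p i" using p_pos[of i] by (intro powr_less_mono2) auto
  thus ?thesis using modular_nonneg[of i u] p_pos[of i] by (simp add: powr_powr)
qed

text \<open>Completeness of the spaces \<open>L^(p i)\<close> supplies the gradient. The
  convergence of the modulars is part of the conclusion because lower semicontinuity is read off
  from it.\<close>

lemma has_gradient_if_Cauchy:
  assumes \<phi>: "\<And>n. \<phi> n \<in> tests" and u: "integrable M u" and L1: "(\<lambda>n. LINT x|M. \<bar>\<phi> n x - u x\<bar>) \<longlonglongrightarrow> 0"
    and C: "\<And>i e. 0 < e \<Longrightarrow> \<exists>N. \<forall>m\<ge>N. \<forall>n\<ge>N. (LINT x|M. \<bar>partial_deriv i (\<phi> m) x - partial_deriv i (\<phi> n) x\<bar> powr p i) < e"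
  obtains g where "has_gradient u g"
    "\<forall>i. (\<lambda>n. LINT x|M. \<bar>partial_deriv i (\<phi> n) x\<bar> powr p i) \<longlonglongrightarrow> (LINT x|M. \<bar>g i x\<bar> powr p i)"
proof -
  note d = tests_measurable[OF tests_partial_deriv[OF \<phi>]] tests_powr_integrable[OF tests_partial_deriv[OF \<phi>] p_pos(1)]
  define P where "P = (\<lambda>i g. g \<in> borel_measurable M \<and> integrable M (\<lambda>x. \<bar>g x\<bar> powr p i) \<and>
      (\<lambda>n. LINT x|M. \<bar>partial_deriv i (\<phi> n) x - g x\<bar> powr p i) \<longlonglongrightarrow> 0)"
  have ex: "\<exists>g. P i g" for i
  proof (rule powr_complete[of "p i" "\<lambda>n. partial_deriv i (\<phi> n)" M])
    show "partial_deriv i (\<phi> n) \<in> borel_measurable M" for n by (rule d(1))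
    show "integrable M (\<lambda>x. \<bar>partial_deriv i (\<phi> n) x\<bar> powr p i)" for n by (rule d(2))
    show "\<exists>N. \<forall>m\<ge>N. \<forall>n\<ge>N. (LINT x|M. \<bar>partial_deriv i (\<phi> m) x - partial_deriv i (\<phi> n) x\<bar> powr p i) < e"
      if "0 < e" for e using C[OF that] .
    fix g :: "real^'n \<Rightarrow> real"
    assume "g \<in> borel_measurable M" "integrable M (\<lambda>x. \<bar>g x\<bar> powr p i)"
      "(\<lambda>n. LINT x|M. \<bar>partial_deriv i (\<phi> n) x - g x\<bar> powr p i) \<longlonglongrightarrow> 0"
    thus ?thesis by (intro exI[of _ g]) (simp add: P_def)
  qed (rule p_pos(1))
  define g where "g = (\<lambda>i. SOME g. P i g)"
  have "P i (g i)" for i unfolding g_def by (rule someI_ex[OF ex])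
  hence g: "g i \<in> borel_measurable M" "integrable M (\<lambda>x. \<bar>g i x\<bar> powr p i)"
      "(\<lambda>n. LINT x|M. \<bar>partial_deriv i (\<phi> n) x - g i x\<bar> powr p i) \<longlonglongrightarrow> 0" for i
    by (simp_all add: P_def)
  show ?thesis
  proof (rule that)
    show "has_gradient u g" unfolding has_gradient_def
      by (intro conjI allI exI[of _ \<phi>] g u \<phi> L1)
    show "\<forall>i. (\<lambda>n. LINT x|M. \<bar>partial_deriv i (\<phi> n) x\<bar> powr p i) \<longlonglongrightarrow> (LINT x|M. \<bar>g i x\<bar> powr p i)"
      by (rule allI, rule powr_integral_continuous[OF p_pos(1) d(1) g(1) d(2) g(2,3)])
  qed
qed

text \<open>For the norm the Cauchy property means smallness of all modulars of differences; the
  exponents \<open>1 / p i\<close> and the number of coordinates only rescale the bounds.\<close>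

lemma anisotropic_space_iff: "u \<in> anisotropic_space \<Omega> p \<longleftrightarrow> (\<exists>g. has_gradient u g)"
proof
  assume u: "u \<in> anisotropic_space \<Omega> p"
  hence iu: "integrable M u" and "\<exists>\<phi>. (\<forall>n. \<phi> n \<in> tests) \<and>
     (\<forall>e>0. \<exists>M. \<forall>m\<ge>M. \<forall>n\<ge>M. anisotropic_norm \<Omega> p (\<lambda>x. \<phi> m x - \<phi> n x) < e) \<and>
     (\<lambda>n. LINT x|M. \<bar>\<phi> n x - u x\<bar>) \<longlonglongrightarrow> 0"
    by (simp_all add: anisotropic_space_def)
  then obtain \<phi> where \<phi>0: "\<forall>n. \<phi> n \<in> tests"
    "\<forall>e>0. \<exists>M. \<forall>m\<ge>M. \<forall>n\<ge>M. anisotropic_norm \<Omega> p (\<lambda>x. \<phi> m x - \<phi> n x) < e"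
    "(\<lambda>n. LINT x|M. \<bar>\<phi> n x - u x\<bar>) \<longlonglongrightarrow> 0" by (elim exE conjE)
  note \<phi> = \<phi>0(1)[rule_format] \<phi>0(2)[rule_format] \<phi>0(3)
  have "\<exists>N. \<forall>m\<ge>N. \<forall>n\<ge>N. (LINT x|M. \<bar>partial_deriv i (\<phi> m) x - partial_deriv i (\<phi> n) x\<bar> powr p i) < e" if e: "0 < e" for i e
  proof -
    have e': "0 < e powr (1 / p i)" using e by simp
    obtain N where N: "\<And>m n. N \<le> m \<Longrightarrow> N \<le> n \<Longrightarrow> anisotropic_norm \<Omega> p (\<lambda>x. \<phi> m x - \<phi> n x) < e powr (1 / p i)"
      using \<phi>(2)[OF e'] by blast
    have "(LINT x|M. \<bar>partial_deriv i (\<phi> m) x - partial_deriv i (\<phi> n) x\<bar> powr p i) < e" if "N \<le> m" "N \<le> n" for m n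
      using modular_less[OF N[OF that], of i] e p_pos[of i]
      unfolding modular_diff_tests[OF \<phi>(1) \<phi>(1)] by (simp add: powr_powr)
    thus ?thesis by blast
  qed
  then obtain g where "has_gradient u g" by (rule has_gradient_if_Cauchy[OF \<phi>(1) iu \<phi>(3)])
  thus "\<exists>g. has_gradient u g" by (intro exI[of _ g])
next
  assume "\<exists>g. has_gradient u g"
  then obtain g where u: "has_gradient u g" by blast
  obtain \<phi> where \<phi>: "\<And>n. \<phi> n \<in> tests"
    "\<And>i. (\<lambda>n. LINT x|M. \<bar>partial_deriv i (\<phi> n) x - g i x\<bar> powr p i) \<longlonglongrightarrow> 0"
    "(\<lambda>n. LINT x|M. \<bar>\<phi> n x - u x\<bar>) \<longlonglongrightarrow> 0" by (rule has_gradientE[OF u]) blast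
  note D = has_gradientD[OF u]
  note d = tests_measurable[OF tests_partial_deriv[OF \<phi>(1)]] tests_powr_integrable[OF tests_partial_deriv[OF \<phi>(1)] p_pos(1)]
  have "\<exists>M. \<forall>m\<ge>M. \<forall>n\<ge>M. anisotropic_norm \<Omega> p (\<lambda>x. \<phi> m x - \<phi> n x) < e" if e: "0 < e" for e
  proof -
    define \<delta> where "\<delta> = (\<lambda>i. (e / real CARD('n)) powr p i / (2 powr p i * 2))"
    have \<delta>: "0 < \<delta> i" for i using e by (simp add: \<delta>_def)
    have "\<forall>\<^sub>F n in sequentially. (LINT x|M. \<bar>partial_deriv i (\<phi> n) x - g i x\<bar> powr p i) < \<delta> i" for i
      by (rule order_tendstoD(2)[OF \<phi>(2) \<delta>])
    hence "\<forall>\<^sub>F n in sequentially. \<forall>i. (LINT x|M. \<bar>partial_deriv i (\<phi> n) x - g i x\<bar> powr p i) < \<delta> i"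
      by (simp add: eventually_all_finite)
    then obtain N where N: "\<And>n i. N \<le> n \<Longrightarrow> (LINT x|M. \<bar>partial_deriv i (\<phi> n) x - g i x\<bar> powr p i) < \<delta> i"
      by (auto simp: eventually_sequentially)
    have "anisotropic_norm \<Omega> p (\<lambda>x. \<phi> m x - \<phi> n x) < e" if mn: "N \<le> m" "N \<le> n" for m n
    proof (rule anisotropic_norm_less[OF e])
      fix i
      have m: "(\<lambda>x. partial_deriv i (\<phi> k) x - g i x) \<in> borel_measurable M" for k
        using d(1)[of i k] D(2)[of i] by (rule borel_measurable_diff)
      have i: "integrable M (\<lambda>x. \<bar>partial_deriv i (\<phi> k) x - g i x\<bar> powr p i)" for k
        by (rule integrable_powr_diff(1)[OF p_pos(2) d(1) D(2) d(2) D(3)])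
      have "modular i (\<lambda>x. \<phi> m x - \<phi> n x)
         = (LINT x|M. \<bar>(partial_deriv i (\<phi> m) x - g i x) - (partial_deriv i (\<phi> n) x - g i x)\<bar> powr p i)"
        unfolding modular_diff_tests[OF \<phi>(1) \<phi>(1)] by simp
      also have "\<dots> \<le> 2 powr p i * ((LINT x|M. \<bar>partial_deriv i (\<phi> m) x - g i x\<bar> powr p i)
          + (LINT x|M. \<bar>partial_deriv i (\<phi> n) x - g i x\<bar> powr p i))"
        by (rule integral_powr_add_le(1)[OF p_pos(2) m m i i])
      also have "\<dots> < 2 powr p i * (\<delta> i + \<delta> i)"
        using N[OF mn(1), of i] N[OF mn(2), of i] by (intro mult_strict_left_mono add_strict_mono) auto
      also have "\<dots> = (e / real CARD('n)) powr p i" by (simp add: \<delta>_def)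
      finally show "modular i (\<lambda>x. \<phi> m x - \<phi> n x) < (e / real CARD('n)) powr p i" .
    qed
    thus ?thesis by blast
  qed
  hence "(\<forall>n. \<phi> n \<in> tests) \<and>
     (\<forall>e>0. \<exists>M. \<forall>m\<ge>M. \<forall>n\<ge>M. anisotropic_norm \<Omega> p (\<lambda>x. \<phi> m x - \<phi> n x) < e) \<and>
     (\<lambda>n. LINT x|M. \<bar>\<phi> n x - u x\<bar>) \<longlonglongrightarrow> 0"
    by (intro conjI allI impI \<phi>)
  thus "u \<in> anisotropic_space \<Omega> p" unfolding anisotropic_space_def mem_Collect_eq
    by (rule conjI[OF D(1) exI[of _ \<phi>]])
qed

lemma has_gradient_add:
  assumes u: "has_gradient u g" and v: "has_gradient v h"
  shows "has_gradient (\<lambda>x. a * u x + b * v x) (\<lambda>i x. a * g i x + b * h i x)"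
proof -
  obtain \<phi> where \<phi>: "\<And>n. \<phi> n \<in> tests"
    "\<And>i. (\<lambda>n. LINT x|M. \<bar>partial_deriv i (\<phi> n) x - g i x\<bar> powr p i) \<longlonglongrightarrow> 0"
    "(\<lambda>n. LINT x|M. \<bar>\<phi> n x - u x\<bar>) \<longlonglongrightarrow> 0" by (rule has_gradientE[OF u]) blast
  obtain \<psi> where \<psi>: "\<And>n. \<psi> n \<in> tests"
    "\<And>i. (\<lambda>n. LINT x|M. \<bar>partial_deriv i (\<psi> n) x - h i x\<bar> powr p i) \<longlonglongrightarrow> 0"
    "(\<lambda>n. LINT x|M. \<bar>\<psi> n x - v x\<bar>) \<longlonglongrightarrow> 0" by (rule has_gradientE[OF v]) blast
  note U = has_gradientD[OF u] and V = has_gradientD[OF v]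
  have comb: "(\<lambda>n. LINT x|M. \<bar>(a * F n x + b * G n x) - (a * k x + b * l x)\<bar> powr r) \<longlonglongrightarrow> 0"
    if r: "1 \<le> r" and m: "\<And>n. F n \<in> borel_measurable M" "\<And>n. G n \<in> borel_measurable M" "k \<in> borel_measurable M" "l \<in> borel_measurable M"
      and i: "\<And>n. integrable M (\<lambda>x. \<bar>F n x - k x\<bar> powr r)" "\<And>n. integrable M (\<lambda>x. \<bar>G n x - l x\<bar> powr r)"
      and lim: "(\<lambda>n. LINT x|M. \<bar>F n x - k x\<bar> powr r) \<longlonglongrightarrow> 0" "(\<lambda>n. LINT x|M. \<bar>G n x - l x\<bar> powr r) \<longlonglongrightarrow> 0"
    for F G k l r
  proof -
    note [measurable] = m
    have sc: "\<bar>c * y\<bar> powr r = \<bar>c\<bar> powr r * \<bar>y\<bar> powr r" for c y :: real by (simp add: abs_mult powr_mult)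
    have le: "(LINT x|M. \<bar>(a * F n x + b * G n x) - (a * k x + b * l x)\<bar> powr r)
        \<le> 2 powr r * (\<bar>a\<bar> powr r * (LINT x|M. \<bar>F n x - k x\<bar> powr r) + \<bar>b\<bar> powr r * (LINT x|M. \<bar>G n x - l x\<bar> powr r))" for n
    proof -
      have "(LINT x|M. \<bar>(a * F n x + b * G n x) - (a * k x + b * l x)\<bar> powr r)
          = (LINT x|M. \<bar>a * (F n x - k x) + b * (G n x - l x)\<bar> powr r)" by (simp add: algebra_simps)
      also have "\<dots> \<le> 2 powr r * ((LINT x|M. \<bar>a * (F n x - k x)\<bar> powr r) + (LINT x|M. \<bar>b * (G n x - l x)\<bar> powr r))"
        using r i by (intro integral_powr_add_le(2)) (auto simp: sc)
      finally show ?thesis by (simp add: sc)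
    qed
    have "(\<lambda>n. 2 powr r * (\<bar>a\<bar> powr r * (LINT x|M. \<bar>F n x - k x\<bar> powr r) + \<bar>b\<bar> powr r * (LINT x|M. \<bar>G n x - l x\<bar> powr r)))
       \<longlonglongrightarrow> 2 powr r * (\<bar>a\<bar> powr r * 0 + \<bar>b\<bar> powr r * 0)" by (intro tendsto_intros lim)
    hence lim0: "(\<lambda>n. 2 powr r * (\<bar>a\<bar> powr r * (LINT x|M. \<bar>F n x - k x\<bar> powr r) + \<bar>b\<bar> powr r * (LINT x|M. \<bar>G n x - l x\<bar> powr r)))
       \<longlonglongrightarrow> 0" by simp
    show ?thesis by (rule Lim_null_comparison[OF always_eventually lim0]) (simp add: le)
  qed
  have lin_i: "integrable M (\<lambda>x. \<bar>a * g i x + b * h i x\<bar> powr p i)" for i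
  proof -
    note [measurable] = U(2) V(2)
    have "integrable M (\<lambda>x. \<bar>a * g i x\<bar> powr p i)" "integrable M (\<lambda>x. \<bar>b * h i x\<bar> powr p i)"
      using U(3)[of i] V(3)[of i] by (auto simp: abs_mult powr_mult)
    thus ?thesis by (intro integrable_powr_diff(2) p_pos) auto
  qed
  have i1: "integrable M (\<lambda>x. \<bar>partial_deriv i (\<phi> n) x - g i x\<bar> powr p i)" for i n
    by (rule integrable_powr_diff(1)[OF p_pos(2) tests_measurable[OF tests_partial_deriv[OF \<phi>(1)]] U(2)
          tests_powr_integrable[OF tests_partial_deriv[OF \<phi>(1)] p_pos(1)] U(3)])
  have i2: "integrable M (\<lambda>x. \<bar>partial_deriv i (\<psi> n) x - h i x\<bar> powr p i)" for i n
    by (rule integrable_powr_diff(1)[OF p_pos(2) tests_measurable[OF tests_partial_deriv[OF \<psi>(1)]] V(2)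
          tests_powr_integrable[OF tests_partial_deriv[OF \<psi>(1)] p_pos(1)] V(3)])
  have 1: "(\<lambda>n. LINT x|M. \<bar>partial_deriv i (\<lambda>x. a * \<phi> n x + b * \<psi> n x) x - (a * g i x + b * h i x)\<bar> powr p i) \<longlonglongrightarrow> 0" for i
    unfolding tests_partial_deriv_add[OF \<phi>(1) \<psi>(1)]
    by (rule comb[OF p_pos(3) tests_measurable[OF tests_partial_deriv[OF \<phi>(1)]]
          tests_measurable[OF tests_partial_deriv[OF \<psi>(1)]] U(2) V(2) i1 i2 \<phi>(2) \<psi>(2)])
  have 2: "(\<lambda>n. LINT x|M. \<bar>(a * \<phi> n x + b * \<psi> n x) - (a * u x + b * v x)\<bar>) \<longlonglongrightarrow> 0"
    using comb[of 1 \<phi> \<psi> u v] \<phi>(3) \<psi>(3) U(1) V(1) tests_integrable[OF \<phi>(1)] tests_integrable[OF \<psi>(1)]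
    by (simp add: tests_measurable[OF \<phi>(1)] tests_measurable[OF \<psi>(1)] borel_measurable_integrable)
  have 3: "integrable M (\<lambda>x. a * u x + b * v x)" using U(1) V(1) by auto
  have 4: "(\<lambda>x. a * g i x + b * h i x) \<in> borel_measurable M" for i
    using U(2)[of i] V(2)[of i] by measurable
  show ?thesis unfolding has_gradient_def
    by (intro conjI allI exI[of _ "\<lambda>n x. a * \<phi> n x + b * \<psi> n x"] tests_add[OF \<phi>(1) \<psi>(1)] 1 2 3 4 lin_i)
qed

definition dirichlet :: "(real^'n \<Rightarrow> real) \<Rightarrow> real" where
  "dirichlet u = (\<Sum>i\<in>UNIV. 1 / p i * modular i u)"

lemma dirichlet_nonneg: "0 \<le> dirichlet u"
  unfolding dirichlet_def using p_pos modular_nonneg by (intro sum_nonneg mult_nonneg_nonneg) auto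

lemma dirichlet_tests: "\<phi> \<in> tests \<Longrightarrow> dirichlet \<phi> = (\<Sum>i\<in>UNIV. 1 / p i * (LINT x|M. \<bar>partial_deriv i \<phi> x\<bar> powr p i))"
  by (simp add: dirichlet_def modular_eq[OF tests_has_gradient])

lemma test_approximation:
  assumes u: "has_gradient u g" and e: "0 < e"
  obtains \<phi> where "\<phi> \<in> tests" "(LINT x|M. \<bar>\<phi> x - u x\<bar>) < e" "\<bar>dirichlet \<phi> - dirichlet u\<bar> < e" "\<And>i. \<bar>modular i \<phi> - modular i u\<bar> < e"
proof -
  obtain \<phi> where \<phi>: "\<And>n. \<phi> n \<in> tests"
    "\<And>i. (\<lambda>n. LINT x|M. \<bar>partial_deriv i (\<phi> n) x - g i x\<bar> powr p i) \<longlonglongrightarrow> 0"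
    "(\<lambda>n. LINT x|M. \<bar>\<phi> n x - u x\<bar>) \<longlonglongrightarrow> 0" by (rule has_gradientE[OF u]) blast
  note D = has_gradientD[OF u]
  note d = tests_measurable[OF tests_partial_deriv[OF \<phi>(1)]] tests_powr_integrable[OF tests_partial_deriv[OF \<phi>(1)] p_pos(1)]
  have m: "(\<lambda>n. modular i (\<phi> n)) \<longlonglongrightarrow> modular i u" for i
    unfolding modular_eq[OF u] modular_eq[OF tests_has_gradient[OF \<phi>(1)]]
    by (rule powr_integral_continuous[OF p_pos(1) d(1) D(2) d(2) D(3) \<phi>(2)])
  have dl: "(\<lambda>n. dirichlet (\<phi> n)) \<longlonglongrightarrow> dirichlet u" unfolding dirichlet_def by (intro tendsto_intros m)
  have "\<forall>\<^sub>F n in sequentially. (LINT x|M. \<bar>\<phi> n x - u x\<bar>) < e" by (rule order_tendstoD(2)[OF \<phi>(3) e])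
  moreover have "\<forall>\<^sub>F n in sequentially. \<bar>dirichlet (\<phi> n) - dirichlet u\<bar> < e" using tendstoD[OF dl e] by (simp add: dist_real_def)
  moreover have "\<forall>\<^sub>F n in sequentially. \<forall>i. \<bar>modular i (\<phi> n) - modular i u\<bar> < e"
    using tendstoD[OF m e] by (simp add: eventually_all_finite dist_real_def)
  ultimately have "\<forall>\<^sub>F n in sequentially. (LINT x|M. \<bar>\<phi> n x - u x\<bar>) < e \<and> \<bar>dirichlet (\<phi> n) - dirichlet u\<bar> < e \<and>
      (\<forall>i. \<bar>modular i (\<phi> n) - modular i u\<bar> < e)" by eventually_elim simp
  then obtain n where "(LINT x|M. \<bar>\<phi> n x - u x\<bar>) < e" "\<bar>dirichlet (\<phi> n) - dirichlet u\<bar> < e" "\<forall>i. \<bar>modular i (\<phi> n) - modular i u\<bar> < e"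
    by (auto simp: eventually_sequentially)
  thus ?thesis using that \<phi>(1) by blast
qed

section \<open>Lower semicontinuity of the Dirichlet energy\<close>

text \<open>Let \<open>d k\<close> be the infimum of the energy over test functions at
  \<open>L\<^sup>1\<close> distance less than \<open>1 / Suc k\<close> from \<open>w\<close>.
  These infima increase to a limit not exceeding \<open>B\<close>. Almost minimizers \<open>\<phi>
  k\<close> have midpoints that compete for the same infimum, so the convexity defects tend to 0,
  and uniform convexity makes the gradients Cauchy sequences. In this way lower semicontinuity and
  closedness of the space follow without weak convergence or Mazur's lemma.\<close>

lemma relaxation_tests:
  assumes w: "integrable M w"
    and ap: "\<And>e. 0 < e \<Longrightarrow> \<exists>\<phi>\<in>tests. (LINT x|M. \<bar>\<phi> x - w x\<bar>) < e \<and> dirichlet \<phi> < B + e"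
  shows "\<exists>g. has_gradient w g \<and> dirichlet w \<le> B"
proof -
  define S where "S = (\<lambda>k. {\<phi>\<in>tests. (LINT x|M. \<bar>\<phi> x - w x\<bar>) < 1 / real (Suc k)})"
  define d where "d = (\<lambda>k. Inf (dirichlet ` S k))"
  have bb: "bdd_below (dirichlet ` S k)" for k using dirichlet_nonneg by (intro bdd_belowI[of _ 0]) auto
  have d_le: "d k \<le> dirichlet \<phi>" if "\<phi> \<in> S k" for \<phi> k unfolding d_def using that bb by (intro cInf_lower) auto
  have ne: "S k \<noteq> {}" for k using ap[of "1 / real (Suc k)"] by (auto simp: S_def)
  have dB: "d k \<le> B" for k
  proof (rule field_le_epsilon)
    fix e :: real assume e: "0 < e"
    obtain \<phi> where \<phi>: "\<phi> \<in> tests" "(LINT x|M. \<bar>\<phi> x - w x\<bar>) < min e (1 / real (Suc k))" "dirichlet \<phi> < B + min e (1 / real (Suc k))"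
      using ap[of "min e (1 / real (Suc k))"] e by auto
    hence "\<phi> \<in> S k" by (simp add: S_def)
    from d_le[OF this] show "d k \<le> B + e" using \<phi>(3) by simp
  qed
  have Smono: "S m \<subseteq> S k" if "k \<le> m" for k m
  proof -
    have "1 / real (Suc m) \<le> 1 / real (Suc k)" using that by (simp add: frac_le)
    thus ?thesis by (auto simp: S_def)
  qed
  have "incseq d" unfolding incseq_def d_def
    using Smono ne bb by (intro allI impI cInf_superset_mono image_mono) auto
  then obtain dsup where dlim: "d \<longlonglongrightarrow> dsup" "\<And>k. d k \<le> dsup" by (rule incseq_convergent[where B = B]) (use dB in auto)
  have "\<exists>\<phi>. \<phi> \<in> S k \<and> dirichlet \<phi> < d k + 1 / real (Suc k)" for k
    using cInf_lessD[of "dirichlet ` S k" "d k + 1 / real (Suc k)"] ne[of k] by (auto simp: d_def)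
  then obtain \<phi> where \<phi>S: "\<And>k. \<phi> k \<in> S k" and \<phi>d: "\<And>k. dirichlet (\<phi> k) < d k + 1 / real (Suc k)" by metis
  have \<phi>: "\<phi> k \<in> tests" and \<phi>w: "(LINT x|M. \<bar>\<phi> k x - w x\<bar>) < 1 / real (Suc k)" for k
    using \<phi>S[of k] by (auto simp: S_def)
  have L1: "(\<lambda>n. LINT x|M. \<bar>\<phi> n x - w x\<bar>) \<longlonglongrightarrow> 0"
  proof (rule tendsto_sandwich[OF _ _ tendsto_const LIMSEQ_Suc[OF lim_inverse_n']])
    show "\<forall>\<^sub>F n in sequentially. (LINT x|M. \<bar>\<phi> n x - w x\<bar>) \<le> 1 / real (Suc n)"
      by (intro always_eventually allI less_imp_le \<phi>w)
  qed simp
  have bound: "dirichlet (\<phi> k) \<le> B + 1" for k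
  proof -
    have "1 / real (Suc k) \<le> 1" by simp
    thus ?thesis using \<phi>d[of k] dB[of k] by linarith
  qed
  \<comment> \<open>the convexity defect in the direction \<open>i\<close>\<close>
  define D where "D = (\<lambda>i m n. (modular i (\<phi> m) + modular i (\<phi> n)) / 2 - modular i (\<lambda>x. 1/2 * \<phi> m x + 1/2 * \<phi> n x))"
  note dm = tests_measurable[OF tests_partial_deriv[OF \<phi>]]
  note di = tests_powr_integrable[OF tests_partial_deriv[OF \<phi>] p_pos(1)]
  have mid: "(\<lambda>x. 1/2 * \<phi> m x + 1/2 * \<phi> n x) \<in> tests" for m n by (rule tests_add[OF \<phi> \<phi>])
  have mod_mid: "modular i (\<lambda>x. 1/2 * \<phi> m x + 1/2 * \<phi> n x) = (LINT x|M. \<bar>(partial_deriv i (\<phi> m) x + partial_deriv i (\<phi> n) x) / 2\<bar> powr p i)"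
    and imid: "integrable M (\<lambda>x. \<bar>(partial_deriv i (\<phi> m) x + partial_deriv i (\<phi> n) x) / 2\<bar> powr p i)" for i m n
  proof -
    have e: "partial_deriv i (\<lambda>x. 1/2 * \<phi> m x + 1/2 * \<phi> n x) = (\<lambda>x. (partial_deriv i (\<phi> m) x + partial_deriv i (\<phi> n) x) / 2)"
      unfolding tests_partial_deriv_add[OF \<phi> \<phi>] by (simp add: add_divide_distrib)
    show "modular i (\<lambda>x. 1/2 * \<phi> m x + 1/2 * \<phi> n x) = (LINT x|M. \<bar>(partial_deriv i (\<phi> m) x + partial_deriv i (\<phi> n) x) / 2\<bar> powr p i)"
      by (subst modular_eq[OF tests_has_gradient[OF mid]]) (simp only: e)
    show "integrable M (\<lambda>x. \<bar>(partial_deriv i (\<phi> m) x + partial_deriv i (\<phi> n) x) / 2\<bar> powr p i)"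
      using tests_powr_integrable[OF tests_partial_deriv[OF mid[of m n], of i] p_pos(1)[of i]] by (simp only: e)
  qed
  have mod: "modular i (\<phi> m) = (LINT x|M. \<bar>partial_deriv i (\<phi> m) x\<bar> powr p i)" for i m by (rule modular_eq[OF tests_has_gradient[OF \<phi>]])
  have D_eq: "D i m n = (LINT x|M. (\<bar>partial_deriv i (\<phi> m) x\<bar> powr p i + \<bar>partial_deriv i (\<phi> n) x\<bar> powr p i) / 2
        - \<bar>(partial_deriv i (\<phi> m) x + partial_deriv i (\<phi> n) x) / 2\<bar> powr p i)" for i m n
    unfolding D_def mod mod_mid using di imid by simp
  have D0: "0 \<le> D i m n" for i m n
    unfolding D_eq using powr_abs_midpoint_le[OF p_gt_one] by (intro integral_nonneg_AE AE_I2) (simp add: diff_ge_0_iff_ge)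
  have Dsum: "(\<Sum>i\<in>UNIV. 1 / p i * D i m n) \<le> (dsup - d k) + 1 / real (Suc k)" if mn: "k \<le> m" "k \<le> n" for k m n
  proof -
    have "(\<lambda>x. 1/2 * \<phi> m x + 1/2 * \<phi> n x) \<in> S k"
    proof -
      have im: "integrable M (\<lambda>x. \<phi> j x - w x)" for j using tests_integrable[OF \<phi>] w by auto
      have s: "(LINT x|M. \<bar>\<phi> j x - w x\<bar>) < 1 / real (Suc k)" if "k \<le> j" for j
        using \<phi>S[of j] Smono[OF that] by (auto simp: S_def)
      have "(LINT x|M. \<bar>1/2 * \<phi> m x + 1/2 * \<phi> n x - w x\<bar>) \<le> (LINT x|M. 1/2 * \<bar>\<phi> m x - w x\<bar> + 1/2 * \<bar>\<phi> n x - w x\<bar>)"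
      proof (rule integral_mono)
        show "\<bar>1/2 * \<phi> m x + 1/2 * \<phi> n x - w x\<bar> \<le> 1/2 * \<bar>\<phi> m x - w x\<bar> + 1/2 * \<bar>\<phi> n x - w x\<bar>" for x
        proof -
          have "1/2 * \<phi> m x + 1/2 * \<phi> n x - w x = 1/2 * (\<phi> m x - w x) + 1/2 * (\<phi> n x - w x)" by (simp add: field_simps)
          also have "\<bar>\<dots>\<bar> \<le> \<bar>1/2 * (\<phi> m x - w x)\<bar> + \<bar>1/2 * (\<phi> n x - w x)\<bar>" by (rule abs_triangle_ineq)
          finally show ?thesis by (simp add: abs_mult)
        qed
      qed (use im tests_integrable[OF \<phi>] w in auto)
      also have "\<dots> = 1/2 * (LINT x|M. \<bar>\<phi> m x - w x\<bar>) + 1/2 * (LINT x|M. \<bar>\<phi> n x - w x\<bar>)" using im by simp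
      also have "\<dots> < 1 / real (Suc k)" using s[OF mn(1)] s[OF mn(2)] by simp
      finally show ?thesis using mid by (simp add: S_def)
    qed
    from d_le[OF this] have low: "d k \<le> dirichlet (\<lambda>x. 1/2 * \<phi> m x + 1/2 * \<phi> n x)" .
    have up: "dirichlet (\<phi> j) \<le> dsup + 1 / real (Suc k)" if "k \<le> j" for j
    proof -
      have "1 / real (Suc j) \<le> 1 / real (Suc k)" using that by (simp add: frac_le)
      thus ?thesis using \<phi>d[of j] dlim(2)[of j] by linarith
    qed
    have "(\<Sum>i\<in>UNIV. 1 / p i * D i m n) = (dirichlet (\<phi> m) + dirichlet (\<phi> n)) / 2 - dirichlet (\<lambda>x. 1/2 * \<phi> m x + 1/2 * \<phi> n x)"
      by (simp add: dirichlet_def D_def right_diff_distrib sum_subtractf sum.distrib sum_divide_distrib add_divide_distrib mult.commute)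
    moreover have "(dirichlet (\<phi> m) + dirichlet (\<phi> n)) / 2 \<le> dsup + 1 / real (Suc k)"
      using add_mono[OF up[OF mn(1)] up[OF mn(2)]] by (simp add: divide_le_eq del: of_nat_Suc)
    from diff_mono[OF this low]
    have "(dirichlet (\<phi> m) + dirichlet (\<phi> n)) / 2 - dirichlet (\<lambda>x. 1/2 * \<phi> m x + 1/2 * \<phi> n x) \<le> (dsup - d k) + 1 / real (Suc k)"
      by (simp only: diff_add_eq)
    ultimately show ?thesis by (simp only:)
  qed
  have C: "\<exists>N. \<forall>m\<ge>N. \<forall>n\<ge>N. (LINT x|M. \<bar>partial_deriv i (\<phi> m) x - partial_deriv i (\<phi> n) x\<bar> powr p i) < e" if e: "0 < e" for i e
  proof -
    define A where "A = 2 * p i * (\<bar>B\<bar> + 1)"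
    have A: "0 < A" using p_pos(1)[of i] by (simp add: A_def)
    have Am: "modular i (\<phi> k) \<le> A / 2" for k
    proof -
      have "1 / p i * modular i (\<phi> k) \<le> dirichlet (\<phi> k)" unfolding dirichlet_def
        using p_pos(2) modular_nonneg by (intro member_le_sum[where f = "\<lambda>i. 1 / p i * modular i (\<phi> k)"]) auto
      hence "1 / p i * modular i (\<phi> k) \<le> \<bar>B\<bar> + 1" using bound[of k] by linarith
      thus ?thesis using p_pos(1)[of i] by (simp add: A_def field_simps)
    qed
    obtain C where C: "0 \<le> C" "\<And>a b. \<bar>a - b\<bar> powr p i \<le> e / (2 * A) * (\<bar>a\<bar> powr p i + \<bar>b\<bar> powr p i)
        + C * ((\<bar>a\<bar> powr p i + \<bar>b\<bar> powr p i) / 2 - \<bar>(a + b) / 2\<bar> powr p i)"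
      using powr_uniformly_convex[OF p_gt_one, of "e / (2 * A)" i] e A by (metis zero_less_divide_iff zero_less_mult_iff zero_less_numeral)
    have main: "(LINT x|M. \<bar>partial_deriv i (\<phi> m) x - partial_deriv i (\<phi> n) x\<bar> powr p i) \<le> e / 2 + C * D i m n" for m n
    proof -
      have "(LINT x|M. \<bar>partial_deriv i (\<phi> m) x - partial_deriv i (\<phi> n) x\<bar> powr p i)
         \<le> (LINT x|M. e / (2 * A) * (\<bar>partial_deriv i (\<phi> m) x\<bar> powr p i + \<bar>partial_deriv i (\<phi> n) x\<bar> powr p i)
        + C * ((\<bar>partial_deriv i (\<phi> m) x\<bar> powr p i + \<bar>partial_deriv i (\<phi> n) x\<bar> powr p i) / 2
               - \<bar>(partial_deriv i (\<phi> m) x + partial_deriv i (\<phi> n) x) / 2\<bar> powr p i))"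
        by (intro integral_mono C(2) integrable_powr_diff p_pos dm di Bochner_Integration.integrable_add
            Bochner_Integration.integrable_diff integrable_mult_right integrable_divide imid)
      also have "\<dots> = e / (2 * A) * (modular i (\<phi> m) + modular i (\<phi> n)) + C * D i m n"
        unfolding D_eq mod using di imid by simp
      also have "\<dots> \<le> e / (2 * A) * (A / 2 + A / 2) + C * D i m n"
        using e A by (intro add_right_mono mult_left_mono add_mono Am) auto
      finally show ?thesis using A by simp
    qed
    have "(\<lambda>k. C * p i * ((dsup - d k) + 1 / real (Suc k))) \<longlonglongrightarrow> C * p i * ((dsup - dsup) + 0)"
      by (intro tendsto_intros dlim LIMSEQ_Suc[OF lim_inverse_n'])
    hence "\<forall>\<^sub>F k in sequentially. C * p i * ((dsup - d k) + 1 / real (Suc k)) < e / 2"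
      by (rule order_tendstoD(2)) (use e in simp)
    then obtain N where N: "C * p i * ((dsup - d N) + 1 / real (Suc N)) < e / 2" by (auto simp: eventually_sequentially)
    have "(LINT x|M. \<bar>partial_deriv i (\<phi> m) x - partial_deriv i (\<phi> n) x\<bar> powr p i) < e" if mn: "N \<le> m" "N \<le> n" for m n
    proof -
      have "1 / p i * D i m n \<le> (\<Sum>i\<in>UNIV. 1 / p i * D i m n)"
        using p_pos(2) D0 by (intro member_le_sum[where f = "\<lambda>i. 1 / p i * D i m n"]) auto
      hence "1 / p i * D i m n \<le> (dsup - d N) + 1 / real (Suc N)" using Dsum[OF mn] by linarith
      hence "C * p i * (1 / p i * D i m n) \<le> C * p i * ((dsup - d N) + 1 / real (Suc N))"
        using C p_pos(2)[of i] by (intro mult_left_mono) auto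
      moreover have "C * p i * (1 / p i * D i m n) = C * D i m n" using p_pos(1)[of i] by simp
      ultimately show ?thesis using main[of m n] N by linarith
    qed
    thus ?thesis by blast
  qed
  obtain g where g: "has_gradient w g" "\<forall>i. (\<lambda>n. LINT x|M. \<bar>partial_deriv i (\<phi> n) x\<bar> powr p i) \<longlonglongrightarrow> (LINT x|M. \<bar>g i x\<bar> powr p i)"
    by (rule has_gradient_if_Cauchy[OF \<phi> w L1 C]) blast
  have "(\<lambda>n. dirichlet (\<phi> n)) \<longlonglongrightarrow> dirichlet w"
    unfolding dirichlet_def modular_eq[OF g(1)] mod by (intro tendsto_intros g(2)[rule_format])
  moreover have "(\<lambda>n. B + 1 / real (Suc n)) \<longlonglongrightarrow> B + 0" by (intro tendsto_intros LIMSEQ_Suc[OF lim_inverse_n'])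
  moreover have "dirichlet (\<phi> n) \<le> B + 1 / real (Suc n)" for n using \<phi>d[of n] dB[of n] by linarith
  ultimately have "dirichlet w \<le> B + 0" by (intro LIMSEQ_le[of _ _ "\<lambda>n. B + 1 / real (Suc n)"]) auto
  thus ?thesis using g(1) by auto
qed

lemma relaxation_space:
  assumes w: "integrable M w"
    and ap: "\<And>e. 0 < e \<Longrightarrow> \<exists>v g. has_gradient v g \<and> (LINT x|M. \<bar>v x - w x\<bar>) \<le> e \<and> dirichlet v \<le> B"
  shows "\<exists>g. has_gradient w g \<and> dirichlet w \<le> B"
proof (rule relaxation_tests[OF w])
  fix e :: real assume e: "0 < e"
  obtain v g where v: "has_gradient v g" "(LINT x|M. \<bar>v x - w x\<bar>) \<le> e / 2" "dirichlet v \<le> B"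
    using ap[of "e / 2"] e by auto
  obtain \<phi> where \<phi>: "\<phi> \<in> tests" "(LINT x|M. \<bar>\<phi> x - v x\<bar>) < e / 2" "\<bar>dirichlet \<phi> - dirichlet v\<bar> < e / 2"
    by (rule test_approximation[OF v(1), of "e / 2"]) (use e in auto)
  have iv: "integrable M v" by (rule has_gradientD(1)[OF v(1)])
  have "(LINT x|M. \<bar>\<phi> x - w x\<bar>) \<le> (LINT x|M. \<bar>\<phi> x - v x\<bar> + \<bar>v x - w x\<bar>)"
    using tests_integrable[OF \<phi>(1)] iv w by (intro integral_mono) auto
  also have "\<dots> = (LINT x|M. \<bar>\<phi> x - v x\<bar>) + (LINT x|M. \<bar>v x - w x\<bar>)" using tests_integrable[OF \<phi>(1)] iv w by simp
  finally have "(LINT x|M. \<bar>\<phi> x - w x\<bar>) < e" using \<phi>(2) v(2) by simp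
  moreover have "dirichlet \<phi> < B + e" using \<phi>(3) v(3) e by linarith
  ultimately show "\<exists>\<phi>\<in>tests. (LINT x|M. \<bar>\<phi> x - w x\<bar>) < e \<and> dirichlet \<phi> < B + e" using \<phi>(1) by blast
qed

text \<open>The factor multiplying the derivative of \<open>\<phi>\<close> is \<open>\<phi> / sqrt
  (\<phi>\<^sup>2 + \<epsilon>\<^sup>2)\<close>, at most 1 in absolute value; subtracting
  \<open>\<epsilon>\<close> restores the compact support.\<close>

lemma tests_abs_regularization:
  assumes \<phi>: "\<phi> \<in> tests" and \<epsilon>: "0 < \<epsilon>"
  defines "\<psi> \<equiv> \<lambda>x. sqrt ((\<phi> x)\<^sup>2 + \<epsilon>\<^sup>2) - \<epsilon>"
  shows "\<psi> \<in> tests" "\<bar>\<psi> x - \<bar>\<phi> x\<bar>\<bar> \<le> \<epsilon>" "dirichlet \<psi> \<le> dirichlet \<phi>"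
proof -
  note s = smooth_sqrt_regularization[OF test_smooth[OF \<phi>] \<epsilon>]
  show \<psi>: "\<psi> \<in> tests" unfolding \<psi>_def
    by (rule test_functions_support_subset[OF bounded_domain \<phi>]) (use s(1) \<epsilon> in \<open>auto intro: smooth_diff smooth_const\<close>)
  have "\<bar>\<phi> x\<bar> \<le> sqrt ((\<phi> x)\<^sup>2 + \<epsilon>\<^sup>2)" by (rule real_le_rsqrt) simp
  moreover have "sqrt ((\<phi> x)\<^sup>2 + \<epsilon>\<^sup>2) \<le> \<bar>\<phi> x\<bar> + \<epsilon>"
    using \<epsilon> sqrt_add_le_add_sqrt[of "(\<phi> x)\<^sup>2" "\<epsilon>\<^sup>2"] by simp
  ultimately show "\<bar>\<psi> x - \<bar>\<phi> x\<bar>\<bar> \<le> \<epsilon>" using \<epsilon> by (auto simp: \<psi>_def abs_if)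
  have dle: "\<bar>partial_deriv i \<psi> x\<bar> \<le> \<bar>partial_deriv i \<phi> x\<bar>" for i x
  proof -
    define r where "r = sqrt ((\<phi> x)\<^sup>2 + \<epsilon>\<^sup>2)"
    have r: "\<bar>\<phi> x\<bar> \<le> r" unfolding r_def by (rule real_le_rsqrt) simp
    have r0: "0 < r" unfolding r_def using \<epsilon> by (simp add: add_nonneg_pos)
    have "partial_deriv i \<psi> x = partial_deriv i (\<lambda>x. sqrt ((\<phi> x)\<^sup>2 + \<epsilon>\<^sup>2)) x"
      unfolding \<psi>_def using partial_deriv_add[of "\<lambda>x. sqrt ((\<phi> x)\<^sup>2 + \<epsilon>\<^sup>2)" "\<lambda>_. - \<epsilon>" i] smooth_differentiable[OF s(1)]
      by (simp add: partial_deriv_const)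
    hence "\<bar>partial_deriv i \<psi> x\<bar> = \<bar>\<phi> x\<bar> / r * \<bar>partial_deriv i \<phi> x\<bar>"
      using r0 by (simp add: s(2) r_def[symmetric] abs_mult)
    also have "\<dots> \<le> 1 * \<bar>partial_deriv i \<phi> x\<bar>" using r r0 by (intro mult_right_mono) auto
    finally show ?thesis by simp
  qed
  show "dirichlet \<psi> \<le> dirichlet \<phi>" unfolding dirichlet_tests[OF \<psi>] dirichlet_tests[OF \<phi>]
    using p_pos tests_powr_integrable[OF tests_partial_deriv[OF \<psi>]] tests_powr_integrable[OF tests_partial_deriv[OF \<phi>]]
    by (intro sum_mono mult_left_mono integral_mono powr_mono2 dle) auto
qed

text \<open>Relaxation with smooth regularizations of \<open>\<bar>\<phi>\<bar>\<close> replaces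
  the chain rule for the absolute value of weakly differentiable functions.\<close>

lemma absolute_value_space:
  assumes u: "has_gradient u g"
  shows "\<exists>h. has_gradient (\<lambda>x. \<bar>u x\<bar>) h" "dirichlet (\<lambda>x. \<bar>u x\<bar>) \<le> dirichlet u"
proof -
  have iu: "integrable M u" by (rule has_gradientD(1)[OF u])
  have *: "\<exists>h. has_gradient (\<lambda>x. \<bar>u x\<bar>) h \<and> dirichlet (\<lambda>x. \<bar>u x\<bar>) \<le> dirichlet u"
  proof (rule relaxation_tests)
    fix e :: real assume e: "0 < e"
    obtain \<phi> where \<phi>: "\<phi> \<in> tests" "(LINT x|M. \<bar>\<phi> x - u x\<bar>) < e / 2" "\<bar>dirichlet \<phi> - dirichlet u\<bar> < e / 2"
      by (rule test_approximation[OF u, of "e / 2"]) (use e in auto)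
    define m where "m = measure M (space M)"
    have m: "0 \<le> m" by (simp add: m_def)
    define \<epsilon> where "\<epsilon> = e / (2 * (m + 1))"
    have \<epsilon>: "0 < \<epsilon>" "\<epsilon> * m \<le> e / 2" using e m by (auto simp: \<epsilon>_def field_simps)
    define \<psi> where "\<psi> = (\<lambda>x. sqrt ((\<phi> x)\<^sup>2 + \<epsilon>\<^sup>2) - \<epsilon>)"
    note r = tests_abs_regularization[OF \<phi>(1) \<epsilon>(1), folded \<psi>_def]
    have "(LINT x|M. \<bar>\<psi> x - \<bar>u x\<bar>\<bar>) \<le> (LINT x|M. \<bar>\<phi> x - u x\<bar> + \<epsilon>)"
    proof (rule integral_mono)
      show "\<bar>\<psi> x - \<bar>u x\<bar>\<bar> \<le> \<bar>\<phi> x - u x\<bar> + \<epsilon>" for x using r(2)[of x] unfolding \<psi>_def by linarith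
    qed (use tests_integrable[OF r(1)] tests_integrable[OF \<phi>(1)] iu in auto)
    also have "\<dots> = (LINT x|M. \<bar>\<phi> x - u x\<bar>) + \<epsilon> * m" using tests_integrable[OF \<phi>(1)] iu by (simp add: m_def)
    finally have "(LINT x|M. \<bar>\<psi> x - \<bar>u x\<bar>\<bar>) < e" using \<phi>(2) \<epsilon>(2) by linarith
    moreover have "dirichlet \<psi> < dirichlet u + e" using r(3) \<phi>(3) e by linarith
    ultimately show "\<exists>\<phi>\<in>tests. (LINT x|M. \<bar>\<phi> x - \<bar>u x\<bar>\<bar>) < e \<and> dirichlet \<phi> < dirichlet u + e" using r(1) by blast
  qed (use iu in auto)
  thus "\<exists>h. has_gradient (\<lambda>x. \<bar>u x\<bar>) h" "dirichlet (\<lambda>x. \<bar>u x\<bar>) \<le> dirichlet u" by auto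
qed

end

section \<open>Translations and the Poincare inequality\<close>

text \<open>A convex function lies above its tangents; with \<open>m\<close> the mean value this
  yields Jensen's inequality after integration.\<close>

lemma powr_tangent_le:
  fixes y m r :: real
  assumes r: "1 \<le> r" and y: "0 \<le> y" and m: "0 < m"
  shows "m powr r + r * m powr (r - 1) * (y - m) \<le> y powr r"
proof -
  have cont: "continuous_on {a..b} (\<lambda>t. t powr r)" if "0 \<le> a" for a b :: real
    using r that by (intro continuous_on_powr' continuous_intros) auto
  have deriv: "((\<lambda>t. t powr r) has_real_derivative r * t powr (r - 1)) (at t)" if "0 < t" for t
    using that by (auto intro!: derivative_eq_intros simp: powr_diff)
  consider "y = m" | "m < y" | "y < m" by linarith
  thus ?thesis
  proof cases
    case 1 thus ?thesis by simp
  next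
    case 2
    obtain \<xi> where \<xi>: "m < \<xi>" "\<xi> < y" "y powr r - m powr r = r * \<xi> powr (r - 1) * (y - m)"
      by (rule mean_value_real[of m y "\<lambda>t. t powr r" "\<lambda>t. r * t powr (r - 1)"]) (use 2 m cont deriv in auto)
    have "r * m powr (r - 1) * (y - m) \<le> r * \<xi> powr (r - 1) * (y - m)"
      using \<xi> m r 2 by (intro mult_right_mono mult_left_mono powr_mono2) auto
    thus ?thesis using \<xi>(3) by linarith
  next
    case 3
    obtain \<xi> where \<xi>: "y < \<xi>" "\<xi> < m" "m powr r - y powr r = r * \<xi> powr (r - 1) * (m - y)"
      by (rule mean_value_real[of y m "\<lambda>t. t powr r" "\<lambda>t. r * t powr (r - 1)"]) (use 3 y cont deriv in auto)
    have "r * \<xi> powr (r - 1) * (m - y) \<le> r * m powr (r - 1) * (m - y)"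
      using \<xi> y r 3 by (intro mult_right_mono mult_left_mono powr_mono2) auto
    thus ?thesis using \<xi>(3) by (simp add: algebra_simps)
  qed
qed

text \<open>Jensen's inequality for the integral of \<open>w'\<close> over the unit interval, by
  means of the tangent at its mean.\<close>

lemma increment_powr_le:
  fixes w w' :: "real \<Rightarrow> real"
  assumes r: "1 \<le> r" and d: "\<And>s. (w has_real_derivative w' s) (at s)" and c: "continuous_on UNIV w'"
  shows "ennreal (\<bar>w 1 - w 0\<bar> powr r) \<le> (\<integral>\<^sup>+s. ennreal (\<bar>w' s\<bar> powr r * indicator {0..1} s) \<partial>lborel)"
proof -
  have r0: "0 < r" using r by simp
  have int: "integrable lborel (\<lambda>s. f s * indicator {0..1} s)" if "continuous_on UNIV f" for f :: "real \<Rightarrow> real"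
    using borel_integrable_compact[of "{0..1::real}" f] continuous_on_subset[OF that] by (simp add: mult.commute)
  have i1: "integrable lborel (\<lambda>s. \<bar>w' s\<bar> * indicator {0..1} s)" by (intro int continuous_intros c)
  have ir: "integrable lborel (\<lambda>s. \<bar>w' s\<bar> powr r * indicator {0..1} s)" by (intro int continuous_on_abs_powr r0 c)
  have ic: "integrable lborel (\<lambda>s::real. k * indicator {0..1} s)" for k :: real by (intro int continuous_intros)
  define m where "m = (LINT s|lborel. \<bar>w' s\<bar> * indicator {0..1} s)"
  have m0: "0 \<le> m" unfolding m_def by (intro integral_nonneg_AE AE_I2) auto
  have "(LINT s|lborel. w' s * indicator {0..1} s) = w 1 - w 0"
    using d c by (intro integral_FTC_Icc_real) (auto simp: continuous_on_eq_continuous_at)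
  hence "\<bar>w 1 - w 0\<bar> \<le> (LINT s|lborel. \<bar>w' s * indicator {0..1} s\<bar>)" using integral_abs_bound[of lborel "\<lambda>s. w' s * indicator {0..1} s"] by simp
  hence wm: "\<bar>w 1 - w 0\<bar> \<le> m" by (simp add: m_def abs_mult)
  have "\<bar>w 1 - w 0\<bar> powr r \<le> (LINT s|lborel. \<bar>w' s\<bar> powr r * indicator {0..1} s)"
  proof (cases "m = 0")
    case True
    thus ?thesis using wm by (auto intro!: integral_nonneg_AE)
  next
    case False
    have "\<bar>w 1 - w 0\<bar> powr r \<le> m powr r" using wm r by (intro powr_mono2) auto
    also have "m powr r = (LINT s|lborel. (m powr r - r * m powr (r - 1) * m) * indicator {0..1} s + r * m powr (r - 1) * (\<bar>w' s\<bar> * indicator {0..1} s))"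
      using i1 ic by (subst Bochner_Integration.integral_add) (auto simp: m_def[symmetric])
    also have "\<dots> \<le> (LINT s|lborel. \<bar>w' s\<bar> powr r * indicator {0..1} s)"
    proof (rule integral_mono)
      fix s show "(m powr r - r * m powr (r - 1) * m) * indicator {0..1} s + r * m powr (r - 1) * (\<bar>w' s\<bar> * indicator {0..1} s)
         \<le> \<bar>w' s\<bar> powr r * indicator {0..1} s"
        using powr_tangent_le[OF r, of "\<bar>w' s\<bar>" m] False m0 by (auto simp: indicator_def algebra_simps)
    qed (use i1 ic ir in auto)
    finally show ?thesis .
  qed
  hence "ennreal (\<bar>w 1 - w 0\<bar> powr r) \<le> ennreal (LINT s|lborel. \<bar>w' s\<bar> powr r * indicator {0..1} s)" by (rule ennreal_leI)
  also have "\<dots> = (\<integral>\<^sup>+s. ennreal (\<bar>w' s\<bar> powr r * indicator {0..1} s) \<partial>lborel)"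
    by (rule nn_integral_eq_integral[symmetric, OF ir]) auto
  finally show ?thesis .
qed

lemma cbox_emeasure_cart:
  fixes h :: "real^'n::finite"
  assumes "\<And>i. 0 \<le> h $ i"
  shows "emeasure lborel (cbox 0 h) = ennreal (\<Prod>i\<in>UNIV. h $ i)"
proof -
  have "cbox 0 h \<noteq> {}" using assms by (auto simp: interval_eq_empty_cart not_less)
  hence "measure lborel (cbox 0 h) = (\<Prod>i\<in>UNIV. h $ i)" using content_cbox_cart[of 0 h] by simp
  thus ?thesis using emeasure_eq_ennreal_measure[of lborel "cbox 0 h"] emeasure_compact_finite[of "cbox 0 h"] by (simp add: less_top)
qed

context anisotropic_domain
begin

lemma tests_borel [measurable_dest]: "\<phi> \<in> tests \<Longrightarrow> \<phi> \<in> borel_measurable borel"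
  by (intro smooth_measurable test_smooth)

text \<open>Integrate the one-dimensional estimate over all lines in the direction
  \<open>i\<close>; by translation invariance the integral over \<open>x\<close> no longer depends
  on the position \<open>s\<close> along the segment.\<close>

lemma axis_translation:
  assumes \<phi>: "\<phi> \<in> tests" and r: "1 \<le> r"
  shows "(\<integral>\<^sup>+x. ennreal (\<bar>\<phi> (x + h *\<^sub>R axis i 1) - \<phi> x\<bar> powr r) \<partial>lborel)
      \<le> ennreal (\<bar>h\<bar> powr r * (LINT x|lborel. \<bar>partial_deriv i \<phi> x\<bar> powr r))"
proof -
  note d\<phi> = tests_partial_deriv[OF \<phi>, of i]
  note [measurable] = tests_borel[OF \<phi>] tests_borel[OF d\<phi>]
  define k where "k = (\<lambda>x (s::real). ennreal (\<bar>h * partial_deriv i \<phi> (x + (s * h) *\<^sub>R axis i 1)\<bar> powr r * indicator {0..1} s))"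
  have "ennreal (\<bar>\<phi> (x + h *\<^sub>R axis i 1) - \<phi> x\<bar> powr r) \<le> (\<integral>\<^sup>+s. k x s \<partial>lborel)" for x
  proof -
    have dw: "((\<lambda>s. \<phi> (x + (s * h) *\<^sub>R axis i 1)) has_real_derivative h * partial_deriv i \<phi> (x + (s * h) *\<^sub>R axis i 1)) (at s)" for s
    proof -
      have "((\<lambda>s. s * h) has_real_derivative h) (at s)" by (auto intro!: derivative_eq_intros)
      from DERIV_chain2[where f = "\<lambda>s. \<phi> (x + s *\<^sub>R axis i 1)", OF smooth_line_derivative[OF test_smooth[OF \<phi>]] this]
      show ?thesis by (simp add: mult.commute)
    qed
    have cw: "continuous_on UNIV (\<lambda>s. h * partial_deriv i \<phi> (x + (s * h) *\<^sub>R axis i 1))"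
      by (intro continuous_intros continuous_on_compose2[OF smooth_continuous[OF test_smooth[OF d\<phi>], of UNIV]]) auto
    from increment_powr_le[OF r dw cw] show ?thesis by (simp add: k_def)
  qed
  hence "(\<integral>\<^sup>+x. ennreal (\<bar>\<phi> (x + h *\<^sub>R axis i 1) - \<phi> x\<bar> powr r) \<partial>lborel) \<le> (\<integral>\<^sup>+x. (\<integral>\<^sup>+s. k x s \<partial>lborel) \<partial>lborel)"
    by (intro nn_integral_mono)
  also have "\<dots> = (\<integral>\<^sup>+s. (\<integral>\<^sup>+x. k x s \<partial>lborel) \<partial>lborel)"
    by (rule lborel_pair.Fubini'[symmetric]) (simp add: k_def split_beta')
  also have "\<dots> = (\<integral>\<^sup>+s. ennreal (\<bar>h\<bar> powr r * (LINT x|lborel. \<bar>partial_deriv i \<phi> x\<bar> powr r)) * indicator {0..1::real} s \<partial>lborel)"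
  proof (rule nn_integral_cong)
    fix s :: real
    have "(\<integral>\<^sup>+x. k x s \<partial>lborel) = (\<integral>\<^sup>+x. k x 0 * indicator {0..1} s \<partial>lborel)"
    proof -
      have "(\<integral>\<^sup>+x. k x s \<partial>lborel) = (\<integral>\<^sup>+x. (\<lambda>y. k y 0 * indicator {0..1} s) (x + (s * h) *\<^sub>R axis i 1) \<partial>lborel)"
        by (intro nn_integral_cong) (auto simp: k_def indicator_def)
      also have "\<dots> = (\<integral>\<^sup>+x. k x 0 * indicator {0..1} s \<partial>lborel)"
        by (rule lborel_nn_integral_shift) (simp add: k_def)
      finally show ?thesis .
    qed
    also have "\<dots> = (\<integral>\<^sup>+x. k x 0 \<partial>lborel) * indicator {0..1} s" by (rule nn_integral_multc) (simp add: k_def)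
    also have "(\<integral>\<^sup>+x. k x 0 \<partial>lborel) = ennreal (LINT x|lborel. \<bar>h\<bar> powr r * \<bar>partial_deriv i \<phi> x\<bar> powr r)"
      unfolding k_def using test_powr_integrable[OF d\<phi>, of r] r
      by (subst nn_integral_eq_integral[symmetric]) (auto simp: abs_mult powr_mult)
    finally show "(\<integral>\<^sup>+x. k x s \<partial>lborel) = ennreal (\<bar>h\<bar> powr r * (LINT x|lborel. \<bar>partial_deriv i \<phi> x\<bar> powr r)) * indicator {0..1} s"
      by simp
  qed
  also have "\<dots> = ennreal (\<bar>h\<bar> powr r * (LINT x|lborel. \<bar>partial_deriv i \<phi> x\<bar> powr r))"
    by (subst nn_integral_cmult_indicator) auto
  finally show ?thesis .
qed

lemma tests_translation_L1:
  assumes \<phi>: "\<phi> \<in> tests"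
  shows "(\<integral>\<^sup>+x. ennreal \<bar>\<phi> (x + t) - \<phi> x\<bar> \<partial>lborel) \<le> ennreal (\<Sum>i\<in>UNIV. \<bar>t $ i\<bar> * (LINT x|lborel. \<bar>partial_deriv i \<phi> x\<bar>))"
proof -
  note [measurable] = tests_borel[OF \<phi>]
  have "(\<integral>\<^sup>+x. ennreal \<bar>\<phi> (x + (\<Sum>i\<in>S. t $ i *\<^sub>R axis i 1)) - \<phi> x\<bar> \<partial>lborel) \<le> ennreal (\<Sum>i\<in>S. \<bar>t $ i\<bar> * (LINT x|lborel. \<bar>partial_deriv i \<phi> x\<bar>))"
    if "finite S" for S
    using that
  proof induction
    case empty show ?case by simp
  next
    case (insert j S)
    define z where "z = (\<Sum>i\<in>S. t $ i *\<^sub>R axis i (1::real))"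
    have "(\<integral>\<^sup>+x. ennreal \<bar>\<phi> (x + (\<Sum>i\<in>insert j S. t $ i *\<^sub>R axis i 1)) - \<phi> x\<bar> \<partial>lborel)
       \<le> (\<integral>\<^sup>+x. ennreal \<bar>\<phi> ((x + z) + t $ j *\<^sub>R axis j 1) - \<phi> (x + z)\<bar> + ennreal \<bar>\<phi> (x + z) - \<phi> x\<bar> \<partial>lborel)"
      using insert by (intro nn_integral_mono) (auto simp: z_def ennreal_plus[symmetric] algebra_simps simp del: ennreal_plus intro!: ennreal_leI)
    also have "\<dots> = (\<integral>\<^sup>+x. ennreal \<bar>\<phi> ((x + z) + t $ j *\<^sub>R axis j 1) - \<phi> (x + z)\<bar> \<partial>lborel) + (\<integral>\<^sup>+x. ennreal \<bar>\<phi> (x + z) - \<phi> x\<bar> \<partial>lborel)"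
      by (rule nn_integral_add) measurable
    also have "(\<integral>\<^sup>+x. ennreal \<bar>\<phi> ((x + z) + t $ j *\<^sub>R axis j 1) - \<phi> (x + z)\<bar> \<partial>lborel) = (\<integral>\<^sup>+x. ennreal \<bar>\<phi> (x + t $ j *\<^sub>R axis j 1) - \<phi> x\<bar> \<partial>lborel)"
      by (rule lborel_nn_integral_shift[of "\<lambda>x. ennreal \<bar>\<phi> (x + t $ j *\<^sub>R axis j 1) - \<phi> x\<bar>"]) measurable
    also have "\<dots> \<le> ennreal (\<bar>t $ j\<bar> * (LINT x|lborel. \<bar>partial_deriv j \<phi> x\<bar>))"
      using axis_translation[OF \<phi>, of 1 "t $ j" j] by simp
    also have "(\<integral>\<^sup>+x. ennreal \<bar>\<phi> (x + z) - \<phi> x\<bar> \<partial>lborel) \<le> ennreal (\<Sum>i\<in>S. \<bar>t $ i\<bar> * (LINT x|lborel. \<bar>partial_deriv i \<phi> x\<bar>))"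
      using insert by (simp add: z_def)
    finally show ?case using insert by (simp add: ennreal_plus[symmetric] sum_nonneg del: ennreal_plus)
  qed
  from this[of UNIV] show ?thesis using basis_expansion[of t] by (simp add: scalar_mult_eq_scaleR)
qed

text \<open>A translation by more than the diameter moves \<open>\<Omega>\<close> off itself, so
  \<open>\<phi>\<close> is pointwise dominated by an increment.\<close>

lemma tests_poincare:
  obtains C where "0 \<le> C" "\<And>\<phi> i. \<phi> \<in> tests \<Longrightarrow> (LINT x|lborel. \<bar>\<phi> x\<bar>) \<le> C * (LINT x|lborel. \<bar>partial_deriv i \<phi> x\<bar>)"
proof -
  obtain R where R: "0 < R" "\<And>x. x \<in> \<Omega> \<Longrightarrow> norm x \<le> R" using bounded_domain by (auto simp: bounded_pos)
  define h where "h = 2 * R + 1"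
  have "(LINT x|lborel. \<bar>\<phi> x\<bar>) \<le> h * (LINT x|lborel. \<bar>partial_deriv i \<phi> x\<bar>)" if \<phi>: "\<phi> \<in> tests" for \<phi> i
  proof -
    have pt: "\<bar>\<phi> x\<bar> \<le> \<bar>\<phi> (x + h *\<^sub>R axis i 1) - \<phi> x\<bar>" for x
    proof (cases "x \<in> \<Omega>")
      case True
      have "norm (h *\<^sub>R axis i (1::real)) \<le> norm (x + h *\<^sub>R axis i 1) + norm x"
        by (metis add.commute add_diff_cancel norm_triangle_ineq4)
      moreover have "norm (h *\<^sub>R axis i (1::real)) = 2 * R + 1" using R by (simp add: h_def)
      ultimately have "R < norm (x + h *\<^sub>R axis i 1)" using R(2)[OF True] by linarith
      hence "x + h *\<^sub>R axis i 1 \<notin> \<Omega>" using R(2) by force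
      thus ?thesis using test_zero[OF \<phi>] by simp
    next
      case False thus ?thesis using test_zero[OF \<phi>] by simp
    qed
    have "ennreal (LINT x|lborel. \<bar>\<phi> x\<bar>) = (\<integral>\<^sup>+x. ennreal \<bar>\<phi> x\<bar> \<partial>lborel)"
      using test_integrable[OF \<phi>] by (intro nn_integral_eq_integral[symmetric]) auto
    also have "\<dots> \<le> (\<integral>\<^sup>+x. ennreal (\<bar>\<phi> (x + h *\<^sub>R axis i 1) - \<phi> x\<bar> powr 1) \<partial>lborel)"
      using pt by (intro nn_integral_mono ennreal_leI) simp
    also have "\<dots> \<le> ennreal (\<bar>h\<bar> powr 1 * (LINT x|lborel. \<bar>partial_deriv i \<phi> x\<bar> powr 1))"
      by (rule axis_translation[OF \<phi>]) simp
    finally show ?thesis using R by (simp add: h_def ennreal_le_iff)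
  qed
  thus ?thesis using R by (intro that[of h]) (auto simp: h_def)
qed

lemma tests_lborel_integral: "\<phi> \<in> tests \<Longrightarrow> (LINT x|lborel. \<bar>\<phi> x\<bar> powr r) = (LINT x|M. \<bar>\<phi> x\<bar> powr r)"
  "\<phi> \<in> tests \<Longrightarrow> (LINT x|lborel. \<bar>\<phi> x\<bar>) = (LINT x|M. \<bar>\<phi> x\<bar>)"
  using tests_borel[of \<phi>] test_zero[of \<phi> \<Omega>]
  by (auto intro!: lebesgue_on_integral[OF domain_measurable, symmetric])

section \<open>The embedding below the critical exponent\<close>

text \<open>Markov's inequality applied to the translation estimate.\<close>

lemma axis_increment_measure:
  assumes \<phi>: "\<phi> \<in> tests" and r: "1 \<le> r" and c: "0 < c" and \<rho>: "(LINT x|lborel. \<bar>partial_deriv i \<phi> x\<bar> powr r) \<le> 1"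
  shows "emeasure lborel {x. c < \<bar>\<phi> (x + h *\<^sub>R axis i 1) - \<phi> x\<bar>} \<le> ennreal ((\<bar>h\<bar> / c) powr r)"
proof -
  note [measurable] = tests_borel[OF \<phi>]
  define u where "u = (\<lambda>x. ennreal (\<bar>\<phi> (x + h *\<^sub>R axis i 1) - \<phi> x\<bar> powr r))"
  have um[measurable]: "u \<in> borel_measurable lborel" unfolding u_def by measurable
  have "{x. c < \<bar>\<phi> (x + h *\<^sub>R axis i 1) - \<phi> x\<bar>} \<subseteq> {x\<in>UNIV. 1 \<le> ennreal (1 / c powr r) * u x}"
  proof safe
    fix x assume x: "c < \<bar>\<phi> (x + h *\<^sub>R axis i 1) - \<phi> x\<bar>"
    have "c powr r \<le> \<bar>\<phi> (x + h *\<^sub>R axis i 1) - \<phi> x\<bar> powr r" using x c r by (intro powr_mono2) auto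
    hence "1 \<le> 1 / c powr r * \<bar>\<phi> (x + h *\<^sub>R axis i 1) - \<phi> x\<bar> powr r" using c by (simp add: field_simps)
    hence "ennreal 1 \<le> ennreal (1 / c powr r * \<bar>\<phi> (x + h *\<^sub>R axis i 1) - \<phi> x\<bar> powr r)" by (rule ennreal_leI)
    moreover have "ennreal (1 / c powr r) * u x = ennreal (1 / c powr r * \<bar>\<phi> (x + h *\<^sub>R axis i 1) - \<phi> x\<bar> powr r)"
      unfolding u_def by (rule ennreal_mult[symmetric]) auto
    ultimately show "1 \<le> ennreal (1 / c powr r) * u x" by (simp only: ennreal_1)
  qed simp
  hence "emeasure lborel {x. c < \<bar>\<phi> (x + h *\<^sub>R axis i 1) - \<phi> x\<bar>} \<le> emeasure lborel {x\<in>UNIV. 1 \<le> ennreal (1 / c powr r) * u x}"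
    by (intro emeasure_mono) auto
  also have "\<dots> \<le> ennreal (1 / c powr r) * (\<integral>\<^sup>+x. u x * indicator UNIV x \<partial>lborel)"
    by (rule nn_integral_Markov_inequality) auto
  also have "\<dots> \<le> ennreal (1 / c powr r) * ennreal (\<bar>h\<bar> powr r * 1)"
  proof (rule mult_left_mono)
    have "(\<integral>\<^sup>+x. u x * indicator UNIV x \<partial>lborel) \<le> ennreal (\<bar>h\<bar> powr r * (LINT x|lborel. \<bar>partial_deriv i \<phi> x\<bar> powr r))"
      using axis_translation[OF \<phi> r, of h i] by (simp add: u_def)
    also have "\<dots> \<le> ennreal (\<bar>h\<bar> powr r * 1)" using \<rho> by (intro ennreal_leI mult_left_mono) auto
    finally show "(\<integral>\<^sup>+x. u x * indicator UNIV x \<partial>lborel) \<le> ennreal (\<bar>h\<bar> powr r * 1)" .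
  qed simp
  also have "\<dots> = ennreal ((\<bar>h\<bar> / c) powr r)" using c by (simp add: ennreal_mult[symmetric] powr_divide)
  finally show ?thesis .
qed

text \<open>A translation is a succession of translations along the axes; if the total increment
  exceeds \<open>CARD('n) * c\<close>, one of the partial increments exceeds \<open>c\<close>.\<close>

lemma increment_measure:
  assumes \<phi>: "\<phi> \<in> tests" and c: "0 < c" and \<rho>: "\<And>i. (LINT x|lborel. \<bar>partial_deriv i \<phi> x\<bar> powr p i) \<le> 1"
  shows "emeasure lborel {x. real CARD('n) * c < \<bar>\<phi> (x + t) - \<phi> x\<bar>} \<le> ennreal (\<Sum>i\<in>UNIV. (\<bar>t $ i\<bar> / c) powr p i)"
proof -
  note [measurable] = tests_borel[OF \<phi>]
  have "emeasure lborel {x. real (card S) * c < \<bar>\<phi> (x + (\<Sum>i\<in>S. t $ i *\<^sub>R axis i 1)) - \<phi> x\<bar>} \<le> ennreal (\<Sum>i\<in>S. (\<bar>t $ i\<bar> / c) powr p i)"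
    if "finite S" for S
    using that
  proof induction
    case empty show ?case by simp
  next
    case (insert j S)
    define z where "z = (\<Sum>i\<in>S. t $ i *\<^sub>R axis i (1::real))"
    define A where "A = {x. c < \<bar>\<phi> (x + t $ j *\<^sub>R axis j 1) - \<phi> x\<bar>}"
    define B where "B = {x. real (card S) * c < \<bar>\<phi> (x + z) - \<phi> x\<bar>}"
    have [measurable]: "A \<in> sets borel" "B \<in> sets borel" unfolding A_def B_def by measurable
    have "{x. real (card (insert j S)) * c < \<bar>\<phi> (x + (\<Sum>i\<in>insert j S. t $ i *\<^sub>R axis i 1)) - \<phi> x\<bar>} \<subseteq> {x. x + z \<in> A} \<union> B"
    proof
      fix x assume "x \<in> {x. real (card (insert j S)) * c < \<bar>\<phi> (x + (\<Sum>i\<in>insert j S. t $ i *\<^sub>R axis i 1)) - \<phi> x\<bar>}"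
      hence x: "real (card S) * c + c < \<bar>\<phi> ((x + z) + t $ j *\<^sub>R axis j 1) - \<phi> x\<bar>"
        using insert by (simp add: z_def algebra_simps)
      show "x \<in> {x. x + z \<in> A} \<union> B"
      proof (rule ccontr)
        assume "x \<notin> {x. x + z \<in> A} \<union> B"
        hence "\<bar>\<phi> ((x + z) + t $ j *\<^sub>R axis j 1) - \<phi> (x + z)\<bar> \<le> c" "\<bar>\<phi> (x + z) - \<phi> x\<bar> \<le> real (card S) * c"
          by (auto simp: A_def B_def not_less)
        thus False using x by linarith
      qed
    qed
    hence "emeasure lborel {x. real (card (insert j S)) * c < \<bar>\<phi> (x + (\<Sum>i\<in>insert j S. t $ i *\<^sub>R axis i 1)) - \<phi> x\<bar>}
       \<le> emeasure lborel ({x. x + z \<in> A} \<union> B)" by (intro emeasure_mono) auto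
    also have "\<dots> \<le> emeasure lborel {x. x + z \<in> A} + emeasure lborel B" by (intro emeasure_subadditive) auto
    also have "emeasure lborel {x. x + z \<in> A} = emeasure lborel A"
    proof -
      have "(\<integral>\<^sup>+x. indicator A (x + z) \<partial>lborel) = (\<integral>\<^sup>+x. indicator A x \<partial>lborel)" by (rule lborel_nn_integral_shift) simp
      moreover have "(\<integral>\<^sup>+x. indicator A (x + z) \<partial>lborel) = (\<integral>\<^sup>+x. indicator {x. x + z \<in> A} x \<partial>lborel)"
        by (intro nn_integral_cong) (auto simp: indicator_def)
      ultimately show ?thesis by simp
    qed
    also have "emeasure lborel A \<le> ennreal ((\<bar>t $ j\<bar> / c) powr p j)"
      unfolding A_def by (rule axis_increment_measure[OF \<phi> p_pos(3) c \<rho>])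
    also have "emeasure lborel B \<le> ennreal (\<Sum>i\<in>S. (\<bar>t $ i\<bar> / c) powr p i)" using insert unfolding B_def z_def by simp
    finally show ?case using insert by (simp add: ennreal_plus[symmetric] sum_nonneg del: ennreal_plus)
  qed
  from this[of UNIV] show ?thesis using basis_expansion[of t] by (simp add: scalar_mult_eq_scaleR)
qed

definition level_measure :: "(real^'n \<Rightarrow> real) \<Rightarrow> real \<Rightarrow> real" where
  "level_measure \<phi> s = measure lborel {x. s < \<bar>\<phi> x\<bar>}"

lemma domain_borel_measure: "emeasure lborel \<Omega> < \<infinity>" "\<Omega> \<in> sets borel"
  by (rule emeasure_bounded_finite[OF bounded_domain]) (use open_domain in auto)

lemma level_set_emeasure:
  assumes \<phi>: "\<phi> \<in> tests" and s: "0 \<le> s"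
  shows "emeasure lborel {x. s < \<bar>\<phi> x\<bar>} = ennreal (level_measure \<phi> s)" "level_measure \<phi> s \<le> measure lborel \<Omega>"
proof -
  note [measurable] = tests_borel[OF \<phi>]
  have sub: "{x. s < \<bar>\<phi> x\<bar>} \<subseteq> \<Omega>" using test_zero[OF \<phi>] s by force
  have "emeasure lborel {x. s < \<bar>\<phi> x\<bar>} \<le> emeasure lborel \<Omega>" using sub domain_borel_measure by (intro emeasure_mono) auto
  hence "emeasure lborel {x. s < \<bar>\<phi> x\<bar>} < \<infinity>" using domain_borel_measure(1) by (rule le_less_trans)
  thus "emeasure lborel {x. s < \<bar>\<phi> x\<bar>} = ennreal (level_measure \<phi> s)"
    unfolding level_measure_def by (intro emeasure_eq_ennreal_measure) (auto simp: less_top)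
  show "level_measure \<phi> s \<le> measure lborel \<Omega>" unfolding level_measure_def
    using sub domain_borel_measure by (intro measure_mono_fmeasurable) (auto intro: fmeasurableI)
qed

text \<open>Consider translations by the vectors \<open>t\<close> of the box \<open>Q\<close> with
  side lengths \<open>h\<close>. A point \<open>x\<close> with \<open>\<bar>\<phi> x\<bar> >
  s\<close> is moved by at least half of them to a point where \<open>\<bar>\<phi>\<bar> \<le> s /
  2\<close>, because the exceptional vectors have measure \<open>level_measure \<phi> (s /
  2)\<close> at most, which is at most half of the volume of \<open>Q\<close>. On the other hand,
  for a fixed vector the points at which \<open>\<phi>\<close> changes by more than \<open>s /
  2\<close> are controlled by \<open>increment_measure\<close>. Integrating over \<open>x\<close>
  and \<open>t\<close> in both orders yields the claim.\<close>

lemma level_measure_step: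
  assumes \<phi>: "\<phi> \<in> tests" and s: "0 < s" and \<rho>: "\<And>i. (LINT x|lborel. \<bar>partial_deriv i \<phi> x\<bar> powr p i) \<le> 1"
    and h: "\<And>i. 0 < h i" and vol: "2 * level_measure \<phi> (s / 2) \<le> (\<Prod>i\<in>UNIV. h i)"
  shows "level_measure \<phi> s \<le> 2 * (\<Sum>i\<in>UNIV. (2 * real CARD('n) * h i / s) powr p i)"
proof -
  note [measurable] = tests_borel[OF \<phi>]
  define N where "N = real CARD('n)"
  have N: "0 < N" by (simp add: N_def)
  define Q :: "(real^'n) set" where "Q = cbox 0 (\<chi> i. h i)"
  define v where "v = (\<Prod>i\<in>UNIV. h i)"
  have v: "0 < v" unfolding v_def using h by (intro prod_pos) auto
  have Q: "emeasure lborel Q = ennreal v" unfolding Q_def v_def using h by (subst cbox_emeasure_cart) (auto intro: less_imp_le)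
  have [measurable]: "Q \<in> sets borel" by (simp add: Q_def)
  define E where "E = {x. s < \<bar>\<phi> x\<bar>}"
  have [measurable]: "E \<in> sets borel" unfolding E_def by measurable
  define T where "T = (\<Sum>i\<in>UNIV. (2 * N * h i / s) powr p i)"
  have T: "0 \<le> T" by (auto simp: T_def intro: sum_nonneg)
  define k :: "real^'n \<Rightarrow> real^'n \<Rightarrow> ennreal" where "k = (\<lambda>x t. indicator E x * (indicator Q t * indicator {y. \<bar>\<phi> y\<bar> \<le> s / 2} (x + t)))"
  have [measurable]: "{y. \<bar>\<phi> y\<bar> \<le> s / 2} \<in> sets borel" by measurable
  have km: "case_prod k \<in> borel_measurable (lborel \<Otimes>\<^sub>M lborel)" unfolding k_def by measurable
  have upper: "(\<integral>\<^sup>+x. k x t \<partial>lborel) \<le> ennreal T * indicator Q t" for t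
  proof (cases "t \<in> Q")
    case True
    define c where "c = s / (2 * N)"
    have c: "0 < c" using s N by (simp add: c_def)
    have Nc: "N * c = s / 2" using N by (simp add: c_def)
    have "(\<integral>\<^sup>+x. k x t \<partial>lborel) \<le> (\<integral>\<^sup>+x. indicator {x. N * c < \<bar>\<phi> (x + t) - \<phi> x\<bar>} x \<partial>lborel)"
    proof (rule nn_integral_mono)
      fix x
      have "N * c < \<bar>\<phi> (x + t) - \<phi> x\<bar>" if "s < \<bar>\<phi> x\<bar>" "\<bar>\<phi> (x + t)\<bar> \<le> s / 2" using that unfolding Nc by linarith
      thus "k x t \<le> indicator {x. N * c < \<bar>\<phi> (x + t) - \<phi> x\<bar>} x" by (auto simp: k_def E_def indicator_def)
    qed
    also have "\<dots> = emeasure lborel {x. N * c < \<bar>\<phi> (x + t) - \<phi> x\<bar>}" by (rule nn_integral_indicator) simp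
    also have "\<dots> \<le> ennreal (\<Sum>i\<in>UNIV. (\<bar>t $ i\<bar> / c) powr p i)" unfolding N_def by (rule increment_measure[OF \<phi> c \<rho>])
    also have "\<dots> \<le> ennreal T" unfolding T_def
    proof (intro ennreal_leI sum_mono powr_mono2)
      fix i
      have "\<bar>t $ i\<bar> \<le> h i" using True by (auto simp: Q_def mem_box_cart)
      hence "\<bar>t $ i\<bar> / c \<le> h i / c" using c by (intro divide_right_mono) auto
      also have "h i / c = 2 * N * h i / s" by (simp add: c_def)
      finally show "\<bar>t $ i\<bar> / c \<le> 2 * N * h i / s" .
    qed (use c p_pos in auto)
    finally show ?thesis using True by simp
  next
    case False thus ?thesis by (simp add: k_def)
  qed
  have lower: "indicator E x * ennreal (v / 2) \<le> (\<integral>\<^sup>+t. k x t \<partial>lborel)" for x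
  proof (cases "x \<in> E")
    case True
    define A where "A = {t. \<bar>\<phi> (x + t)\<bar> \<le> s / 2}"
    have [measurable]: "A \<in> sets borel" unfolding A_def by measurable
    have "(\<integral>\<^sup>+t. k x t \<partial>lborel) = (\<integral>\<^sup>+t. indicator (Q \<inter> A) t \<partial>lborel)"
      using True by (intro nn_integral_cong) (auto simp: k_def A_def indicator_def)
    hence kA: "(\<integral>\<^sup>+t. k x t \<partial>lborel) = emeasure lborel (Q \<inter> A)" by simp
    have "emeasure lborel (- A) = (\<integral>\<^sup>+t. indicator (- A) t \<partial>lborel)" by simp
    also have "\<dots> = (\<integral>\<^sup>+t. indicator {y. s / 2 < \<bar>\<phi> y\<bar>} (t + x) \<partial>lborel)"
      by (intro nn_integral_cong) (auto simp: A_def indicator_def add.commute)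
    also have "\<dots> = (\<integral>\<^sup>+t. indicator {y. s / 2 < \<bar>\<phi> y\<bar>} t \<partial>lborel)" by (rule lborel_nn_integral_shift) measurable
    also have "\<dots> = ennreal (level_measure \<phi> (s / 2))" using level_set_emeasure(1)[OF \<phi>, of "s / 2"] s by simp
    also have "\<dots> \<le> ennreal (v / 2)" using vol by (intro ennreal_leI) (simp add: v_def)
    finally have cA: "emeasure lborel (- A) \<le> ennreal (v / 2)" .
    have "ennreal v \<le> emeasure lborel ((Q \<inter> A) \<union> - A)" unfolding Q[symmetric] by (intro emeasure_mono) auto
    also have "\<dots> \<le> emeasure lborel (Q \<inter> A) + emeasure lborel (- A)" by (intro emeasure_subadditive) auto
    also have "\<dots> \<le> emeasure lborel (Q \<inter> A) + ennreal (v / 2)" using cA by (intro add_left_mono)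
    finally have "ennreal (v / 2) + ennreal (v / 2) \<le> emeasure lborel (Q \<inter> A) + ennreal (v / 2)"
      using v by (simp add: ennreal_plus[symmetric] del: ennreal_plus)
    hence "ennreal (v / 2) \<le> emeasure lborel (Q \<inter> A)" by (simp add: ennreal_add_left_cancel_le add.commute)
    thus ?thesis using True kA by simp
  next
    case False thus ?thesis by simp
  qed
  have "emeasure lborel E * ennreal (v / 2) = (\<integral>\<^sup>+x. indicator E x * ennreal (v / 2) \<partial>lborel)"
    by (subst nn_integral_multc) auto
  also have "\<dots> \<le> (\<integral>\<^sup>+x. (\<integral>\<^sup>+t. k x t \<partial>lborel) \<partial>lborel)" by (intro nn_integral_mono lower)
  also have "\<dots> = (\<integral>\<^sup>+t. (\<integral>\<^sup>+x. k x t \<partial>lborel) \<partial>lborel)" by (rule lborel_pair.Fubini'[symmetric, OF km])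
  also have "\<dots> \<le> (\<integral>\<^sup>+t. ennreal T * indicator Q t \<partial>lborel)" by (intro nn_integral_mono upper)
  also have "\<dots> = ennreal T * ennreal v" by (subst nn_integral_cmult_indicator) (auto simp: Q)
  finally have "emeasure lborel E * ennreal (v / 2) \<le> ennreal T * ennreal v" .
  moreover have "emeasure lborel E = ennreal (level_measure \<phi> s)"
    using level_set_emeasure(1)[OF \<phi>, of s] s by (simp add: E_def)
  moreover have "ennreal (level_measure \<phi> s * (v / 2)) = ennreal (level_measure \<phi> s) * ennreal (v / 2)"
    using v by (intro ennreal_mult) (auto simp: level_measure_def)
  moreover have "ennreal (T * v) = ennreal T * ennreal v" using v T by (intro ennreal_mult) auto
  ultimately have "ennreal (level_measure \<phi> s * (v / 2)) \<le> ennreal (T * v)" by simp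
  hence "level_measure \<phi> s * (v / 2) \<le> T * v" using T v by (simp add: ennreal_le_iff)
  hence "level_measure \<phi> s \<le> 2 * T" using v by (simp add: field_simps)
  thus ?thesis by (simp add: T_def N_def)
qed

end

text \<open>Locates a value between consecutive powers of 2, for the decomposition of the integral
  of a power into level sets.\<close>

lemma dyadic_level:
  fixes y :: real
  assumes "1 < y"
  obtains k where "2 ^ k < y" "y \<le> 2 ^ Suc k"
proof -
  have ex: "\<exists>k. y \<le> 2 ^ Suc k"
  proof -
    obtain n where "y < 2 ^ n" using real_arch_pow[of 2 y] by auto
    also have "(2::real) ^ n \<le> 2 ^ Suc n" by simp
    finally show ?thesis by (auto intro: less_imp_le)
  qed
  define k where "k = (LEAST k. y \<le> 2 ^ Suc k)"
  have 1: "y \<le> 2 ^ Suc k" unfolding k_def by (rule LeastI_ex[OF ex])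
  have 2: "2 ^ k < y"
  proof (cases k)
    case 0 thus ?thesis using assms by simp
  next
    case (Suc j)
    have "\<not> y \<le> 2 ^ Suc j" using not_less_Least[of j "\<lambda>k. y \<le> 2 ^ Suc k"] Suc unfolding k_def by simp
    thus ?thesis using Suc by simp
  qed
  show ?thesis by (rule that[OF 2 1])
qed

context anisotropic_domain
begin

text \<open>The recursion of \<open>level_measure_step\<close> at the levels \<open>s = 2 ^ Suc
  k\<close>, with the box whose sides are proportional to \<open>\<tau> powr (1 / p i)\<close>:
  then all summands equal \<open>\<tau>\<close>, and the prescribed volume \<open>v\<close>
  determines \<open>\<tau>\<close>. With \<open>\<sigma> = (\<Sum>i. 1 / p i)\<close> the
  recursion takes the form that the new measure is at most a constant times \<open>(v * s powr (-
  CARD('n))) powr (1 / \<sigma>)\<close>. The decay rate \<open>ps\<close> is reproduced exactly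
  if \<open>(ps + CARD('n)) / \<sigma> = ps\<close>, the defining equation of the critical
  exponent.\<close>

lemma level_measure_decay:
  assumes \<sigma>1: "1 < (\<Sum>i\<in>UNIV. 1 / p i)"
  obtains K where "0 < K" "\<And>\<phi> k. \<phi> \<in> tests \<Longrightarrow> (\<And>i. (LINT x|lborel. \<bar>partial_deriv i \<phi> x\<bar> powr p i) \<le> 1) \<Longrightarrow>
     level_measure \<phi> (2 ^ k) \<le> K * 2 powr (- critical_exponent p * real k)"
proof -
  define \<sigma> where "\<sigma> = (\<Sum>i\<in>UNIV. 1 / p i)"
  define n where "n = CARD('n)"
  define N where "N = real n"
  define ps where "ps = critical_exponent p"
  have \<sigma>: "1 < \<sigma>" using \<sigma>1 by (simp add: \<sigma>_def)
  have N: "1 \<le> N" by (simp add: N_def n_def Suc_leI)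
  have psn: "ps + N = \<sigma> * ps" using \<sigma> unfolding ps_def critical_exponent_def \<sigma>_def[symmetric] N_def n_def by (simp add: field_simps)
  define A where "A = 2 * 2 powr ps * (2 * N) ^ n"
  have A: "0 < A" using N by (simp add: A_def)
  define B where "B = 2 * N * A powr (1 / \<sigma>)"
  have B: "0 < B" using N A by (simp add: B_def)
  \<comment> \<open>The first entry starts the induction at level 1; the second one makes the
    constant reproduce itself, as \<open>1 / \<sigma> < 1\<close> leaves a positive power of
    \<open>K\<close> to spare.\<close>
  define K where "K = max (measure lborel \<Omega> + 1) (B powr (\<sigma> / (\<sigma> - 1)))"
  have K: "0 < K" "measure lborel \<Omega> \<le> K" by (auto simp: K_def add_nonneg_pos intro: less_max_iff_disj[THEN iffD2])
  have KB: "2 * N * (A * K) powr (1 / \<sigma>) \<le> K"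
  proof -
    have "B = (B powr (\<sigma> / (\<sigma> - 1))) powr ((\<sigma> - 1) / \<sigma>)" using \<sigma> B by (simp add: powr_powr)
    also have "\<dots> \<le> K powr ((\<sigma> - 1) / \<sigma>)" using \<sigma> by (intro powr_mono2) (auto simp: K_def)
    finally have "K powr (1 / \<sigma>) * B \<le> K powr (1 / \<sigma>) * K powr ((\<sigma> - 1) / \<sigma>)" by (intro mult_left_mono) auto
    also have "\<dots> = K powr (1 / \<sigma> + (\<sigma> - 1) / \<sigma>)" by (rule powr_add[symmetric])
    also have "1 / \<sigma> + (\<sigma> - 1) / \<sigma> = 1" using \<sigma> by (simp add: field_simps)
    finally show ?thesis using K by (simp add: B_def powr_mult mult_ac)
  qed
  have "level_measure \<phi> (2 ^ k) \<le> K * 2 powr (- ps * real k)"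
    if \<phi>: "\<phi> \<in> tests" and \<rho>: "\<And>i. (LINT x|lborel. \<bar>partial_deriv i \<phi> x\<bar> powr p i) \<le> 1" for \<phi> k
  proof (induction k)
    case 0
    show ?case using level_set_emeasure(2)[OF \<phi>, of 1] K by simp
  next
    case (Suc k)
    define s :: real where "s = 2 ^ Suc k"
    have s: "0 < s" "s / 2 = 2 ^ k" by (auto simp: s_def)
    define v where "v = 2 * (K * 2 powr (- ps * real k))"
    have v: "0 < v" using K by (simp add: v_def)
    define \<tau> where "\<tau> = (v * (2 * N / s) ^ n) powr (1 / \<sigma>)"
    have \<tau>: "0 < \<tau>" using v N s by (simp add: \<tau>_def)
    have \<tau>\<sigma>: "\<tau> powr \<sigma> = v * (2 * N / s) ^ n" using \<sigma> v N s by (simp add: \<tau>_def powr_powr)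
    define h where "h = (\<lambda>i. s / (2 * N) * \<tau> powr (1 / p i))"
    have h: "0 < h i" for i using s N \<tau> by (simp add: h_def)
    have "(\<Prod>i\<in>UNIV. h i) = (s / (2 * N)) ^ n * (\<Prod>i\<in>UNIV. \<tau> powr (1 / p i))"
      unfolding h_def prod.distrib by (simp add: n_def)
    also have "(\<Prod>i\<in>UNIV. \<tau> powr (1 / p i)) = \<tau> powr \<sigma>" unfolding \<sigma>_def using \<tau> by (simp add: powr_sum)
    also have "(s / (2 * N)) ^ n * \<tau> powr \<sigma> = v * ((s / (2 * N)) ^ n * (2 * N / s) ^ n)" by (simp add: \<tau>\<sigma>)
    also have "(s / (2 * N)) ^ n * (2 * N / s) ^ n = 1" using s N by (simp add: power_mult_distrib[symmetric])
    finally have vol: "(\<Prod>i\<in>UNIV. h i) = v" by simp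
    have "level_measure \<phi> s \<le> 2 * (\<Sum>i\<in>UNIV. (2 * real CARD('n) * h i / s) powr p i)"
      by (rule level_measure_step[OF \<phi> s(1) \<rho> h]) (use Suc.IH in \<open>simp add: vol v_def s\<close>)
    also have "(2 * real CARD('n) * h i / s) powr p i = \<tau>" for i
    proof -
      have "2 * real CARD('n) * h i / s = \<tau> powr (1 / p i)" using s N by (simp add: h_def N_def n_def)
      thus ?thesis using \<tau> p_pos(1)[of i] by (simp add: powr_powr)
    qed
    hence "2 * (\<Sum>i\<in>UNIV. (2 * real CARD('n) * h i / s) powr p i) = 2 * N * \<tau>" by (simp add: N_def n_def)
    also have "\<tau> = (A * K) powr (1 / \<sigma>) * 2 powr (- ps * real (Suc k))"
    proof -
      have "v * (2 * N / s) ^ n = A * K * (2 powr (- ps * real (Suc k)) * (1 / s) ^ n)"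
      proof -
        have "2 powr (- ps * real k) = 2 powr ps * 2 powr (- ps * real (Suc k))"
          by (simp add: powr_add[symmetric] algebra_simps)
        thus ?thesis by (simp add: v_def A_def power_divide power_mult_distrib)
      qed
      also have "(1 / s) ^ n = 2 powr (- N * real (Suc k))"
        by (simp add: s_def N_def powr_minus powr_realpow[symmetric] power_one_over inverse_eq_divide powr_powr mult.commute del: power_Suc of_nat_Suc)
      also have "2 powr (- ps * real (Suc k)) * 2 powr (- N * real (Suc k)) = 2 powr (- \<sigma> * ps * real (Suc k))"
        by (simp add: powr_add[symmetric] psn[symmetric] algebra_simps del: of_nat_Suc)
      finally have "\<tau> = (A * K) powr (1 / \<sigma>) * (2 powr (- \<sigma> * ps * real (Suc k))) powr (1 / \<sigma>)"
        by (simp add: \<tau>_def powr_mult)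
      also have "(2 powr (- \<sigma> * ps * real (Suc k))) powr (1 / \<sigma>) = 2 powr (- ps * real (Suc k))"
        using \<sigma> by (simp add: powr_powr del: of_nat_Suc)
      finally show ?thesis .
    qed
    also have "2 * N * ((A * K) powr (1 / \<sigma>) * 2 powr (- ps * real (Suc k))) \<le> K * 2 powr (- ps * real (Suc k))"
      using KB by (simp add: mult.assoc[symmetric])
    finally show ?case by (simp add: s_def)
  qed
  thus ?thesis using K(1) by (intro that[of K]) (auto simp: ps_def)
qed

text \<open>Sum the decay of the level sets over dyadic levels: the series is geometric with ratio
  \<open>2 powr (q - critical_exponent p) < 1\<close>.\<close>

lemma tests_embedding:
  assumes \<sigma>: "1 < (\<Sum>i\<in>UNIV. 1 / p i)" and q: "0 < q" "q < critical_exponent p"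
  obtains C where "\<And>\<phi>. \<phi> \<in> tests \<Longrightarrow> (\<And>i. modular i \<phi> \<le> 1) \<Longrightarrow> (LINT x|M. \<bar>\<phi> x\<bar> powr q) \<le> C"
proof -
  define ps where "ps = critical_exponent p"
  obtain K where K: "0 < K" "\<And>\<phi> k. \<phi> \<in> tests \<Longrightarrow> (\<And>i. (LINT x|lborel. \<bar>partial_deriv i \<phi> x\<bar> powr p i) \<le> 1) \<Longrightarrow>
     level_measure \<phi> (2 ^ k) \<le> K * 2 powr (- ps * real k)"
    unfolding ps_def by (rule level_measure_decay[OF \<sigma>]) blast
  define r where "r = 2 powr (q - ps)"
  have r: "0 \<le> r" "r < 1" using q powr_less_mono[of "q - ps" 0 2] by (auto simp: r_def ps_def)
  define C where "C = measure lborel \<Omega> + 2 powr q * K * (1 / (1 - r))"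
  have "(LINT x|M. \<bar>\<phi> x\<bar> powr q) \<le> C" if \<phi>: "\<phi> \<in> tests" and m: "\<And>i. modular i \<phi> \<le> 1" for \<phi>
  proof -
    note [measurable] = tests_borel[OF \<phi>]
    have \<Omega>b[measurable]: "\<Omega> \<in> sets borel" by (rule domain_borel_measure)
    have \<rho>: "(LINT x|lborel. \<bar>partial_deriv i \<phi> x\<bar> powr p i) \<le> 1" for i
      using m[of i] modular_eq[OF tests_has_gradient[OF \<phi>], of i] tests_lborel_integral(1)[OF tests_partial_deriv[OF \<phi>, of i], of "p i"] by simp
    define T where "T = (\<lambda>(k::nat) x. ennreal (2 powr (q * real (Suc k))) * indicator {x. 2 ^ k < \<bar>\<phi> x\<bar>} x)"
    have [measurable]: "T k \<in> borel_measurable lborel" for k unfolding T_def by measurable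
    have pt: "ennreal (\<bar>\<phi> x\<bar> powr q) \<le> indicator \<Omega> x + (\<Sum>k. T k x)" for x
    proof (cases "\<bar>\<phi> x\<bar> \<le> 1")
      case True
      show ?thesis
      proof (cases "x \<in> \<Omega>")
        case True
        have "\<bar>\<phi> x\<bar> powr q \<le> 1 powr q" using \<open>\<bar>\<phi> x\<bar> \<le> 1\<close> q by (intro powr_mono2) auto
        hence "ennreal (\<bar>\<phi> x\<bar> powr q) \<le> 1" by (simp add: ennreal_le_1)
        thus ?thesis using True by (simp add: add_increasing2)
      next
        case False thus ?thesis using test_zero[OF \<phi>] by simp
      qed
    next
      case False
      then obtain k where k: "2 ^ k < \<bar>\<phi> x\<bar>" "\<bar>\<phi> x\<bar> \<le> 2 ^ Suc k" using dyadic_level[of "\<bar>\<phi> x\<bar>"] by auto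
      have "\<bar>\<phi> x\<bar> powr q \<le> (2 ^ Suc k) powr q" using k q by (intro powr_mono2) auto
      also have "(2 ^ Suc k) powr q = 2 powr (q * real (Suc k))"
        by (simp add: powr_realpow[symmetric] powr_powr mult.commute del: power_Suc of_nat_Suc)
      finally have "ennreal (\<bar>\<phi> x\<bar> powr q) \<le> T k x" using k(1) by (simp add: T_def ennreal_leI del: of_nat_Suc)
      also have "T k x \<le> (\<Sum>k. T k x)" using sum_le_suminf[of "\<lambda>k. T k x" "{k}"] by (simp add: summableI)
      finally show ?thesis by (simp add: add_increasing)
    qed
    have "ennreal (LINT x|M. \<bar>\<phi> x\<bar> powr q) = (\<integral>\<^sup>+x. ennreal (\<bar>\<phi> x\<bar> powr q) \<partial>lborel)"
      using test_powr_integrable[OF \<phi> q(1)] tests_lborel_integral(1)[OF \<phi>, of q] by (subst nn_integral_eq_integral) auto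
    also have "\<dots> \<le> (\<integral>\<^sup>+x. indicator \<Omega> x + (\<Sum>k. T k x) \<partial>lborel)" by (intro nn_integral_mono pt)
    also have "\<dots> = emeasure lborel \<Omega> + (\<Sum>k. \<integral>\<^sup>+x. T k x \<partial>lborel)"
      by (subst nn_integral_add) (auto simp: nn_integral_suminf)
    also have "(\<Sum>k. \<integral>\<^sup>+x. T k x \<partial>lborel) \<le> (\<Sum>k. ennreal (2 powr q * K * r ^ k))"
    proof (intro suminf_le)
      fix k
      have "(\<integral>\<^sup>+x. T k x \<partial>lborel) = ennreal (2 powr (q * real (Suc k))) * ennreal (level_measure \<phi> (2 ^ k))"
        unfolding T_def using level_set_emeasure(1)[OF \<phi>, of "2 ^ k"] by (subst nn_integral_cmult_indicator) (auto simp del: of_nat_Suc)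
      also have "\<dots> \<le> ennreal (2 powr (q * real (Suc k))) * ennreal (K * 2 powr (- ps * real k))"
        by (intro mult_left_mono ennreal_leI K(2)[OF \<phi> \<rho>]) auto
      also have "\<dots> = ennreal (2 powr (q * real (Suc k)) * (K * 2 powr (- ps * real k)))"
        using K(1) by (intro ennreal_mult[symmetric]) auto
      also have "2 powr (q * real (Suc k)) * (K * 2 powr (- ps * real k)) = 2 powr q * K * (2 powr (q * real k) * 2 powr (- ps * real k))"
        by (simp add: powr_add algebra_simps)
      also have "2 powr (q * real k) * 2 powr (- ps * real k) = r ^ k"
        unfolding r_def by (simp add: powr_add[symmetric] powr_realpow[symmetric] powr_powr algebra_simps)
      finally show "(\<integral>\<^sup>+x. T k x \<partial>lborel) \<le> ennreal (2 powr q * K * r ^ k)" .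
    qed auto
    also have "\<dots> = ennreal (\<Sum>k. 2 powr q * K * r ^ k)"
      using r K by (intro suminf_ennreal2 summable_mult summable_geometric) auto
    also have "(\<Sum>k. 2 powr q * K * r ^ k) = 2 powr q * K * (1 / (1 - r))"
      using r by (subst suminf_mult) (auto simp: suminf_geometric summable_geometric)
    also have "emeasure lborel \<Omega> = ennreal (measure lborel \<Omega>)"
      using domain_borel_measure(1) by (intro emeasure_eq_ennreal_measure) (simp add: less_top)
    also have "ennreal (measure lborel \<Omega>) + ennreal (2 powr q * K * (1 / (1 - r))) = ennreal C"
      unfolding C_def using r K by (intro ennreal_plus[symmetric]) auto
    finally have "ennreal (LINT x|M. \<bar>\<phi> x\<bar> powr q) \<le> ennreal C" by (simp add: add_left_mono)
    moreover have "0 \<le> C" unfolding C_def using r K by (intro add_nonneg_nonneg mult_nonneg_nonneg) auto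
    ultimately show ?thesis by (simp add: ennreal_le_iff)
  qed
  thus ?thesis using that by blast
qed

text \<open>Approximating test functions may have modulars slightly above 1. Halving them brings
  the modulars below 1, as \<open>p i \<ge> 1\<close>, at the price of the factor \<open>2 powr
  q\<close>.\<close>

lemma space_embedding:
  assumes \<sigma>: "1 < (\<Sum>i\<in>UNIV. 1 / p i)" and q: "0 < q" "q < critical_exponent p"
  shows "\<exists>K. \<forall>u g. has_gradient u g \<longrightarrow> (\<forall>i. modular i u \<le> 1) \<longrightarrow>
           integrable M (\<lambda>x. \<bar>u x\<bar> powr q) \<and> (LINT x|M. \<bar>u x\<bar> powr q) \<le> K"
proof -
  obtain C where C: "\<And>\<phi>. \<phi> \<in> tests \<Longrightarrow> (\<And>i. modular i \<phi> \<le> 1) \<Longrightarrow> (LINT x|M. \<bar>\<phi> x\<bar> powr q) \<le> C"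
    by (rule tests_embedding[OF assms]) blast
  have "integrable M (\<lambda>x. \<bar>u x\<bar> powr q) \<and> (LINT x|M. \<bar>u x\<bar> powr q) \<le> 2 powr q * C"
    if u: "has_gradient u g" and m: "\<And>i. modular i u \<le> 1" for u g
  proof -
    have "\<exists>\<phi>. \<phi> \<in> tests \<and> (LINT x|M. \<bar>\<phi> x - u x\<bar>) < 1 / real (Suc n) \<and> (\<forall>i. \<bar>modular i \<phi> - modular i u\<bar> < 1)" for n
      by (rule test_approximation[OF u, of "1 / real (Suc n)"]) (force intro: less_le_trans simp del: of_nat_Suc)+
    then obtain \<phi> where \<phi>: "\<And>n. \<phi> n \<in> tests" "\<And>n. (LINT x|M. \<bar>\<phi> n x - u x\<bar>) < 1 / real (Suc n)" "\<And>n i. \<bar>modular i (\<phi> n) - modular i u\<bar> < 1"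
      by metis
    have L1: "(\<lambda>n. LINT x|M. \<bar>\<phi> n x - u x\<bar>) \<longlonglongrightarrow> 0"
    proof (rule tendsto_sandwich[OF _ _ tendsto_const LIMSEQ_Suc[OF lim_inverse_n']])
      show "\<forall>\<^sub>F n in sequentially. (LINT x|M. \<bar>\<phi> n x - u x\<bar>) \<le> 1 / real (Suc n)"
        by (intro always_eventually allI less_imp_le \<phi>(2))
    qed simp
    have b: "(LINT x|M. \<bar>\<phi> n x\<bar> powr q) \<le> 2 powr q * C" for n
    proof -
      have t: "(\<lambda>x. 1/2 * \<phi> n x) \<in> tests" using tests_add[OF \<phi>(1)[of n] \<phi>(1)[of n], of "1/2" 0] by simp
      have e: "\<bar>1/2 * y\<bar> powr r = (1/2) powr r * \<bar>y\<bar> powr r" for y r :: real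
      proof -
        have "\<bar>1/2 * y\<bar> = (1/2) * \<bar>y\<bar>" by (simp add: abs_mult)
        thus ?thesis by (simp only: powr_mult)
      qed
      have "modular i (\<lambda>x. 1/2 * \<phi> n x) \<le> 1" for i
      proof -
        have "partial_deriv i (\<lambda>x. 1/2 * \<phi> n x) = (\<lambda>x. 1/2 * partial_deriv i (\<phi> n) x)"
          using tests_partial_deriv_add[OF \<phi>(1)[of n] \<phi>(1)[of n], of i "1/2" 0] by simp
        hence "modular i (\<lambda>x. 1/2 * \<phi> n x) = (1/2) powr p i * modular i (\<phi> n)"
          unfolding modular_eq[OF tests_has_gradient[OF t]] modular_eq[OF tests_has_gradient[OF \<phi>(1)]]
          by (simp only: e integral_mult_right_zero)
        also have "\<dots> \<le> (1/2) powr 1 * 2"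
          using \<phi>(3)[where n=n and i=i] m[of i] p_pos(3)[of i] modular_nonneg[of i "\<phi> n"] by (intro mult_mono powr_mono') auto
        finally show ?thesis by simp
      qed
      from C[OF t this] have "(1/2) powr q * (LINT x|M. \<bar>\<phi> n x\<bar> powr q) \<le> C" by (simp only: e integral_mult_right_zero)
      hence "2 powr q * ((1/2) powr q * (LINT x|M. \<bar>\<phi> n x\<bar> powr q)) \<le> 2 powr q * C" by (intro mult_left_mono) auto
      moreover have "2 powr q * (1/2) powr q = (1::real)" unfolding powr_mult[symmetric] by simp
      ultimately show ?thesis by (simp add: mult.assoc[symmetric])
    qed
    show ?thesis
      using integral_powr_le_if_L1_limit[OF q(1) tests_integrable[OF \<phi>(1)] has_gradientD(1)[OF u] L1 tests_powr_integrable[OF \<phi>(1) q(1)] b]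
      by blast
  qed
  thus ?thesis by blast
qed

section \<open>Compactness and nontriviality\<close>

lemma L1_Cauchy_limit:
  fixes v :: "nat \<Rightarrow> real^'n \<Rightarrow> real"
  assumes i: "\<And>n. integrable M (v n)"
    and C: "\<And>e. 0 < e \<Longrightarrow> \<exists>N. \<forall>m\<ge>N. \<forall>n\<ge>N. (LINT x|M. \<bar>v m x - v n x\<bar>) < e"
  obtains w where "integrable M w" "(\<lambda>n. LINT x|M. \<bar>v n x - w x\<bar>) \<longlonglongrightarrow> 0"
proof (rule powr_complete[of 1 v M])
  fix g :: "real^'n \<Rightarrow> real"
  assume g: "g \<in> borel_measurable M" "integrable M (\<lambda>x. \<bar>g x\<bar> powr 1)" "(\<lambda>n. LINT x|M. \<bar>v n x - g x\<bar> powr 1) \<longlonglongrightarrow> 0"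
  have "integrable M g" by (rule integrable_if_powr_integrable[OF _ g(1,2)]) simp
  thus ?thesis using that g(3) by simp
qed (use i C in auto)

text \<open>The averages over the cubes \<open>Q k\<close> of side length \<open>1 / Suc k\<close>
  are close to the functions in \<open>L\<^sup>1\<close>, uniformly in \<open>n\<close>. For fixed
  \<open>k\<close> they are uniformly bounded and uniformly Lipschitz continuous, so that a
  diagonal subsequence converges at all points. Along it the averages converge in
  \<open>L\<^sup>1\<close> by dominated convergence, and the functions form a Cauchy sequence.\<close>

lemma tests_L1_compact:
  fixes \<phi> :: "nat \<Rightarrow> real^'n \<Rightarrow> real"
  assumes \<phi>: "\<And>n. \<phi> n \<in> tests" and B: "\<And>n i. (LINT x|lborel. \<bar>partial_deriv i (\<phi> n) x\<bar>) \<le> B"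
  obtains r :: "nat \<Rightarrow> nat" and w where "strict_mono r" "integrable M w" "(\<lambda>n. LINT x|M. \<bar>\<phi> (r n) x - w x\<bar>) \<longlonglongrightarrow> 0"
proof -
  note [measurable] = tests_borel[OF \<phi>]
  \<comment> \<open>\<open>undefined\<close> stands for an arbitrary coordinate; at least one
    exists.\<close>
  have B0: "0 \<le> B" using B[of undefined 0] by (rule order_trans[rotated]) simp
  define N where "N = real CARD('n)"
  have N: "0 < N" by (simp add: N_def)
  obtain C0 where C0: "0 \<le> C0" "\<And>\<phi> i. \<phi> \<in> tests \<Longrightarrow> (LINT x|lborel. \<bar>\<phi> x\<bar>) \<le> C0 * (LINT x|lborel. \<bar>partial_deriv i \<phi> x\<bar>)"
    by (rule tests_poincare) blast
  define C where "C = C0 * B"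
  have C: "(LINT x|lborel. \<bar>\<phi> n x\<bar>) \<le> C" for n
    using C0(2)[OF \<phi>, of n undefined] mult_left_mono[OF B C0(1), of undefined n] by (simp add: C_def)
  have i\<phi>: "integrable lborel (\<phi> n)" for n by (rule test_integrable[OF \<phi>])
  have trans: "(\<integral>\<^sup>+x. ennreal \<bar>\<phi> n (x + t) - \<phi> n x\<bar> \<partial>lborel) \<le> ennreal (N * B * norm t)" for n t
  proof -
    have "(\<Sum>i\<in>UNIV. \<bar>t $ i\<bar> * (LINT x|lborel. \<bar>partial_deriv i (\<phi> n) x\<bar>)) \<le> (\<Sum>i\<in>(UNIV::'n set). norm t * B)"
      by (intro sum_mono mult_mono B component_le_norm_cart) auto
    also have "\<dots> = N * B * norm t" by (simp add: N_def)
    finally show ?thesis using tests_translation_L1[OF \<phi>, of n t] by (meson ennreal_leI order_trans)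
  qed
  define Q :: "nat \<Rightarrow> (real^'n) set" where "Q = (\<lambda>k. cbox 0 (\<chi> i. 1 / real (Suc k)))"
  define v where "v = (\<lambda>k. (1 / real (Suc k)) ^ CARD('n))"
  have v: "0 < v k" for k by (simp add: v_def)
  have Q: "emeasure lborel (Q k) = ennreal (v k)" for k unfolding Q_def v_def by (subst cbox_emeasure_cart) auto
  have [measurable]: "Q k \<in> sets borel" for k by (simp add: Q_def)
  have Qn: "norm t \<le> N * (1 / real (Suc k))" if "t \<in> Q k" for t k
  proof -
    have "norm t \<le> (\<Sum>i\<in>UNIV. \<bar>t $ i\<bar>)" by (rule norm_le_l1_cart)
    also have "\<dots> \<le> (\<Sum>i\<in>(UNIV::'n set). 1 / real (Suc k))"
      using that by (intro sum_mono) (auto simp: Q_def mem_box_cart simp del: of_nat_Suc)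
    finally show ?thesis by (simp add: N_def)
  qed
  \<comment> \<open>Averages without the normalizing factor \<open>1 / v k\<close>, to be compared
    with \<open>v k * \<phi> n\<close>.\<close>
  define J where "J = (\<lambda>n k x. LINT t|lborel. indicator (Q k) t * \<phi> n (x + t))"
  have shift: "integrable lborel (\<lambda>t. \<phi> n (x + t))" for n x
    using lborel_integrable_shift[OF i\<phi>, of n x] by (simp add: add.commute)
  have iJ: "integrable lborel (\<lambda>t. indicator (Q k) t * \<phi> n (x + t))" for n k x
    using integrable_mult_indicator[OF _ shift, of "Q k" n x] by simp
  have Jb: "\<bar>J n k x\<bar> \<le> C" for n k x
  proof -
    have "\<bar>J n k x\<bar> \<le> (LINT t|lborel. \<bar>indicator (Q k) t * \<phi> n (x + t)\<bar>)" unfolding J_def by (rule integral_abs_bound)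
    also have "\<dots> \<le> (LINT t|lborel. \<bar>\<phi> n (x + t)\<bar>)"
      by (rule integral_mono) (use iJ shift in \<open>auto simp: indicator_def\<close>)
    also have "\<dots> = (LINT t|lborel. \<bar>\<phi> n t\<bar>)" using lborel_integral_shift[of "\<lambda>t. \<bar>\<phi> n t\<bar>" x] by (simp add: add.commute)
    finally show ?thesis using C[of n] by simp
  qed
  have Jlip: "\<bar>J n k x - J n k y\<bar> \<le> N * B * norm (x - y)" for n k x y
  proof -
    have id: "integrable lborel (\<lambda>t. \<bar>\<phi> n (x + t) - \<phi> n (y + t)\<bar>)" using shift by auto
    have "\<bar>J n k x - J n k y\<bar> = \<bar>LINT t|lborel. indicator (Q k) t * \<phi> n (x + t) - indicator (Q k) t * \<phi> n (y + t)\<bar>"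
      unfolding J_def using iJ by simp
    also have "\<dots> \<le> (LINT t|lborel. \<bar>indicator (Q k) t * \<phi> n (x + t) - indicator (Q k) t * \<phi> n (y + t)\<bar>)" by (rule integral_abs_bound)
    also have "\<dots> \<le> (LINT t|lborel. \<bar>\<phi> n (x + t) - \<phi> n (y + t)\<bar>)"
      by (rule integral_mono) (use iJ id in \<open>auto simp: indicator_def\<close>)
    finally have "ennreal \<bar>J n k x - J n k y\<bar> \<le> ennreal (LINT t|lborel. \<bar>\<phi> n (x + t) - \<phi> n (y + t)\<bar>)" by (rule ennreal_leI)
    also have "\<dots> = (\<integral>\<^sup>+t. ennreal \<bar>\<phi> n (x + t) - \<phi> n (y + t)\<bar> \<partial>lborel)"
      by (rule nn_integral_eq_integral[symmetric, OF id]) auto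
    also have "\<dots> = (\<integral>\<^sup>+t. (\<lambda>z. ennreal \<bar>\<phi> n (z + (x - y)) - \<phi> n z\<bar>) (t + y) \<partial>lborel)"
      by (intro nn_integral_cong) (simp add: algebra_simps)
    also have "\<dots> = (\<integral>\<^sup>+z. ennreal \<bar>\<phi> n (z + (x - y)) - \<phi> n z\<bar> \<partial>lborel)"
      by (rule lborel_nn_integral_shift) measurable
    also have "\<dots> \<le> ennreal (N * B * norm (x - y))" by (rule trans)
    finally show ?thesis using N B0 by (simp add: ennreal_le_iff)
  qed
  have Jc: "continuous_on UNIV (J n k)" for n k
  proof (rule continuous_on_iff[THEN iffD2], intro ballI allI impI)
    fix x :: "real^'n" and e :: real assume e: "0 < e"
    have "dist (J n k y) (J n k x) < e" if "dist y x < e / (N * B + 1)" for y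
    proof -
      have "\<bar>J n k y - J n k x\<bar> \<le> N * B * norm (y - x)" by (rule Jlip)
      also have "\<dots> \<le> (N * B + 1) * norm (y - x)" by (intro mult_right_mono) auto
      also have "\<dots> < e"
      proof -
        have "0 < N * B + 1" using N B0 by (simp add: add_nonneg_pos)
        thus ?thesis using that by (simp only: dist_norm pos_less_divide_eq mult.commute)
      qed
      finally show ?thesis by (simp add: dist_real_def)
    qed
    thus "\<exists>d>0. \<forall>y\<in>UNIV. dist y x < d \<longrightarrow> dist (J n k y) (J n k x) < e"
      using e N B0 by (intro exI[of _ "e / (N * B + 1)"]) (auto intro!: divide_pos_pos add_nonneg_pos)
  qed
  have JM: "J n k \<in> borel_measurable M" for n k by (intro lebesgue_on_measurable borel_measurable_continuous_onI Jc)
  have Jclose: "(LINT x|M. \<bar>J n k x - v k * \<phi> n x\<bar>) \<le> v k * (N * B * (N * (1 / real (Suc k))))" for n k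
  proof -
    define b where "b = N * B * (N * (1 / real (Suc k)))"
    have b: "0 \<le> b" using N B0 by (simp add: b_def)
    have ivv: "integrable lborel (\<lambda>t. indicator (Q k) t * c)" for c :: real
      using Q[of k] by (intro integrable_mult_left integrable_real_indicator) (auto simp: less_top)
    have pt: "ennreal \<bar>J n k x - v k * \<phi> n x\<bar> \<le> (\<integral>\<^sup>+t. indicator (Q k) t * ennreal \<bar>\<phi> n (x + t) - \<phi> n x\<bar> \<partial>lborel)" for x
    proof -
      have "v k = (LINT t|lborel. indicator (Q k) t)" using Q[of k] v[of k] by (simp add: measure_def)
      hence vphi: "v k * \<phi> n x = (LINT t|lborel. indicator (Q k) t * \<phi> n x)" by simp
      have "(LINT t|lborel. indicator (Q k) t * \<phi> n (x + t) - indicator (Q k) t * \<phi> n x) = J n k x - v k * \<phi> n x"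
        unfolding J_def vphi by (rule Bochner_Integration.integral_diff[OF iJ ivv])
      hence "\<bar>J n k x - v k * \<phi> n x\<bar> = \<bar>LINT t|lborel. indicator (Q k) t * \<phi> n (x + t) - indicator (Q k) t * \<phi> n x\<bar>"
        by (simp only:)
      also have "\<dots> \<le> (LINT t|lborel. \<bar>indicator (Q k) t * \<phi> n (x + t) - indicator (Q k) t * \<phi> n x\<bar>)" by (rule integral_abs_bound)
      finally have "ennreal \<bar>J n k x - v k * \<phi> n x\<bar> \<le> ennreal (LINT t|lborel. \<bar>indicator (Q k) t * \<phi> n (x + t) - indicator (Q k) t * \<phi> n x\<bar>)"
        by (rule ennreal_leI)
      also have "\<dots> = (\<integral>\<^sup>+t. ennreal \<bar>indicator (Q k) t * \<phi> n (x + t) - indicator (Q k) t * \<phi> n x\<bar> \<partial>lborel)"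
        using iJ ivv by (intro nn_integral_eq_integral[symmetric]) auto
      also have "\<dots> = (\<integral>\<^sup>+t. indicator (Q k) t * ennreal \<bar>\<phi> n (x + t) - \<phi> n x\<bar> \<partial>lborel)"
        by (intro nn_integral_cong) (auto simp: indicator_def)
      finally show ?thesis .
    qed
    have i1: "integrable M (\<lambda>x. J n k x - v k * \<phi> n x)"
    proof (rule Bochner_Integration.integrable_diff)
      show "integrable M (J n k)" using Jb JM by (intro integrable_const_bound[where B = C]) auto
      show "integrable M (\<lambda>x. v k * \<phi> n x)" using tests_integrable[OF \<phi>] by simp
    qed
    have Jbor[measurable]: "J n k \<in> borel_measurable borel" by (intro borel_measurable_continuous_onI Jc)
    have "ennreal (LINT x|M. \<bar>J n k x - v k * \<phi> n x\<bar>) = (\<integral>\<^sup>+x. ennreal \<bar>J n k x - v k * \<phi> n x\<bar> \<partial>M)"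
      using i1 by (intro nn_integral_eq_integral[symmetric]) auto
    also have "\<dots> = (\<integral>\<^sup>+x. ennreal \<bar>J n k x - v k * \<phi> n x\<bar> * indicator \<Omega> x \<partial>lebesgue)"
      using domain_measurable by (intro nn_integral_restrict_space) auto
    also have "\<dots> \<le> (\<integral>\<^sup>+x. ennreal \<bar>J n k x - v k * \<phi> n x\<bar> \<partial>lebesgue)" by (intro nn_integral_mono) (auto simp: indicator_def)
    also have "\<dots> = (\<integral>\<^sup>+x. ennreal \<bar>J n k x - v k * \<phi> n x\<bar> \<partial>lborel)" by (rule nn_integral_completion)
    also have "\<dots> \<le> (\<integral>\<^sup>+x. (\<integral>\<^sup>+t. indicator (Q k) t * ennreal \<bar>\<phi> n (x + t) - \<phi> n x\<bar> \<partial>lborel) \<partial>lborel)"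
      by (intro nn_integral_mono pt)
    also have "\<dots> = (\<integral>\<^sup>+t. (\<integral>\<^sup>+x. indicator (Q k) t * ennreal \<bar>\<phi> n (x + t) - \<phi> n x\<bar> \<partial>lborel) \<partial>lborel)"
      by (rule lborel_pair.Fubini'[symmetric]) (simp add: split_beta')
    also have "\<dots> \<le> (\<integral>\<^sup>+t. ennreal b * indicator (Q k) t \<partial>lborel)"
    proof (rule nn_integral_mono)
      fix t
      show "(\<integral>\<^sup>+x. indicator (Q k) t * ennreal \<bar>\<phi> n (x + t) - \<phi> n x\<bar> \<partial>lborel) \<le> ennreal b * indicator (Q k) t"
      proof (cases "t \<in> Q k")
        case True
        have "N * B * norm t \<le> b" unfolding b_def using Qn[OF True] N B0 by (intro mult_left_mono) auto
        hence "(\<integral>\<^sup>+x. ennreal \<bar>\<phi> n (x + t) - \<phi> n x\<bar> \<partial>lborel) \<le> ennreal b" using trans[of n t] by (meson ennreal_leI order_trans)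
        thus ?thesis using True by simp
      next
        case False thus ?thesis by simp
      qed
    qed
    also have "\<dots> = ennreal b * ennreal (v k)" by (subst nn_integral_cmult_indicator) (auto simp: Q)
    also have "\<dots> = ennreal (b * v k)" using b v[of k] by (intro ennreal_mult[symmetric]) auto
    finally have "(LINT x|M. \<bar>J n k x - v k * \<phi> n x\<bar>) \<le> b * v k" by (rule ennreal_le_iff[THEN iffD1, rotated]) (use b v[of k] in auto)
    thus ?thesis by (simp only: b_def mult.commute)
  qed
  \<comment> \<open>Convergence on a countable dense set extends to all points by the common
    Lipschitz constant.\<close>
  obtain D :: "(real^'n) set" where D: "countable D" "\<And>X. open X \<Longrightarrow> X \<noteq> {} \<Longrightarrow> \<exists>d\<in>D. d \<in> X"
    using countable_dense_exists by blast
  obtain r :: "nat \<Rightarrow> nat" where r: "strict_mono r" "\<And>z. z \<in> UNIV \<times> D \<Longrightarrow> \<exists>l. (\<lambda>n. (\<lambda>n (k, x). J n k x) (r n) z) \<longlonglongrightarrow> l"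
    by (rule function_convergent_subsequence[of "UNIV \<times> D" "\<lambda>n (k, x). J n k x" C])
      (use D(1) Jb in \<open>auto simp: real_norm_def\<close>)
  have Jconv: "convergent (\<lambda>n. J (r n) k x)" for k x
  proof (rule Cauchy_convergent, rule CauchyI)
    fix e :: real assume e: "0 < e"
    have d0: "0 < e / (3 * (N * B + 1))" using e N B0 by (intro divide_pos_pos mult_pos_pos add_nonneg_pos) auto
    hence "ball x (e / (3 * (N * B + 1))) \<noteq> {}" by (metis centre_in_ball empty_iff)
    then obtain y where y: "y \<in> D" "dist x y < e / (3 * (N * B + 1))" using D(2)[of "ball x (e / (3 * (N * B + 1)))"] by auto
    have lip: "\<bar>J n k x - J n k y\<bar> < e / 3" for n
    proof -
      have "\<bar>J n k x - J n k y\<bar> \<le> N * B * norm (x - y)" by (rule Jlip)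
      also have "\<dots> \<le> (N * B + 1) * norm (x - y)" by (intro mult_right_mono) auto
      also have "\<dots> < e / 3"
      proof -
        have "0 < N * B + 1" using N B0 by (simp add: add_nonneg_pos)
        moreover have "norm (x - y) < (e / 3) / (N * B + 1)" using y(2) by (simp add: dist_norm)
        ultimately show ?thesis by (simp only: pos_less_divide_eq mult.commute)
      qed
      finally show ?thesis .
    qed
    have "convergent (\<lambda>n. J (r n) k y)" using r(2)[of "(k, y)"] y(1) by (auto simp: convergent_def)
    hence "Cauchy (\<lambda>n. J (r n) k y)" by (rule convergent_Cauchy)
    then obtain NN where NN: "\<And>m n. NN \<le> m \<Longrightarrow> NN \<le> n \<Longrightarrow> norm (J (r m) k y - J (r n) k y) < e / 3"
      using CauchyD[of "\<lambda>n. J (r n) k y" "e / 3"] e by auto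
    have "norm (J (r m) k x - J (r n) k x) < e" if mn: "NN \<le> m" "NN \<le> n" for m n
    proof -
      have "J (r m) k x - J (r n) k x = (J (r m) k x - J (r m) k y) + ((J (r m) k y - J (r n) k y) + - (J (r n) k x - J (r n) k y))" by simp
      also have "\<bar>\<dots>\<bar> \<le> \<bar>J (r m) k x - J (r m) k y\<bar> + (\<bar>J (r m) k y - J (r n) k y\<bar> + \<bar>J (r n) k x - J (r n) k y\<bar>)"
        using abs_triangle_ineq abs_triangle_ineq[THEN add_left_mono] by (smt (verit))
      also have "\<dots> < e / 3 + (e / 3 + e / 3)" using lip[of "r m"] lip[of "r n"] NN[OF mn] by (intro add_strict_mono) auto
      finally show ?thesis by simp
    qed
    thus "\<exists>M. \<forall>m\<ge>M. \<forall>n\<ge>M. norm (J (r m) k x - J (r n) k x) < e" by blast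
  qed
  define l where "l = (\<lambda>k x. lim (\<lambda>n. J (r n) k x))"
  have Jl: "(\<lambda>n. J (r n) k x) \<longlonglongrightarrow> l k x" for k x using Jconv by (simp add: l_def convergent_LIMSEQ_iff)
  have lM: "l k \<in> borel_measurable M" for k unfolding l_def using JM by measurable
  have lb: "\<bar>l k x\<bar> \<le> C" for k x
    by (rule LIMSEQ_le_const2[OF tendsto_rabs[OF Jl]]) (use Jb in auto)
  have iJM: "integrable M (J n k)" "integrable M (l k)" for n k
    using Jb lb JM lM by (auto intro!: integrable_const_bound[where B = C])
  have JL1: "(\<lambda>n. LINT x|M. \<bar>J (r n) k x - l k x\<bar>) \<longlonglongrightarrow> 0" for k
  proof -
    have "(\<lambda>n. LINT x|M. \<bar>J (r n) k x - l k x\<bar>) \<longlonglongrightarrow> (LINT x|M. 0)"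
    proof (rule integral_dominated_convergence[where w = "\<lambda>_. 2 * C"])
      show "AE x in M. (\<lambda>n. \<bar>J (r n) k x - l k x\<bar>) \<longlonglongrightarrow> 0"
        using Jl by (intro AE_I2) (simp add: LIM_zero tendsto_rabs_zero)
      show "AE x in M. norm \<bar>J (r n) k x - l k x\<bar> \<le> 2 * C" for n
      proof (rule AE_I2)
        fix x
        have "\<bar>J (r n) k x - l k x\<bar> \<le> \<bar>J (r n) k x\<bar> + \<bar>l k x\<bar>" by (rule abs_triangle_ineq4)
        thus "norm \<bar>J (r n) k x - l k x\<bar> \<le> 2 * C" using Jb[of "r n" k x] lb[of k x] by simp
      qed
    qed (use JM lM in measurable)
    thus ?thesis by simp
  qed
  have "\<exists>NN. \<forall>m\<ge>NN. \<forall>n\<ge>NN. (LINT x|M. \<bar>\<phi> (r m) x - \<phi> (r n) x\<bar>) < e" if e: "0 < e" for e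
  proof -
    define b where "b = N * B * N"
    have b: "0 \<le> b" using N B0 by (simp add: b_def)
    have "(\<lambda>k. b * (1 / real (Suc k))) \<longlonglongrightarrow> b * 0" by (intro tendsto_intros LIMSEQ_Suc[OF lim_inverse_n'])
    hence "\<forall>\<^sub>F k in sequentially. b * (1 / real (Suc k)) < e / 4" by (rule order_tendstoD(2)) (use e in simp)
    then obtain k where k: "b * (1 / real (Suc k)) < e / 4" by (auto simp: eventually_sequentially)
    have "\<forall>\<^sub>F n in sequentially. (LINT x|M. \<bar>J (r n) k x - l k x\<bar>) < v k * (e / 4)"
      by (rule order_tendstoD(2)[OF JL1]) (use e v[of k] in simp)
    then obtain NN where NN: "\<And>n. NN \<le> n \<Longrightarrow> (LINT x|M. \<bar>J (r n) k x - l k x\<bar>) < v k * (e / 4)"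
      by (auto simp: eventually_sequentially)
    have i\<phi>M: "integrable M (\<lambda>x. v k * \<phi> n x)" for n using tests_integrable[OF \<phi>] by simp
    have one: "(LINT x|M. \<bar>v k * \<phi> (r n) x - l k x\<bar>) < v k * (e / 2)" if "NN \<le> n" for n
    proof -
      have "(LINT x|M. \<bar>v k * \<phi> (r n) x - l k x\<bar>) \<le> (LINT x|M. \<bar>J (r n) k x - v k * \<phi> (r n) x\<bar> + \<bar>J (r n) k x - l k x\<bar>)"
      proof (rule integral_mono)
        show "\<bar>v k * \<phi> (r n) x - l k x\<bar> \<le> \<bar>J (r n) k x - v k * \<phi> (r n) x\<bar> + \<bar>J (r n) k x - l k x\<bar>" for x by simp
      qed (use iJM i\<phi>M in auto)
      also have "\<dots> = (LINT x|M. \<bar>J (r n) k x - v k * \<phi> (r n) x\<bar>) + (LINT x|M. \<bar>J (r n) k x - l k x\<bar>)"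
        using iJM i\<phi>M by simp
      also have "\<dots> < v k * (b * (1 / real (Suc k))) + v k * (e / 4)"
        using Jclose[of "r n" k] NN[OF that] by (intro add_le_less_mono) (simp_all add: b_def mult_ac)
      also have "\<dots> \<le> v k * (e / 4) + v k * (e / 4)" using k v[of k] by (intro add_right_mono mult_left_mono) auto
      finally show ?thesis by (simp add: algebra_simps)
    qed
    have "(LINT x|M. \<bar>\<phi> (r m) x - \<phi> (r n) x\<bar>) < e" if mn: "NN \<le> m" "NN \<le> n" for m n
    proof -
      have "v k * (LINT x|M. \<bar>\<phi> (r m) x - \<phi> (r n) x\<bar>) = (LINT x|M. v k * \<bar>\<phi> (r m) x - \<phi> (r n) x\<bar>)" by simp
      also have "\<dots> \<le> (LINT x|M. \<bar>v k * \<phi> (r m) x - l k x\<bar> + \<bar>v k * \<phi> (r n) x - l k x\<bar>)"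
      proof (rule integral_mono)
        fix x
        have "v k * \<bar>\<phi> (r m) x - \<phi> (r n) x\<bar> = \<bar>(v k * \<phi> (r m) x - l k x) - (v k * \<phi> (r n) x - l k x)\<bar>"
          using v[of k] by (simp add: abs_mult[symmetric] right_diff_distrib[symmetric] abs_mult)
        also have "\<dots> \<le> \<bar>v k * \<phi> (r m) x - l k x\<bar> + \<bar>v k * \<phi> (r n) x - l k x\<bar>" by (rule abs_triangle_ineq4)
        finally show "v k * \<bar>\<phi> (r m) x - \<phi> (r n) x\<bar> \<le> \<bar>v k * \<phi> (r m) x - l k x\<bar> + \<bar>v k * \<phi> (r n) x - l k x\<bar>" .
      qed (use iJM i\<phi>M tests_integrable[OF \<phi>] in auto)
      also have "\<dots> = (LINT x|M. \<bar>v k * \<phi> (r m) x - l k x\<bar>) + (LINT x|M. \<bar>v k * \<phi> (r n) x - l k x\<bar>)" using iJM i\<phi>M by simp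
      also have "\<dots> < v k * (e / 2) + v k * (e / 2)" by (intro add_strict_mono one mn)
      also have "\<dots> = v k * e" by (simp add: algebra_simps)
      finally show ?thesis using v[of k] by simp
    qed
    thus ?thesis by blast
  qed
  then obtain w where "integrable M w" "(\<lambda>n. LINT x|M. \<bar>\<phi> (r n) x - w x\<bar>) \<longlonglongrightarrow> 0"
    by (rule L1_Cauchy_limit[OF tests_integrable[OF \<phi>]])
  thus ?thesis by (rule that[OF r(1)])
qed

text \<open>A bound on the modulars bounds the \<open>L\<^sup>1\<close> norms of the derivatives,
  as \<open>\<Omega>\<close> has finite measure; the sequence is replaced by test functions at
  vanishing \<open>L\<^sup>1\<close> distance.\<close>

lemma space_compactness:
  fixes u :: "nat \<Rightarrow> real^'n \<Rightarrow> real"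
  assumes u: "\<And>n. has_gradient (u n) (g n)" and B: "\<And>n i. modular i (u n) \<le> B"
  shows "\<exists>(r :: nat \<Rightarrow> nat) w. strict_mono r \<and> integrable M w \<and> (\<lambda>n. LINT x|M. \<bar>u (r n) x - w x\<bar>) \<longlonglongrightarrow> 0"
proof -
  have "\<exists>\<phi>. \<phi> \<in> tests \<and> (LINT x|M. \<bar>\<phi> x - u n x\<bar>) < 1 / real (Suc n) \<and> (\<forall>i. \<bar>modular i \<phi> - modular i (u n)\<bar> < 1)" for n
    by (rule test_approximation[OF u, of "1 / real (Suc n)"]) (force intro: less_le_trans simp del: of_nat_Suc)+
  then obtain \<phi> where \<phi>: "\<And>n. \<phi> n \<in> tests" "\<And>n. (LINT x|M. \<bar>\<phi> n x - u n x\<bar>) < 1 / real (Suc n)"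
     "\<And>n i. \<bar>modular i (\<phi> n) - modular i (u n)\<bar> < 1" by metis
  define B' where "B' = measure M (space M) + (B + 1)"
  have "(LINT x|lborel. \<bar>partial_deriv i (\<phi> n) x\<bar>) \<le> B'" for n i
  proof -
    note d = tests_partial_deriv[OF \<phi>(1), of i n]
    have pt: "\<bar>y\<bar> \<le> 1 + \<bar>y\<bar> powr p i" for y :: real
    proof (cases "\<bar>y\<bar> \<le> 1")
      case False
      hence "\<bar>y\<bar> powr 1 \<le> \<bar>y\<bar> powr p i" using p_pos(3)[of i] by (intro powr_mono) auto
      thus ?thesis by simp
    qed (simp add: add_increasing2)
    have "(LINT x|M. \<bar>partial_deriv i (\<phi> n) x\<bar>) \<le> (LINT x|M. 1 + \<bar>partial_deriv i (\<phi> n) x\<bar> powr p i)"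
      by (intro integral_mono pt) (use tests_integrable[OF d] tests_powr_integrable[OF d p_pos(1)] in auto)
    also have "\<dots> = measure M (space M) + modular i (\<phi> n)"
      using tests_powr_integrable[OF d p_pos(1)] modular_eq[OF tests_has_gradient[OF \<phi>(1)], of i n] by simp
    also have "\<dots> \<le> B'" using \<phi>(3)[where i=i and n=n] B[of i n] unfolding B'_def by linarith
    finally show ?thesis by (simp add: tests_lborel_integral(2)[OF d])
  qed
  then obtain r :: "nat \<Rightarrow> nat" and w where r: "strict_mono r" "integrable M w" "(\<lambda>n. LINT x|M. \<bar>\<phi> (r n) x - w x\<bar>) \<longlonglongrightarrow> 0"
    by (rule tests_L1_compact[OF \<phi>(1)])
  have L1: "(\<lambda>n. LINT x|M. \<bar>\<phi> n x - u n x\<bar>) \<longlonglongrightarrow> 0"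
  proof (rule tendsto_sandwich[OF _ _ tendsto_const LIMSEQ_Suc[OF lim_inverse_n']])
    show "\<forall>\<^sub>F n in sequentially. (LINT x|M. \<bar>\<phi> n x - u n x\<bar>) \<le> 1 / real (Suc n)"
      by (intro always_eventually allI less_imp_le \<phi>(2))
  qed simp
  have "(\<lambda>n. (LINT x|M. \<bar>\<phi> (r n) x - u (r n) x\<bar>) + (LINT x|M. \<bar>\<phi> (r n) x - w x\<bar>)) \<longlonglongrightarrow> 0 + 0"
    by (intro tendsto_add r(3) LIMSEQ_subseq_LIMSEQ[OF L1 r(1), unfolded o_def])
  hence lim: "(\<lambda>n. (LINT x|M. \<bar>\<phi> (r n) x - u (r n) x\<bar>) + (LINT x|M. \<bar>\<phi> (r n) x - w x\<bar>)) \<longlonglongrightarrow> 0" by simp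
  have le: "(LINT x|M. \<bar>u (r n) x - w x\<bar>) \<le> (LINT x|M. \<bar>\<phi> (r n) x - u (r n) x\<bar>) + (LINT x|M. \<bar>\<phi> (r n) x - w x\<bar>)" for n
  proof -
    note i = tests_integrable[OF \<phi>(1)] has_gradientD(1)[OF u] r(2)
    have "(LINT x|M. \<bar>u (r n) x - w x\<bar>) \<le> (LINT x|M. \<bar>\<phi> (r n) x - u (r n) x\<bar> + \<bar>\<phi> (r n) x - w x\<bar>)"
      by (rule integral_mono) (use i in auto)
    thus ?thesis using i by simp
  qed
  have "(\<lambda>n. LINT x|M. \<bar>u (r n) x - w x\<bar>) \<longlonglongrightarrow> 0"
    by (rule Lim_null_comparison[OF always_eventually lim]) (use le in simp)
  thus ?thesis using r(1,2) by (intro exI[of _ r] exI[of _ w] conjI)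
qed

lemma space_poincare:
  assumes u: "has_gradient u g" and z: "modular i u = 0"
  shows "AE x in M. u x = 0"
proof -
  obtain \<phi> where \<phi>: "\<And>n. \<phi> n \<in> tests"
    "\<And>i. (\<lambda>n. LINT x|M. \<bar>partial_deriv i (\<phi> n) x - g i x\<bar> powr p i) \<longlonglongrightarrow> 0"
    "(\<lambda>n. LINT x|M. \<bar>\<phi> n x - u x\<bar>) \<longlonglongrightarrow> 0" by (rule has_gradientE[OF u]) blast
  note D = has_gradientD[OF u]
  note d = tests_measurable[OF tests_partial_deriv[OF \<phi>(1)]] tests_powr_integrable[OF tests_partial_deriv[OF \<phi>(1)] p_pos(1)]
  have "(\<lambda>n. LINT x|M. \<bar>partial_deriv i (\<phi> n) x\<bar> powr p i) \<longlonglongrightarrow> (LINT x|M. \<bar>g i x\<bar> powr p i)"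
    by (rule powr_integral_continuous[OF p_pos(1) d(1) D(2) d(2) D(3) \<phi>(2)])
  hence "(\<lambda>n. LINT x|M. \<bar>partial_deriv i (\<phi> n) x\<bar> powr p i) \<longlonglongrightarrow> 0" using z modular_eq[OF u, of i] by simp
  hence dl: "(\<lambda>n. LINT x|M. \<bar>partial_deriv i (\<phi> n) x\<bar>) \<longlonglongrightarrow> 0" by (rule L1_tendsto_zero_if_powr[OF p_pos(3) d])
  obtain C where C: "0 \<le> C" "\<And>\<phi> i. \<phi> \<in> tests \<Longrightarrow> (LINT x|lborel. \<bar>\<phi> x\<bar>) \<le> C * (LINT x|lborel. \<bar>partial_deriv i \<phi> x\<bar>)"
    by (rule tests_poincare) blast
  have lim: "(\<lambda>n. C * (LINT x|M. \<bar>partial_deriv i (\<phi> n) x\<bar>) + (LINT x|M. \<bar>\<phi> n x - u x\<bar>)) \<longlonglongrightarrow> C * 0 + 0"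
    by (intro tendsto_intros dl \<phi>(3))
  have "(LINT x|M. \<bar>u x\<bar>) \<le> C * (LINT x|M. \<bar>partial_deriv i (\<phi> n) x\<bar>) + (LINT x|M. \<bar>\<phi> n x - u x\<bar>)" for n
  proof -
    note i = tests_integrable[OF \<phi>(1)[of n]] D(1)
    have "(LINT x|M. \<bar>u x\<bar>) \<le> (LINT x|M. \<bar>\<phi> n x\<bar> + \<bar>\<phi> n x - u x\<bar>)" by (rule integral_mono) (use i in auto)
    also have "\<dots> = (LINT x|M. \<bar>\<phi> n x\<bar>) + (LINT x|M. \<bar>\<phi> n x - u x\<bar>)" using i by simp
    also have "(LINT x|M. \<bar>\<phi> n x\<bar>) \<le> C * (LINT x|M. \<bar>partial_deriv i (\<phi> n) x\<bar>)"
      using C(2)[OF \<phi>(1), of n i] by (simp add: tests_lborel_integral(2)[OF \<phi>(1)] tests_lborel_integral(2)[OF tests_partial_deriv[OF \<phi>(1)]])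
    finally show ?thesis by simp
  qed
  hence "(LINT x|M. \<bar>u x\<bar>) \<le> C * 0 + 0" by (intro LIMSEQ_le_const[OF lim]) auto
  hence "(LINT x|M. \<bar>u x\<bar> powr 1) = 0" by (simp add: antisym)
  thus ?thesis using D(1) by (intro AE_zero_if_powr_integral_zero[of M u 1]) auto
qed

lemma nontrivial_test_exists:
  assumes "\<Omega> \<noteq> {}"
  obtains \<phi> where "\<phi> \<in> tests" "\<not> (AE x in M. \<phi> x = 0)"
proof -
  obtain x where "x \<in> \<Omega>" using assms by auto
  then obtain a b where ab: "x \<in> box a b" "cbox a b \<subseteq> \<Omega>" using open_contains_cbox[OF open_domain] by metis
  have t: "box_bump 0 a b \<in> tests" by (rule box_bump_test[OF bounded_domain ab(2)])
  have "\<not> (AE x in M. box_bump 0 a b x = 0)"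
  proof
    assume "AE x in M. box_bump 0 a b x = 0"
    hence "AE x in lebesgue. x \<in> \<Omega> \<longrightarrow> box_bump 0 a b x = 0" using domain_measurable by (subst (asm) AE_restrict_space_iff) auto
    hence "AE x in lebesgue. x \<notin> box a b"
      by eventually_elim (use ab(2) box_subset_cbox box_bump_pos[of _ a b 0] in force)
    hence "box a b \<in> null_sets lebesgue" by (subst AE_iff_null_sets) auto
    hence "negligible (box a b)" by (simp add: negligible_iff_null_sets)
    thus False using ab(1) open_box open_not_negligible by blast
  qed
  thus ?thesis using t that by blast
qed

end

section \<open>Existence of a ground state\<close>

lemma primitive_zero: "primitive f 0 = 0"
  unfolding primitive_def zero_ereal_def by (rule interval_integral_endpoints_same)

text \<open>The interval contains 0, where the primitive starts, and has \<open>t\<close> in its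
  interior, so that the derivative within the interval is the full derivative.\<close>

lemma primitive_has_derivative:
  assumes f: "continuous_on UNIV f"
  shows "(primitive f has_real_derivative f t) (at t)"
proof -
  define c where "c = \<bar>t\<bar> + 1"
  have c: "- c < t" "t < c" "- c \<le> 0" "0 \<le> c" by (auto simp: c_def)
  have "((\<lambda>u. LBINT s=0..u. f s) has_vector_derivative f t) (at t within {- c..c})"
    unfolding zero_ereal_def
    by (rule interval_integral_FTC2) (use c in \<open>auto intro: continuous_on_subset[OF f]\<close>)
  hence "(primitive f has_vector_derivative f t) (at t within {- c..c})"
    unfolding primitive_def[abs_def] .
  moreover have "at t within {- c..c} = at t" using c by (intro at_within_interior) auto
  ultimately show ?thesis by (simp add: has_real_derivative_iff_has_vector_derivative)
qed

text \<open>Each requirement of the variational argument is a property of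
  \<open>has_gradient\<close> proved above, transported along the identification of chosen weak
  derivatives with gradients almost everywhere.\<close>

lemma functional_on_anisotropic_space:
  fixes \<Omega> :: "(real^'n::{finite,linorder}) set" and p :: "'n \<Rightarrow> real"
  assumes open_domain: "open \<Omega>" and bounded_domain: "bounded \<Omega>" and nonempty: "\<Omega> \<noteq> {}"
    and p1: "1 < first_exponent p" and p: "mono p" and \<sigma>: "1 < (\<Sum>i\<in>UNIV. 1 / p i)"
    and f: "superlinear_nonlinearity f F (first_exponent p) (last_exponent p) \<alpha>"
    and q: "\<alpha> < q" "q < critical_exponent p"
  shows "anisotropic_functional (lebesgue_on \<Omega>) f F (first_exponent p) (last_exponent p) \<alpha>
     (anisotropic_space \<Omega> p) (weak_partial_deriv \<Omega>) p (Min UNIV) q"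
proof -
  have p_ge: "first_exponent p \<le> p i" for i
    unfolding first_exponent_def by (rule monoD[OF p]) simp
  have p_le: "p i \<le> last_exponent p" for i
    unfolding last_exponent_def by (rule monoD[OF p]) simp
  interpret A: anisotropic_domain \<Omega> p
    by standard (use open_domain bounded_domain less_le_trans[OF p1 p_ge] in auto)
  interpret f: superlinear_nonlinearity f F "first_exponent p" "last_exponent p" \<alpha> by (rule f)
  have q0: "0 < q" using f.p1 f.p1_le f.pN_less q(1) by simp
  note in_space = A.anisotropic_space_iff
  note gradient = A.weak_partial_deriv_eq_gradient
  show ?thesis
  proof
    show "first_exponent p \<le> p i" "p i \<le> last_exponent p" for i by (rule p_ge p_le)+
    show "p (Min UNIV) = first_exponent p" by (simp add: first_exponent_def)
    show "\<alpha> < q" by (rule q(1))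
    show "integrable (lebesgue_on \<Omega>) u" if "u \<in> anisotropic_space \<Omega> p" for u
      using that A.has_gradientD(1) unfolding in_space by blast
    show "weak_partial_deriv \<Omega> i u \<in> borel_measurable (lebesgue_on \<Omega>)" if "u \<in> anisotropic_space \<Omega> p" for u i
      using that A.weak_partial_deriv_measurable unfolding in_space by blast
    show "integrable (lebesgue_on \<Omega>) (\<lambda>x. \<bar>weak_partial_deriv \<Omega> i u x\<bar> powr p i)" if "u \<in> anisotropic_space \<Omega> p" for u i
    proof -
      have "\<exists>g. A.has_gradient u g" using that unfolding in_space by blast
      then obtain g where g: "A.has_gradient u g" ..
      have [measurable]: "weak_partial_deriv \<Omega> i u \<in> borel_measurable (lebesgue_on \<Omega>)" "g i \<in> borel_measurable (lebesgue_on \<Omega>)"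
        by (rule A.weak_partial_deriv_measurable[OF g] A.has_gradientD(2)[OF g])+
      have "AE x in lebesgue_on \<Omega>. \<bar>weak_partial_deriv \<Omega> i u x\<bar> powr p i = \<bar>g i x\<bar> powr p i"
        using gradient[OF g, of i] by eventually_elim simp
      thus ?thesis by (subst integrable_cong_AE) (auto intro: A.has_gradientD(3)[OF g])
    qed
    show "(\<lambda>x. a * u x + b * v x) \<in> anisotropic_space \<Omega> p"
      if "u \<in> anisotropic_space \<Omega> p" "v \<in> anisotropic_space \<Omega> p" for a b u v
      using that A.has_gradient_add unfolding in_space by blast
    show "AE x in lebesgue_on \<Omega>. weak_partial_deriv \<Omega> i (\<lambda>x. a * u x + b * v x) x =
        a * weak_partial_deriv \<Omega> i u x + b * weak_partial_deriv \<Omega> i v x"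
      if "u \<in> anisotropic_space \<Omega> p" "v \<in> anisotropic_space \<Omega> p" for a b u v i
    proof -
      have "\<exists>g. A.has_gradient u g" "\<exists>h. A.has_gradient v h" using that unfolding in_space by blast+
      then obtain g h where gh: "A.has_gradient u g" "A.has_gradient v h" by (elim exE)
      show ?thesis
        using gradient[OF gh(1), of i] gradient[OF gh(2), of i] gradient[OF A.has_gradient_add[OF gh, of a b], of i]
        by eventually_elim simp
    qed
    show "\<exists>K. \<forall>u\<in>anisotropic_space \<Omega> p. (\<forall>i. (LINT x|lebesgue_on \<Omega>. \<bar>weak_partial_deriv \<Omega> i u x\<bar> powr p i) \<le> 1) \<longrightarrow>
        integrable (lebesgue_on \<Omega>) (\<lambda>x. \<bar>u x\<bar> powr q) \<and> (LINT x|lebesgue_on \<Omega>. \<bar>u x\<bar> powr q) \<le> K"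
    proof -
      obtain K where "\<forall>u g. A.has_gradient u g \<longrightarrow> (\<forall>i. A.modular i u \<le> 1) \<longrightarrow>
           integrable (lebesgue_on \<Omega>) (\<lambda>x. \<bar>u x\<bar> powr q) \<and> (LINT x|lebesgue_on \<Omega>. \<bar>u x\<bar> powr q) \<le> K"
        using A.space_embedding[OF \<sigma> q0 q(2)] by (elim exE)
      thus ?thesis unfolding Ball_def in_space A.modular_def by (intro exI[of _ K]) blast
    qed
    show "\<exists>(r :: nat \<Rightarrow> nat) w. strict_mono r \<and> integrable (lebesgue_on \<Omega>) w \<and>
        (\<lambda>n. LINT x|lebesgue_on \<Omega>. \<bar>u (r n) x - w x\<bar>) \<longlonglongrightarrow> 0"
      if u: "\<And>n. u n \<in> anisotropic_space \<Omega> p"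
        and B: "\<And>n i. (LINT x|lebesgue_on \<Omega>. \<bar>weak_partial_deriv \<Omega> i (u n) x\<bar> powr p i) \<le> B"
      for u :: "nat \<Rightarrow> real^'n::{finite,linorder} \<Rightarrow> real" and B
    proof -
      have "\<forall>n. \<exists>g. A.has_gradient (u n) g" using u unfolding in_space by blast
      then obtain g where g: "\<And>n. A.has_gradient (u n) (g n)" by metis
      show ?thesis by (rule A.space_compactness[of u g B, OF g]) (simp add: A.modular_def B)
    qed
    show "w \<in> anisotropic_space \<Omega> p \<and>
        (\<Sum>i\<in>UNIV. 1 / p i * (LINT x|lebesgue_on \<Omega>. \<bar>weak_partial_deriv \<Omega> i w x\<bar> powr p i)) \<le> B"
      if w: "integrable (lebesgue_on \<Omega>) w"
        and ap: "\<And>e. 0 < e \<Longrightarrow> \<exists>v\<in>anisotropic_space \<Omega> p. (LINT x|lebesgue_on \<Omega>. \<bar>v x - w x\<bar>) \<le> e \<and>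
           (\<Sum>i\<in>UNIV. 1 / p i * (LINT x|lebesgue_on \<Omega>. \<bar>weak_partial_deriv \<Omega> i v x\<bar> powr p i)) \<le> B" for w B
    proof -
      have "\<exists>g. A.has_gradient w g \<and> A.dirichlet w \<le> B"
      proof (rule A.relaxation_space[OF w])
        fix e :: real assume "0 < e"
        from ap[OF this] show "\<exists>v g. A.has_gradient v g \<and> (LINT x|lebesgue_on \<Omega>. \<bar>v x - w x\<bar>) \<le> e \<and> A.dirichlet v \<le> B"
          unfolding Bex_def in_space A.dirichlet_def A.modular_def by blast
      qed
      thus ?thesis unfolding in_space A.dirichlet_def A.modular_def by blast
    qed
    show "(\<lambda>x. \<bar>u x\<bar>) \<in> anisotropic_space \<Omega> p \<and>
        (\<Sum>i\<in>UNIV. 1 / p i * (LINT x|lebesgue_on \<Omega>. \<bar>weak_partial_deriv \<Omega> i (\<lambda>x. \<bar>u x\<bar>) x\<bar> powr p i))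
        \<le> (\<Sum>i\<in>UNIV. 1 / p i * (LINT x|lebesgue_on \<Omega>. \<bar>weak_partial_deriv \<Omega> i u x\<bar> powr p i))"
      if "u \<in> anisotropic_space \<Omega> p" for u
    proof -
      have "\<exists>g. A.has_gradient u g" using that unfolding in_space by blast
      then obtain g where g: "A.has_gradient u g" ..
      show ?thesis using A.absolute_value_space[OF g] unfolding in_space A.dirichlet_def A.modular_def by (intro conjI)
    qed
    show "AE x in lebesgue_on \<Omega>. u x = 0"
      if "u \<in> anisotropic_space \<Omega> p" "(LINT x|lebesgue_on \<Omega>. \<bar>weak_partial_deriv \<Omega> (Min UNIV) u x\<bar> powr p (Min UNIV)) = 0" for u
    proof -
      have "\<exists>g. A.has_gradient u g" using that(1) unfolding in_space by blast
      then obtain g where g: "A.has_gradient u g" ..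
      show ?thesis by (rule A.space_poincare[OF g]) (unfold A.modular_def, rule that(2))
    qed
    obtain \<phi> where \<phi>: "\<phi> \<in> test_functions \<Omega>" "\<not> (AE x in lebesgue_on \<Omega>. \<phi> x = 0)"
      by (rule A.nontrivial_test_exists[OF nonempty])
    show "\<exists>u\<in>anisotropic_space \<Omega> p. \<not> (AE x in lebesgue_on \<Omega>. u x = 0)"
      using A.tests_has_gradient[OF \<phi>(1)] \<phi>(2) unfolding Bex_def in_space by blast
  qed
qed

text \<open>The embedding is used for an exponent \<open>q\<close> strictly between
  \<open>\<alpha>\<close> and the critical exponent: the gap between \<open>\<alpha>\<close> and
  \<open>q\<close> provides the uniform integrability needed for the potential.\<close>

theorem corollary2p5:
  fixes \<Omega> :: "(real^'n::{finite,linorder}) set"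
    and p :: "'n \<Rightarrow> real"
    and f :: "real \<Rightarrow> real"
  assumes "CARD('n) \<ge> 3"
    and "open \<Omega>" and "connected \<Omega>" and "\<Omega> \<noteq> {}" and "bounded \<Omega>"
    and "f C1_differentiable_on UNIV"
    and "\<And>t. f (- t) = - f t"
    and "\<And>t. t \<ge> 0 \<Longrightarrow> f t \<ge> 0"
    and "1 < first_exponent p" and "mono p"
    and "(\<Sum>i\<in>UNIV. 1 / p i) > 1"
    and "last_exponent p < critical_exponent p"
    and "((\<lambda>t. f t / t powr (first_exponent p - 1)) \<longlongrightarrow> 0) (at_right 0)"
    and "filterlim (\<lambda>t. primitive f t / t powr last_exponent p) at_top at_top"
    and "\<exists>\<alpha>. last_exponent p < \<alpha> \<and> \<alpha> < critical_exponent p \<and>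
           ((\<lambda>t. f t / t powr (\<alpha> - 1)) \<longlongrightarrow> 0) at_top"
    and "strict_mono_on {0<..} (\<lambda>t. f t / t powr (last_exponent p - 1))"
  shows "\<exists>u. nontrivial_ground_state \<Omega> p f u \<and> (AE x in lebesgue_on \<Omega>. u x \<ge> 0)"
proof -
  obtain \<alpha> where \<alpha>: "last_exponent p < \<alpha>" "\<alpha> < critical_exponent p"
    "((\<lambda>t. f t / t powr (\<alpha> - 1)) \<longlongrightarrow> 0) at_top"
    using assms(15) by (elim exE conjE)
  obtain q where q: "\<alpha> < q" "q < critical_exponent p" using dense[OF \<alpha>(2)] by (elim exE conjE)
  have cont: "continuous_on UNIV f" by (rule C1_differentiable_imp_continuous_on[OF assms(6)])
  have "first_exponent p \<le> last_exponent p"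
    unfolding first_exponent_def last_exponent_def by (rule monoD[OF assms(10)]) simp
  hence f: "superlinear_nonlinearity f (primitive f) (first_exponent p) (last_exponent p) \<alpha>"
    using assms(7-9,13,14,16) \<alpha>(1,3) cont primitive_has_derivative[OF cont] primitive_zero
    by unfold_locales
  interpret P: anisotropic_functional "lebesgue_on \<Omega>" f "primitive f" "first_exponent p" "last_exponent p" \<alpha>
    "anisotropic_space \<Omega> p" "weak_partial_deriv \<Omega>" p "Min UNIV" q
    by (rule functional_on_anisotropic_space[OF assms(2,5,4,9,10,11) f q])
  have energy: "P.functional = energy \<Omega> p f"
    by (rule ext) (simp only: P.functional_def energy_def)
  have norm: "P.nrm = anisotropic_norm \<Omega> p"
    by (rule ext) (simp only: P.nrm_def anisotropic_norm_def Lp_norm_def)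
  obtain u where u: "weak_solution \<Omega> p f u" "nontrivial_on \<Omega> u" "\<And>x. 0 \<le> u x"
    "\<And>v. weak_solution \<Omega> p f v \<Longrightarrow> nontrivial_on \<Omega> v \<Longrightarrow> energy \<Omega> p f u \<le> energy \<Omega> p f v"
    using P.ground_state_exists unfolding energy norm weak_solution_def nontrivial_on_def by blast
  show ?thesis
  proof (intro exI conjI)
    show "nontrivial_ground_state \<Omega> p f u"
      unfolding nontrivial_ground_state_def using u(1,2,4) by blast
    show "AE x in lebesgue_on \<Omega>. 0 \<le> u x" using u(3) by (intro AE_I2)
  qed
qed

end
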